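(* Let $N\ge2$, let $V\in L^\infty(\mathbb{R}^N)$ satisfy $\lim_{|x|\to\infty}V(x)=V^\infty>0$, and let $p\in C(\mathbb{R}^N)$ satisfy $2<p^-:=\inf_{\mathbb{R}^N}p\le\sup_{\mathbb{R}^N}p=:p^+<2^*$ and $\lim_{|x|\to\infty}p(x)=p^\infty$. Let $c\in\mathbb{R}$ and let $(u_k)$ be a $(\mathrm{PS})_c$-sequence for $J|_{\mathcal{M}}$. Then there exist an integer $m\ge1$, functions $w^{(1)},\dots,w^{(m)}\in H^1(\mathbb{R}^N)$, and sequences $(y^{(1)}_k),\dots,(y^{(m)}_k)$ in $\mathbb{R}^N$, with $y^{(1)}_k=0$ for all $k\in\mathbb{N}$ and $w^{(n)}\ne0$ for all $2\le n\le m$, such that, on a renumbered subsequence, $\rho(u_k)\to\rho_0$ for some $\rho_0\in[p^-,p^+]$, and (i) $u_k(\cdot+y^{(n)}_k)\rightharpoonup w^{(n)}$ weakly in $H^1(\mathbb{R}^N)$ for $1\le n\le m$; (ii) $|y^{(n)}_k-y^{(l)}_k|\to\infty$ for all $n\ne l$; (iii) $\sum_{n=1}^m\|w^{(n)}\|^2\le\liminf_k\|u_k\|^2$; (iv) $-\Delta w^{(1)}+V(x)w^{(1)}=\dfrac{c}{\rho_0}|w^{(1)}|^{p(x)-2}w^{(1)}$; (v) $-\Delta w^{(n)}+V^\infty w^{(n)}=\dfrac{c}{\rho_0}|w^{(n)}|^{p^\infty-2}w^{(n)}$ for $2\le n\le m$; (vi) $J(w^{(1)})=\dfrac{c}{\rho_0}\,\rho(w^{(1)})$;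 (vii) $J^\infty(w^{(n)})=\dfrac{c}{\rho_0}\,\rho^\infty(w^{(n)})$ for $2\le n\le m$; (viii) $\rho(w^{(1)})+\sum_{n=2}^m\rho^\infty(w^{(n)})=\rho_0$; (ix) $J(w^{(1)})+\sum_{n=2}^mJ^\infty(w^{(n)})=c$; (x) $u_k-\sum_{n=1}^m w^{(n)}(\cdot-y^{(n)}_k)\to0$ in $H^1(\mathbb{R}^N)$.
   Context: All functions are real valued. $2^*=2N/(N-2)$ if $N\ge3$ and $2^*=\infty$ if $N=2$. $H^1(\mathbb{R}^N)$ carries the norm $\|u\|^2=\int_{\mathbb{R}^N}(|\nabla u|^2+V^\infty u^2)\,dx$, and $H^{-1}(\mathbb{R}^N)$ is its dual. For $u\in H^1(\mathbb{R}^N)$ set $$J(u)=\int_{\mathbb{R}^N}\left(|\nabla u|^2+V(x)u^2\right)dx,\quad J^\infty(u)=\int_{\mathbb{R}^N}\left(|\nabla u|^2+V^\infty u^2\right)dx,$$ $$\rho(u)=\int_{\mathbb{R}^N}|u(x)|^{p(x)}dx,\quad \rho^\infty(u)=\int_{\mathbb{R}^N}|u(x)|^{p^\infty}dx,\quad I(u)=\inf\Big\{\gamma>0:\int_{\mathbb{R}^N}\Big|\frac{u(x)}{\gamma}\Big|^{p(x)}\frac{dx}{p(x)}\le1\Big\},$$ and $\mathcal{M}=\{u\in H^1(\mathbb{R}^N):I(u)=1\}$. The functional $I$ is $C^1$ on $H^1(\mathbb{R}^N)\setminus\{0\}$, and for $u\in\mathcal{M}$ one has $\langle I'(u),v\rangle=\rho(u)^{-1}\int_{\mathbb{R}^N}|u|^{p(x)-2}uv\,dx$;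 $\mathcal{M}$ is a $C^1$ Hilbert manifold. A $(\mathrm{PS})_c$-sequence for $J|_{\mathcal{M}}$ is a sequence $(u_k)$ in $\mathcal{M}$ such that $J(u_k)\to c$ and $(J|_{\mathcal{M}})'(u_k)\to0$; the latter means that there are $\mu_k\in\mathbb{R}$ with $J'(u_k)-\mu_kI'(u_k)\to0$ in $H^{-1}(\mathbb{R}^N)$. Equations are understood in the weak sense in $H^1(\mathbb{R}^N)$. *)

theory Defs
  imports "HOL-Analysis.Analysis"
begin

text \<open>
  Elements of the Lebesgue and Sobolev spaces are represented by functions, Lebesgue measurable
  and everywhere defined; equality in the space is equality almost everywhere.
\<close>

definition L2 :: "('a::euclidean_space \<Rightarrow> 'b::euclidean_space) set" where
  "L2 = {f. f \<in> borel_measurable lebesgue \<and> integrable lebesgue (\<lambda>x. (norm (f x))\<^sup>2)}"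

definition L_infinity :: "('a::euclidean_space \<Rightarrow> real) set" where
  "L_infinity = {f. f \<in> borel_measurable lebesgue \<and> (\<exists>C. AE x in lebesgue. \<bar>f x\<bar> \<le> C)}"

definition locally_integrable :: "('a::euclidean_space \<Rightarrow> 'b::euclidean_space) \<Rightarrow> bool" where
  "locally_integrable f \<longleftrightarrow> (\<forall>K. compact K \<longrightarrow> set_integrable lebesgue K f)"

primrec C_k :: "nat \<Rightarrow> ('a::euclidean_space \<Rightarrow> real) \<Rightarrow> bool" where
  "C_k 0 f \<longleftrightarrow> continuous_on UNIV f"
| "C_k (Suc k) f \<longleftrightarrow> (\<forall>x. f differentiable (at x)) \<and>
     (\<forall>e\<in>Basis. C_k k (\<lambda>x. frechet_derivative f (at x) e))"

definition test_function :: "('a::euclidean_space \<Rightarrow> real) \<Rightarrow> bool" where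
  "test_function \<phi> \<longleftrightarrow> (\<forall>k. C_k k \<phi>) \<and> compact (closure {x. \<phi> x \<noteq> 0})"

definition has_weak_gradient ::
    "('a::euclidean_space \<Rightarrow> real) \<Rightarrow> ('a \<Rightarrow> 'a) \<Rightarrow> bool" where
  "has_weak_gradient u G \<longleftrightarrow> locally_integrable u \<and> locally_integrable G \<and>
     (\<forall>\<phi> e. test_function \<phi> \<longrightarrow> e \<in> Basis \<longrightarrow>
        (LINT x|lebesgue. u x * frechet_derivative \<phi> (at x) e)
          = - (LINT x|lebesgue. (G x \<bullet> e) * \<phi> x))"

text \<open>The weak gradient is determined only up to a null set; a representative is chosen.\<close>

definition weak_gradient :: "('a::euclidean_space \<Rightarrow> real) \<Rightarrow> 'a \<Rightarrow> 'a" where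
  "weak_gradient u = (SOME G. has_weak_gradient u G)"

definition H1 :: "('a::euclidean_space \<Rightarrow> real) set" where
  "H1 = {u \<in> L2. \<exists>G \<in> L2. has_weak_gradient u G}"

text \<open>
  \<open>energy V\<close> is \<open>J\<close>, and \<open>energy (\<lambda>_. Vinf)\<close> is \<open>J\<^sup>\<infinity>\<close>; likewise \<open>modular p\<close> is \<open>\<rho>\<close> and
  \<open>modular (\<lambda>_. pinf)\<close> is \<open>\<rho>\<^sup>\<infinity>\<close>.  On \<open>H1\<close>, for bounded \<open>V\<close> and for exponents bounded away from
  the critical one, the integrands are integrable, so that the value \<open>0\<close> of the Bochner
  integral for non-integrable functions plays no role.
\<close>

definition energy :: "('a::euclidean_space \<Rightarrow> real) \<Rightarrow> ('a \<Rightarrow> real) \<Rightarrow> real" where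
  "energy V u = (LINT x|lebesgue. (norm (weak_gradient u x))\<^sup>2 + V x * (u x)\<^sup>2)"

definition modular :: "('a::euclidean_space \<Rightarrow> real) \<Rightarrow> ('a \<Rightarrow> real) \<Rightarrow> real" where
  "modular p u = (LINT x|lebesgue. \<bar>u x\<bar> powr p x)"

definition luxemburg :: "('a::euclidean_space \<Rightarrow> real) \<Rightarrow> ('a \<Rightarrow> real) \<Rightarrow> real" where
  "luxemburg p u =
     Inf {\<gamma>. \<gamma> > 0 \<and> (\<integral>\<^sup>+ x. ennreal (\<bar>u x / \<gamma>\<bar> powr p x / p x) \<partial>lebesgue) \<le> 1}"

definition constraint_manifold :: "('a::euclidean_space \<Rightarrow> real) \<Rightarrow> ('a \<Rightarrow> real) set" where
  "constraint_manifold p = {u \<in> H1. luxemburg p u = 1}"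

definition H1_norm :: "real \<Rightarrow> ('a::euclidean_space \<Rightarrow> real) \<Rightarrow> real" where
  "H1_norm Vinf u = sqrt (energy (\<lambda>_. Vinf) u)"

text \<open>
  The dual space \<open>H\<^sup>-\<^sup>1\<close>.  Only the values of a functional on \<open>H1\<close> matter; boundedness
  and linearity make them independent of the representative.
\<close>

definition H1_dual :: "real \<Rightarrow> (('a::euclidean_space \<Rightarrow> real) \<Rightarrow> real) set" where
  "H1_dual Vinf = {f.
     (\<forall>u\<in>H1. \<forall>v\<in>H1. f (\<lambda>x. u x + v x) = f u + f v) \<and>
     (\<forall>a. \<forall>u\<in>H1. f (\<lambda>x. a * u x) = a * f u) \<and>
     (\<exists>C. \<forall>u\<in>H1. \<bar>f u\<bar> \<le> C * H1_norm Vinf u)}"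

definition H1_dual_norm :: "real \<Rightarrow> (('a::euclidean_space \<Rightarrow> real) \<Rightarrow> real) \<Rightarrow> real" where
  "H1_dual_norm Vinf f = (SUP v \<in> {v \<in> H1. H1_norm Vinf v \<le> 1}. \<bar>f v\<bar>)"

definition H1_weakly_converges ::
    "real \<Rightarrow> (nat \<Rightarrow> 'a::euclidean_space \<Rightarrow> real) \<Rightarrow> ('a \<Rightarrow> real) \<Rightarrow> bool" where
  "H1_weakly_converges Vinf u w \<longleftrightarrow> (\<forall>k. u k \<in> H1) \<and> w \<in> H1 \<and>
     (\<forall>f \<in> H1_dual Vinf. (\<lambda>k. f (u k)) \<longlonglongrightarrow> f w)"

text \<open>The Frechet derivative on \<open>H1\<close> with respect to \<open>H1_norm Vinf\<close>.\<close>

definition has_H1_derivative ::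
    "real \<Rightarrow> (('a::euclidean_space \<Rightarrow> real) \<Rightarrow> real) \<Rightarrow> (('a \<Rightarrow> real) \<Rightarrow> real) \<Rightarrow> ('a \<Rightarrow> real) \<Rightarrow> bool"
  where
  "has_H1_derivative Vinf F D u \<longleftrightarrow> D \<in> H1_dual Vinf \<and>
     (\<forall>\<epsilon>>0. \<exists>\<delta>>0. \<forall>h\<in>H1. H1_norm Vinf h < \<delta> \<longrightarrow>
        \<bar>F (\<lambda>x. u x + h x) - F u - D h\<bar> \<le> \<epsilon> * H1_norm Vinf h)"

text \<open>
  Here \<open>D k\<close> and \<open>E k\<close> are \<open>J'(u\<^sub>k)\<close> and \<open>I'(u\<^sub>k)\<close>; both derivatives exist, as \<open>J\<close> and \<open>I\<close> are
  continuously differentiable away from \<open>0\<close>, and they are unique on \<open>H1\<close>.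
\<close>

definition Palais_Smale ::
    "real \<Rightarrow> ('a::euclidean_space \<Rightarrow> real) \<Rightarrow> ('a \<Rightarrow> real) \<Rightarrow> real \<Rightarrow> (nat \<Rightarrow> 'a \<Rightarrow> real) \<Rightarrow> bool"
  where
  "Palais_Smale Vinf V p c u \<longleftrightarrow>
     (\<forall>k. u k \<in> constraint_manifold p) \<and>
     (\<lambda>k. energy V (u k)) \<longlonglongrightarrow> c \<and>
     (\<exists>D E \<mu>.
        (\<forall>k. has_H1_derivative Vinf (energy V) (D k) (u k)) \<and>
        (\<forall>k. has_H1_derivative Vinf (luxemburg p) (E k) (u k)) \<and>
        (\<lambda>k. H1_dual_norm Vinf (\<lambda>v. D k v - \<mu> k * E k v)) \<longlonglongrightarrow> 0)"

text \<open>\<open>w\<close> is a weak solution in \<open>H1\<close> of \<open>- \<Delta> w + V w = g\<close>.\<close>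

definition weak_solution ::
    "('a::euclidean_space \<Rightarrow> real) \<Rightarrow> ('a \<Rightarrow> real) \<Rightarrow> ('a \<Rightarrow> real) \<Rightarrow> bool" where
  "weak_solution V g w \<longleftrightarrow> w \<in> H1 \<and>
     (\<forall>v\<in>H1. integrable lebesgue (\<lambda>x. g x * v x) \<and>
        (LINT x|lebesgue. weak_gradient w x \<bullet> weak_gradient v x + V x * w x * v x)
          = (LINT x|lebesgue. g x * v x))"

definition critical_exponent :: "nat \<Rightarrow> ereal" where
  "critical_exponent N = (if N \<ge> 3 then ereal (2 * real N / (real N - 2)) else \<infinity>)"

definition p_minus :: "('a \<Rightarrow> real) \<Rightarrow> ereal" where
  "p_minus p = (INF x. ereal (p x))"

definition p_plus :: "('a \<Rightarrow> real) \<Rightarrow> ereal" where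
  "p_plus p = (SUP x. ereal (p x))"

text \<open>
  For a function given up to null sets, the limit at infinity is the essential one: for every
  \<open>\<epsilon> > 0\<close> there is \<open>R\<close> such that \<open>\<bar>V x - l\<bar> < \<epsilon>\<close> for almost every \<open>x\<close> with \<open>norm x \<ge> R\<close>.
\<close>

definition ess_at_infinity :: "'a::euclidean_space filter" where
  "ess_at_infinity = inf at_infinity (ae_filter lebesgue)"

end

theory Submission
  imports Defs "HOL-Library.Diagonal_Subsequence"
begin

text \<open>
  A Palais-Smale sequence on the constraint is bounded, because the constraint controls the square of
  \<open>u\<^sub>k\<close> on bounded sets and the energy controls it elsewhere.  Testing the condition with \<open>u\<^sub>k\<close> itself
  determines the multipliers, and along a subsequence with \<open>\<rho>(u\<^sub>k) \<rightarrow> \<rho>\<^sub>0\<close> the condition becomes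
  \<open>- \<Delta> u\<^sub>k + V u\<^sub>k = \<lambda>\<^sub>k \<bar>u\<^sub>k\<bar> powr (p - 2) u\<^sub>k + o(1)\<close> with \<open>\<lambda>\<^sub>k \<rightarrow> c / \<rho>\<^sub>0\<close>
  (\<open>Palais_Smale_almost_critical\<close>).  The decomposition is derived from this equation, in the locale
  \<open>almost_critical\<close>.

  A profile is a weak limit of translates of the sequence.  The nonlinearity is weakly continuous, even when its
  exponent changes with \<open>k\<close> (\<open>odd_power_weak_continuity\<close>); since \<open>p\<close> and \<open>V\<close> have limits at infinity, every
  profile solves its limit equation.  By the Sobolev inequality a nonzero solution of the equation at infinity
  cannot have a small norm (\<open>limit_solution_lower_bound\<close>), while translates moving apart become orthogonal, so
  that the squared norms of the profiles have a bounded sum.  There are thus only finitely many profiles, and a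
  family of greatest length exists (\<open>maximal_profiles\<close>).

  Let \<open>R\<^sub>k\<close> be \<open>u\<^sub>k\<close> minus the translated profiles of such a family.  If the averages of \<open>R\<^sub>k\<close> over cubes did not
  tend to zero uniformly, the weak limit around the exceptional points would be one more profile (\<open>new_profile\<close>).
  Hence they do tend to zero, which forces \<open>R\<^sub>k \<rightarrow> 0\<close> in \<open>L\<^sup>q\<close> for all subcritical \<open>q > 2\<close> (\<open>vanishing\<close>).  Therefore
  the nonlinearity at \<open>u\<^sub>k\<close> tested with \<open>R\<^sub>k\<close> tends to zero, and the equation tested with \<open>R\<^sub>k\<close> gives \<open>R\<^sub>k \<rightarrow> 0\<close> in
  \<open>H1\<close> (\<open>remainder_vanishes\<close>).  The identity for \<open>\<rho>\<close> follows by testing the nonlinearity with the decomposition of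
  \<open>u\<^sub>k\<close>, in which each profile sees only itself in the limit; the identity for \<open>J\<close> follows from the orthogonality
  of the profiles and from \<open>V - Vinf \<rightarrow> 0\<close> at infinity.

  The facts about \<open>H1\<close> come from averages over cubes of side \<open>l\<close>.  In \<open>L2\<close> a function differs from its averages by
  at most \<open>sqrt N l\<close> times the norm of its gradient (\<open>average_deviation\<close>), and an average is at most
  \<open>l powr (- N/2)\<close> times the \<open>L2\<close> norm.  As \<open>\<bar>u\<bar> \<le> 2 \<bar>u - average l u\<bar>\<close> wherever \<open>\<bar>u\<bar>\<close> is at least twice the
  modulus of the average, these two estimates, used at the scales \<open>l = 1 / 2\<^sup>j\<close>, yield the subcritical Sobolev
  inequality; a single small scale yields Rellich's theorem and, together with the Sobolev tail, the vanishing
  lemma.  The deviation estimate itself follows from \<open>\<parallel>u(\<cdot> + h) - u\<parallel> \<le> \<bar>h\<bar> \<parallel>\<nabla>u\<parallel>\<close>, which is obtained by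
  duality with test functions (\<open>H1_difference_segment_integral\<close>).
\<close>

section \<open>Translations of Lebesgue integrals\<close>

lemma distr_lebesgue_translation:
  fixes a :: "'a::euclidean_space"
  shows measurable_lebesgue_translation: "(\<lambda>x. x + a) \<in> lebesgue \<rightarrow>\<^sub>M lebesgue"
    and "distr lebesgue lebesgue (\<lambda>x. x + a) = lebesgue"
proof -
  have T: "(\<lambda>x. a + (\<Sum>j\<in>Basis. (1 * (x \<bullet> j)) *\<^sub>R j)) = (\<lambda>x. x + a)"
    by (simp add: euclidean_representation add.commute)
  show "(\<lambda>x. x + a) \<in> lebesgue \<rightarrow>\<^sub>M lebesgue"
    using lebesgue_affine_measurable[of "\<lambda>_. 1" a] T by simp
  show "distr lebesgue lebesgue (\<lambda>x. x + a) = lebesgue"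
    using lebesgue_affine_euclidean[of "\<lambda>_. 1" a] T by (simp add: density_1)
qed

lemma measurable_translate:
  "f \<in> lebesgue \<rightarrow>\<^sub>M N \<Longrightarrow> (\<lambda>x. f (x + a)) \<in> lebesgue \<rightarrow>\<^sub>M N"
  using measurable_compose[OF measurable_lebesgue_translation] by blast

lemma nn_integral_translate:
  assumes [measurable]: "f \<in> borel_measurable lebesgue"
  shows "(\<integral>\<^sup>+ x. f (x + a) \<partial>lebesgue) = (\<integral>\<^sup>+ x. f x \<partial>lebesgue)"
proof -
  have "(\<integral>\<^sup>+ x. f x \<partial>distr lebesgue lebesgue (\<lambda>x. x + a)) = (\<integral>\<^sup>+ x. f (x + a) \<partial>lebesgue)"
    by (rule nn_integral_distr[OF measurable_lebesgue_translation]) simp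
  then show ?thesis by (simp add: distr_lebesgue_translation)
qed

lemma integral_translate:
  fixes f :: "'a::euclidean_space \<Rightarrow> 'b::{banach, second_countable_topology}"
  assumes "f \<in> borel_measurable lebesgue"
  shows "(LINT x|lebesgue. f (x + a)) = (LINT x|lebesgue. f x)"
  using integral_distr[OF measurable_lebesgue_translation[of a] assms]
  by (simp add: distr_lebesgue_translation)

lemma integrable_translate:
  fixes f :: "'a::euclidean_space \<Rightarrow> 'b::{banach, second_countable_topology}"
  assumes "integrable lebesgue f"
  shows "integrable lebesgue (\<lambda>x. f (x + a))"
  using assms integrable_distr_eq[OF measurable_lebesgue_translation[of a] borel_measurable_integrable[OF assms]]
  by (simp add: distr_lebesgue_translation)

lemma AE_translate:
  assumes "AE x in lebesgue. P x"
  shows "AE x in lebesgue. P (x + a)"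
proof -
  obtain N where N': "\<And>x. x \<in> space lebesgue - N \<Longrightarrow> P x" and N: "N \<in> null_sets lebesgue"
    by (fact AE_E3[OF assms])
  have "(\<lambda>x. x + a) -` N \<inter> space lebesgue \<in> null_sets lebesgue"
  proof (rule null_setsI)
    show "(\<lambda>x. x + a) -` N \<inter> space lebesgue \<in> sets lebesgue"
      using N by (intro measurable_sets[OF measurable_lebesgue_translation]) auto
    show "emeasure lebesgue ((\<lambda>x. x + a) -` N \<inter> space lebesgue) = 0"
      using emeasure_distr[OF measurable_lebesgue_translation null_setsD2[OF N], of a] null_setsD1[OF N]
      unfolding distr_lebesgue_translation(2) by simp
  qed
  moreover have "{x \<in> space lebesgue. \<not> P (x + a)} \<subseteq> (\<lambda>x. x + a) -` N \<inter> space lebesgue"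
    using N' by auto
  ultimately show ?thesis by (rule AE_I')
qed

section \<open>Smooth functions and the fundamental lemma of the calculus of variations\<close>

lemma C_k_Suc_D: "C_k (Suc k) f \<Longrightarrow> C_k k f"
proof (induction k arbitrary: f)
  case 0
  then show ?case
    by (auto intro!: continuous_at_imp_continuous_on differentiable_imp_continuous_within)
next
  case (Suc k)
  then show ?case by simp
qed

lemma C_k_const: "C_k k (\<lambda>x. c)"
  by (induction k arbitrary: c) auto

lemma C_k_add: "C_k k f \<Longrightarrow> C_k k g \<Longrightarrow> C_k k (\<lambda>x. f x + g x)"
proof (induction k arbitrary: f g)
  case 0
  then show ?case by (auto intro: continuous_intros)
next
  case (Suc k)
  have eq: "frechet_derivative (\<lambda>x. f x + g x) (at x)
      = (\<lambda>e. frechet_derivative f (at x) e + frechet_derivative g (at x) e)" for x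
    by (rule frechet_derivative_at[symmetric])
      (use Suc.prems in \<open>auto intro!: has_derivative_add simp: frechet_derivative_works[symmetric]\<close>)
  show ?case
    using Suc by (auto simp: eq intro!: differentiable_add)
qed

lemma C_k_mult: "C_k k f \<Longrightarrow> C_k k g \<Longrightarrow> C_k k (\<lambda>x. f x * g x)"
proof (induction k arbitrary: f g)
  case 0
  then show ?case by (auto intro: continuous_intros)
next
  case (Suc k)
  have eq: "frechet_derivative (\<lambda>x. f x * g x) (at x)
      = (\<lambda>e. f x * frechet_derivative g (at x) e + frechet_derivative f (at x) e * g x)" for x
    by (rule frechet_derivative_at[symmetric])
      (use Suc.prems in \<open>auto intro!: has_derivative_mult simp: frechet_derivative_works[symmetric]\<close>)
  show ?case
    using Suc.IH Suc.prems C_k_Suc_D[OF Suc.prems(1)] C_k_Suc_D[OF Suc.prems(2)]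
    by (auto simp: eq intro!: C_k_add differentiable_mult)
qed

lemma C_k_prod: "(\<And>i. i \<in> I \<Longrightarrow> C_k k (f i)) \<Longrightarrow> C_k k (\<lambda>x. \<Prod>i\<in>I. f i x)"
  by (induction I rule: infinite_finite_induct) (auto intro: C_k_const C_k_mult)

lemma C_k_translate: "C_k k f \<Longrightarrow> C_k k (\<lambda>x. f (x + a))"
proof (induction k arbitrary: f)
  case 0
  then show ?case
    by (auto intro!: continuous_on_compose2[of UNIV f] continuous_intros)
next
  case (Suc k)
  have eq: "((\<lambda>x. f (x + a)) has_derivative frechet_derivative f (at (x + a))) (at x)" for x
  proof -
    have 1: "((\<lambda>x. x + a) has_derivative (\<lambda>x. x)) (at x)"
      by (auto intro!: derivative_eq_intros)
    have "(f has_derivative frechet_derivative f (at (x + a))) (at (x + a))"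
      using Suc.prems by (simp add: frechet_derivative_works[symmetric])
    from has_derivative_compose[OF 1 this] show ?thesis by simp
  qed
  show ?case
    using Suc by (auto simp: frechet_derivative_at[OF eq, symmetric] intro: differentiableI[OF eq])
qed

text \<open>
  All derivatives of \<open>exp (-1/t)\<close>, extended by \<open>0\<close> to \<open>t \<le> 0\<close>, have this form with a polynomial \<open>P\<close>;
  the family is closed under differentiation.
\<close>

definition flat :: "real poly \<Rightarrow> real \<Rightarrow> real" where
  "flat P t = (if t > 0 then poly P (1 / t) * exp (- (1 / t)) else 0)"

lemma poly_times_exp_tendsto_0: "((\<lambda>s. poly P s * exp (- s)) \<longlongrightarrow> (0::real)) at_top"
proof -
  have "((\<lambda>s. \<Sum>i\<le>degree P. coeff P i * (s ^ i / exp s)) \<longlongrightarrow> (\<Sum>i\<le>degree P. coeff P i * 0)) at_top"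
    by (intro tendsto_intros tendsto_power_div_exp_0)
  then show ?thesis
    by (simp add: poly_altdef sum_divide_distrib exp_minus field_simps)
qed

lemma has_derivative_flat:
  "(flat P has_real_derivative flat ([:0, 0, 1:] * (P - pderiv P)) t) (at t)"
proof -
  consider "t > 0" | "t < 0" | "t = 0" by linarith
  then show ?thesis
  proof cases
    case 1
    have "((\<lambda>t. poly P (1 / t) * exp (- (1 / t))) has_real_derivative
        flat ([:0, 0, 1:] * (P - pderiv P)) t) (at t)"
      unfolding flat_def using 1
      by (auto intro!: derivative_eq_intros DERIV_chain2[OF poly_DERIV] simp: field_simps power2_eq_square)
    then show ?thesis
      by (rule DERIV_cong_ev[THEN iffD1, rotated -1])
        (use 1 in \<open>auto simp: flat_def intro: eventually_mono[OF eventually_gt_at_top]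
            eventually_nhds_in_open[of "{0<..}", THEN eventually_mono]\<close>)
  next
    case 2
    have "((\<lambda>t. 0) has_real_derivative 0) (at t)" by simp
    then show ?thesis
      by (rule DERIV_cong_ev[THEN iffD1, rotated -1])
        (use 2 in \<open>auto simp: flat_def intro: eventually_nhds_in_open[of "{..<0}", THEN eventually_mono]\<close>)
  next
    case 3
    \<comment> \<open>With \<open>s = 1/h\<close> the quotient is \<open>s P(s) exp (-s)\<close>.\<close>
    have "((\<lambda>h. flat P h / h) \<longlongrightarrow> 0) (at_right 0)"
    proof -
      have "((\<lambda>h. poly ([:0,1:] * P) (inverse h) * exp (- inverse h)) \<longlongrightarrow> 0) (at_right (0::real))"
        by (rule filterlim_compose[OF poly_times_exp_tendsto_0 filterlim_inverse_at_top_right])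
      then show ?thesis
        by (rule Lim_transform_eventually)
          (auto simp: eventually_at_filter flat_def field_simps)
    qed
    moreover have "((\<lambda>h. flat P h / h) \<longlongrightarrow> 0) (at_left 0)"
      by (rule tendsto_eventually) (auto simp: eventually_at_filter flat_def)
    ultimately have "((\<lambda>h. flat P h / h) \<longlongrightarrow> 0) (at 0)"
      by (simp add: filterlim_split_at)
    then show ?thesis
      using 3 by (simp add: DERIV_def flat_def)
  qed
qed

lemma C_k_flat_affine: "C_k k (\<lambda>x. flat P (x \<bullet> v + c))"
proof (induction k arbitrary: P)
  case 0
  have "continuous_on UNIV (flat P)" for P
    using DERIV_isCont[OF has_derivative_flat] by (simp add: continuous_at_imp_continuous_on)
  then have "continuous_on UNIV (\<lambda>x. flat P (x \<bullet> v + c))"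
    by (rule continuous_on_compose2) (intro continuous_intros, simp)
  then show ?case by simp
next
  case (Suc k)
  let ?Q = "[:0, 0, 1:] * (P - pderiv P)"
  have eq: "((\<lambda>x. flat P (x \<bullet> v + c)) has_derivative (\<lambda>e. flat ?Q (x \<bullet> v + c) * (e \<bullet> v))) (at x)" for x
  proof -
    have 1: "((\<lambda>x. x \<bullet> v + c) has_derivative (\<lambda>e. e \<bullet> v)) (at x)"
      by (auto intro!: derivative_eq_intros)
    have "(flat P has_derivative (*) (flat ?Q (x \<bullet> v + c))) (at (x \<bullet> v + c))"
      using has_derivative_flat[of P "x \<bullet> v + c"] unfolding has_field_derivative_def .
    from has_derivative_compose[OF 1 this] show ?thesis .
  qed
  show ?case
    using C_k_mult[OF Suc[of ?Q] C_k_const]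
    by (auto simp: frechet_derivative_at[OF eq, symmetric] intro: differentiableI[OF eq])
qed

lemma test_function_translate:
  assumes "test_function \<phi>" shows "test_function (\<lambda>x. \<phi> (x + a))"
proof -
  have "bounded {x. \<phi> x \<noteq> 0}"
    using assms by (simp add: test_function_def)
  then have "bounded ((\<lambda>x. x - a) ` {x. \<phi> x \<noteq> 0})"
    by (rule bounded_translation_minus)
  then have "bounded {x. \<phi> (x + a) \<noteq> 0}"
    by (rule bounded_subset) (force simp: image_iff intro: exI[of _ "_ + a"])
  then show ?thesis
    using assms by (auto simp: test_function_def C_k_translate)
qed

text \<open>
  Smooth functions supported in the box that increase to its indicator: each factor \<open>exp (- 1 / ((n + 1) s))\<close>
  measures the distance \<open>s\<close> to one face.
\<close>

definition box_bump :: "'a::euclidean_space \<Rightarrow> 'a \<Rightarrow> nat \<Rightarrow> 'a \<Rightarrow> real" where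
  "box_bump a b n x = (\<Prod>e\<in>Basis.
     flat 1 (real (Suc n) * (x \<bullet> e - a \<bullet> e)) * flat 1 (real (Suc n) * (b \<bullet> e - x \<bullet> e)))"

lemma flat_one_bounds: "0 \<le> flat 1 t" "flat 1 t \<le> 1"
  by (auto simp: flat_def)

lemma box_bump_bounds: "0 \<le> box_bump a b n x" "box_bump a b n x \<le> 1"
  unfolding box_bump_def
  by (auto intro!: prod_nonneg prod_le_1 mult_nonneg_nonneg mult_le_one simp: flat_one_bounds)

lemma box_bump_outside:
  assumes "x \<notin> box a b" shows "box_bump a b n x = 0"
proof -
  obtain e where e: "e \<in> Basis" "x \<bullet> e \<le> a \<bullet> e \<or> b \<bullet> e \<le> x \<bullet> e"
    using assms by (fastforce simp: mem_box not_less)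
  then have "flat 1 (real (Suc n) * (x \<bullet> e - a \<bullet> e)) * flat 1 (real (Suc n) * (b \<bullet> e - x \<bullet> e)) = 0"
    by (auto simp: flat_def zero_less_mult_iff simp del: of_nat_Suc)
  with e(1) show ?thesis
    unfolding box_bump_def by (auto intro!: prod_zero simp del: mult_eq_0_iff of_nat_Suc)
qed

lemma test_function_box_bump: "test_function (box_bump a b n)"
proof -
  have "C_k k (box_bump a b n)" for k
  proof -
    have "C_k k (\<lambda>x. \<Prod>e\<in>Basis. flat 1 (x \<bullet> (real (Suc n) *\<^sub>R e) + (- real (Suc n) * (a \<bullet> e)))
        * flat 1 (x \<bullet> (- real (Suc n) *\<^sub>R e) + real (Suc n) * (b \<bullet> e)))"
      by (intro C_k_prod C_k_mult C_k_flat_affine)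
    then show ?thesis
      unfolding box_bump_def by (simp add: algebra_simps)
  qed
  moreover have "bounded {x. box_bump a b n x \<noteq> 0}"
    by (rule bounded_subset[OF bounded_box[of a b]]) (use box_bump_outside in blast)
  ultimately show ?thesis
    by (simp add: test_function_def)
qed

lemma box_bump_tendsto: "(\<lambda>n. box_bump a b n x) \<longlonglongrightarrow> indicat_real (box a b) x"
proof (cases "x \<in> box a b")
  case True
  have lim: "(\<lambda>n. flat 1 (real (Suc n) * s)) \<longlonglongrightarrow> 1" if "s > 0" for s
  proof -
    have "(\<lambda>n. exp (- ((1 / s) * inverse (real (Suc n))))) \<longlonglongrightarrow> exp (- ((1 / s) * 0))"
      by (intro tendsto_intros LIMSEQ_inverse_real_of_nat)
    then show ?thesis
      using that by (simp add: flat_def field_simps zero_less_mult_iff add_pos_nonneg)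
  qed
  have "(\<lambda>n. box_bump a b n x) \<longlonglongrightarrow> (\<Prod>e\<in>(Basis::'a set). 1 * 1)"
    unfolding box_bump_def
    by (intro tendsto_prod tendsto_mult lim) (use True in \<open>auto simp: mem_box\<close>)
  then show ?thesis using True by simp
next
  case False
  then show ?thesis by (simp add: box_bump_outside)
qed

lemma integrable_imp_set_integrable:
  fixes f :: "'a \<Rightarrow> 'b::{banach, second_countable_topology}"
  assumes "integrable M f" "A \<in> sets M"
  shows "set_integrable M A f"
  using integrable_mult_indicator[OF assms(2,1)] by (simp add: set_integrable_def)

lemma locally_integrableD:
  fixes g :: "'a::euclidean_space \<Rightarrow> 'b::euclidean_space"
  assumes "locally_integrable g" "bounded S" "S \<in> sets lebesgue"
  shows "set_integrable lebesgue S g"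
proof -
  have "set_integrable lebesgue (closure S) g"
    using assms by (simp add: locally_integrable_def)
  then show ?thesis
    by (rule set_integrable_subset) (use assms closure_subset in auto)
qed

lemma locally_integrable_measurable:
  assumes "locally_integrable g"
  shows "g \<in> borel_measurable lebesgue"
proof -
  have lim: "(\<lambda>n. indicator (cball 0 (real n)) x *\<^sub>R g x) \<longlonglongrightarrow> g x" for x
  proof (rule tendsto_eventually)
    obtain m where "norm x \<le> real m" using real_arch_simple by blast
    then show "\<forall>\<^sub>F n in sequentially. indicator (cball 0 (real n)) x *\<^sub>R g x = g x"
      by (auto simp: eventually_sequentially intro!: exI[of _ m])
  qed
  show ?thesis
    by (rule borel_measurable_LIMSEQ_metric[OF _ lim])
      (use locally_integrableD[OF assms, of "cball 0 _"] in \<open>auto simp: set_integrable_def\<close>)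
qed

text \<open>
  Testing with the bump functions shows that \<open>g\<close> has integral zero over every box.  The boxes are stable under
  intersection and generate the Borel sets, so on a large box an integrable Borel representative of \<open>g\<close> has
  integral zero over every Borel set, hence vanishes.
\<close>

lemma fundamental_lemma:
  fixes g :: "'a::euclidean_space \<Rightarrow> real"
  assumes g: "locally_integrable g"
    and 0: "\<And>\<phi>. test_function \<phi> \<Longrightarrow> (LINT x|lebesgue. g x * \<phi> x) = 0"
  shows "AE x in lebesgue. g x = 0"
proof -
  have [measurable]: "g \<in> borel_measurable lebesgue"
    using g by (rule locally_integrable_measurable)
  have box0: "(LINT x:box a b|lebesgue. g x) = 0" for a b
  proof -
    have int: "integrable lebesgue (\<lambda>x. indicator (box a b) x * g x)"
      using locally_integrableD[OF g, of "box a b"] by (simp add: set_integrable_def)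
    have [measurable]: "g \<in> borel_measurable lebesgue" by fact
    have [measurable]: "box a b \<in> sets lebesgue" by simp
    have bm[measurable]: "box_bump a b n \<in> borel_measurable lebesgue" for n
    proof -
      have "C_k 0 (box_bump a b n)"
        using test_function_box_bump[of a b n] unfolding test_function_def by blast
      then show ?thesis
        by (intro measurable_completion) (simp add: borel_measurable_continuous_onI)
    qed
    have "(\<lambda>n. LINT x|lebesgue. g x * box_bump a b n x) \<longlonglongrightarrow> (LINT x|lebesgue. g x * indicat_real (box a b) x)"
    proof (rule integral_dominated_convergence[where w="\<lambda>x. \<bar>indicator (box a b) x * g x\<bar>"])
      show "AE x in lebesgue. norm (g x * box_bump a b n x) \<le> \<bar>indicator (box a b) x * g x\<bar>" for n
      proof (rule AE_I2)
        fix x show "norm (g x * box_bump a b n x) \<le> \<bar>indicator (box a b) x * g x\<bar>"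
          using box_bump_bounds[of a b n x]
          by (cases "x \<in> box a b") (auto simp: abs_mult box_bump_outside intro: mult_left_le)
      qed
      show "AE x in lebesgue. (\<lambda>n. g x * box_bump a b n x) \<longlonglongrightarrow> g x * indicat_real (box a b) x"
        by (intro AE_I2 tendsto_intros box_bump_tendsto)
      show "integrable lebesgue (\<lambda>x. \<bar>indicator (box a b) x * g x\<bar>)"
        using int by (rule integrable_abs)
    qed measurable
    then have "(LINT x|lebesgue. g x * indicat_real (box a b) x) = 0"
      by (simp add: 0[OF test_function_box_bump] LIMSEQ_const_iff)
    then show ?thesis
      by (simp add: set_lebesgue_integral_def mult.commute)
  qed
  have Bs: "box a b \<in> sets lebesgue" for a b :: 'a by simp
  have ball0: "AE x in lebesgue. x \<in> box (- (real n *\<^sub>R One)) (real n *\<^sub>R One) \<longrightarrow> g x = 0" for n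
  proof -
    let ?B = "box (- (real n *\<^sub>R One)) (real n *\<^sub>R One) :: 'a set"
    have int: "integrable lebesgue (\<lambda>x. indicator ?B x * g x)"
      using locally_integrableD[OF g, of ?B] Bs by (simp add: set_integrable_def)
    obtain f where f[measurable]: "f \<in> borel_measurable lborel" and fg': "AE x in lborel. indicator ?B x * g x = f x"
      using completion_ex_borel_measurable_real[OF borel_measurable_integrable[OF int]] by blast
    then have fg: "AE x in lebesgue. indicator ?B x * g x = f x"
      by (simp add: AE_completion)
    have intf: "integrable lborel f"
    proof -
      have "integrable lebesgue f"
        by (rule integrable_cong_AE_imp[OF int]) (use f fg in \<open>auto intro: measurable_completion elim: AE_mp\<close>)
      then show ?thesis using integrable_completion[of f lborel] f by simp
    qed
    have eq: "(LINT x:A|lborel. f x) = (LINT x:A \<inter> ?B|lebesgue. g x)" if "A \<in> sets borel" for A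
    proof -
      have "(LINT x:A|lborel. f x) = (LINT x|lebesgue. indicator A x * f x)"
        using that by (simp add: set_lebesgue_integral_def integral_completion)
      also have "\<dots> = (LINT x|lebesgue. indicator A x * (indicator ?B x * g x))"
      proof (rule integral_cong_AE)
        have [measurable]: "A \<in> sets lebesgue" "?B \<in> sets lebesgue" "f \<in> borel_measurable lebesgue"
          using that f by (auto intro: measurable_completion)
        show "(\<lambda>x. indicator A x * f x) \<in> borel_measurable lebesgue" by measurable
        show "(\<lambda>x. indicator A x * (indicator ?B x * g x)) \<in> borel_measurable lebesgue" by measurable
        show "AE x in lebesgue. indicator A x * f x = indicator A x * (indicator ?B x * g x)"
          using fg by eventually_elim simp
      qed
      finally show ?thesis
        by (simp add: set_lebesgue_integral_def indicator_inter_arith mult.assoc)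
    qed
    have "AE x in lborel. f x = (\<lambda>_. 0) x"
    proof (rule density_unique_real[OF intf])
      fix A assume "A \<in> sets (lborel :: 'a measure)"
      then have A_in: "A \<in> sigma_sets UNIV (range (\<lambda>(a, b). box a b :: 'a set))"
        by (simp add: borel_eq_box)
      have "Int_stable (range (\<lambda>(a, b). box a b :: 'a set))"
        by (auto simp: Int_stable_def box_Int_box)
      moreover have "range (\<lambda>(a, b). box a b :: 'a set) \<subseteq> Pow UNIV" by simp
      ultimately have "(LINT x:A|lborel. f x) = 0"
        using A_in
      proof (induction rule: sigma_sets_induct_disjoint)
        case (basic A)
        then obtain a b where "A = box a b" by auto
        then show ?case
          using box0 by (subst eq) (auto simp: box_Int_box)
      next
        case (compl A)
        then have A: "A \<in> sets borel" by (simp add: borel_eq_box)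
        have "(LINT x:UNIV|lborel. f x) = (LINT x:A|lborel. f x) + (LINT x:UNIV - A|lborel. f x)"
        proof -
          have "set_integrable lborel A f" "set_integrable lborel (UNIV - A) f"
            using A by (intro integrable_imp_set_integrable[OF intf]; simp)+
          from set_integral_Un[OF _ this] show ?thesis by simp
        qed
        moreover have "(LINT x:UNIV|lborel. f x) = 0"
          using box0[of "- (real n *\<^sub>R One)" "real n *\<^sub>R One"] eq[of UNIV] by simp
        ultimately show ?case using compl by simp
      next
        case (union F)
        then have F: "\<And>i. F i \<in> sets borel" by (auto simp: borel_eq_box)
        have "(LINT x:(\<Union>i. F i)|lborel. f x) = (\<Sum>i. LINT x:F i|lborel. f x)"
        proof (rule lebesgue_integral_countable_add)
          show "F i \<inter> F j = {}" if "i \<noteq> j" for i j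
            using union(1) that by (auto simp: disjoint_family_on_def)
          show "set_integrable lborel (\<Union>i. F i) f"
            using F by (intro integrable_imp_set_integrable[OF intf]) auto
        qed (use F in auto)
        then show ?case using union by simp
      qed (auto simp: set_lebesgue_integral_def)
      then show "(LINT x:A|lborel. f x) = (LINT x:A|lborel. 0)" by simp
    qed simp
    then have "AE x in lebesgue. f x = 0"
      by (simp add: AE_completion)
    with fg show ?thesis by eventually_elim (auto simp: indicator_def split: if_splits)
  qed
  have "AE x in lebesgue. \<forall>n. x \<in> box (- (real n *\<^sub>R One)) (real n *\<^sub>R One) \<longrightarrow> g x = 0"
    unfolding AE_all_countable using ball0 by blast
  then show ?thesis
  proof eventually_elim
    case (elim x)
    obtain n where "norm x < real n" using reals_Archimedean2 by blast
    then have "x \<in> box (- (real n *\<^sub>R One)) (real n *\<^sub>R One)"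
    proof -
      have "\<bar>x \<bullet> e\<bar> < real n" if "e \<in> Basis" for e
        using Basis_le_norm[OF that, of x] \<open>norm x < real n\<close> by linarith
      then show ?thesis by (auto simp: mem_box abs_less_iff minus_less_iff)
    qed
    then show ?case using elim by blast
  qed
qed

section \<open>Square integrable functions\<close>

lemma L2_measurable: "f \<in> L2 \<Longrightarrow> f \<in> borel_measurable lebesgue"
  and L2_integrable: "f \<in> L2 \<Longrightarrow> integrable lebesgue (\<lambda>x. (norm (f x))\<^sup>2)"
  by (auto simp: L2_def)

lemma L2_real_integrable: "(f :: 'a::euclidean_space \<Rightarrow> real) \<in> L2 \<Longrightarrow> integrable lebesgue (\<lambda>x. (f x)\<^sup>2)"
  using L2_integrable[of f] by simp

lemma L2_bound:
  assumes "g \<in> L2" "f \<in> borel_measurable lebesgue" "AE x in lebesgue. norm (f x) \<le> C * norm (g x)"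
  shows "f \<in> L2"
proof -
  have [measurable]: "f \<in> borel_measurable lebesgue" "g \<in> borel_measurable lebesgue"
    using assms L2_measurable by auto
  have "integrable lebesgue (\<lambda>x. (norm (f x))\<^sup>2)"
  proof (rule Bochner_Integration.integrable_bound)
    show "integrable lebesgue (\<lambda>x. C\<^sup>2 * (norm (g x))\<^sup>2)"
      using L2_integrable[OF assms(1)] by simp
    show "AE x in lebesgue. norm ((norm (f x))\<^sup>2) \<le> norm (C\<^sup>2 * (norm (g x))\<^sup>2)"
      using assms(3)
    proof eventually_elim
      case (elim x)
      have "(norm (f x))\<^sup>2 \<le> (C * norm (g x))\<^sup>2"
        using elim by (intro power_mono) auto
      then show ?case by (simp add: power_mult_distrib)
    qed
  qed measurable
  then show ?thesis using assms(2) by (simp add: L2_def)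
qed

lemma L2_cong_AE:
  fixes f g :: "'a::euclidean_space \<Rightarrow> 'b::euclidean_space"
  assumes "g \<in> L2" "AE x in lebesgue. f x = g x"
  shows "f \<in> L2"
proof (rule L2_bound[OF assms(1), of _ 1])
  have "AE x in lebesgue. g x = f x" using assms(2) by eventually_elim simp
  then show "f \<in> borel_measurable lebesgue"
    by (rule borel_measurable_AE[OF L2_measurable[OF assms(1)]])
  show "AE x in lebesgue. norm (f x) \<le> 1 * norm (g x)"
    using assms(2) by eventually_elim simp
qed

lemma norm_add_sq_le: "(norm (a + b))\<^sup>2 \<le> 2 * (norm a)\<^sup>2 + 2 * (norm (b::'a::real_normed_vector))\<^sup>2"
proof -
  have "(norm (a + b))\<^sup>2 \<le> (norm a + norm b)\<^sup>2"
    by (intro power_mono norm_triangle_ineq) simp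
  also have "\<dots> \<le> 2 * (norm a)\<^sup>2 + 2 * (norm b)\<^sup>2"
    using sum_squares_bound[of "norm a" "norm b"] by (simp add: power2_sum)
  finally show ?thesis .
qed

lemma L2_add:
  assumes "f \<in> L2" "g \<in> L2" shows "(\<lambda>x. f x + g x) \<in> L2"
proof -
  have [measurable]: "f \<in> borel_measurable lebesgue" "g \<in> borel_measurable lebesgue"
    using assms L2_measurable by auto
  have "integrable lebesgue (\<lambda>x. (norm (f x + g x))\<^sup>2)"
  proof (rule Bochner_Integration.integrable_bound)
    show "integrable lebesgue (\<lambda>x. 2 * (norm (f x))\<^sup>2 + 2 * (norm (g x))\<^sup>2)"
      using L2_integrable[OF assms(1)] L2_integrable[OF assms(2)] by simp
  qed (use norm_add_sq_le in auto)
  then show ?thesis by (simp add: L2_def)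
qed

lemma L2_scale: "f \<in> L2 \<Longrightarrow> (\<lambda>x. c *\<^sub>R f x) \<in> L2"
  by (rule L2_bound[where C="\<bar>c\<bar>" and g=f]) (auto intro: borel_measurable_scaleR L2_measurable)

lemma L2_mult: "(f :: 'a::euclidean_space \<Rightarrow> real) \<in> L2 \<Longrightarrow> (\<lambda>x. c * f x) \<in> L2"
  using L2_scale[of f c] by simp

lemma L2_diff: "f \<in> L2 \<Longrightarrow> g \<in> L2 \<Longrightarrow> (\<lambda>x. f x - g x) \<in> L2"
  using L2_add[of f "\<lambda>x. (-1) *\<^sub>R g x"] L2_scale[of g "-1"] by simp

lemma L2_norm: "f \<in> L2 \<Longrightarrow> (\<lambda>x. norm (f x)) \<in> L2"
  by (rule L2_bound[where C=1 and g=f]) (auto intro: measurable_compose[OF L2_measurable borel_measurable_norm])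

lemma L2_translate: "f \<in> L2 \<Longrightarrow> (\<lambda>x. f (x + a)) \<in> L2"
  using integrable_translate[of "\<lambda>x. (norm (f x))\<^sup>2" a] by (auto simp: L2_def measurable_translate)

lemma L2_inner_integrable:
  assumes "f \<in> L2" "g \<in> L2" shows "integrable lebesgue (\<lambda>x. f x \<bullet> g x)"
proof -
  have [measurable]: "f \<in> borel_measurable lebesgue" "g \<in> borel_measurable lebesgue"
    using assms L2_measurable by auto
  show ?thesis
  proof (rule Bochner_Integration.integrable_bound)
    show "integrable lebesgue (\<lambda>x. (norm (f x))\<^sup>2 + (norm (g x))\<^sup>2)"
      using L2_integrable[OF assms(1)] L2_integrable[OF assms(2)] by simp
    show "AE x in lebesgue. norm (f x \<bullet> g x) \<le> norm ((norm (f x))\<^sup>2 + (norm (g x))\<^sup>2)"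
    proof (rule AE_I2)
      fix x
      have "\<bar>f x \<bullet> g x\<bar> \<le> norm (f x) * norm (g x)" by (rule Cauchy_Schwarz_ineq2)
      also have "\<dots> \<le> (norm (f x))\<^sup>2 + (norm (g x))\<^sup>2"
      proof -
        have "0 \<le> norm (f x) * norm (g x)" by simp
        then show ?thesis using sum_squares_bound[of "norm (f x)" "norm (g x)"] by linarith
      qed
      finally show "norm (f x \<bullet> g x) \<le> norm ((norm (f x))\<^sup>2 + (norm (g x))\<^sup>2)" by simp
    qed
  qed measurable
qed

lemma L2_mult_integrable:
  "(f :: 'a::euclidean_space \<Rightarrow> real) \<in> L2 \<Longrightarrow> g \<in> L2 \<Longrightarrow> integrable lebesgue (\<lambda>x. f x * g x)"
  using L2_inner_integrable[of f g] by simp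

text \<open>
  The discriminant of a nonnegative quadratic polynomial is not positive.  This serves both the inner product of
  \<open>L2\<close> and the one of \<open>H1\<close>.
\<close>

lemma semidefinite_Cauchy_Schwarz:
  fixes a b c :: real
  assumes pos: "\<And>t. 0 \<le> a + 2 * t * b + t\<^sup>2 * c" and "0 \<le> a" "0 \<le> c"
  shows "\<bar>b\<bar> \<le> sqrt a * sqrt c"
proof -
  have "b\<^sup>2 \<le> a * c"
  proof (cases "c = 0")
    case True
    have "b = 0"
    proof (rule ccontr)
      assume "b \<noteq> 0"
      \<comment> \<open>For this \<open>t\<close> the polynomial has the value \<open>-1\<close>.\<close>
      with pos[of "- (a + 1) / (2 * b)"] True show False by (simp add: field_simps)
    qed
    then show ?thesis using assms by simp
  next
    case False
    with \<open>0 \<le> c\<close> have "c > 0" by simp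
    have "0 \<le> (a + 2 * (- b / c) * b + (- b / c)\<^sup>2 * c) * c"
      using pos[of "- b / c"] \<open>c > 0\<close> by (intro mult_nonneg_nonneg) auto
    also have "\<dots> = a * c - b\<^sup>2"
      using \<open>c > 0\<close> by (simp add: field_simps power2_eq_square)
    finally show ?thesis by simp
  qed
  then have "sqrt (b\<^sup>2) \<le> sqrt (a * c)" by (rule real_sqrt_le_mono)
  then show ?thesis by (simp add: real_sqrt_mult)
qed

lemma L2_Cauchy_Schwarz:
  assumes f: "f \<in> L2" and g: "g \<in> L2"
  shows "\<bar>LINT x|lebesgue. f x \<bullet> g x\<bar>
    \<le> sqrt (LINT x|lebesgue. (norm (f x))\<^sup>2) * sqrt (LINT x|lebesgue. (norm (g x))\<^sup>2)"
proof (rule semidefinite_Cauchy_Schwarz)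
  fix t
  have "0 \<le> (LINT x|lebesgue. (norm (f x + t *\<^sub>R g x))\<^sup>2)" by simp
  also have "\<dots> = (LINT x|lebesgue. (norm (f x))\<^sup>2 + 2 * t * (f x \<bullet> g x) + t\<^sup>2 * (norm (g x))\<^sup>2)"
    unfolding power2_norm_eq_inner
    by (intro Bochner_Integration.integral_cong refl)
      (simp add: inner_add_left inner_add_right inner_commute power2_eq_square algebra_simps)
  also have "\<dots> = (LINT x|lebesgue. (norm (f x))\<^sup>2) + 2 * t * (LINT x|lebesgue. f x \<bullet> g x)
      + t\<^sup>2 * (LINT x|lebesgue. (norm (g x))\<^sup>2)"
    using L2_integrable[OF f] L2_integrable[OF g] L2_inner_integrable[OF f g] by simp
  finally show "0 \<le> \<dots>" .
qed auto

lemma L2_Cauchy_Schwarz_real: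
  fixes f g :: "'a::euclidean_space \<Rightarrow> real"
  assumes f: "f \<in> L2" and g: "g \<in> L2"
  shows "(LINT x|lebesgue. \<bar>f x * g x\<bar>)
    \<le> sqrt (LINT x|lebesgue. (f x)\<^sup>2) * sqrt (LINT x|lebesgue. (g x)\<^sup>2)"
proof -
  have "(LINT x|lebesgue. \<bar>f x * g x\<bar>) = (LINT x|lebesgue. norm (f x) \<bullet> norm (g x))"
    by (simp add: abs_mult)
  then show ?thesis
    using L2_Cauchy_Schwarz[OF L2_norm[OF f] L2_norm[OF g]] by simp
qed

lemma L2_locally_integrable:
  fixes f :: "'a::euclidean_space \<Rightarrow> 'b::euclidean_space"
  assumes "f \<in> L2" shows "locally_integrable f"
  unfolding locally_integrable_def
proof (intro allI impI)
  fix K :: "'a set" assume K: "compact K"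
  have [measurable]: "f \<in> borel_measurable lebesgue" "K \<in> sets lebesgue"
    using assms L2_measurable lmeasurable_compact[OF K] by (auto intro: fmeasurableD)
  have "integrable lebesgue (indicat_real K)"
    using K lmeasurable_compact[of K] by (auto simp: fmeasurable_def)
  then have "integrable lebesgue (\<lambda>x. indicat_real K x + (norm (f x))\<^sup>2)"
    using L2_integrable[OF assms] by simp
  then show "set_integrable lebesgue K f"
    unfolding set_integrable_def
  proof (rule Bochner_Integration.integrable_bound)
    show "AE x in lebesgue. norm (indicat_real K x *\<^sub>R f x) \<le> norm (indicat_real K x + (norm (f x))\<^sup>2)"
    proof (rule AE_I2)
      fix x
      have "norm (f x) \<le> 1 + (norm (f x))\<^sup>2"
      proof -
        have "2 * norm (f x) \<le> 1 + (norm (f x))\<^sup>2" using sum_squares_bound[of 1 "norm (f x)"] by simp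
        with norm_ge_zero[of "f x"] show ?thesis by linarith
      qed
      then show "norm (indicat_real K x *\<^sub>R f x) \<le> norm (indicat_real K x + (norm (f x))\<^sup>2)"
        by (auto simp: indicator_def)
    qed
  qed measurable
qed

section \<open>Weak gradients\<close>

lemma test_function_bounded_support:
  assumes "test_function \<phi>"
  obtains K C where "compact K" "continuous_on UNIV \<phi>" "\<And>x. x \<notin> K \<Longrightarrow> \<phi> x = 0" "\<And>x. \<bar>\<phi> x\<bar> \<le> C"
    "\<And>x. \<phi> differentiable (at x)"
    "\<And>e. e \<in> Basis \<Longrightarrow> continuous_on UNIV (\<lambda>x. frechet_derivative \<phi> (at x) e)"
    "\<And>x e. x \<notin> K \<Longrightarrow> frechet_derivative \<phi> (at x) e = 0"
    "\<And>x e. e \<in> Basis \<Longrightarrow> \<bar>frechet_derivative \<phi> (at x) e\<bar> \<le> C"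
proof -
  let ?K = "closure {x. \<phi> x \<noteq> 0}"
  have K: "compact ?K" and C: "\<And>k. C_k k \<phi>"
    using assms by (auto simp: test_function_def)
  have cont: "continuous_on UNIV \<phi>" using C[of 0] by simp
  have C1: "C_k (Suc 0) \<phi>" by (rule C)
  have out: "\<phi> x = 0" if "x \<notin> ?K" for x
    using that closure_subset[of "{x. \<phi> x \<noteq> 0}"] by auto
  have dout: "frechet_derivative \<phi> (at x) e = 0" if "x \<notin> ?K" for x e
  proof -
    have "((\<lambda>x. 0) has_derivative (\<lambda>e. 0)) (at x)" by simp
    then have "(\<phi> has_derivative (\<lambda>e. 0)) (at x)"
    proof (rule has_derivative_transform_within_open)
      show "open (- ?K)" by (intro open_Compl closed_closure)
      show "x \<in> - ?K" using that unfolding Compl_iff .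
      show "0 = \<phi> z" if "z \<in> - ?K" for z using out[of z] that by simp
    qed
    from frechet_derivative_at[OF this] show ?thesis by metis
  qed
  have dcont: "continuous_on UNIV (\<lambda>x. frechet_derivative \<phi> (at x) e)" if "e \<in> Basis" for e
    using C1 that by simp
  have bdd: "\<exists>C. \<forall>x. \<bar>f x\<bar> \<le> C" if "continuous_on UNIV f" "\<And>x. x \<notin> ?K \<Longrightarrow> f x = 0" for f :: "'a \<Rightarrow> real"
  proof -
    have "bounded (f ` ?K)"
      by (intro compact_imp_bounded compact_continuous_image K continuous_on_subset[OF that(1)]) simp
    then obtain C where C: "\<And>x. x \<in> ?K \<Longrightarrow> \<bar>f x\<bar> \<le> C"
      by (auto simp: bounded_iff)
    have "\<bar>f x\<bar> \<le> max C 0" for x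
      using C[of x] that(2)[of x] by (cases "x \<in> ?K") auto
    then show ?thesis by blast
  qed
  obtain C0 where C0: "\<And>x. \<bar>\<phi> x\<bar> \<le> C0" using bdd[OF cont out] by blast
  have "\<forall>e\<in>Basis. \<exists>C. \<forall>x. \<bar>frechet_derivative \<phi> (at x) e\<bar> \<le> C"
    using bdd[OF dcont dout] by blast
  then obtain D where D: "\<And>e x. e \<in> Basis \<Longrightarrow> \<bar>frechet_derivative \<phi> (at x) e\<bar> \<le> D e"
    by metis
  have D0: "D e \<ge> 0" if "e \<in> Basis" for e
    using D[OF that, of 0] by linarith
  have D1: "D e \<le> (\<Sum>e\<in>Basis. D e)" if "e \<in> Basis" for e
    using that D0 by (intro member_le_sum) auto
  have S0: "0 \<le> (\<Sum>e\<in>(Basis::'a set). D e)" using D0 by (rule sum_nonneg)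
  have C00: "0 \<le> C0" using C0[of 0] by linarith
  show ?thesis
  proof (rule that[of ?K "C0 + (\<Sum>e\<in>(Basis::'a set). D e)"])
    show "\<bar>\<phi> x\<bar> \<le> C0 + (\<Sum>e\<in>(Basis::'a set). D e)" for x using C0[of x] S0 by linarith
    show "\<bar>frechet_derivative \<phi> (at x) e\<bar> \<le> C0 + (\<Sum>e\<in>(Basis::'a set). D e)" if "e \<in> Basis" for x e
      using D[OF that, of x] D1[OF that] C00 by linarith
    show "\<phi> differentiable at x" for x using C1 by simp
  qed (fact K cont out dout dcont)+
qed

lemma integrable_mult_bounded_support:
  fixes g \<phi> :: "'a::euclidean_space \<Rightarrow> real"
  assumes g: "locally_integrable g" and "compact K" "\<phi> \<in> borel_measurable lebesgue"
    and "\<And>x. x \<notin> K \<Longrightarrow> \<phi> x = 0" "\<And>x. \<bar>\<phi> x\<bar> \<le> C"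
  shows "integrable lebesgue (\<lambda>x. g x * \<phi> x)"
proof -
  have [measurable]: "g \<in> borel_measurable lebesgue" "\<phi> \<in> borel_measurable lebesgue"
    using locally_integrable_measurable[OF g] assms by auto
  have "integrable lebesgue (\<lambda>x. indicat_real K x *\<^sub>R g x)"
    using g \<open>compact K\<close> by (simp add: locally_integrable_def set_integrable_def)
  then have "integrable lebesgue (\<lambda>x. C * (indicat_real K x * g x))" by simp
  then show ?thesis
  proof (rule Bochner_Integration.integrable_bound)
    show "AE x in lebesgue. norm (g x * \<phi> x) \<le> norm (C * (indicat_real K x * g x))"
    proof (rule AE_I2)
      fix x
      have "\<bar>\<phi> x\<bar> \<le> \<bar>C\<bar>" using assms(5)[of x] by linarith
      then show "norm (g x * \<phi> x) \<le> norm (C * (indicat_real K x * g x))"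
      proof (cases "x \<in> K")
        case True
        have "\<bar>g x\<bar> * \<bar>\<phi> x\<bar> \<le> \<bar>g x\<bar> * \<bar>C\<bar>"
          using \<open>\<bar>\<phi> x\<bar> \<le> \<bar>C\<bar>\<close> by (rule mult_left_mono) simp
        then show ?thesis using True by (simp add: abs_mult mult.commute)
      next
        case False
        then show ?thesis using assms(4)[of x] by simp
      qed
    qed
  qed measurable
qed

lemma continuous_measurable_lebesgue: "continuous_on UNIV f \<Longrightarrow> f \<in> borel_measurable lebesgue"
  by (intro measurable_completion) (simp add: borel_measurable_continuous_onI)

lemma test_function_integrable:
  assumes "locally_integrable g" "test_function \<phi>"
  shows "integrable lebesgue (\<lambda>x. g x * \<phi> x)"
    and "e \<in> Basis \<Longrightarrow> integrable lebesgue (\<lambda>x. g x * frechet_derivative \<phi> (at x) e)"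
proof -
  obtain K C where K: "compact K" "continuous_on UNIV \<phi>" "\<And>x. x \<notin> K \<Longrightarrow> \<phi> x = 0" "\<And>x. \<bar>\<phi> x\<bar> \<le> C"
    "\<And>x. \<phi> differentiable (at x)"
    "\<And>e. e \<in> Basis \<Longrightarrow> continuous_on UNIV (\<lambda>x. frechet_derivative \<phi> (at x) e)"
    "\<And>x e. x \<notin> K \<Longrightarrow> frechet_derivative \<phi> (at x) e = 0"
    "\<And>x e. e \<in> Basis \<Longrightarrow> \<bar>frechet_derivative \<phi> (at x) e\<bar> \<le> C"
    by (fact test_function_bounded_support[OF assms(2)])
  show "integrable lebesgue (\<lambda>x. g x * \<phi> x)"
    by (rule integrable_mult_bounded_support[OF assms(1) K(1) _ K(3,4)])
      (rule continuous_measurable_lebesgue[OF K(2)])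
  show "integrable lebesgue (\<lambda>x. g x * frechet_derivative \<phi> (at x) e)" if "e \<in> Basis"
    by (rule integrable_mult_bounded_support[OF assms(1) K(1) _ K(7) K(8)[OF that]])
      (rule continuous_measurable_lebesgue[OF K(6)[OF that]])
qed

lemma locally_integrable_inner:
  assumes "locally_integrable G" shows "locally_integrable (\<lambda>x. G x \<bullet> e)"
  unfolding locally_integrable_def set_integrable_def
proof (intro allI impI)
  fix K :: "'a set" assume "compact K"
  then have "integrable lebesgue (\<lambda>x. indicat_real K x *\<^sub>R G x)"
    using assms by (simp add: locally_integrable_def set_integrable_def)
  then have "integrable lebesgue (\<lambda>x. (indicat_real K x *\<^sub>R G x) \<bullet> e)"
    by (rule integrable_inner_left)
  then show "integrable lebesgue (\<lambda>x. indicat_real K x *\<^sub>R (G x \<bullet> e))" by simp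
qed

lemma locally_integrable_add: "locally_integrable f \<Longrightarrow> locally_integrable g \<Longrightarrow> locally_integrable (\<lambda>x. f x + g x)"
  unfolding locally_integrable_def by (auto intro: set_integral_add)

lemma locally_integrable_scale: "locally_integrable f \<Longrightarrow> locally_integrable (\<lambda>x. c *\<^sub>R f x)"
  unfolding locally_integrable_def by (auto intro: set_integrable_scaleR_right)

lemma has_weak_gradientD:
  assumes "has_weak_gradient u G" "test_function \<phi>" "e \<in> Basis"
  shows "(LINT x|lebesgue. u x * frechet_derivative \<phi> (at x) e) = - (LINT x|lebesgue. (G x \<bullet> e) * \<phi> x)"
  using assms by (simp add: has_weak_gradient_def)

lemma has_weak_gradient_unique:
  assumes G: "has_weak_gradient u G" and H: "has_weak_gradient u H"
  shows "AE x in lebesgue. G x = H x"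
proof -
  have lG: "locally_integrable G" and lH: "locally_integrable H"
    using assms by (auto simp: has_weak_gradient_def)
  have "AE x in lebesgue. G x \<bullet> e + (- 1) *\<^sub>R (H x \<bullet> e) = 0" if "e \<in> Basis" for e
  proof (rule fundamental_lemma)
    show "locally_integrable (\<lambda>x. G x \<bullet> e + (- 1) *\<^sub>R (H x \<bullet> e))"
      by (intro locally_integrable_add locally_integrable_scale locally_integrable_inner lG lH)
    fix \<phi> :: "'a \<Rightarrow> real" assume \<phi>: "test_function \<phi>"
    have "(LINT x|lebesgue. (G x \<bullet> e + (- 1) *\<^sub>R (H x \<bullet> e)) * \<phi> x)
        = (LINT x|lebesgue. (G x \<bullet> e) * \<phi> x) - (LINT x|lebesgue. (H x \<bullet> e) * \<phi> x)"
      using test_function_integrable(1)[OF locally_integrable_inner[OF lG] \<phi>]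
        test_function_integrable(1)[OF locally_integrable_inner[OF lH] \<phi>]
      by (simp add: left_diff_distrib)
    also have "\<dots> = 0"
    proof -
      show ?thesis
        using has_weak_gradientD[OF G \<phi> that] has_weak_gradientD[OF H \<phi> that] by simp
    qed
    finally show "(LINT x|lebesgue. (G x \<bullet> e + (- 1) *\<^sub>R (H x \<bullet> e)) * \<phi> x) = 0" .
  qed
  then have "AE x in lebesgue. \<forall>e\<in>Basis. G x \<bullet> e = H x \<bullet> e"
    by (intro AE_finite_allI) auto
  then show ?thesis
    by eventually_elim (rule euclidean_eqI, blast)
qed

lemma has_weak_gradient_add:
  assumes "has_weak_gradient u G" "has_weak_gradient v H"
  shows "has_weak_gradient (\<lambda>x. u x + v x) (\<lambda>x. G x + H x)"
  unfolding has_weak_gradient_def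
proof (intro conjI allI impI)
  have l: "locally_integrable u" "locally_integrable G" "locally_integrable v" "locally_integrable H"
    using assms by (auto simp: has_weak_gradient_def)
  show "locally_integrable (\<lambda>x. u x + v x)" "locally_integrable (\<lambda>x. G x + H x)"
    by (intro locally_integrable_add l)+
  fix \<phi> :: "'a \<Rightarrow> real" and e :: 'a assume \<phi>: "test_function \<phi>" "e \<in> Basis"
  note eqs = has_weak_gradientD[OF assms(1) \<phi>] has_weak_gradientD[OF assms(2) \<phi>]
  show "(LINT x|lebesgue. (u x + v x) * frechet_derivative \<phi> (at x) e)
      = - (LINT x|lebesgue. ((G x + H x) \<bullet> e) * \<phi> x)"
    using test_function_integrable(2)[OF l(1) \<phi>] test_function_integrable(2)[OF l(3) \<phi>]
      test_function_integrable(1)[OF locally_integrable_inner[OF l(2)] \<phi>(1), of e]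
      test_function_integrable(1)[OF locally_integrable_inner[OF l(4)] \<phi>(1), of e] eqs
    by (simp add: distrib_right inner_add_left)
qed

lemma has_weak_gradient_scale:
  assumes "has_weak_gradient u G"
  shows "has_weak_gradient (\<lambda>x. c * u x) (\<lambda>x. c *\<^sub>R G x)"
  unfolding has_weak_gradient_def
proof (intro conjI allI impI)
  have l: "locally_integrable u" "locally_integrable G"
    using assms by (auto simp: has_weak_gradient_def)
  show "locally_integrable (\<lambda>x. c * u x)" "locally_integrable (\<lambda>x. c *\<^sub>R G x)"
    using locally_integrable_scale[OF l(1), of c] locally_integrable_scale[OF l(2), of c] by auto
  fix \<phi> :: "'a \<Rightarrow> real" and e :: 'a assume \<phi>: "test_function \<phi>" "e \<in> Basis"
  show "(LINT x|lebesgue. (c * u x) * frechet_derivative \<phi> (at x) e)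
      = - (LINT x|lebesgue. ((c *\<^sub>R G x) \<bullet> e) * \<phi> x)"
    using has_weak_gradientD[OF assms \<phi>] by (simp add: mult.assoc)
qed

lemma locally_integrable_translate:
  fixes f :: "'a::euclidean_space \<Rightarrow> 'b::euclidean_space"
  assumes "locally_integrable f"
  shows "locally_integrable (\<lambda>x. f (x + a))"
  unfolding locally_integrable_def
proof (intro allI impI)
  fix K :: "'a set" assume "compact K"
  then have "compact ((\<lambda>x. x + a) ` K)"
    by (intro compact_continuous_image continuous_intros)
  then have "integrable lebesgue (\<lambda>x. indicat_real ((\<lambda>x. x + a) ` K) x *\<^sub>R f x)"
    using assms by (simp add: locally_integrable_def set_integrable_def)
  from integrable_translate[OF this, of a]
  have "integrable lebesgue (\<lambda>x. indicat_real ((\<lambda>x. x + a) ` K) (x + a) *\<^sub>R f (x + a))" .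
  moreover have "indicat_real ((\<lambda>x. x + a) ` K) (x + a) = indicat_real K x" for x
    by (auto simp: indicator_def)
  ultimately show "set_integrable lebesgue K (\<lambda>x. f (x + a))"
    by (simp add: set_integrable_def)
qed

lemma frechet_derivative_translate:
  assumes "f differentiable (at (x + a))"
  shows "frechet_derivative (\<lambda>x. f (x + a)) (at x) = frechet_derivative f (at (x + a))"
proof -
  have 1: "((\<lambda>x. x + a) has_derivative (\<lambda>x. x)) (at x)"
    by (auto intro!: derivative_eq_intros)
  have "(f has_derivative frechet_derivative f (at (x + a))) (at (x + a))"
    using assms by (simp add: frechet_derivative_works[symmetric])
  from has_derivative_compose[OF 1 this] show ?thesis
    by (simp add: frechet_derivative_at[symmetric])
qed

lemma has_weak_gradient_translate:
  assumes "has_weak_gradient u G"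
  shows "has_weak_gradient (\<lambda>x. u (x + a)) (\<lambda>x. G (x + a))"
  unfolding has_weak_gradient_def
proof (intro conjI allI impI)
  have l: "locally_integrable u" "locally_integrable G"
    using assms by (auto simp: has_weak_gradient_def)
  show "locally_integrable (\<lambda>x. u (x + a))" "locally_integrable (\<lambda>x. G (x + a))"
    by (intro locally_integrable_translate l)+
  fix \<phi> :: "'a \<Rightarrow> real" and e :: 'a assume \<phi>: "test_function \<phi>" "e \<in> Basis"
  define \<psi> where "\<psi> = (\<lambda>x. \<phi> (x + - a))"
  have \<psi>: "test_function \<psi>" unfolding \<psi>_def by (rule test_function_translate[OF \<phi>(1)])
  have "\<psi> differentiable (at x)" for x
    using \<psi> by (auto simp: test_function_def dest: spec[of _ "Suc 0"])
  then have fd: "frechet_derivative \<phi> (at x) = frechet_derivative \<psi> (at (x + a))" for x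
    using frechet_derivative_translate[of \<psi> x a] by (simp add: \<psi>_def)
  have "(LINT x|lebesgue. u (x + a) * frechet_derivative \<phi> (at x) e)
      = (LINT x|lebesgue. u x * frechet_derivative \<psi> (at x) e)"
    using integral_translate[OF borel_measurable_integrable[OF test_function_integrable(2)[OF l(1) \<psi> \<phi>(2)]], of a]
    by (simp add: fd)
  also have "\<dots> = - (LINT x|lebesgue. (G x \<bullet> e) * \<psi> x)"
    by (rule has_weak_gradientD[OF assms \<psi> \<phi>(2)])
  also have "(LINT x|lebesgue. (G x \<bullet> e) * \<psi> x) = (LINT x|lebesgue. (G (x + a) \<bullet> e) * \<phi> x)"
    using integral_translate[OF borel_measurable_integrable[OF test_function_integrable(1)[OF locally_integrable_inner[OF l(2)] \<psi>, of e]], of a]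
    by (simp add: \<psi>_def)
  finally show "(LINT x|lebesgue. u (x + a) * frechet_derivative \<phi> (at x) e)
      = - (LINT x|lebesgue. (G (x + a) \<bullet> e) * \<phi> x)" .
qed

section \<open>The space \<open>H1\<close> and its quadratic forms\<close>

lemma H1_L2: "u \<in> H1 \<Longrightarrow> u \<in> L2"
  by (simp add: H1_def)

lemma H1_weak_gradient: "u \<in> H1 \<Longrightarrow> has_weak_gradient u (weak_gradient u)"
  unfolding weak_gradient_def H1_def by (auto intro: someI[of "has_weak_gradient u"])

lemma weak_gradient_eq: "u \<in> H1 \<Longrightarrow> has_weak_gradient u G \<Longrightarrow> AE x in lebesgue. weak_gradient u x = G x"
  by (rule has_weak_gradient_unique[OF H1_weak_gradient])

lemma weak_gradient_L2:
  assumes "u \<in> H1" shows "weak_gradient u \<in> L2"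
proof -
  obtain G where "G \<in> L2" "has_weak_gradient u G" using assms by (auto simp: H1_def)
  then show ?thesis using weak_gradient_eq[OF assms] L2_cong_AE by blast
qed

lemma H1I: "u \<in> L2 \<Longrightarrow> G \<in> L2 \<Longrightarrow> has_weak_gradient u G \<Longrightarrow> u \<in> H1"
  by (auto simp: H1_def)

lemma H1_add: "u \<in> H1 \<Longrightarrow> v \<in> H1 \<Longrightarrow> (\<lambda>x. u x + v x) \<in> H1"
  by (intro H1I[OF L2_add L2_add has_weak_gradient_add[OF H1_weak_gradient H1_weak_gradient]] H1_L2 weak_gradient_L2)

lemma H1_scale: "u \<in> H1 \<Longrightarrow> (\<lambda>x. c * u x) \<in> H1"
  by (intro H1I[OF L2_mult L2_scale has_weak_gradient_scale[OF H1_weak_gradient]] H1_L2 weak_gradient_L2)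

lemma H1_diff: "u \<in> H1 \<Longrightarrow> v \<in> H1 \<Longrightarrow> (\<lambda>x. u x - v x) \<in> H1"
  using H1_add[of u "\<lambda>x. (- 1) * v x"] H1_scale[of v "- 1"] by simp

lemma H1_translate: "u \<in> H1 \<Longrightarrow> (\<lambda>x. u (x + a)) \<in> H1"
  by (intro H1I[OF L2_translate L2_translate has_weak_gradient_translate[OF H1_weak_gradient]] H1_L2 weak_gradient_L2)

lemma H1_zero: "(\<lambda>x. 0) \<in> H1"
proof (rule H1I)
  show "(\<lambda>x. 0) \<in> L2" "(\<lambda>x. 0) \<in> L2" by (auto simp: L2_def)
  show "has_weak_gradient (\<lambda>x. 0) (\<lambda>x. 0)"
    by (auto simp: has_weak_gradient_def locally_integrable_def set_integrable_def)
qed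

lemma H1_sum: "(\<And>i. i \<in> I \<Longrightarrow> u i \<in> H1) \<Longrightarrow> (\<lambda>x. \<Sum>i\<in>I. u i x) \<in> H1"
  by (induction I rule: infinite_finite_induct) (auto intro: H1_zero H1_add)

lemma weak_gradient_add:
  "u \<in> H1 \<Longrightarrow> v \<in> H1 \<Longrightarrow> AE x in lebesgue. weak_gradient (\<lambda>x. u x + v x) x = weak_gradient u x + weak_gradient v x"
  by (intro weak_gradient_eq H1_add has_weak_gradient_add H1_weak_gradient)

lemma weak_gradient_scale:
  "u \<in> H1 \<Longrightarrow> AE x in lebesgue. weak_gradient (\<lambda>x. c * u x) x = c *\<^sub>R weak_gradient u x"
  by (intro weak_gradient_eq H1_scale has_weak_gradient_scale H1_weak_gradient)

lemma weak_gradient_translate: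
  "u \<in> H1 \<Longrightarrow> AE x in lebesgue. weak_gradient (\<lambda>x. u (x + a)) x = weak_gradient u (x + a)"
  by (intro weak_gradient_eq H1_translate has_weak_gradient_translate H1_weak_gradient)

text \<open>
  The bilinear form of \<open>energy V\<close>.  For a positive constant in place of \<open>V\<close> it is the inner product of \<open>H1\<close>.
\<close>

definition form :: "('a::euclidean_space \<Rightarrow> real) \<Rightarrow> ('a \<Rightarrow> real) \<Rightarrow> ('a \<Rightarrow> real) \<Rightarrow> real" where
  "form V u v = (LINT x|lebesgue. weak_gradient u x \<bullet> weak_gradient v x + V x * u x * v x)"

lemma energy_form: "energy V u = form V u u"
  by (simp add: energy_def form_def dot_square_norm power2_eq_square mult.assoc)

lemma form_commute: "form V u v = form V v u"
  by (simp add: form_def inner_commute mult_ac)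

lemma L_infinity_const: "(\<lambda>_. c) \<in> L_infinity"
  by (auto simp: L_infinity_def)

lemma L_infinity_mult_L2:
  assumes "V \<in> L_infinity" "u \<in> L2" shows "(\<lambda>x. V x * u x) \<in> L2"
proof -
  obtain C where [measurable]: "V \<in> borel_measurable lebesgue" and C: "AE x in lebesgue. \<bar>V x\<bar> \<le> C"
    using assms by (auto simp: L_infinity_def)
  have [measurable]: "u \<in> borel_measurable lebesgue" using assms L2_measurable by blast
  show ?thesis
    by (rule L2_bound[OF assms(2), of _ C]) (use C in \<open>auto simp: abs_mult elim!: eventually_mono intro: mult_right_mono\<close>)
qed

lemma potential_integrable:
  "V \<in> L_infinity \<Longrightarrow> u \<in> L2 \<Longrightarrow> v \<in> L2 \<Longrightarrow> integrable lebesgue (\<lambda>x. V x * u x * v x)"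
  by (rule L2_mult_integrable[OF L_infinity_mult_L2])

lemma form_split:
  assumes "V \<in> L_infinity" "u \<in> H1" "v \<in> H1"
  shows "form V u v = (LINT x|lebesgue. weak_gradient u x \<bullet> weak_gradient v x) + (LINT x|lebesgue. V x * u x * v x)"
  unfolding form_def using assms
  by (intro Bochner_Integration.integral_add L2_inner_integrable weak_gradient_L2 potential_integrable H1_L2)

lemma form_integrable:
  assumes "V \<in> L_infinity" "u \<in> H1" "v \<in> H1"
  shows "integrable lebesgue (\<lambda>x. weak_gradient u x \<bullet> weak_gradient v x + V x * u x * v x)"
  using assms by (intro Bochner_Integration.integrable_add L2_inner_integrable weak_gradient_L2 potential_integrable H1_L2)

lemma form_add_left:
  assumes V: "V \<in> L_infinity" and u: "u \<in> H1" and v: "v \<in> H1" and w: "w \<in> H1"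
  shows "form V (\<lambda>x. u x + v x) w = form V u w + form V v w"
proof -
  have "form V (\<lambda>x. u x + v x) w = (LINT x|lebesgue. (weak_gradient u x \<bullet> weak_gradient w x + V x * u x * w x)
      + (weak_gradient v x \<bullet> weak_gradient w x + V x * v x * w x))"
    unfolding form_def
  proof (rule integral_cong_AE)
    show "AE x in lebesgue. weak_gradient (\<lambda>x. u x + v x) x \<bullet> weak_gradient w x + V x * (u x + v x) * w x
        = (weak_gradient u x \<bullet> weak_gradient w x + V x * u x * w x)
      + (weak_gradient v x \<bullet> weak_gradient w x + V x * v x * w x)"
      using weak_gradient_add[OF u v] by eventually_elim (simp add: inner_add_left algebra_simps)
  qed (use form_integrable[OF V H1_add[OF u v] w] form_integrable[OF V u w] form_integrable[OF V v w] in
      \<open>auto intro: borel_measurable_integrable\<close>)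
  then show ?thesis
    using form_integrable[OF V u w] form_integrable[OF V v w] by (simp add: form_def)
qed

lemma form_scale_left:
  assumes V: "V \<in> L_infinity" and u: "u \<in> H1" and w: "w \<in> H1"
  shows "form V (\<lambda>x. c * u x) w = c * form V u w"
proof -
  have "form V (\<lambda>x. c * u x) w = (LINT x|lebesgue. c * (weak_gradient u x \<bullet> weak_gradient w x + V x * u x * w x))"
    unfolding form_def
  proof (rule integral_cong_AE)
    show "AE x in lebesgue. weak_gradient (\<lambda>x. c * u x) x \<bullet> weak_gradient w x + V x * (c * u x) * w x
        = c * (weak_gradient u x \<bullet> weak_gradient w x + V x * u x * w x)"
      using weak_gradient_scale[OF u, of c] by eventually_elim (simp add: algebra_simps)
  qed (use form_integrable[OF V H1_scale[OF u] w] form_integrable[OF V u w] in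
      \<open>auto intro: borel_measurable_integrable\<close>)
  then show ?thesis by (simp add: form_def)
qed

lemma form_diff_left:
  assumes V: "V \<in> L_infinity" and u: "u \<in> H1" and v: "v \<in> H1" and w: "w \<in> H1"
  shows "form V (\<lambda>x. u x - v x) w = form V u w - form V v w"
  using form_add_left[OF V u H1_scale[OF v, of "- 1"] w] form_scale_left[OF V v w, of "- 1"] by simp

lemma form_zero_left: "V \<in> L_infinity \<Longrightarrow> w \<in> H1 \<Longrightarrow> form V (\<lambda>x. 0) w = 0"
  using form_scale_left[OF _ H1_zero, of V w 0] by simp

lemma form_sum_left:
  assumes V: "V \<in> L_infinity" and u: "\<And>i. i \<in> I \<Longrightarrow> u i \<in> H1" and w: "w \<in> H1"
  shows "form V (\<lambda>x. \<Sum>i\<in>I. u i x) w = (\<Sum>i\<in>I. form V (u i) w)"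
  using u by (induction I rule: infinite_finite_induct)
    (auto simp: form_zero_left V w form_add_left H1_sum)

lemma form_translate:
  assumes u: "u \<in> H1" and v: "v \<in> H1"
  shows "form (\<lambda>_. c) (\<lambda>x. u (x + a)) (\<lambda>x. v (x + a)) = form (\<lambda>_. c) u v"
proof -
  note int = form_integrable[OF L_infinity_const]
  have "form (\<lambda>_. c) (\<lambda>x. u (x + a)) (\<lambda>x. v (x + a))
      = (LINT x|lebesgue. weak_gradient u (x + a) \<bullet> weak_gradient v (x + a) + c * u (x + a) * v (x + a))"
    unfolding form_def
  proof (rule integral_cong_AE)
    show "AE x in lebesgue. weak_gradient (\<lambda>x. u (x + a)) x \<bullet> weak_gradient (\<lambda>x. v (x + a)) x
          + c * u (x + a) * v (x + a)
        = weak_gradient u (x + a) \<bullet> weak_gradient v (x + a) + c * u (x + a) * v (x + a)"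
      using weak_gradient_translate[OF u, of a] weak_gradient_translate[OF v, of a] by eventually_elim simp
    show "(\<lambda>x. weak_gradient (\<lambda>x. u (x + a)) x \<bullet> weak_gradient (\<lambda>x. v (x + a)) x
          + c * u (x + a) * v (x + a)) \<in> borel_measurable lebesgue"
      using int[OF H1_translate[OF u] H1_translate[OF v]] by (rule borel_measurable_integrable)
    show "(\<lambda>x. weak_gradient u (x + a) \<bullet> weak_gradient v (x + a) + c * u (x + a) * v (x + a))
        \<in> borel_measurable lebesgue"
      using integrable_translate[OF int[OF u v], where a=a] by (rule borel_measurable_integrable)
  qed
  also have "\<dots> = form (\<lambda>_. c) u v"
    unfolding form_def
    by (rule integral_translate[OF borel_measurable_integrable[OF int[OF u v]]])
  finally show ?thesis .
qed

section \<open>Completeness of \<open>L2\<close>\<close>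

lemma rapid_subsequence:
  fixes d :: "nat \<Rightarrow> nat \<Rightarrow> real"
  assumes "\<And>e. e > 0 \<Longrightarrow> \<exists>N. \<forall>m\<ge>N. \<forall>n\<ge>N. d m n < e" and "\<And>j. (\<epsilon> :: nat \<Rightarrow> real) j > 0"
  obtains r where "strict_mono r" "\<And>j. d (r (Suc j)) (r j) < \<epsilon> j"
proof -
  have "\<forall>j. \<exists>N. \<forall>m\<ge>N. \<forall>n\<ge>N. d m n < \<epsilon> j" using assms by blast
  then obtain N where N: "\<And>j m n. m \<ge> N j \<Longrightarrow> n \<ge> N j \<Longrightarrow> d m n < \<epsilon> j" by metis
  define r where "r = rec_nat (N 0) (\<lambda>j rj. max (N (Suc j)) (Suc rj))"
  have rS: "r (Suc j) = max (N (Suc j)) (Suc (r j))" and r0: "r 0 = N 0" for j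
    by (simp_all add: r_def)
  have ge: "r j \<ge> N j" for j by (cases j) (simp_all add: rS r0)
  have mono: "r j < r (Suc j)" for j by (simp add: rS)
  show ?thesis
  proof (rule that[of r])
    show "strict_mono r" using mono by (simp add: strict_mono_Suc_iff)
    show "d (r (Suc j)) (r j) < \<epsilon> j" for j
      by (rule N) (use ge[of j] mono[of j] in linarith)+
  qed
qed

text \<open>
  Along a subsequence whose increments satisfy \<open>\<parallel>d\<^sub>j\<parallel>\<^sup>2 < 8\<^sup>-\<^sup>j\<close> the series \<open>\<Sum>\<^sub>j 4\<^sup>j \<bar>d\<^sub>j\<bar>\<^sup>2\<close> is integrable, hence finite
  almost everywhere, and there the increments are summable.  Fatou's lemma shows that the pointwise limit
  is also the limit in \<open>L2\<close>.
\<close>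

lemma L2_complete:
  fixes f :: "nat \<Rightarrow> 'a::euclidean_space \<Rightarrow> 'b::euclidean_space"
  assumes f: "\<And>n. f n \<in> L2"
    and cauchy: "\<And>e. e > 0 \<Longrightarrow> \<exists>N. \<forall>m\<ge>N. \<forall>n\<ge>N. (LINT x|lebesgue. (norm (f m x - f n x))\<^sup>2) < e"
  obtains g where "g \<in> L2" "(\<lambda>n. LINT x|lebesgue. (norm (f n x - g x))\<^sup>2) \<longlonglongrightarrow> 0"
proof -
  have [measurable]: "f n \<in> borel_measurable lebesgue" for n using f L2_measurable by blast
  obtain r where r: "strict_mono r"
    and small: "\<And>j. (LINT x|lebesgue. (norm (f (r (Suc j)) x - f (r j) x))\<^sup>2) < (1/8) ^ j"
    using rapid_subsequence[of "\<lambda>m n. LINT x|lebesgue. (norm (f m x - f n x))\<^sup>2" "\<lambda>j. (1/8) ^ j"] cauchy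
    by auto
  define d where "d j x = (norm (f (r (Suc j)) x - f (r j) x))\<^sup>2" for j x
  have [measurable]: "d j \<in> borel_measurable lebesgue" for j unfolding d_def by measurable
  have d0: "d j x \<ge> 0" for j x by (simp add: d_def)
  have int_d: "integrable lebesgue (d j)" for j
    unfolding d_def using L2_integrable[OF L2_diff[OF f f]] .
  have nnd: "(\<integral>\<^sup>+x. ennreal (4 ^ j * d j x) \<partial>lebesgue) \<le> ennreal ((1/2) ^ j)" for j
  proof -
    have "(\<integral>\<^sup>+x. ennreal (4 ^ j * d j x) \<partial>lebesgue) = ennreal (LINT x|lebesgue. 4 ^ j * d j x)"
      using int_d d0 by (intro nn_integral_eq_integral) auto
    also have "(LINT x|lebesgue. 4 ^ j * d j x) \<le> 4 ^ j * (1/8) ^ j"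
      using small[of j] by (simp add: d_def)
    also have "4 ^ j * (1/8) ^ j = (1/2::real) ^ j"
      by (simp flip: power_mult_distrib)
    finally show ?thesis by (simp add: ennreal_leI)
  qed
  have "(\<integral>\<^sup>+x. (\<Sum>j. ennreal (4 ^ j * d j x)) \<partial>lebesgue) = (\<Sum>j. \<integral>\<^sup>+x. ennreal (4 ^ j * d j x) \<partial>lebesgue)"
    by (rule nn_integral_suminf) measurable
  also have "\<dots> \<le> (\<Sum>j. ennreal ((1/2) ^ j))"
    by (intro suminf_le nnd summableI)
  also have "\<dots> < \<infinity>"
  proof -
    have "(\<lambda>j. (1/2) ^ j) sums (2::real)" using geometric_sums[of "1/2::real"] by simp
    then have "(\<Sum>j. ennreal ((1/2) ^ j)) = ennreal 2" by (intro suminf_ennreal_eq) simp_all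
    then show ?thesis by simp
  qed
  finally have "AE x in lebesgue. (\<Sum>j. ennreal (4 ^ j * d j x)) \<noteq> \<infinity>"
    by (intro nn_integral_noteq_infinite) auto
  then have conv: "AE x in lebesgue. convergent (\<lambda>j. f (r j) x)"
  proof eventually_elim
    case (elim x)
    have summ: "summable (\<lambda>j. 4 ^ j * d j x)"
      using elim d0 by (intro summable_suminf_not_top) (auto simp: top_ennreal_def)
    have "summable (\<lambda>j. norm (f (r (Suc j)) x - f (r j) x))"
    proof (rule summable_comparison_test')
      show "summable (\<lambda>j. (1/4) ^ j + 4 ^ j * d j x)"
        by (intro summable_add summ summable_geometric) simp
      fix j :: nat assume "0 \<le> j"
      let ?t = "norm (f (r (Suc j)) x - f (r j) x)"
      \<comment> \<open>Hence \<open>2 ?t \<le> 4\<^sup>-\<^sup>j + 4\<^sup>j ?t\<^sup>2\<close>, and both terms are summable.\<close>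
      have "2 * (1/2) ^ j * (2 ^ j * ?t) \<le> ((1/2) ^ j)\<^sup>2 + (2 ^ j * ?t)\<^sup>2"
        by (rule sum_squares_bound)
      moreover have "2 ^ j * (1/2::real) ^ j = 1" by (simp flip: power_mult_distrib)
      then have "2 * (1/2) ^ j * (2 ^ j * ?t) = 2 * ?t" by (simp add: mult.commute)
      moreover have "((1/2::real) ^ j)\<^sup>2 = (1/4) ^ j"
        by (simp add: power2_eq_square flip: power_mult_distrib)
      moreover have "((2::real) ^ j)\<^sup>2 = 4 ^ j"
        by (simp add: power2_eq_square flip: power_mult_distrib)
      then have "(2 ^ j * ?t)\<^sup>2 = 4 ^ j * d j x"
        unfolding power_mult_distrib by (simp add: d_def)
      ultimately have "2 * ?t \<le> (1/4) ^ j + 4 ^ j * d j x" by simp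
      moreover have "0 \<le> ?t" by simp
      ultimately have "?t \<le> (1/4) ^ j + 4 ^ j * d j x" by linarith
      then show "norm ?t \<le> (1/4) ^ j + 4 ^ j * d j x" by simp
    qed
    then have "summable (\<lambda>j. f (r (Suc j)) x - f (r j) x)" by (rule summable_norm_cancel)
    then have "convergent (\<lambda>n. \<Sum>j<n. f (r (Suc j)) x - f (r j) x)"
      by (simp add: summable_iff_convergent)
    then have "convergent (\<lambda>n. f (r n) x - f (r 0) x)"
      by (simp add: sum_lessThan_telescope[of "\<lambda>j. f (r j) x"])
    from convergent_add[OF this convergent_const[of "f (r 0) x"]] show ?case by simp
  qed
  define g where "g x = lim (\<lambda>j. f (r j) x)" for x
  have [measurable]: "g \<in> borel_measurable lebesgue"
    unfolding g_def by (rule borel_measurable_lim_metric) measurable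
  have fatou: "(\<integral>\<^sup>+x. ennreal ((norm (f n x - g x))\<^sup>2) \<partial>lebesgue) \<le> ennreal e"
    if N: "\<forall>m\<ge>N. \<forall>n\<ge>N. (LINT x|lebesgue. (norm (f m x - f n x))\<^sup>2) < e" and n: "n \<ge> N" for n N e
  proof -
    have "(\<integral>\<^sup>+x. ennreal ((norm (f n x - g x))\<^sup>2) \<partial>lebesgue)
        = (\<integral>\<^sup>+x. liminf (\<lambda>j. ennreal ((norm (f n x - f (r j) x))\<^sup>2)) \<partial>lebesgue)"
    proof (rule nn_integral_cong_AE)
      show "AE x in lebesgue. ennreal ((norm (f n x - g x))\<^sup>2) = liminf (\<lambda>j. ennreal ((norm (f n x - f (r j) x))\<^sup>2))"
        using conv
      proof eventually_elim
        case (elim x)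
        then have "(\<lambda>j. f (r j) x) \<longlonglongrightarrow> g x" by (simp add: g_def convergent_LIMSEQ_iff)
        then have "(\<lambda>j. ennreal ((norm (f n x - f (r j) x))\<^sup>2)) \<longlonglongrightarrow> ennreal ((norm (f n x - g x))\<^sup>2)"
          by (intro tendsto_ennrealI tendsto_intros)
        then show ?case by (metis lim_imp_Liminf sequentially_bot)
      qed
    qed
    also have "\<dots> \<le> liminf (\<lambda>j. \<integral>\<^sup>+x. ennreal ((norm (f n x - f (r j) x))\<^sup>2) \<partial>lebesgue)"
      by (rule nn_integral_liminf) measurable
    also have "\<dots> \<le> ennreal e"
    proof -
      have "\<forall>\<^sub>F j in sequentially. (\<integral>\<^sup>+x. ennreal ((norm (f n x - f (r j) x))\<^sup>2) \<partial>lebesgue) \<le> ennreal e"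
        using eventually_ge_at_top[of N]
      proof eventually_elim
        case (elim j)
        have "(\<integral>\<^sup>+x. ennreal ((norm (f n x - f (r j) x))\<^sup>2) \<partial>lebesgue)
            = ennreal (LINT x|lebesgue. (norm (f n x - f (r j) x))\<^sup>2)"
          by (rule nn_integral_eq_integral[OF L2_integrable[OF L2_diff[OF f f]]]) auto
        moreover have "(LINT x|lebesgue. (norm (f n x - f (r j) x))\<^sup>2) < e"
          using N n elim seq_suble[OF r, of j] by auto
        ultimately show ?case by (simp add: ennreal_leI)
      qed
      then have "liminf (\<lambda>j. \<integral>\<^sup>+x. ennreal ((norm (f n x - f (r j) x))\<^sup>2) \<partial>lebesgue) \<le> liminf (\<lambda>j. ennreal e)"
        by (rule Liminf_mono)
      then show ?thesis by (simp add: Liminf_const)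
    qed
    finally show ?thesis .
  qed
  have diff: "(\<lambda>x. f n x - g x) \<in> L2" if "\<forall>m\<ge>N. \<forall>n\<ge>N. (LINT x|lebesgue. (norm (f m x - f n x))\<^sup>2) < e" "n \<ge> N" for n N e
  proof -
    have "integrable lebesgue (\<lambda>x. (norm (f n x - g x))\<^sup>2)"
    proof (rule integrableI_bounded)
      have "(\<integral>\<^sup>+ x. ennreal (norm ((norm (f n x - g x))\<^sup>2)) \<partial>lebesgue) \<le> ennreal e"
        using fatou[OF that] by simp
      also have "\<dots> < \<infinity>" by simp
      finally show "(\<integral>\<^sup>+ x. ennreal (norm ((norm (f n x - g x))\<^sup>2)) \<partial>lebesgue) < \<infinity>" .
    qed measurable
    then show ?thesis by (simp add: L2_def)
  qed
  show ?thesis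
  proof (rule that)
    obtain N where N: "\<forall>m\<ge>N. \<forall>n\<ge>N. (LINT x|lebesgue. (norm (f m x - f n x))\<^sup>2) < 1"
      using cauchy[of 1] by auto
    show "g \<in> L2" using L2_diff[OF f[of N] diff[OF N order.refl]] by simp
    show "(\<lambda>n. LINT x|lebesgue. (norm (f n x - g x))\<^sup>2) \<longlonglongrightarrow> 0"
    proof (rule LIMSEQ_I)
      fix e :: real assume "e > 0"
      then obtain N where N: "\<forall>m\<ge>N. \<forall>n\<ge>N. (LINT x|lebesgue. (norm (f m x - f n x))\<^sup>2) < e / 2"
        using cauchy[of "e / 2"] by auto
      have "norm ((LINT x|lebesgue. (norm (f n x - g x))\<^sup>2) - 0) < e" if "n \<ge> N" for n
      proof -
        have "ennreal (LINT x|lebesgue. (norm (f n x - g x))\<^sup>2) \<le> ennreal (e / 2)"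
          using fatou[OF N that] nn_integral_eq_integral[OF L2_integrable[OF diff[OF N that]]] by simp
        then have "(LINT x|lebesgue. (norm (f n x - g x))\<^sup>2) \<le> e / 2"
          using \<open>e > 0\<close> by (simp add: ennreal_le_iff)
        moreover have "0 \<le> (LINT x|lebesgue. (norm (f n x - g x))\<^sup>2)" by simp
        ultimately show ?thesis using \<open>e > 0\<close> by simp
      qed
      then show "\<exists>no. \<forall>n\<ge>no. norm ((LINT x|lebesgue. (norm (f n x - g x))\<^sup>2) - 0) < e" by blast
    qed
  qed
qed

lemma L2_bounded_support:
  fixes \<phi> :: "'a::euclidean_space \<Rightarrow> real"
  assumes "compact K" "\<phi> \<in> borel_measurable lebesgue" "\<And>x. x \<notin> K \<Longrightarrow> \<phi> x = 0" "\<And>x. \<bar>\<phi> x\<bar> \<le> C"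
  shows "\<phi> \<in> L2"
proof -
  have [measurable]: "\<phi> \<in> borel_measurable lebesgue" by fact
  have "locally_integrable (\<lambda>x::'a. 1::real)"
    unfolding locally_integrable_def set_integrable_def
  proof (intro allI impI)
    fix K :: "'a set" assume "compact K"
    then show "integrable lebesgue (\<lambda>x. indicat_real K x *\<^sub>R (1::real))"
      using lmeasurable_compact[of K] by (auto simp: fmeasurable_def)
  qed
  then have "integrable lebesgue (\<lambda>x. 1 * (\<phi> x)\<^sup>2)"
  proof (rule integrable_mult_bounded_support[OF _ assms(1)])
    show "\<bar>(\<phi> x)\<^sup>2\<bar> \<le> C\<^sup>2" for x using power_mono[OF assms(4)[of x], of 2] by simp
  qed (use assms(3) in auto)
  then show ?thesis by (simp add: L2_def)
qed

lemma test_function_L2: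
  assumes "test_function \<phi>"
  shows "\<phi> \<in> L2" and "e \<in> Basis \<Longrightarrow> (\<lambda>x. frechet_derivative \<phi> (at x) e) \<in> L2"
proof -
  obtain K C where K: "compact K" "continuous_on UNIV \<phi>" "\<And>x. x \<notin> K \<Longrightarrow> \<phi> x = 0" "\<And>x. \<bar>\<phi> x\<bar> \<le> C"
    "\<And>x. \<phi> differentiable (at x)"
    "\<And>e. e \<in> Basis \<Longrightarrow> continuous_on UNIV (\<lambda>x. frechet_derivative \<phi> (at x) e)"
    "\<And>x e. x \<notin> K \<Longrightarrow> frechet_derivative \<phi> (at x) e = 0"
    "\<And>x e. e \<in> Basis \<Longrightarrow> \<bar>frechet_derivative \<phi> (at x) e\<bar> \<le> C"
    by (fact test_function_bounded_support[OF assms])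
  show "\<phi> \<in> L2"
    by (rule L2_bounded_support[OF K(1) continuous_measurable_lebesgue[OF K(2)] K(3,4)])
  show "(\<lambda>x. frechet_derivative \<phi> (at x) e) \<in> L2" if "e \<in> Basis"
    by (rule L2_bounded_support[OF K(1) continuous_measurable_lebesgue[OF K(6)[OF that]] K(7) K(8)[OF that]])
qed

lemma L2_limit_inner:
  fixes f :: "nat \<Rightarrow> 'a::euclidean_space \<Rightarrow> 'b::euclidean_space"
  assumes f: "\<And>n. f n \<in> L2" and g: "g \<in> L2" and h: "h \<in> L2"
    and lim: "(\<lambda>n. LINT x|lebesgue. (norm (f n x - g x))\<^sup>2) \<longlonglongrightarrow> 0"
  shows "(\<lambda>n. LINT x|lebesgue. f n x \<bullet> h x) \<longlonglongrightarrow> (LINT x|lebesgue. g x \<bullet> h x)"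
proof -
  have "(\<lambda>n. (LINT x|lebesgue. f n x \<bullet> h x) - (LINT x|lebesgue. g x \<bullet> h x)) \<longlonglongrightarrow> 0"
  proof (rule Lim_null_comparison)
    show "\<forall>\<^sub>F n in sequentially. norm ((LINT x|lebesgue. f n x \<bullet> h x) - (LINT x|lebesgue. g x \<bullet> h x))
        \<le> sqrt (LINT x|lebesgue. (norm (f n x - g x))\<^sup>2) * sqrt (LINT x|lebesgue. (norm (h x))\<^sup>2)"
    proof (rule always_eventually, rule allI)
      fix n
      have "(LINT x|lebesgue. f n x \<bullet> h x) - (LINT x|lebesgue. g x \<bullet> h x)
          = (LINT x|lebesgue. (f n x - g x) \<bullet> h x)"
        using L2_inner_integrable[OF f h, of n] L2_inner_integrable[OF g h] by (simp add: inner_diff_left)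
      then show "norm ((LINT x|lebesgue. f n x \<bullet> h x) - (LINT x|lebesgue. g x \<bullet> h x))
        \<le> sqrt (LINT x|lebesgue. (norm (f n x - g x))\<^sup>2) * sqrt (LINT x|lebesgue. (norm (h x))\<^sup>2)"
        using L2_Cauchy_Schwarz[OF L2_diff[OF f g] h, of n] by simp
    qed
    show "(\<lambda>n. sqrt (LINT x|lebesgue. (norm (f n x - g x))\<^sup>2) * sqrt (LINT x|lebesgue. (norm (h x))\<^sup>2)) \<longlonglongrightarrow> 0"
      using tendsto_mult_right[OF tendsto_real_sqrt[OF lim]] by simp
  qed
  then show ?thesis by (simp add: LIM_zero_iff)
qed

section \<open>The Hilbert space \<open>H1\<close>\<close>

lemma form_diagonal:
  assumes "u \<in> H1"
  shows "form (\<lambda>_. b) u u = (LINT x|lebesgue. (norm (weak_gradient u x))\<^sup>2) + b * (LINT x|lebesgue. (u x)\<^sup>2)"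
  using form_split[OF L_infinity_const assms assms, of b]
  by (simp add: dot_square_norm power2_eq_square[symmetric] mult.assoc)

context
  fixes b :: real
  assumes b: "b > 0"
begin

lemma form_nonneg: "u \<in> H1 \<Longrightarrow> 0 \<le> form (\<lambda>_. b) u u"
  using b by (simp add: form_diagonal)

lemma H1_norm_nonneg: "0 \<le> H1_norm b u" if "u \<in> H1"
  using form_nonneg[OF that] by (simp add: H1_norm_def energy_form)

lemma H1_norm_power2: "u \<in> H1 \<Longrightarrow> (H1_norm b u)\<^sup>2 = form (\<lambda>_. b) u u"
  using form_nonneg by (simp add: H1_norm_def energy_form)

lemma gradient_le_H1_norm: "u \<in> H1 \<Longrightarrow> (LINT x|lebesgue. (norm (weak_gradient u x))\<^sup>2) \<le> (H1_norm b u)\<^sup>2"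
  using b by (simp add: H1_norm_power2 form_diagonal)

lemma L2_le_H1_norm: "u \<in> H1 \<Longrightarrow> (LINT x|lebesgue. (u x)\<^sup>2) \<le> (H1_norm b u)\<^sup>2 / b"
  using b by (simp add: H1_norm_power2 form_diagonal field_simps)

lemma form_add_right: "u \<in> H1 \<Longrightarrow> v \<in> H1 \<Longrightarrow> w \<in> H1 \<Longrightarrow>
    form (\<lambda>_. b) w (\<lambda>x. u x + v x) = form (\<lambda>_. b) w u + form (\<lambda>_. b) w v"
  by (simp add: form_commute[of _ w] form_add_left L_infinity_const)

lemma form_scale_right: "u \<in> H1 \<Longrightarrow> w \<in> H1 \<Longrightarrow> form (\<lambda>_. b) w (\<lambda>x. c * u x) = c * form (\<lambda>_. b) w u"
  by (simp add: form_commute[of _ w] form_scale_left L_infinity_const)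

lemma form_diff_right: "u \<in> H1 \<Longrightarrow> v \<in> H1 \<Longrightarrow> w \<in> H1 \<Longrightarrow>
    form (\<lambda>_. b) w (\<lambda>x. u x - v x) = form (\<lambda>_. b) w u - form (\<lambda>_. b) w v"
  by (simp add: form_commute[of _ w] form_diff_left L_infinity_const)

lemma form_square_add:
  assumes u: "u \<in> H1" and v: "v \<in> H1"
  shows "form (\<lambda>_. b) (\<lambda>x. u x + t * v x) (\<lambda>x. u x + t * v x)
    = form (\<lambda>_. b) u u + 2 * t * form (\<lambda>_. b) u v + t\<^sup>2 * form (\<lambda>_. b) v v"
  using form_commute[of "\<lambda>_. b" u v]
  by (simp add: form_add_left form_add_right form_scale_left form_scale_right L_infinity_const u v H1_add H1_scale
      power2_eq_square algebra_simps)

lemma H1_Cauchy_Schwarz: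
  assumes u: "u \<in> H1" and v: "v \<in> H1"
  shows "\<bar>form (\<lambda>_. b) u v\<bar> \<le> H1_norm b u * H1_norm b v"
  unfolding H1_norm_def energy_form
proof (rule semidefinite_Cauchy_Schwarz)
  show "0 \<le> form (\<lambda>_. b) u u + 2 * t * form (\<lambda>_. b) u v + t\<^sup>2 * form (\<lambda>_. b) v v" for t
    unfolding form_square_add[OF u v, symmetric] by (intro form_nonneg H1_add H1_scale u v)
qed (intro form_nonneg u v)+

lemma H1_norm_triangle:
  assumes u: "u \<in> H1" and v: "v \<in> H1"
  shows "H1_norm b (\<lambda>x. u x + v x) \<le> H1_norm b u + H1_norm b v"
proof (rule power2_le_imp_le)
  have "(H1_norm b (\<lambda>x. u x + v x))\<^sup>2 = (H1_norm b u)\<^sup>2 + 2 * form (\<lambda>_. b) u v + (H1_norm b v)\<^sup>2"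
    using form_square_add[OF u v, of 1] by (simp add: H1_norm_power2 u v H1_add)
  also have "\<dots> \<le> (H1_norm b u + H1_norm b v)\<^sup>2"
    using H1_Cauchy_Schwarz[OF u v] by (simp add: power2_sum)
  finally show "(H1_norm b (\<lambda>x. u x + v x))\<^sup>2 \<le> (H1_norm b u + H1_norm b v)\<^sup>2" .
qed (intro add_nonneg_nonneg H1_norm_nonneg u v)

lemma H1_norm_scale: "u \<in> H1 \<Longrightarrow> H1_norm b (\<lambda>x. c * u x) = \<bar>c\<bar> * H1_norm b u"
  by (simp add: H1_norm_def energy_form form_scale_left form_scale_right L_infinity_const H1_scale
      real_sqrt_mult mult.assoc[symmetric])

lemma H1_norm_zero: "H1_norm b (\<lambda>x. 0) = 0"
  by (simp add: H1_norm_def energy_form form_zero_left L_infinity_const H1_zero)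

lemma H1_norm_translate: "u \<in> H1 \<Longrightarrow> H1_norm b (\<lambda>x. u (x + a)) = H1_norm b u"
  by (simp add: H1_norm_def energy_form form_translate)

text \<open>
  The functions and their gradients converge in \<open>L2\<close>, and the identity that defines a weak gradient is continuous
  in both.
\<close>

lemma H1_complete:
  assumes u: "\<And>n. u n \<in> H1"
    and cauchy: "\<And>e. e > 0 \<Longrightarrow> \<exists>N. \<forall>m\<ge>N. \<forall>n\<ge>N. (H1_norm b (\<lambda>x. u m x - u n x))\<^sup>2 < e"
  obtains w where "w \<in> H1" "(\<lambda>n. H1_norm b (\<lambda>x. u n x - w x)) \<longlonglongrightarrow> 0"
proof -
  have graddiff: "(LINT x|lebesgue. (norm (weak_gradient v x - weak_gradient w x))\<^sup>2)
      = (LINT x|lebesgue. (norm (weak_gradient (\<lambda>x. v x - w x) x))\<^sup>2)" if "v \<in> H1" "w \<in> H1" for v w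
  proof (rule integral_cong_AE)
    have "AE x in lebesgue. weak_gradient (\<lambda>x. v x - w x) x = weak_gradient v x - weak_gradient w x"
      using weak_gradient_add[OF that(1) H1_scale[OF that(2), of "- 1"]] weak_gradient_scale[OF that(2), of "- 1"]
      by eventually_elim simp
    then show "AE x in lebesgue. (norm (weak_gradient v x - weak_gradient w x))\<^sup>2
        = (norm (weak_gradient (\<lambda>x. v x - w x) x))\<^sup>2" by eventually_elim simp
    show "(\<lambda>x. (norm (weak_gradient v x - weak_gradient w x))\<^sup>2) \<in> borel_measurable lebesgue"
      using L2_integrable[OF L2_diff[OF weak_gradient_L2[OF that(1)] weak_gradient_L2[OF that(2)]]]
      by (rule borel_measurable_integrable)
    show "(\<lambda>x. (norm (weak_gradient (\<lambda>x. v x - w x) x))\<^sup>2) \<in> borel_measurable lebesgue"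
      using L2_integrable[OF weak_gradient_L2[OF H1_diff[OF that]]] by (rule borel_measurable_integrable)
  qed
  obtain w where w: "w \<in> L2" and wlim: "(\<lambda>n. LINT x|lebesgue. (norm (u n x - w x))\<^sup>2) \<longlonglongrightarrow> 0"
  proof (rule L2_complete[of u])
    show "u n \<in> L2" for n using u by (rule H1_L2)
    fix e :: real assume "e > 0"
    then obtain N where N: "\<And>m n. m \<ge> N \<Longrightarrow> n \<ge> N \<Longrightarrow> (H1_norm b (\<lambda>x. u m x - u n x))\<^sup>2 < e * b"
      using cauchy[of "e * b"] b by auto
    have "(LINT x|lebesgue. (norm (u m x - u n x))\<^sup>2) < e" if "m \<ge> N" "n \<ge> N" for m n
    proof -
      have "(LINT x|lebesgue. (u m x - u n x)\<^sup>2) \<le> (H1_norm b (\<lambda>x. u m x - u n x))\<^sup>2 / b"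
        by (rule L2_le_H1_norm[OF H1_diff[OF u u]])
      also have "\<dots> < e" using N[OF that] b by (simp add: pos_divide_less_eq)
      finally show ?thesis by simp
    qed
    then show "\<exists>N. \<forall>m\<ge>N. \<forall>n\<ge>N. (LINT x|lebesgue. (norm (u m x - u n x))\<^sup>2) < e" by blast
  qed
  obtain G where G: "G \<in> L2" and Glim: "(\<lambda>n. LINT x|lebesgue. (norm (weak_gradient (u n) x - G x))\<^sup>2) \<longlonglongrightarrow> 0"
  proof (rule L2_complete[of "\<lambda>n. weak_gradient (u n)"])
    show "weak_gradient (u n) \<in> L2" for n using u by (rule weak_gradient_L2)
    fix e :: real assume "e > 0"
    then obtain N where N: "\<And>m n. m \<ge> N \<Longrightarrow> n \<ge> N \<Longrightarrow> (H1_norm b (\<lambda>x. u m x - u n x))\<^sup>2 < e"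
      using cauchy[of e] by auto
    have "(LINT x|lebesgue. (norm (weak_gradient (u m) x - weak_gradient (u n) x))\<^sup>2) < e" if "m \<ge> N" "n \<ge> N" for m n
      using N[OF that] gradient_le_H1_norm[OF H1_diff[OF u[of m] u[of n]]] graddiff[OF u[of m] u[of n]] by simp
    then show "\<exists>N. \<forall>m\<ge>N. \<forall>n\<ge>N. (LINT x|lebesgue. (norm (weak_gradient (u m) x - weak_gradient (u n) x))\<^sup>2) < e" by blast
  qed
  have hwg: "has_weak_gradient w G"
    unfolding has_weak_gradient_def
  proof (intro conjI allI impI L2_locally_integrable w G)
    fix \<phi> :: "'a \<Rightarrow> real" and e :: 'a assume \<phi>: "test_function \<phi>" "e \<in> Basis"
    have 1: "(\<lambda>n. LINT x|lebesgue. u n x * frechet_derivative \<phi> (at x) e)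
        \<longlonglongrightarrow> (LINT x|lebesgue. w x * frechet_derivative \<phi> (at x) e)"
      using L2_limit_inner[OF H1_L2[OF u] w test_function_L2(2)[OF \<phi>] wlim] by simp
    have 2: "(\<lambda>n. LINT x|lebesgue. weak_gradient (u n) x \<bullet> (\<phi> x *\<^sub>R e))
        \<longlonglongrightarrow> (LINT x|lebesgue. G x \<bullet> (\<phi> x *\<^sub>R e))"
    proof (rule L2_limit_inner[OF weak_gradient_L2[OF u] G _ Glim])
      have [measurable]: "\<phi> \<in> borel_measurable lebesgue" using test_function_L2(1)[OF \<phi>(1)] L2_measurable by blast
      show "(\<lambda>x. \<phi> x *\<^sub>R e) \<in> L2"
        by (rule L2_bound[OF test_function_L2(1)[OF \<phi>(1)], where C=1]) (use \<phi>(2) in auto)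
    qed
    have 3: "(LINT x|lebesgue. u n x * frechet_derivative \<phi> (at x) e)
        = - (LINT x|lebesgue. weak_gradient (u n) x \<bullet> (\<phi> x *\<^sub>R e))" for n
      using has_weak_gradientD[OF H1_weak_gradient[OF u] \<phi>, of n] by (simp add: mult.commute)
    have "(LINT x|lebesgue. w x * frechet_derivative \<phi> (at x) e) = - (LINT x|lebesgue. G x \<bullet> (\<phi> x *\<^sub>R e))"
      using LIMSEQ_unique[OF 1[unfolded 3] tendsto_minus[OF 2]] .
    then show "(LINT x|lebesgue. w x * frechet_derivative \<phi> (at x) e) = - (LINT x|lebesgue. (G x \<bullet> e) * \<phi> x)"
      by (simp add: mult.commute)
  qed
  then have wH: "w \<in> H1" using w G by (blast intro: H1I)
  have eq: "H1_norm b (\<lambda>x. u n x - w x) = sqrt ((LINT x|lebesgue. (norm (weak_gradient (u n) x - G x))\<^sup>2)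
      + b * (LINT x|lebesgue. (norm (u n x - w x))\<^sup>2))" for n
  proof -
    have "(LINT x|lebesgue. (norm (weak_gradient (u n) x - weak_gradient w x))\<^sup>2)
        = (LINT x|lebesgue. (norm (weak_gradient (u n) x - G x))\<^sup>2)"
    proof (rule integral_cong_AE)
      show "AE x in lebesgue. (norm (weak_gradient (u n) x - weak_gradient w x))\<^sup>2 = (norm (weak_gradient (u n) x - G x))\<^sup>2"
        using weak_gradient_eq[OF wH hwg] by eventually_elim simp
    qed (use L2_integrable[OF L2_diff[OF weak_gradient_L2[OF u] weak_gradient_L2[OF wH]]]
        L2_integrable[OF L2_diff[OF weak_gradient_L2[OF u] G]] in \<open>auto intro: borel_measurable_integrable\<close>)
    then show ?thesis
      by (simp add: H1_norm_def energy_form form_diagonal[OF H1_diff[OF u wH]] graddiff[OF u wH])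
  qed
  have "(\<lambda>n. H1_norm b (\<lambda>x. u n x - w x)) \<longlonglongrightarrow> sqrt (0 + b * 0)"
    unfolding eq by (intro tendsto_intros Glim wlim)
  then show ?thesis using that wH by simp
qed

lemma form_norm_limit:
  assumes u: "\<And>n. u n \<in> H1" and w: "w \<in> H1" and v: "v \<in> H1"
    and lim: "(\<lambda>n. H1_norm b (\<lambda>x. u n x - w x)) \<longlonglongrightarrow> 0"
  shows "(\<lambda>n. form (\<lambda>_. b) (u n) v) \<longlonglongrightarrow> form (\<lambda>_. b) w v"
proof -
  have "(\<lambda>n. form (\<lambda>_. b) (u n) v - form (\<lambda>_. b) w v) \<longlonglongrightarrow> 0"
  proof (rule Lim_null_comparison)
    show "\<forall>\<^sub>F n in sequentially. norm (form (\<lambda>_. b) (u n) v - form (\<lambda>_. b) w v)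
        \<le> H1_norm b (\<lambda>x. u n x - w x) * H1_norm b v"
      using H1_Cauchy_Schwarz[OF H1_diff[OF u w] v]
      by (simp add: form_diff_left[OF L_infinity_const u w v])
    show "(\<lambda>n. H1_norm b (\<lambda>x. u n x - w x) * H1_norm b v) \<longlonglongrightarrow> 0"
      using tendsto_mult_right[OF lim] by simp
  qed
  then show ?thesis by (simp add: LIM_zero_iff)
qed

text \<open>
  The representing element is the limit of a sequence in \<open>S\<close> minimizing \<open>\<parallel>s\<parallel>\<^sup>2 - 2 f s\<close>; the
  parallelogram identity makes such a sequence a Cauchy sequence.  For an arbitrary subspace \<open>S\<close> the
  element lies in the closure of \<open>S\<close>, which is what \<open>\<sigma>\<close> records.
\<close>

lemma Riesz_subspace:
  fixes S :: "('a::euclidean_space \<Rightarrow> real) set"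
  assumes S: "S \<subseteq> H1" and S0: "(\<lambda>x. 0) \<in> S"
    and Sadd: "\<And>s t. s \<in> S \<Longrightarrow> t \<in> S \<Longrightarrow> (\<lambda>x. s x + t x) \<in> S"
    and Sscale: "\<And>s c. s \<in> S \<Longrightarrow> (\<lambda>x. c * s x) \<in> S"
    and fadd: "\<And>s t. s \<in> S \<Longrightarrow> t \<in> S \<Longrightarrow> f (\<lambda>x. s x + t x) = f s + f t"
    and fscale: "\<And>s c. s \<in> S \<Longrightarrow> f (\<lambda>x. c * s x) = c * f s"
    and fbound: "\<And>s. s \<in> S \<Longrightarrow> \<bar>f s\<bar> \<le> C * H1_norm b s"
  obtains w \<sigma> where "w \<in> H1" "\<And>s. s \<in> S \<Longrightarrow> form (\<lambda>_. b) w s = f s"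
    "\<And>n::nat. \<sigma> n \<in> S" "(\<lambda>n. H1_norm b (\<lambda>x. \<sigma> n x - w x)) \<longlonglongrightarrow> 0"
proof -
  define Q where "Q s = form (\<lambda>_. b) s s - 2 * f s" for s
  have inH: "s \<in> H1" if "s \<in> S" for s using that S by blast
  have lower: "- C\<^sup>2 \<le> Q s" if "s \<in> S" for s
  proof -
    have "0 \<le> (H1_norm b s - C)\<^sup>2" by simp
    then show ?thesis
      using fbound[OF that] abs_le_D1[of "f s" "C * H1_norm b s"]
      by (simp add: Q_def H1_norm_power2[OF inH[OF that], symmetric] power2_diff mult.commute)
  qed
  define m where "m = Inf (Q ` S)"
  have bdd: "bdd_below (Q ` S)" using lower by (auto intro!: bdd_belowI)
  have m_le: "m \<le> Q s" if "s \<in> S" for s unfolding m_def using bdd that by (intro cInf_lower) auto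
  have "\<exists>s\<in>S. Q s < m + 1 / real (Suc n)" for n
    using cInf_lessD[of "Q ` S" "m + 1 / real (Suc n)"] S0 unfolding m_def by auto
  then obtain \<sigma> where \<sigma>: "\<And>n. \<sigma> n \<in> S" "\<And>n. Q (\<sigma> n) < m + 1 / real (Suc n)" by metis
  have par: "(H1_norm b (\<lambda>x. \<sigma> i x - \<sigma> j x))\<^sup>2 < 2 * (1 / real (Suc i) + 1 / real (Suc j))" for i j
  proof -
    let ?h = "\<lambda>x. (1/2) * (\<sigma> i x + 1 * \<sigma> j x)"
    have hS: "?h \<in> S" using Sscale[OF Sadd[OF \<sigma>(1)[of i] \<sigma>(1)[of j]], of "1/2"] by simp
    have fh: "f ?h = (f (\<sigma> i) + f (\<sigma> j)) / 2"
      using fscale[OF Sadd[OF \<sigma>(1)[of i] \<sigma>(1)[of j]], of "1/2"] fadd[OF \<sigma>(1)[of i] \<sigma>(1)[of j]] by simp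
    have hh: "form (\<lambda>_. b) ?h ?h = (form (\<lambda>_. b) (\<sigma> i) (\<sigma> i) + 2 * form (\<lambda>_. b) (\<sigma> i) (\<sigma> j) + form (\<lambda>_. b) (\<sigma> j) (\<sigma> j)) / 4"
    proof -
      let ?t = "\<lambda>x. \<sigma> i x + 1 * \<sigma> j x"
      have t: "?t \<in> H1" using H1_add[OF inH inH, OF \<sigma>(1)[of i] \<sigma>(1)[of j]] by simp
      have "form (\<lambda>_. b) ?h ?h = (1/2) * ((1/2) * form (\<lambda>_. b) ?t ?t)"
        unfolding form_scale_left[OF L_infinity_const t H1_scale[OF t]] form_scale_right[OF t t] ..
      then show ?thesis
        unfolding form_square_add[OF inH inH, OF \<sigma>(1)[of i] \<sigma>(1)[of j]] by simp
    qed
    have dd: "(H1_norm b (\<lambda>x. \<sigma> i x - \<sigma> j x))\<^sup>2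
        = form (\<lambda>_. b) (\<sigma> i) (\<sigma> i) - 2 * form (\<lambda>_. b) (\<sigma> i) (\<sigma> j) + form (\<lambda>_. b) (\<sigma> j) (\<sigma> j)"
      using form_square_add[OF inH inH, OF \<sigma>(1)[of i] \<sigma>(1)[of j], of "- 1"]
      by (simp add: H1_norm_power2 H1_diff inH \<sigma>(1))
    have "(H1_norm b (\<lambda>x. \<sigma> i x - \<sigma> j x))\<^sup>2 = 2 * Q (\<sigma> i) + 2 * Q (\<sigma> j) - 4 * Q ?h"
      unfolding dd Q_def hh fh by (simp add: field_simps)
    moreover have "m \<le> Q ?h" using hS by (rule m_le)
    ultimately show ?thesis using \<sigma>(2)[of i] \<sigma>(2)[of j] by simp
  qed
  obtain w where w: "w \<in> H1" and lim: "(\<lambda>n. H1_norm b (\<lambda>x. \<sigma> n x - w x)) \<longlonglongrightarrow> 0"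
  proof (rule H1_complete[of \<sigma>])
    fix e :: real assume "e > 0"
    then obtain N where N: "1 / real (Suc N) < e / 4" by (meson nat_approx_posE zero_less_divide_iff zero_less_numeral)
    have "(H1_norm b (\<lambda>x. \<sigma> i x - \<sigma> j x))\<^sup>2 < e" if "i \<ge> N" "j \<ge> N" for i j
    proof -
      have "1 / real (Suc i) \<le> 1 / real (Suc N)" "1 / real (Suc j) \<le> 1 / real (Suc N)"
        using that by (auto intro!: divide_left_mono)
      then show ?thesis using par[of i j] N by argo
    qed
    then show "\<exists>N. \<forall>m\<ge>N. \<forall>n\<ge>N. (H1_norm b (\<lambda>x. \<sigma> m x - \<sigma> n x))\<^sup>2 < e" by blast
  qed (use \<sigma> inH in auto)
  have Qlim: "(\<lambda>n. Q (\<sigma> n)) \<longlonglongrightarrow> m"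
  proof (rule tendsto_sandwich[of "\<lambda>_. m" _ _ "\<lambda>n. m + 1 / real (Suc n)"])
    show "(\<lambda>n. m + 1 / real (Suc n)) \<longlonglongrightarrow> m"
      using tendsto_add[OF tendsto_const LIMSEQ_inverse_real_of_nat, of m] by (simp add: inverse_eq_divide)
    show "\<forall>\<^sub>F n in sequentially. Q (\<sigma> n) \<le> m + 1 / real (Suc n)"
      using \<sigma>(2) by (intro always_eventually allI less_imp_le)
  qed (use m_le \<sigma>(1) in auto)
  have rep: "form (\<lambda>_. b) w s = f s" if s: "s \<in> S" for s
  proof -
    have "\<bar>form (\<lambda>_. b) w s - f s\<bar> \<le> sqrt 0 * sqrt (form (\<lambda>_. b) s s)"
    proof (rule semidefinite_Cauchy_Schwarz)
      fix t
      have "m \<le> m + 2 * t * (form (\<lambda>_. b) w s - f s) + t\<^sup>2 * form (\<lambda>_. b) s s"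
      proof (rule tendsto_lowerbound)
        show "(\<lambda>n. Q (\<sigma> n) + 2 * t * (form (\<lambda>_. b) (\<sigma> n) s - f s) + t\<^sup>2 * form (\<lambda>_. b) s s)
            \<longlonglongrightarrow> m + 2 * t * (form (\<lambda>_. b) w s - f s) + t\<^sup>2 * form (\<lambda>_. b) s s"
          by (intro tendsto_intros Qlim form_norm_limit inH \<sigma> w s lim)
        have "m \<le> Q (\<sigma> n) + 2 * t * (form (\<lambda>_. b) (\<sigma> n) s - f s) + t\<^sup>2 * form (\<lambda>_. b) s s" for n
        proof -
          have "m \<le> Q (\<lambda>x. \<sigma> n x + t * s x)"
            by (intro m_le Sadd Sscale \<sigma> s)
          then show ?thesis
            using form_square_add[OF inH[OF \<sigma>(1)[of n]] inH[OF s], of t] fadd[OF \<sigma>(1)[of n] Sscale[OF s, of t]] fscale[OF s, of t]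
            by (simp add: Q_def algebra_simps)
        qed
        then show "\<forall>\<^sub>F n in sequentially. m \<le> Q (\<sigma> n) + 2 * t * (form (\<lambda>_. b) (\<sigma> n) s - f s) + t\<^sup>2 * form (\<lambda>_. b) s s"
          by simp
      qed simp
      then show "0 \<le> 0 + 2 * t * (form (\<lambda>_. b) w s - f s) + t\<^sup>2 * form (\<lambda>_. b) s s" by simp
    qed (use form_nonneg inH s in auto)
    then show ?thesis by simp
  qed
  show ?thesis by (rule that[OF w rep \<sigma>(1) lim])
qed

lemma form_in_H1_dual:
  assumes "w \<in> H1" shows "form (\<lambda>_. b) w \<in> H1_dual b"
  using assms H1_Cauchy_Schwarz
  by (auto simp: H1_dual_def form_add_right form_scale_right)

lemma Riesz:
  assumes "f \<in> H1_dual b"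
  obtains w where "w \<in> H1" "\<And>v. v \<in> H1 \<Longrightarrow> f v = form (\<lambda>_. b) w v"
proof -
  obtain C where C: "\<And>u. u \<in> H1 \<Longrightarrow> \<bar>f u\<bar> \<le> C * H1_norm b u"
  proof -
    have "\<exists>C. \<forall>u\<in>H1. \<bar>f u\<bar> \<le> C * H1_norm b u" using assms by (simp add: H1_dual_def)
    then show ?thesis using that by blast
  qed
  show ?thesis
    by (rule Riesz_subspace[of H1 f C])
      (use assms C that in \<open>auto simp: H1_dual_def H1_zero H1_add H1_scale\<close>)
qed

lemma H1_weakly_converges_iff:
  fixes u :: "nat \<Rightarrow> 'a::euclidean_space \<Rightarrow> real"
  shows "H1_weakly_converges b u w \<longleftrightarrow> (\<forall>k. u k \<in> H1) \<and> w \<in> H1 \<and>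
     (\<forall>v\<in>H1. (\<lambda>k. form (\<lambda>_. b) (u k) v) \<longlonglongrightarrow> form (\<lambda>_. b) w v)"
proof (intro iffI conjI ballI)
  fix v :: "'a \<Rightarrow> real" assume "H1_weakly_converges b u w" "v \<in> H1"
  then show "(\<lambda>k. form (\<lambda>_. b) (u k) v) \<longlonglongrightarrow> form (\<lambda>_. b) w v"
    using form_in_H1_dual[of v] by (auto simp: H1_weakly_converges_def form_commute[of _ _ v])
next
  assume *: "(\<forall>k. u k \<in> H1) \<and> w \<in> H1 \<and> (\<forall>v\<in>H1. (\<lambda>k. form (\<lambda>_. b) (u k) v) \<longlonglongrightarrow> form (\<lambda>_. b) w v)"
  show "H1_weakly_converges b u w"
    unfolding H1_weakly_converges_def
  proof (intro conjI ballI)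
    fix f :: "('a \<Rightarrow> real) \<Rightarrow> real" assume "f \<in> H1_dual b"
    then obtain z where z: "z \<in> H1" "\<And>v. v \<in> H1 \<Longrightarrow> f v = form (\<lambda>_. b) z v"
      by (rule Riesz) (use that in blast)
    have "(\<lambda>k. form (\<lambda>_. b) (u k) z) \<longlonglongrightarrow> form (\<lambda>_. b) w z" using * z(1) by blast
    then show "(\<lambda>k. f (u k)) \<longlonglongrightarrow> f w" using * by (simp add: z(2) form_commute[of _ z])
  qed (use * in auto)
qed (auto simp: H1_weakly_converges_def)

lemma bounded_double_sequence_convergent_subsequence:
  fixes a :: "nat \<Rightarrow> nat \<Rightarrow> real"
  assumes "\<And>k j. \<bar>a k j\<bar> \<le> M"
  obtains r where "strict_mono r" "\<And>j. convergent (\<lambda>k. a (r k) j)"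
proof -
  interpret subseqs "\<lambda>j s. convergent (\<lambda>k. a (s k) j)"
  proof
    fix n :: nat and s :: "nat \<Rightarrow> nat"
    have "bounded (range (\<lambda>k. a (s k) n))" using assms by (auto simp: bounded_iff)
    then obtain l r where "strict_mono r" "((\<lambda>k. a (s k) n) \<circ> r) \<longlonglongrightarrow> l"
      using bounded_imp_convergent_subsequence by blast
    then show "\<exists>r'. strict_mono r' \<and> convergent (\<lambda>k. a ((s \<circ> r') k) n)"
      by (auto simp: convergent_def o_def)
  qed
  have "convergent (\<lambda>k. a (diagseq k) j)" for j
  proof -
    have "convergent (\<lambda>k. a ((diagseq \<circ> (+) (Suc j)) k) j)"
      by (rule diagseq_holds) (auto simp: o_def intro: convergent_subseq_convergent[unfolded o_def])
    then have "convergent (\<lambda>k. a (diagseq (k + Suc j)) j)" by (simp add: o_def add.commute)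
    then show ?thesis by (rule convergent_ignore_initial_segment[THEN iffD1])
  qed
  then show ?thesis using that subseq_diagseq by blast
qed

text \<open>
  Along a subsequence the products with all members of the sequence itself converge.  The vectors
  \<open>v\<close> for which the products converge then form a closed subspace \<open>G\<close> that contains the sequence,
  so that a general \<open>v\<close> may be replaced by its projection to \<open>G\<close>.
\<close>

lemma weak_compactness:
  fixes u :: "nat \<Rightarrow> 'a::euclidean_space \<Rightarrow> real" and M :: real
  assumes u: "\<And>k. u k \<in> H1" and M: "\<And>k. H1_norm b (u k) \<le> M"
  obtains r w where "strict_mono r" "H1_weakly_converges b (\<lambda>k. u (r k)) w"
proof -
  let ?B = "form (\<lambda>_. b)"
  have M0: "0 \<le> M" using H1_norm_nonneg[OF u[of 0]] M[of 0] by linarith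
  have bound: "\<bar>?B (u k) v\<bar> \<le> M * H1_norm b v" if "v \<in> H1" for k v
    using H1_Cauchy_Schwarz[OF u that, of k] mult_right_mono[OF M[of k] H1_norm_nonneg[OF that]] by linarith
  have "\<bar>?B (u k) (u j)\<bar> \<le> M * M" for k j
    using bound[OF u[of j], of k] mult_left_mono[OF M[of j] M0] by linarith
  from bounded_double_sequence_convergent_subsequence[of "\<lambda>k j. ?B (u k) (u j)", OF this]
  obtain r where r: "strict_mono r" and conv: "\<And>j. convergent (\<lambda>k. ?B (u (r k)) (u j))" by blast
  define G where "G = {v \<in> H1. convergent (\<lambda>k. ?B (u (r k)) v)}"
  define f where "f v = lim (\<lambda>k. ?B (u (r k)) v)" for v
  have GH: "G \<subseteq> H1" by (auto simp: G_def)
  have flim: "(\<lambda>k. ?B (u (r k)) v) \<longlonglongrightarrow> f v" if "v \<in> G" for v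
    using that by (auto simp: G_def f_def convergent_LIMSEQ_iff)
  have GI: "v \<in> G" "f v = l" if "v \<in> H1" "(\<lambda>k. ?B (u (r k)) v) \<longlonglongrightarrow> l" for v l
    using that by (auto simp: G_def f_def convergent_def limI)
  have G0: "(\<lambda>x. 0) \<in> G"
    by (rule GI(1)[OF H1_zero, of 0]) (simp add: form_commute[of _ _ "\<lambda>x. 0"] form_zero_left L_infinity_const u)
  have Gadd: "(\<lambda>x. s x + t x) \<in> G \<and> f (\<lambda>x. s x + t x) = f s + f t" if "s \<in> G" "t \<in> G" for s t
  proof -
    have st: "s \<in> H1" "t \<in> H1" using that GH by auto
    have "(\<lambda>k. ?B (u (r k)) (\<lambda>x. s x + t x)) \<longlonglongrightarrow> f s + f t"
      by (simp add: form_add_right st u) (intro tendsto_add flim that)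
    then show ?thesis using GI H1_add[OF st] by blast
  qed
  have Gscale: "(\<lambda>x. c * s x) \<in> G \<and> f (\<lambda>x. c * s x) = c * f s" if "s \<in> G" for s c
  proof -
    have st: "s \<in> H1" using that GH by auto
    have "(\<lambda>k. ?B (u (r k)) (\<lambda>x. c * s x)) \<longlonglongrightarrow> c * f s"
      by (simp add: form_scale_right st u) (intro tendsto_mult_left flim that)
    then show ?thesis using GI H1_scale[OF st] by blast
  qed
  have fb: "\<bar>f s\<bar> \<le> M * H1_norm b s" if "s \<in> G" for s
    using LIMSEQ_le_const2[OF tendsto_rabs[OF flim[OF that]]] bound that GH by blast
  have Gclosed: "v \<in> G" if \<sigma>: "\<And>n. \<sigma> n \<in> G" and v: "v \<in> H1"
    and lim: "(\<lambda>n. H1_norm b (\<lambda>x. \<sigma> n x - v x)) \<longlonglongrightarrow> 0" for \<sigma> v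
  proof -
    have "Cauchy (\<lambda>k. ?B (u (r k)) v)"
    proof (rule metric_CauchyI)
      fix e :: real assume e: "e > 0"
      then have "e / (4 * (M + 1)) > 0" using M0 by simp
      from LIMSEQ_D[OF lim this] obtain n where n: "H1_norm b (\<lambda>x. \<sigma> n x - v x) < e / (4 * (M + 1))"
        using H1_norm_nonneg[OF H1_diff[OF _ v]] GH \<sigma> by (metis abs_of_nonneg diff_zero order_refl real_norm_def subsetD)
      have \<sigma>n: "\<sigma> n \<in> H1" using \<sigma> GH by blast
      have close: "\<bar>?B (u (r k)) (\<sigma> n) - ?B (u (r k)) v\<bar> < e / 4" for k
      proof -
        have "\<bar>?B (u (r k)) (\<sigma> n) - ?B (u (r k)) v\<bar> \<le> M * H1_norm b (\<lambda>x. \<sigma> n x - v x)"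
          using bound[OF H1_diff[OF \<sigma>n v], of "r k"] by (simp add: form_diff_right \<sigma>n v u)
        also have "\<dots> \<le> (M + 1) * H1_norm b (\<lambda>x. \<sigma> n x - v x)"
          using H1_norm_nonneg[OF H1_diff[OF \<sigma>n v]] by (intro mult_right_mono) auto
        also have "\<dots> < (M + 1) * (e / (4 * (M + 1)))" using n M0 by (intro mult_strict_left_mono) auto
        also have "\<dots> = e / 4"
        proof -
          have "c * (e / (4 * c)) = e / 4" if "c > 0" for c using that by simp
          from this[of "M + 1"] show ?thesis using M0 by simp
        qed
        finally show ?thesis .
      qed
      have "Cauchy (\<lambda>k. ?B (u (r k)) (\<sigma> n))" using flim[OF \<sigma>[of n]] by (rule LIMSEQ_imp_Cauchy)
      then obtain K where K: "\<And>k l. k \<ge> K \<Longrightarrow> l \<ge> K \<Longrightarrow> dist (?B (u (r k)) (\<sigma> n)) (?B (u (r l)) (\<sigma> n)) < e / 4"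
        using metric_CauchyD[of _ "e / 4"] e by (metis divide_pos_pos zero_less_numeral)
      have "dist (?B (u (r k)) v) (?B (u (r l)) v) < e" if "k \<ge> K" "l \<ge> K" for k l
        using K[OF that] close[of k] close[of l] unfolding dist_real_def by linarith
      then show "\<exists>K. \<forall>k\<ge>K. \<forall>l\<ge>K. dist (?B (u (r k)) v) (?B (u (r l)) v) < e" by blast
    qed
    then show ?thesis using v by (simp add: G_def Cauchy_convergent)
  qed
  obtain w \<sigma> where w: "w \<in> H1" "\<And>s. s \<in> G \<Longrightarrow> ?B w s = f s"
    "\<And>n::nat. \<sigma> n \<in> G" "(\<lambda>n. H1_norm b (\<lambda>x. \<sigma> n x - w x)) \<longlonglongrightarrow> 0"
    by (rule Riesz_subspace[of G f M]) (use GH G0 Gadd Gscale fb in auto)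
  have wG: "w \<in> G" by (rule Gclosed[OF w(3) w(1) w(4)])
  have "(\<lambda>k. ?B (u (r k)) v) \<longlonglongrightarrow> ?B w v" if v: "v \<in> H1" for v
  proof -
    obtain v' \<tau> where v': "v' \<in> H1" "\<And>s. s \<in> G \<Longrightarrow> ?B v' s = ?B v s"
      "\<And>n::nat. \<tau> n \<in> G" "(\<lambda>n. H1_norm b (\<lambda>x. \<tau> n x - v' x)) \<longlonglongrightarrow> 0"
      by (rule Riesz_subspace[of G "?B v" "H1_norm b v"])
        (use GH G0 Gadd Gscale v H1_Cauchy_Schwarz[OF v] in \<open>auto simp: form_add_right form_scale_right subset_iff\<close>)
    have v'G: "v' \<in> G" by (rule Gclosed[OF v'(3) v'(1) v'(4)])
    have uG: "u j \<in> G" for j using conv u by (simp add: G_def)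
    have "(\<lambda>k. ?B v' (u (r k))) \<longlonglongrightarrow> ?B v' w"
      using flim[OF v'G] w(2)[OF v'G] by (simp add: form_commute[of _ v'])
    then show ?thesis using v'(2)[OF uG] v'(2)[OF wG] by (simp add: form_commute[of _ _ v])
  qed
  then have "H1_weakly_converges b (\<lambda>k. u (r k)) w"
    by (simp add: H1_weakly_converges_iff u w(1))
  then show ?thesis using that r by blast
qed

end

section \<open>Translations of \<open>H1\<close> functions\<close>

definition segment_integral :: "('a::euclidean_space \<Rightarrow> real) \<Rightarrow> 'a \<Rightarrow> 'a \<Rightarrow> real" where
  "segment_integral F h x = (LINT t|lborel. F (x + t *\<^sub>R h) * indicator {0..1} t)"

lemma nn_integral_translate_lborel:
  assumes "f \<in> borel_measurable borel"
  shows "(\<integral>\<^sup>+ x. f (x + a) \<partial>lborel) = (\<integral>\<^sup>+ x. f x \<partial>lborel)"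
  using nn_integral_translate[of f a] assms by (simp add: nn_integral_completion measurable_completion)

lemma borel_measurable_segment_integral[measurable]:
  assumes [measurable]: "F \<in> borel_measurable borel"
  shows "segment_integral F h \<in> borel_measurable borel"
  unfolding segment_integral_def by measurable

text \<open>
  By the Cauchy-Schwarz inequality the square of the segment integral is at most the segment integral of the
  square, and translations preserve the integral.
\<close>

lemma nn_integral_segment_integral:
  fixes F :: "'a::euclidean_space \<Rightarrow> real"
  assumes [measurable]: "F \<in> borel_measurable borel"
  shows "(\<integral>\<^sup>+ x. ennreal ((segment_integral F h x)\<^sup>2) \<partial>lborel) \<le> (\<integral>\<^sup>+ x. ennreal ((F x)\<^sup>2) \<partial>lborel)"
proof -
  have pw: "ennreal ((segment_integral F h x)\<^sup>2) \<le> (\<integral>\<^sup>+ t. ennreal ((F (x + t *\<^sub>R h))\<^sup>2) * indicator {0..1} t \<partial>lborel)" for x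
  proof -
    have "ennreal \<bar>segment_integral F h x\<bar> \<le> (\<integral>\<^sup>+ t. ennreal (norm (F (x + t *\<^sub>R h) * indicator {0..1} t)) \<partial>lborel)"
    proof (cases "integrable lborel (\<lambda>t. F (x + t *\<^sub>R h) * indicator {0..1} t)")
      case True
      then show ?thesis
        using integral_norm_bound_ennreal[OF True] by (simp add: segment_integral_def)
    next
      case False
      then show ?thesis by (simp add: segment_integral_def not_integrable_integral_eq)
    qed
    also have "\<dots> = (\<integral>\<^sup>+ t. (ennreal \<bar>F (x + t *\<^sub>R h)\<bar> * indicator {0..1} t) * indicator {0..1} t \<partial>lborel)"
      by (intro nn_integral_cong) (simp add: indicator_def)
    finally have "ennreal \<bar>segment_integral F h x\<bar> ^ 2
        \<le> (\<integral>\<^sup>+ t. (ennreal \<bar>F (x + t *\<^sub>R h)\<bar> * indicator {0..1} t) * indicator {0..1} t \<partial>lborel) ^ 2"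
      by (rule power_mono) simp
    also have "\<dots> \<le> (\<integral>\<^sup>+ t. (ennreal \<bar>F (x + t *\<^sub>R h)\<bar> * indicator {0..1} t) ^ 2 \<partial>lborel)
        * (\<integral>\<^sup>+ t. (indicator {0..1::real} t) ^ 2 \<partial>lborel)"
      by (rule Cauchy_Schwarz_nn_integral) measurable
    also have "(\<integral>\<^sup>+ t. (indicator {0..1::real} t) ^ 2 \<partial>lborel) = (\<integral>\<^sup>+ t. indicator {0..1::real} t \<partial>lborel)"
      by (intro nn_integral_cong) (simp add: indicator_def)
    also have "\<dots> = 1" by simp
    also have "(\<integral>\<^sup>+ t. (ennreal \<bar>F (x + t *\<^sub>R h)\<bar> * indicator {0..1} t) ^ 2 \<partial>lborel)
        = (\<integral>\<^sup>+ t. ennreal ((F (x + t *\<^sub>R h))\<^sup>2) * indicator {0..1} t \<partial>lborel)"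
      by (intro nn_integral_cong) (simp add: indicator_def ennreal_power)
    finally show ?thesis by (simp add: ennreal_power)
  qed
  have "(\<integral>\<^sup>+ x. ennreal ((segment_integral F h x)\<^sup>2) \<partial>lborel)
      \<le> (\<integral>\<^sup>+ x. (\<integral>\<^sup>+ t. ennreal ((F (x + t *\<^sub>R h))\<^sup>2) * indicator {0..1} t \<partial>lborel) \<partial>lborel)"
    by (intro nn_integral_mono pw)
  also have "\<dots> = (\<integral>\<^sup>+ t. (\<integral>\<^sup>+ x. ennreal ((F (x + t *\<^sub>R h))\<^sup>2) * indicator {0..1} t \<partial>lborel) \<partial>lborel)"
    by (rule lborel_pair.Fubini'[symmetric]) measurable
  also have "\<dots> = (\<integral>\<^sup>+ t. (\<integral>\<^sup>+ x. ennreal ((F x)\<^sup>2) \<partial>lborel) * indicator {0..1::real} t \<partial>lborel)"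
  proof (rule nn_integral_cong)
    fix t :: real
    have "(\<integral>\<^sup>+ x. ennreal ((F (x + t *\<^sub>R h))\<^sup>2) * indicator {0..1} t \<partial>lborel)
        = (\<integral>\<^sup>+ x. ennreal ((F (x + t *\<^sub>R h))\<^sup>2) \<partial>lborel) * indicator {0..1} t"
      by (rule nn_integral_multc) measurable
    then show "(\<integral>\<^sup>+ x. ennreal ((F (x + t *\<^sub>R h))\<^sup>2) * indicator {0..1} t \<partial>lborel)
        = (\<integral>\<^sup>+ x. ennreal ((F x)\<^sup>2) \<partial>lborel) * indicator {0..1} t"
      using nn_integral_translate_lborel[of "\<lambda>x. ennreal ((F x)\<^sup>2)" "t *\<^sub>R h"] by simp
  qed
  also have "\<dots> = (\<integral>\<^sup>+ x. ennreal ((F x)\<^sup>2) \<partial>lborel)"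
    by (simp add: nn_integral_cmult)
  finally show ?thesis .
qed

lemma segment_integral_Fubini:
  fixes F \<psi> :: "'a::euclidean_space \<Rightarrow> real"
  assumes [measurable]: "F \<in> borel_measurable borel" "\<psi> \<in> borel_measurable borel"
    and F: "(\<integral>\<^sup>+ x. ennreal ((F x)\<^sup>2) \<partial>lborel) < \<infinity>" and \<psi>: "(\<integral>\<^sup>+ x. ennreal ((\<psi> x)\<^sup>2) \<partial>lborel) < \<infinity>"
  shows "(LINT x|lborel. segment_integral F h x * \<psi> x)
    = (LINT t|lborel. (LINT x|lborel. F (x + t *\<^sub>R h) * \<psi> x) * indicator {0..1} t)"
proof -
  let ?f = "\<lambda>x t. F (x + t *\<^sub>R h) * indicator {0..1} t * \<psi> x"
  have "integrable (lborel \<Otimes>\<^sub>M lborel) (case_prod ?f)"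
  proof (rule integrableI_bounded)
    have "(\<integral>\<^sup>+ z. ennreal (norm (case_prod ?f z)) \<partial>(lborel \<Otimes>\<^sub>M lborel))
        = (\<integral>\<^sup>+ t. \<integral>\<^sup>+ x. ennreal (norm (?f x t)) \<partial>lborel \<partial>lborel)"
      by (subst lborel_pair.nn_integral_snd[symmetric]) auto
    also have "\<dots> \<le> (\<integral>\<^sup>+ t. ((\<integral>\<^sup>+ x. ennreal ((F x)\<^sup>2) \<partial>lborel) + (\<integral>\<^sup>+ x. ennreal ((\<psi> x)\<^sup>2) \<partial>lborel))
        * indicator {0..1::real} t \<partial>lborel)"
    proof (rule nn_integral_mono)
      fix t :: real
      have "(\<integral>\<^sup>+ x. ennreal (norm (?f x t)) \<partial>lborel)
          \<le> (\<integral>\<^sup>+ x. (ennreal ((F (x + t *\<^sub>R h))\<^sup>2) + ennreal ((\<psi> x)\<^sup>2)) * indicator {0..1} t \<partial>lborel)"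
      proof (rule nn_integral_mono)
        fix x
        have "\<bar>F (x + t *\<^sub>R h)\<bar> * \<bar>\<psi> x\<bar> \<le> (F (x + t *\<^sub>R h))\<^sup>2 + (\<psi> x)\<^sup>2"
        proof -
          have "0 \<le> \<bar>F (x + t *\<^sub>R h)\<bar> * \<bar>\<psi> x\<bar>" by simp
          then show ?thesis
            using sum_squares_bound[of "\<bar>F (x + t *\<^sub>R h)\<bar>" "\<bar>\<psi> x\<bar>"]
            unfolding power2_abs by linarith
        qed
        then show "ennreal (norm (?f x t)) \<le> (ennreal ((F (x + t *\<^sub>R h))\<^sup>2) + ennreal ((\<psi> x)\<^sup>2)) * indicator {0..1} t"
          by (auto simp: abs_mult indicator_def simp flip: ennreal_plus intro: ennreal_leI)
      qed
      also have "\<dots> = ((\<integral>\<^sup>+ x. ennreal ((F (x + t *\<^sub>R h))\<^sup>2) \<partial>lborel) + (\<integral>\<^sup>+ x. ennreal ((\<psi> x)\<^sup>2) \<partial>lborel)) * indicator {0..1} t"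
        by (simp add: nn_integral_multc nn_integral_add)
      also have "(\<integral>\<^sup>+ x. ennreal ((F (x + t *\<^sub>R h))\<^sup>2) \<partial>lborel) = (\<integral>\<^sup>+ x. ennreal ((F x)\<^sup>2) \<partial>lborel)"
        using nn_integral_translate_lborel[of "\<lambda>x. ennreal ((F x)\<^sup>2)" "t *\<^sub>R h"] by simp
      finally show "(\<integral>\<^sup>+ x. ennreal (norm (?f x t)) \<partial>lborel) \<le> ((\<integral>\<^sup>+ x. ennreal ((F x)\<^sup>2) \<partial>lborel)
          + (\<integral>\<^sup>+ x. ennreal ((\<psi> x)\<^sup>2) \<partial>lborel)) * indicator {0..1} t" .
    qed
    also have "\<dots> = (\<integral>\<^sup>+ x. ennreal ((F x)\<^sup>2) \<partial>lborel) + (\<integral>\<^sup>+ x. ennreal ((\<psi> x)\<^sup>2) \<partial>lborel)"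
      by (simp add: nn_integral_cmult)
    also have "\<dots> < \<infinity>" using F \<psi> by simp
    finally show "(\<integral>\<^sup>+ z. ennreal (norm (case_prod ?f z)) \<partial>(lborel \<Otimes>\<^sub>M lborel)) < \<infinity>" .
  qed measurable
  from lborel_pair.Fubini_integral[OF this]
  have "(LINT x|lborel. LINT t|lborel. ?f x t) = (LINT t|lborel. LINT x|lborel. ?f x t)" by simp
  moreover have "(LINT x|lborel. ?f x t) = (LINT x|lborel. F (x + t *\<^sub>R h) * \<psi> x) * indicator {0..1} t" for t
  proof -
    have "(LINT x|lborel. ?f x t) = (LINT x|lborel. (F (x + t *\<^sub>R h) * \<psi> x) * indicator {0..1} t)"
      by (intro Bochner_Integration.integral_cong) (auto simp: mult_ac)
    then show ?thesis by simp
  qed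
  ultimately show ?thesis unfolding segment_integral_def by simp
qed

lemma test_function_directional_derivative:
  assumes \<phi>: "test_function \<phi>"
  shows "frechet_derivative \<phi> (at z) h = (\<Sum>e\<in>Basis. (h \<bullet> e) * frechet_derivative \<phi> (at z) e)"
proof -
  have "\<phi> differentiable (at z)"
    using \<phi> by (auto simp: test_function_def dest: spec[of _ "Suc 0"])
  then have lin: "linear (frechet_derivative \<phi> (at z))"
    by (simp add: frechet_derivative_works has_derivative_linear)
  from linear_sum[OF this, of "\<lambda>e. (h \<bullet> e) *\<^sub>R e" Basis] show ?thesis
    by (simp add: euclidean_representation linear_scale[OF lin])
qed

lemma test_function_gradient_segment:
  assumes \<phi>: "test_function \<phi>"
  shows "segment_integral (\<lambda>z. frechet_derivative \<phi> (at z) h) (- h) x = \<phi> x - \<phi> (x - h)"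
proof -
  have diff: "\<phi> differentiable (at z)" for z
    using \<phi> by (auto simp: test_function_def dest: spec[of _ "Suc 0"])
  have lin: "frechet_derivative \<phi> (at z) (- h) = - frechet_derivative \<phi> (at z) h" for z
    using diff[of z] by (simp add: frechet_derivative_works has_derivative_linear linear_neg)
  have cont: "continuous_on UNIV (\<lambda>z. frechet_derivative \<phi> (at z) h)"
  proof -
    note eq = test_function_directional_derivative[OF \<phi>, of _ h]
    have "continuous_on UNIV (\<lambda>z. frechet_derivative \<phi> (at z) e)" if "e \<in> Basis" for e
      using \<phi> that by (auto simp: test_function_def dest: spec[of _ "Suc 0"])
    then show ?thesis by (subst eq) (intro continuous_intros)
  qed
  have "(LINT t|lborel. frechet_derivative \<phi> (at (x + t *\<^sub>R (- h))) h * indicator {0..1} t)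
      = (- \<phi> (x + 1 *\<^sub>R (- h))) - (- \<phi> (x + 0 *\<^sub>R (- h)))"
  proof (rule integral_FTC_Icc_real)
    fix t :: real
    have 1: "((\<lambda>t. x + t *\<^sub>R (- h)) has_derivative (\<lambda>s. s *\<^sub>R (- h))) (at t)"
      by (auto intro!: derivative_eq_intros)
    have "(\<phi> has_derivative frechet_derivative \<phi> (at (x + t *\<^sub>R (- h)))) (at (x + t *\<^sub>R (- h)))"
      using diff by (simp add: frechet_derivative_works[symmetric])
    from has_derivative_minus[OF has_derivative_compose[OF 1 this]]
    have "((\<lambda>t. - \<phi> (x + t *\<^sub>R (- h))) has_derivative
        (\<lambda>s. - frechet_derivative \<phi> (at (x + t *\<^sub>R (- h))) (s *\<^sub>R (- h)))) (at t)" .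
    moreover have "- frechet_derivative \<phi> (at z) (s *\<^sub>R (- h)) = frechet_derivative \<phi> (at z) h * s" for z s
    proof -
      have "linear (frechet_derivative \<phi> (at z))"
        using diff[of z] by (simp add: frechet_derivative_works has_derivative_linear)
      from linear_scale[OF this, of s "- h"] show ?thesis by (simp add: lin)
    qed
    ultimately show "((\<lambda>t. - \<phi> (x + t *\<^sub>R (- h))) has_real_derivative
        frechet_derivative \<phi> (at (x + t *\<^sub>R (- h))) h) (at t)"
      by (simp add: has_field_derivative_def)
    have "continuous_on UNIV (\<lambda>t. frechet_derivative \<phi> (at (x + t *\<^sub>R (- h))) h)"
      by (rule continuous_on_compose2[OF cont]) (auto intro!: continuous_intros)
    then show "isCont (\<lambda>t. frechet_derivative \<phi> (at (x + t *\<^sub>R (- h))) h) t"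
      by (simp add: continuous_on_eq_continuous_at)
  qed simp
  then show ?thesis by (simp add: segment_integral_def)
qed

lemma L2_borel_representative:
  fixes f :: "'a::euclidean_space \<Rightarrow> real"
  assumes "f \<in> L2"
  obtains g where "g \<in> borel_measurable borel" "AE x in lebesgue. f x = g x" "g \<in> L2"
    "(\<integral>\<^sup>+ x. ennreal ((g x)\<^sup>2) \<partial>lborel) = ennreal (LINT x|lebesgue. (f x)\<^sup>2)"
proof -
  obtain g where g: "g \<in> borel_measurable lborel" "AE x in lborel. f x = g x"
    using completion_ex_borel_measurable_real[OF L2_measurable[OF assms]] by blast
  then have gm: "g \<in> borel_measurable borel" by simp
  have ae: "AE x in lebesgue. f x = g x" using g(2) by (rule AE_completion)
  then have "AE x in lebesgue. g x = f x" by eventually_elim simp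
  then have gL: "g \<in> L2" by (rule L2_cong_AE[OF assms])
  have "(\<integral>\<^sup>+ x. ennreal ((g x)\<^sup>2) \<partial>lborel) = (\<integral>\<^sup>+ x. ennreal ((g x)\<^sup>2) \<partial>lebesgue)"
    by (simp add: nn_integral_completion)
  also have "\<dots> = (\<integral>\<^sup>+ x. ennreal ((f x)\<^sup>2) \<partial>lebesgue)"
    by (rule nn_integral_cong_AE) (use ae in eventually_elim, simp)
  also have "\<dots> = ennreal (LINT x|lebesgue. (f x)\<^sup>2)"
    by (rule nn_integral_eq_integral[OF L2_real_integrable[OF assms]]) simp
  finally show ?thesis using that gm ae gL by blast
qed

lemma has_weak_gradient_direction:
  assumes u: "has_weak_gradient u G" and \<phi>: "test_function \<phi>"
  shows "(LINT x|lebesgue. u x * frechet_derivative \<phi> (at x) h) = - (LINT x|lebesgue. (G x \<bullet> h) * \<phi> x)"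
proof -
  have l: "locally_integrable u" "locally_integrable G" using u by (auto simp: has_weak_gradient_def)
  have "(LINT x|lebesgue. u x * frechet_derivative \<phi> (at x) h)
      = (LINT x|lebesgue. (\<Sum>e\<in>Basis. (h \<bullet> e) * (u x * frechet_derivative \<phi> (at x) e)))"
    by (subst test_function_directional_derivative[OF \<phi>]) (simp add: sum_distrib_left mult_ac)
  also have "\<dots> = (\<Sum>e\<in>Basis. (h \<bullet> e) * (LINT x|lebesgue. u x * frechet_derivative \<phi> (at x) e))"
    by (subst Bochner_Integration.integral_sum) (auto intro: test_function_integrable[OF l(1) \<phi>])
  also have "\<dots> = - (\<Sum>e\<in>Basis. (h \<bullet> e) * (LINT x|lebesgue. (G x \<bullet> e) * \<phi> x))"
    by (simp add: has_weak_gradientD[OF u \<phi>] sum_negf)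
  also have "(\<Sum>e\<in>Basis. (h \<bullet> e) * (LINT x|lebesgue. (G x \<bullet> e) * \<phi> x))
      = (LINT x|lebesgue. (\<Sum>e\<in>Basis. (h \<bullet> e) * ((G x \<bullet> e) * \<phi> x)))"
    by (subst Bochner_Integration.integral_sum)
      (auto intro: test_function_integrable[OF locally_integrable_inner[OF l(2)] \<phi>])
  also have "\<dots> = (LINT x|lebesgue. (G x \<bullet> h) * \<phi> x)"
    by (simp add: euclidean_inner[of "G _" h] sum_distrib_left mult_ac)
  finally show ?thesis .
qed

text \<open>
  For a test function \<open>\<phi>\<close>, integrating \<open>\<phi> x - \<phi> (x - h) = \<integral>\<^sub>0\<^sup>1 \<partial>\<^sub>h\<phi> (x - t h) dt\<close> against \<open>u\<close> and moving
  the derivative and the translation to \<open>u\<close> shows that \<open>u (x + h) - u x\<close> is the integral of the weak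
  derivative along the segment.
\<close>

lemma H1_difference_segment_integral:
  assumes u: "u \<in> H1" and F[measurable]: "F \<in> borel_measurable borel" and FL: "F \<in> L2"
    and FG: "AE x in lebesgue. weak_gradient u x \<bullet> h = F x"
    and Fn: "(\<integral>\<^sup>+ x. ennreal ((F x)\<^sup>2) \<partial>lborel) < \<infinity>"
  shows "AE x in lebesgue. u (x + h) - u x = segment_integral F h x"
proof -
  have uL: "u \<in> L2" by (rule H1_L2[OF u])
  have uhL: "(\<lambda>x. u (x + h)) \<in> L2" by (rule L2_translate[OF uL])
  have sm: "segment_integral F h \<in> borel_measurable lebesgue"
    by (intro measurable_completion) simp
  have sL: "segment_integral F h \<in> L2"
  proof -
    have "integrable lebesgue (\<lambda>x. (segment_integral F h x)\<^sup>2)"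
    proof (rule integrableI_bounded)
      show "(\<lambda>x. (segment_integral F h x)\<^sup>2) \<in> borel_measurable lebesgue" using sm by measurable
      show "(\<integral>\<^sup>+ x. ennreal (norm ((segment_integral F h x)\<^sup>2)) \<partial>lebesgue) < \<infinity>"
        using nn_integral_segment_integral[OF F, of h] Fn by (simp add: nn_integral_completion)
    qed
    then show ?thesis using sm by (simp add: L2_def)
  qed
  have "AE x in lebesgue. (u (x + h) - u x) - segment_integral F h x = 0"
  proof (rule fundamental_lemma)
    show "locally_integrable (\<lambda>x. (u (x + h) - u x) - segment_integral F h x)"
      by (intro L2_locally_integrable L2_diff uL uhL sL)
    fix \<phi> :: "'a \<Rightarrow> real" assume \<phi>: "test_function \<phi>"
    have \<phi>L: "\<phi> \<in> L2" by (rule test_function_L2(1)[OF \<phi>])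
    obtain K C where K: "compact K" "continuous_on UNIV \<phi>" "\<And>x. x \<notin> K \<Longrightarrow> \<phi> x = 0" "\<And>x. \<bar>\<phi> x\<bar> \<le> C"
      "\<And>x. \<phi> differentiable (at x)"
      "\<And>e. e \<in> Basis \<Longrightarrow> continuous_on UNIV (\<lambda>x. frechet_derivative \<phi> (at x) e)"
      "\<And>x e. x \<notin> K \<Longrightarrow> frechet_derivative \<phi> (at x) e = 0"
      "\<And>x e. e \<in> Basis \<Longrightarrow> \<bar>frechet_derivative \<phi> (at x) e\<bar> \<le> C"
      by (fact test_function_bounded_support[OF \<phi>])
    let ?d = "\<lambda>z. frechet_derivative \<phi> (at z) h"
    note deq = test_function_directional_derivative[OF \<phi>, of _ h]
    have dcont: "continuous_on UNIV ?d" by (subst deq) (intro continuous_intros K(6))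
    then have dm[measurable]: "?d \<in> borel_measurable borel" by (rule borel_measurable_continuous_onI)
    have \<phi>m[measurable]: "\<phi> \<in> borel_measurable borel" using K(2) by (rule borel_measurable_continuous_onI)
    have dbound: "\<bar>?d z\<bar> \<le> (\<Sum>e\<in>Basis. \<bar>h \<bullet> e\<bar> * C)" for z
      by (subst deq, rule order.trans[OF sum_abs]) (auto simp: abs_mult intro!: sum_mono mult_left_mono K(8))
    have dL: "?d \<in> L2"
      by (rule L2_bounded_support[OF K(1) continuous_measurable_lebesgue[OF dcont] K(7) dbound])
    have finL2: "(\<integral>\<^sup>+ x. ennreal ((f x)\<^sup>2) \<partial>lborel) < \<infinity>" if "f \<in> L2" for f :: "'a \<Rightarrow> real"
      using nn_integral_eq_integral[OF L2_real_integrable[OF that]] by (simp add: nn_integral_completion)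
    obtain v where v[measurable]: "v \<in> borel_measurable borel" "AE x in lebesgue. u x = v x" "v \<in> L2"
      "(\<integral>\<^sup>+ x. ennreal ((v x)\<^sup>2) \<partial>lborel) = ennreal (LINT x|lebesgue. (u x)\<^sup>2)"
      by (fact L2_borel_representative[OF uL])
    have bm: "f \<in> borel_measurable lebesgue" if "f \<in> borel_measurable borel" for f :: "'a \<Rightarrow> real"
      using that by (intro measurable_completion) simp
    have um: "u \<in> borel_measurable lebesgue" by (rule L2_measurable[OF uL])
    have cong: "(LINT x|lebesgue. u x * \<psi> x) = (LINT x|lborel. v x * \<psi> x)" if [measurable]: "\<psi> \<in> borel_measurable borel" for \<psi>
    proof -
      have "(LINT x|lebesgue. u x * \<psi> x) = (LINT x|lebesgue. v x * \<psi> x)"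
      proof (rule integral_cong_AE)
        show "(\<lambda>x. u x * \<psi> x) \<in> borel_measurable lebesgue" using um bm[OF that] by simp
        show "(\<lambda>x. v x * \<psi> x) \<in> borel_measurable lebesgue" by (rule bm) measurable
        show "AE x in lebesgue. u x * \<psi> x = v x * \<psi> x" using v(2) by eventually_elim simp
      qed
      also have "\<dots> = (LINT x|lborel. v x * \<psi> x)" by (rule integral_completion) measurable
      finally show ?thesis .
    qed
    have key: "(LINT x|lborel. ?d (x + t *\<^sub>R (- h)) * v x) = - (LINT x|lborel. F (x + t *\<^sub>R h) * \<phi> x)" for t
    proof -
      define \<psi> where "\<psi> = (\<lambda>x. \<phi> (x + t *\<^sub>R (- h)))"
      have \<psi>: "test_function \<psi>" unfolding \<psi>_def by (rule test_function_translate[OF \<phi>])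
      have fd: "frechet_derivative \<psi> (at x) = frechet_derivative \<phi> (at (x + t *\<^sub>R (- h)))" for x
        unfolding \<psi>_def by (rule frechet_derivative_translate[OF K(5)])
      have \<psi>m[measurable]: "\<psi> \<in> borel_measurable borel" unfolding \<psi>_def by measurable
      have "(LINT x|lborel. ?d (x + t *\<^sub>R (- h)) * v x) = (LINT x|lborel. v x * ?d (x + t *\<^sub>R (- h)))"
        by (simp add: mult.commute)
      also have "\<dots> = (LINT x|lebesgue. u x * ?d (x + t *\<^sub>R (- h)))"
        by (rule cong[symmetric]) measurable
      also have "\<dots> = (LINT x|lebesgue. u x * frechet_derivative \<psi> (at x) h)" by (simp add: fd)
      also have "\<dots> = - (LINT x|lebesgue. (weak_gradient u x \<bullet> h) * \<psi> x)"
        by (rule has_weak_gradient_direction[OF H1_weak_gradient[OF u] \<psi>])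
      also have "(LINT x|lebesgue. (weak_gradient u x \<bullet> h) * \<psi> x) = (LINT x|lebesgue. F x * \<psi> x)"
      proof (rule integral_cong_AE)
        show "AE x in lebesgue. (weak_gradient u x \<bullet> h) * \<psi> x = F x * \<psi> x" using FG by eventually_elim simp
        show "(\<lambda>x. (weak_gradient u x \<bullet> h) * \<psi> x) \<in> borel_measurable lebesgue"
          using L2_measurable[OF weak_gradient_L2[OF u]] bm[OF \<psi>m] by simp
        show "(\<lambda>x. F x * \<psi> x) \<in> borel_measurable lebesgue" by (rule bm) measurable
      qed
      also have "\<dots> = (LINT x|lebesgue. F (x + t *\<^sub>R h) * \<psi> (x + t *\<^sub>R h))"
        by (rule integral_translate[symmetric], rule bm) measurable
      also have "\<dots> = (LINT x|lebesgue. F (x + t *\<^sub>R h) * \<phi> x)" by (simp add: \<psi>_def)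
      also have "\<dots> = (LINT x|lborel. F (x + t *\<^sub>R h) * \<phi> x)"
        by (rule integral_completion) measurable
      finally show ?thesis .
    qed
    have "(LINT x|lebesgue. (u (x + h) - u x) * \<phi> x) = (LINT x|lebesgue. u (x + h) * \<phi> x) - (LINT x|lebesgue. u x * \<phi> x)"
      using L2_mult_integrable[OF uhL \<phi>L] L2_mult_integrable[OF uL \<phi>L] by (simp add: left_diff_distrib)
    also have "(LINT x|lebesgue. u (x + h) * \<phi> x) = (LINT x|lebesgue. u x * \<phi> (x - h))"
      using integral_translate[OF borel_measurable_integrable[OF L2_mult_integrable[OF uL L2_translate[OF \<phi>L, of "- h"]]], of h]
      by simp
    also have "(LINT x|lebesgue. u x * \<phi> (x - h)) - (LINT x|lebesgue. u x * \<phi> x)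
        = - (LINT x|lebesgue. u x * (\<phi> x - \<phi> (x - h)))"
      using L2_mult_integrable[OF uL \<phi>L] L2_mult_integrable[OF uL L2_translate[OF \<phi>L, of "- h"]]
      by (simp add: right_diff_distrib)
    also have "(LINT x|lebesgue. u x * (\<phi> x - \<phi> (x - h))) = (LINT x|lborel. v x * (\<phi> x - \<phi> (x - h)))"
      by (rule cong) measurable
    also have "\<dots> = (LINT x|lborel. segment_integral ?d (- h) x * v x)"
      by (simp add: test_function_gradient_segment[OF \<phi>] mult.commute)
    also have "\<dots> = (LINT t|lborel. (LINT x|lborel. ?d (x + t *\<^sub>R (- h)) * v x) * indicator {0..1} t)"
      by (rule segment_integral_Fubini[OF dm v(1) finL2[OF dL] finL2[OF v(3)]])
    also have "\<dots> = - (LINT t|lborel. (LINT x|lborel. F (x + t *\<^sub>R h) * \<phi> x) * indicator {0..1} t)"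
      unfolding key by simp
    also have "(LINT t|lborel. (LINT x|lborel. F (x + t *\<^sub>R h) * \<phi> x) * indicator {0..1} t)
        = (LINT x|lborel. segment_integral F h x * \<phi> x)"
      by (rule segment_integral_Fubini[OF F \<phi>m Fn finL2[OF \<phi>L], symmetric])
    also have "\<dots> = (LINT x|lebesgue. segment_integral F h x * \<phi> x)"
      by (rule integral_completion[symmetric]) measurable
    finally have "(LINT x|lebesgue. (u (x + h) - u x) * \<phi> x) = (LINT x|lebesgue. segment_integral F h x * \<phi> x)"
      by simp
    then show "(LINT x|lebesgue. ((u (x + h) - u x) - segment_integral F h x) * \<phi> x) = 0"
      using L2_mult_integrable[OF L2_diff[OF uhL uL] \<phi>L] L2_mult_integrable[OF sL \<phi>L]
      by (simp add: left_diff_distrib[of "u _ - u _"])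
  qed
  then show ?thesis by eventually_elim simp
qed

lemma H1_translation_estimate:
  assumes u: "u \<in> H1"
  shows "(LINT x|lebesgue. (u (x + h) - u x)\<^sup>2) \<le> (norm h)\<^sup>2 * (LINT x|lebesgue. (norm (weak_gradient u x))\<^sup>2)"
proof -
  let ?g = "\<lambda>x. weak_gradient u x \<bullet> h"
  have GL: "weak_gradient u \<in> L2" by (rule weak_gradient_L2[OF u])
  have gL: "?g \<in> L2"
  proof (rule L2_bound[OF GL])
    show "AE x in lebesgue. norm (weak_gradient u x \<bullet> h) \<le> norm h * norm (weak_gradient u x)"
      using Cauchy_Schwarz_ineq2[of "weak_gradient u _" h] by (simp add: mult.commute)
  qed (use L2_measurable[OF GL] in measurable)
  obtain F where F: "F \<in> borel_measurable borel" "AE x in lebesgue. ?g x = F x" "F \<in> L2"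
    "(\<integral>\<^sup>+ x. ennreal ((F x)\<^sup>2) \<partial>lborel) = ennreal (LINT x|lebesgue. (?g x)\<^sup>2)"
    by (fact L2_borel_representative[OF gL])
  have d: "AE x in lebesgue. u (x + h) - u x = segment_integral F h x"
    by (rule H1_difference_segment_integral[OF u F(1) F(3) F(2)]) (simp add: F(4))
  have "ennreal (LINT x|lebesgue. (u (x + h) - u x)\<^sup>2) = (\<integral>\<^sup>+ x. ennreal ((u (x + h) - u x)\<^sup>2) \<partial>lebesgue)"
    by (rule nn_integral_eq_integral[symmetric])
      (intro L2_real_integrable L2_diff L2_translate H1_L2[OF u], simp)
  also have "\<dots> = (\<integral>\<^sup>+ x. ennreal ((segment_integral F h x)\<^sup>2) \<partial>lebesgue)"
    by (rule nn_integral_cong_AE) (use d in eventually_elim, simp)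
  also have "\<dots> = (\<integral>\<^sup>+ x. ennreal ((segment_integral F h x)\<^sup>2) \<partial>lborel)"
    by (simp add: nn_integral_completion)
  also have "\<dots> \<le> ennreal (LINT x|lebesgue. (?g x)\<^sup>2)"
    using nn_integral_segment_integral[OF F(1), of h] by (simp add: F(4))
  finally have "(LINT x|lebesgue. (u (x + h) - u x)\<^sup>2) \<le> (LINT x|lebesgue. (?g x)\<^sup>2)"
    by (simp add: ennreal_le_iff)
  also have "\<dots> \<le> (LINT x|lebesgue. (norm h)\<^sup>2 * (norm (weak_gradient u x))\<^sup>2)"
  proof (rule integral_mono)
    show "(?g x)\<^sup>2 \<le> (norm h)\<^sup>2 * (norm (weak_gradient u x))\<^sup>2" for x
    proof -
      have "\<bar>?g x\<bar>\<^sup>2 \<le> (norm (weak_gradient u x) * norm h)\<^sup>2"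
        by (intro power_mono Cauchy_Schwarz_ineq2) simp
      then show ?thesis by (simp add: power_mult_distrib mult.commute)
    qed
  qed (use L2_real_integrable[OF gL] L2_integrable[OF GL] in auto)
  finally show ?thesis by simp
qed

section \<open>Averages over small cubes and the Sobolev embedding\<close>

definition cube :: "real \<Rightarrow> 'a::euclidean_space set" where
  "cube l = cbox 0 (l *\<^sub>R One)"

definition average :: "real \<Rightarrow> ('a::euclidean_space \<Rightarrow> real) \<Rightarrow> 'a \<Rightarrow> real" where
  "average l u x = (LINT z|lebesgue. indicat_real (cube l) z * u (x + z)) / l ^ DIM('a)"

lemma cube_sets[measurable]: "cube l \<in> sets lebesgue" "cube l \<in> sets borel"
  by (auto simp: cube_def)

lemma cube_integral:
  assumes "l > 0"
  shows "integrable lebesgue (indicat_real (cube l :: 'a::euclidean_space set))"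
    and "(LINT z|lebesgue. indicat_real (cube l :: 'a set) z) = l ^ DIM('a)"
proof -
  have lm: "(cube l :: 'a set) \<in> lmeasurable" unfolding cube_def by (rule lmeasurable_cbox)
  then show "integrable lebesgue (indicat_real (cube l :: 'a set))"
    by (auto simp: fmeasurable_def)
  have "measure lebesgue (cube l :: 'a set) = measure lborel (cube l :: 'a set)"
    by (simp add: cube_def)
  also have "\<dots> = l ^ DIM('a)"
    using assms by (simp add: cube_def content_cbox)
  finally show "(LINT z|lebesgue. indicat_real (cube l :: 'a set) z) = l ^ DIM('a)"
    by simp
qed

lemma cube_content: "l > 0 \<Longrightarrow> measure lborel (cube l :: 'a::euclidean_space set) = l ^ DIM('a)"
  by (simp add: cube_def content_cbox)

lemma cube_norm:
  assumes "z \<in> (cube l :: 'a::euclidean_space set)" shows "(norm z)\<^sup>2 \<le> real DIM('a) * l\<^sup>2"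
proof -
  have "(norm z)\<^sup>2 = (\<Sum>e\<in>Basis. (z \<bullet> e)\<^sup>2)"
    by (simp add: norm_eq_sqrt_inner euclidean_inner[of z z] power2_eq_square sum_nonneg)
  also have "\<dots> \<le> (\<Sum>e\<in>(Basis::'a set). l\<^sup>2)"
    using assms by (intro sum_mono power_mono) (auto simp: cube_def mem_box)
  finally show ?thesis by simp
qed

lemma L2_indicator_mult:
  assumes "f \<in> L2" "S \<in> sets lebesgue" shows "(\<lambda>x. indicat_real S x * f x) \<in> L2"
proof (rule L2_bound[OF assms(1)])
  have [measurable]: "f \<in> borel_measurable lebesgue" "S \<in> sets lebesgue" using assms L2_measurable by auto
  show "(\<lambda>x. indicat_real S x * f x) \<in> borel_measurable lebesgue" by measurable
  show "AE x in lebesgue. norm (indicat_real S x * f x) \<le> 1 * norm (f x)"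
    by (simp add: indicator_def)
qed

lemma indicator_power2: "(indicat_real S x)\<^sup>2 = indicat_real S x"
  by (simp add: indicator_def)

lemma cube_L2:
  assumes "l > 0" shows "indicat_real (cube l) \<in> L2"
  using cube_integral(1)[OF assms] by (auto simp: L2_def indicator_power2)

lemma L2_shift: "u \<in> L2 \<Longrightarrow> (\<lambda>z. u (x + z)) \<in> L2"
  using L2_translate[of u x] by (simp add: add.commute)

lemma LINT_shift: "u \<in> L2 \<Longrightarrow> (LINT z|lebesgue. (u (x + z))\<^sup>2) = (LINT z|lebesgue. (u z :: real)\<^sup>2)"
  using integral_translate[OF borel_measurable_integrable[OF L2_real_integrable], of u x] by (simp add: add.commute)

lemma average_integrable: "l > 0 \<Longrightarrow> u \<in> L2 \<Longrightarrow> integrable lebesgue (\<lambda>z. indicat_real (cube l) z * u (x + z))"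
  by (intro L2_mult_integrable cube_L2 L2_shift)

lemma average_bound:
  fixes u :: "'a::euclidean_space \<Rightarrow> real"
  assumes l: "l > 0" and u: "u \<in> L2"
  shows "\<bar>average l u x\<bar> \<le> sqrt (LINT x|lebesgue. (u x)\<^sup>2) / sqrt (l ^ DIM('a))"
proof -
  have "\<bar>LINT z|lebesgue. indicat_real (cube l) z * u (x + z)\<bar>
      \<le> sqrt (l ^ DIM('a)) * sqrt (LINT x|lebesgue. (u x)\<^sup>2)"
    using L2_Cauchy_Schwarz[OF cube_L2[OF l] L2_shift[OF u, of x]]
    by (simp add: indicator_power2 cube_content[OF l] LINT_shift[OF u])
  then have "\<bar>average l u x\<bar> \<le> sqrt (l ^ DIM('a)) * sqrt (LINT x|lebesgue. (u x)\<^sup>2) / l ^ DIM('a)"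
    using l by (simp add: average_def divide_right_mono)
  also have "\<dots> = sqrt (LINT x|lebesgue. (u x)\<^sup>2) / sqrt (l ^ DIM('a))"
  proof -
    have "s * t / c = t / s" if "s * s = c" "s > 0" for s t c :: real
      using that by (auto simp: field_simps)
    from this[of "sqrt (l ^ DIM('a))" "l ^ DIM('a)"] show ?thesis using l by simp
  qed
  finally show ?thesis .
qed

lemma average_diff: "l > 0 \<Longrightarrow> u \<in> L2 \<Longrightarrow> v \<in> L2 \<Longrightarrow> average l (\<lambda>x. u x - v x) x = average l u x - average l v x"
  using average_integrable[of l u x] average_integrable[of l v x]
  by (simp add: average_def right_diff_distrib diff_divide_distrib)

lemma average_le:
  fixes v :: "'a::euclidean_space \<Rightarrow> real"
  assumes l: "l > 0" and v: "v \<in> L2" and bound: "\<And>x. \<bar>v x\<bar> \<le> M"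
  shows "\<bar>average l v x\<bar> \<le> M"
proof -
  have "\<bar>LINT z|lebesgue. indicat_real (cube l) z * v (x + z)\<bar> \<le> (LINT z|lebesgue. \<bar>indicat_real (cube l) z * v (x + z)\<bar>)"
    by (rule integral_abs_bound)
  also have "\<dots> \<le> (LINT z|lebesgue. M * indicat_real (cube l :: 'a set) z)"
  proof (rule integral_mono)
    show "integrable lebesgue (\<lambda>z. \<bar>indicat_real (cube l) z * v (x + z)\<bar>)"
      by (rule integrable_abs[OF average_integrable[OF l v]])
    show "integrable lebesgue (\<lambda>z. M * indicat_real (cube l :: 'a set) z)"
      by (rule integrable_mult_right[OF cube_integral(1)[OF l]])
    show "\<bar>indicat_real (cube l) z * v (x + z)\<bar> \<le> M * indicat_real (cube l) z" for z
      using bound[of "x + z"] by (simp add: indicator_def)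
  qed
  also have "\<dots> = M * l ^ DIM('a)" by (simp add: cube_content[OF l])
  finally show ?thesis using l by (simp add: average_def pos_divide_le_eq)
qed

lemma average_measurable:
  fixes u :: "'a::euclidean_space \<Rightarrow> real"
  assumes u: "u \<in> L2"
  shows "average l u \<in> borel_measurable lebesgue"
proof -
  obtain v where v[measurable]: "v \<in> borel_measurable borel" "AE x in lebesgue. u x = v x" "v \<in> L2"
    "(\<integral>\<^sup>+ x. ennreal ((v x)\<^sup>2) \<partial>lborel) = ennreal (LINT x|lebesgue. (u x)\<^sup>2)"
    by (fact L2_borel_representative[OF u])
  have bm: "f \<in> borel_measurable lebesgue" if "f \<in> borel_measurable borel" for f :: "'a \<Rightarrow> real"
    using that by (intro measurable_completion) simp
  have eq: "average l u = (\<lambda>x. (LINT z|lborel. indicat_real (cube l) z * v (x + z)) / l ^ DIM('a))"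
  proof
    fix x
    have ae: "AE z in lebesgue. u (z + x) = v (z + x)" using v(2) by (rule AE_translate)
    have [measurable]: "u \<in> borel_measurable lebesgue" by (rule L2_measurable[OF u])
    have "(LINT z|lebesgue. indicat_real (cube l) z * u (z + x)) = (LINT z|lebesgue. indicat_real (cube l) z * v (z + x))"
    proof (rule integral_cong_AE)
      have "(\<lambda>z. u (z + x)) \<in> borel_measurable lebesgue" by (rule measurable_translate[OF L2_measurable[OF u]])
      then show "(\<lambda>z. indicat_real (cube l) z * u (z + x)) \<in> borel_measurable lebesgue" by measurable
      show "(\<lambda>z. indicat_real (cube l) z * v (z + x)) \<in> borel_measurable lebesgue"
        by (rule bm) measurable
      show "AE z in lebesgue. indicat_real (cube l) z * u (z + x) = indicat_real (cube l) z * v (z + x)"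
        using ae by eventually_elim simp
    qed
    also have "\<dots> = (LINT z|lborel. indicat_real (cube l) z * v (z + x))"
      by (rule integral_completion) measurable
    finally show "average l u x = (LINT z|lborel. indicat_real (cube l) z * v (x + z)) / l ^ DIM('a)"
      by (simp add: average_def add.commute)
  qed
  show ?thesis unfolding eq by (rule bm) measurable
qed

lemma average_deviation_pointwise:
  fixes u :: "'a::euclidean_space \<Rightarrow> real"
  assumes l: "l > 0" and u: "u \<in> L2"
  shows "(u x - average l u x)\<^sup>2 \<le> (LINT z|lebesgue. indicat_real (cube l) z * (u x - u (x + z))\<^sup>2) / l ^ DIM('a)"
    and "integrable lebesgue (\<lambda>z. indicat_real (cube l) z * (u x - u (x + z))\<^sup>2)"
proof -
  let ?I = "indicat_real (cube l :: 'a set)"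
  let ?g = "\<lambda>z. ?I z * (u x - u (x + z))"
  have gL: "?g \<in> L2"
    using L2_diff[OF L2_mult[OF cube_L2[OF l], of "u x"] L2_indicator_mult[OF L2_shift[OF u, of x], of "cube l"]]
    by (simp add: cube_sets algebra_simps)
  have g2: "(?g z)\<^sup>2 = ?I z * (u x - u (x + z))\<^sup>2" for z
    by (simp add: power_mult_distrib indicator_power2)
  show "integrable lebesgue (\<lambda>z. ?I z * (u x - u (x + z))\<^sup>2)"
    using L2_real_integrable[OF gL] by (simp add: g2)
  have "(LINT z|lebesgue. ?I z * ?g z) = (LINT z|lebesgue. u x * ?I z - ?I z * u (x + z))"
    by (intro Bochner_Integration.integral_cong) (auto simp: indicator_def)
  also have "\<dots> = u x * l ^ DIM('a) - (LINT z|lebesgue. ?I z * u (x + z))"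
    using cube_integral(1)[OF l, where 'a='a] average_integrable[OF l u, of x] by (simp add: cube_content[OF l])
  finally have eq: "(LINT z|lebesgue. ?I z * ?g z) = l ^ DIM('a) * (u x - average l u x)"
    using l by (simp add: average_def algebra_simps)
  have "\<bar>LINT z|lebesgue. ?I z * ?g z\<bar> \<le> sqrt (l ^ DIM('a)) * sqrt (LINT z|lebesgue. ?I z * (u x - u (x + z))\<^sup>2)"
    using L2_Cauchy_Schwarz[OF cube_L2[OF l] gL]
    by (simp add: indicator_power2 cube_content[OF l] power_mult_distrib)
  then have "\<bar>l ^ DIM('a) * (u x - average l u x)\<bar>\<^sup>2 \<le> (sqrt (l ^ DIM('a)) * sqrt (LINT z|lebesgue. ?I z * (u x - u (x + z))\<^sup>2))\<^sup>2"
    unfolding eq by (rule power_mono) simp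
  also have "\<dots> = l ^ DIM('a) * (LINT z|lebesgue. ?I z * (u x - u (x + z))\<^sup>2)"
    using l by (simp add: power_mult_distrib)
  finally have "l ^ DIM('a) * (l ^ DIM('a) * (u x - average l u x)\<^sup>2)
      \<le> l ^ DIM('a) * (LINT z|lebesgue. ?I z * (u x - u (x + z))\<^sup>2)"
    by (simp add: power_mult_distrib power2_eq_square mult_ac)
  then show "(u x - average l u x)\<^sup>2 \<le> (LINT z|lebesgue. ?I z * (u x - u (x + z))\<^sup>2) / l ^ DIM('a)"
    using l by (simp add: pos_le_divide_eq mult.commute)
qed

lemma average_cong:
  assumes "u \<in> L2" "v \<in> L2" "AE x in lebesgue. u x = v x"
  shows "average l u x = average l v x"
proof -
  have "(LINT z|lebesgue. indicat_real (cube l) z * u (x + z)) = (LINT z|lebesgue. indicat_real (cube l) z * v (x + z))"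
  proof (rule integral_cong_AE)
    have [measurable]: "(\<lambda>z. u (x + z)) \<in> borel_measurable lebesgue" "(\<lambda>z. v (x + z)) \<in> borel_measurable lebesgue"
      using L2_measurable[OF L2_shift] assms by auto
    show "(\<lambda>z. indicat_real (cube l) z * u (x + z)) \<in> borel_measurable lebesgue"
      "(\<lambda>z. indicat_real (cube l) z * v (x + z)) \<in> borel_measurable lebesgue" by measurable
    show "AE z in lebesgue. indicat_real (cube l) z * u (x + z) = indicat_real (cube l) z * v (x + z)"
      using AE_translate[OF assms(3), of x] by eventually_elim (simp add: add.commute)
  qed
  then show ?thesis by (simp add: average_def)
qed

text \<open>
  The deviation at \<open>x\<close> is the mean of \<open>u x - u (x + z)\<close> over the cube, and \<open>H1_translation_estimate\<close> applies to
  each \<open>z\<close>, with \<open>\<bar>z\<bar>\<^sup>2 \<le> N l\<^sup>2\<close>.  The double integral is formed with a Borel representative of \<open>u\<close>, which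
  makes the integrand jointly measurable in \<open>x\<close> and \<open>z\<close>.
\<close>

lemma average_deviation:
  fixes u :: "'a::euclidean_space \<Rightarrow> real"
  assumes l: "l > 0" and u: "u \<in> H1"
  shows "(\<lambda>x. u x - average l u x) \<in> L2"
    and "(LINT x|lebesgue. (u x - average l u x)\<^sup>2)
      \<le> real DIM('a) * l\<^sup>2 * (LINT x|lebesgue. (norm (weak_gradient u x))\<^sup>2)"
proof -
  define K where "K = (LINT x|lebesgue. (norm (weak_gradient u x))\<^sup>2)"
  have K0: "K \<ge> 0" by (simp add: K_def)
  have uL: "u \<in> L2" by (rule H1_L2[OF u])
  obtain v where v[measurable]: "v \<in> borel_measurable borel" "AE x in lebesgue. u x = v x" "v \<in> L2"
    "(\<integral>\<^sup>+ x. ennreal ((v x)\<^sup>2) \<partial>lborel) = ennreal (LINT x|lebesgue. (u x)\<^sup>2)"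
    by (fact L2_borel_representative[OF uL])
  let ?I = "indicat_real (cube l :: 'a set)"
  have trans: "(\<integral>\<^sup>+ x. ennreal ((v x - v (x + z))\<^sup>2) \<partial>lborel) \<le> ennreal ((norm z)\<^sup>2 * K)" for z
  proof -
    have "(\<integral>\<^sup>+ x. ennreal ((v x - v (x + z))\<^sup>2) \<partial>lborel) = (\<integral>\<^sup>+ x. ennreal ((v x - v (x + z))\<^sup>2) \<partial>lebesgue)"
      by (simp add: nn_integral_completion)
    also have "\<dots> = (\<integral>\<^sup>+ x. ennreal ((u (x + z) - u x)\<^sup>2) \<partial>lebesgue)"
      by (rule nn_integral_cong_AE) (use v(2) AE_translate[OF v(2), of z] in eventually_elim, simp add: power2_commute)
    also have "\<dots> = ennreal (LINT x|lebesgue. (u (x + z) - u x)\<^sup>2)"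
      by (intro nn_integral_eq_integral L2_real_integrable L2_diff L2_translate uL) simp
    also have "\<dots> \<le> ennreal ((norm z)\<^sup>2 * K)"
      unfolding K_def by (intro ennreal_leI H1_translation_estimate u)
    finally show ?thesis .
  qed
  have pw: "ennreal ((v x - average l v x)\<^sup>2)
      \<le> (\<integral>\<^sup>+ z. ennreal (?I z * (v x - v (x + z))\<^sup>2) \<partial>lborel) * ennreal (1 / l ^ DIM('a))" for x
  proof -
    have "ennreal ((v x - average l v x)\<^sup>2)
        \<le> ennreal ((LINT z|lebesgue. ?I z * (v x - v (x + z))\<^sup>2) * (1 / l ^ DIM('a)))"
      using average_deviation_pointwise(1)[OF l v(3), of x] by (intro ennreal_leI) simp
    also have "\<dots> = ennreal (LINT z|lebesgue. ?I z * (v x - v (x + z))\<^sup>2) * ennreal (1 / l ^ DIM('a))"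
      using l by (intro ennreal_mult) auto
    also have "ennreal (LINT z|lebesgue. ?I z * (v x - v (x + z))\<^sup>2) = (\<integral>\<^sup>+ z. ennreal (?I z * (v x - v (x + z))\<^sup>2) \<partial>lebesgue)"
      by (rule nn_integral_eq_integral[symmetric, OF average_deviation_pointwise(2)[OF l v(3)]]) simp
    finally show ?thesis by (simp add: nn_integral_completion)
  qed
  have "(\<integral>\<^sup>+ x. ennreal ((u x - average l u x)\<^sup>2) \<partial>lebesgue) = (\<integral>\<^sup>+ x. ennreal ((v x - average l v x)\<^sup>2) \<partial>lebesgue)"
    by (rule nn_integral_cong_AE) (use v(2) in eventually_elim, simp add: average_cong[OF uL v(3) v(2)])
  also have "\<dots> \<le> (\<integral>\<^sup>+ x. (\<integral>\<^sup>+ z. ennreal (?I z * (v x - v (x + z))\<^sup>2) \<partial>lborel) * ennreal (1 / l ^ DIM('a)) \<partial>lborel)"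
    unfolding nn_integral_completion by (intro nn_integral_mono pw)
  also have "\<dots> = (\<integral>\<^sup>+ x. (\<integral>\<^sup>+ z. ennreal (?I z * (v x - v (x + z))\<^sup>2) \<partial>lborel) \<partial>lborel) * ennreal (1 / l ^ DIM('a))"
    by (rule nn_integral_multc) measurable
  also have "(\<integral>\<^sup>+ x. (\<integral>\<^sup>+ z. ennreal (?I z * (v x - v (x + z))\<^sup>2) \<partial>lborel) \<partial>lborel)
      = (\<integral>\<^sup>+ z. (\<integral>\<^sup>+ x. ennreal (?I z * (v x - v (x + z))\<^sup>2) \<partial>lborel) \<partial>lborel)"
    by (rule lborel_pair.Fubini'[symmetric]) measurable
  also have "\<dots> \<le> (\<integral>\<^sup>+ z. ennreal (real DIM('a) * l\<^sup>2 * K) * indicator (cube l :: 'a set) z \<partial>lborel)"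
  proof (rule nn_integral_mono)
    fix z :: 'a
    show "(\<integral>\<^sup>+ x. ennreal (?I z * (v x - v (x + z))\<^sup>2) \<partial>lborel) \<le> ennreal (real DIM('a) * l\<^sup>2 * K) * indicator (cube l) z"
    proof (cases "z \<in> cube l")
      case True
      then have "(norm z)\<^sup>2 * K \<le> real DIM('a) * l\<^sup>2 * K" using cube_norm[of z l] K0 by (intro mult_right_mono) auto
      then show ?thesis using True order.trans[OF trans[of z] ennreal_leI] by simp
    qed simp
  qed
  also have "\<dots> = ennreal (real DIM('a) * l\<^sup>2 * K) * emeasure lborel (cube l :: 'a set)"
    by (simp add: nn_integral_cmult)
  also have "emeasure lborel (cube l :: 'a set) = ennreal (l ^ DIM('a))"
    using l by (simp add: cube_def emeasure_lborel_cbox_eq)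
  also have "ennreal (real DIM('a) * l\<^sup>2 * K) * ennreal (l ^ DIM('a)) * ennreal (1 / l ^ DIM('a)) = ennreal (real DIM('a) * l\<^sup>2 * K)"
    using l K0 by (simp add: ennreal_mult[symmetric])
  finally have le: "(\<integral>\<^sup>+ x. ennreal ((u x - average l u x)\<^sup>2) \<partial>lebesgue) \<le> ennreal (real DIM('a) * l\<^sup>2 * K)"
    by (simp add: mult_right_mono)
  have m: "(\<lambda>x. u x - average l u x) \<in> borel_measurable lebesgue"
    using L2_measurable[OF uL] average_measurable[OF uL, of l] by simp
  have int: "integrable lebesgue (\<lambda>x. (u x - average l u x)\<^sup>2)"
  proof (rule integrableI_bounded)
    show "(\<lambda>x. (u x - average l u x)\<^sup>2) \<in> borel_measurable lebesgue" using m by measurable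
    show "(\<integral>\<^sup>+ x. ennreal (norm ((u x - average l u x)\<^sup>2)) \<partial>lebesgue) < \<infinity>"
      using order.strict_trans1[OF le ennreal_less_top] by simp
  qed
  then show "(\<lambda>x. u x - average l u x) \<in> L2" using m by (simp add: L2_def)
  have "ennreal (LINT x|lebesgue. (u x - average l u x)\<^sup>2) \<le> ennreal (real DIM('a) * l\<^sup>2 * K)"
    using le nn_integral_eq_integral[OF int] by simp
  then show "(LINT x|lebesgue. (u x - average l u x)\<^sup>2)
      \<le> real DIM('a) * l\<^sup>2 * (LINT x|lebesgue. (norm (weak_gradient u x))\<^sup>2)"
    using K0 by (simp add: ennreal_le_iff K_def)
qed

lemma average_L2: "l > 0 \<Longrightarrow> u \<in> H1 \<Longrightarrow> average l u \<in> L2"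
  using L2_diff[OF H1_L2[of u] average_deviation(1)[of l u]] by simp

text \<open>
  A bound on the function and its gradient in \<open>L2\<close> that makes no reference to the constant in the norm of \<open>H1\<close>.
\<close>

definition H1_size :: "('a::euclidean_space \<Rightarrow> real) \<Rightarrow> real \<Rightarrow> bool" where
  "H1_size u B \<longleftrightarrow> u \<in> H1 \<and> B > 0 \<and> (LINT x|lebesgue. (u x)\<^sup>2) \<le> B\<^sup>2 \<and>
     (LINT x|lebesgue. (norm (weak_gradient u x))\<^sup>2) \<le> B\<^sup>2"

lemma average_deviation_size:
  fixes u :: "'a::euclidean_space \<Rightarrow> real"
  assumes "H1_size u B" "l > 0"
  shows "(LINT x|lebesgue. (u x - average l u x)\<^sup>2) \<le> real DIM('a) * l\<^sup>2 * B\<^sup>2"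
proof -
  have "real DIM('a) * l\<^sup>2 * (LINT x|lebesgue. (norm (weak_gradient u x))\<^sup>2) \<le> real DIM('a) * l\<^sup>2 * B\<^sup>2"
    using assms by (intro mult_left_mono) (auto simp: H1_size_def)
  moreover have "u \<in> H1" using assms by (simp add: H1_size_def)
  ultimately show ?thesis using average_deviation(2)[OF assms(2)] by (rule_tac order.trans)
qed

definition growth_const :: "nat \<Rightarrow> real \<Rightarrow> real" where
  "growth_const N q = 1 + 2 * sqrt N * q / (q - 1)"

lemma growth_const_pos: "q > 1 \<Longrightarrow> growth_const N q \<ge> 1"
  by (simp add: growth_const_def)

text \<open>
  Passing from the side \<open>2l\<close> to \<open>l\<close> changes the average by at most the average of \<open>u - average (2l) u\<close>, that is by
  \<open>2 sqrt N B l / l powr (N/2)\<close>.  For \<open>l = 2\<^sup>-\<^sup>j\<close> this is \<open>2 sqrt N B (2 powr (N/2) / 2)\<^sup>j\<close>, and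
  \<open>growth_const\<close> bounds the resulting geometric sum.
\<close>

lemma average_growth:
  fixes u :: "'a::euclidean_space \<Rightarrow> real"
  assumes u: "H1_size u B" and q: "q > 1" "sqrt (2 ^ DIM('a)) / 2 \<le> q"
  shows "\<bar>average (1 / 2 ^ j) u x\<bar> \<le> growth_const (DIM('a)) q * B * q ^ j"
proof (induction j arbitrary: x)
  case 0
  have uL: "u \<in> L2" and B: "B > 0" using u H1_L2 by (auto simp: H1_size_def)
  have "sqrt (LINT x|lebesgue. (u x)\<^sup>2) \<le> sqrt (B\<^sup>2)"
    using u by (intro real_sqrt_le_mono) (auto simp: H1_size_def)
  then have "\<bar>average 1 u x\<bar> \<le> B"
    using average_bound[of 1 u x] uL B by simp
  also have "\<dots> \<le> growth_const (DIM('a)) q * B" using growth_const_pos[OF q(1)] B by simp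
  finally show ?case by simp
next
  case (Suc j)
  let ?N = "DIM('a)" and ?D = "growth_const (DIM('a)) q * B"
  have uH: "u \<in> H1" and B: "B > 0" using u by (auto simp: H1_size_def)
  define l :: real where "l = 1 / 2 ^ Suc j"
  have l: "l > 0" and l2: "1 / 2 ^ j = 2 * l" by (simp_all add: l_def)
  have "average l u x = average l (\<lambda>x. u x - average (2 * l) u x) x + average l (average (2 * l) u) x"
    using average_diff[OF l H1_L2[OF uH] average_L2[of "2 * l" u], of x] l uH by simp
  moreover have "\<bar>average l (average (2 * l) u) x\<bar> \<le> ?D * q ^ j"
    by (rule average_le[OF l]) (use l uH Suc in \<open>auto intro!: average_L2 simp: l2\<close>)
  moreover have "\<bar>average l (\<lambda>x. u x - average (2 * l) u x) x\<bar> \<le> 2 * sqrt ?N * B * q ^ Suc j"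
  proof -
    have "sqrt (LINT x|lebesgue. (u x - average (2 * l) u x)\<^sup>2) \<le> sqrt (real ?N * (2 * l)\<^sup>2 * B\<^sup>2)"
      using average_deviation_size[OF u, of "2 * l"] l by (intro real_sqrt_le_mono) simp
    also have "\<dots> = sqrt ?N * (2 * l) * B" using l B by (simp add: real_sqrt_mult)
    finally have "sqrt (LINT x|lebesgue. (u x - average (2 * l) u x)\<^sup>2) / sqrt (l ^ ?N)
        \<le> sqrt ?N * (2 * l) * B / sqrt (l ^ ?N)"
      using l by (intro divide_right_mono) auto
    also have "\<dots> = 2 * sqrt ?N * B * (l / sqrt (l ^ ?N))" by simp
    also have "l / sqrt (l ^ ?N) = (sqrt (2 ^ ?N) / 2) ^ Suc j"
    proof -
      have "sqrt (l ^ ?N) = 1 / sqrt (2 ^ ?N) ^ Suc j"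
        by (simp add: l_def real_sqrt_divide real_sqrt_power[symmetric] power_one_over power_mult[symmetric] mult.commute
            real_sqrt_mult[symmetric] power_add[symmetric] del: power_Suc)
      then show ?thesis by (simp add: l_def power_divide)
    qed
    also have "2 * sqrt ?N * B * (sqrt (2 ^ ?N) / 2) ^ Suc j \<le> 2 * sqrt ?N * B * q ^ Suc j"
      using q B by (intro mult_left_mono power_mono) auto
    finally show ?thesis
      using average_bound[OF l average_deviation(1)[of "2 * l" u], of x] l uH by simp
  qed
  moreover have "?D * q ^ j + 2 * sqrt ?N * B * q ^ Suc j \<le> ?D * q ^ Suc j"
  proof -
    have "?D * (q - 1) = B * (q - 1) + 2 * sqrt ?N * B * q"
      using q by (simp add: growth_const_def field_simps)
    then have "2 * sqrt ?N * B * q \<le> ?D * (q - 1)" using B q by simp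
    then have "2 * sqrt ?N * B * q * q ^ j \<le> ?D * (q - 1) * q ^ j" using q by (intro mult_right_mono) auto
    then show ?thesis by (simp add: algebra_simps)
  qed
  ultimately show ?case unfolding l_def[symmetric] by linarith
qed

text \<open>
  Where \<open>\<bar>u\<bar>\<close> exceeds \<open>t\<close> and the average is at most \<open>t/2\<close>, the function is at most twice its deviation from the
  average.
\<close>

lemma superlevel_estimate:
  fixes u :: "'a::euclidean_space \<Rightarrow> real"
  assumes u: "H1_size u B" and l: "l > 0" and avg: "\<And>x. \<bar>average l u x\<bar> \<le> t / 2"
  shows "(\<integral>\<^sup>+ x. ennreal (indicat_real {x. t < \<bar>u x\<bar>} x * (u x)\<^sup>2) \<partial>lebesgue) \<le> ennreal (4 * real DIM('a) * l\<^sup>2 * B\<^sup>2)"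
proof -
  have uH: "u \<in> H1" using u by (auto simp: H1_size_def)
  have "(\<integral>\<^sup>+ x. ennreal (indicat_real {x. t < \<bar>u x\<bar>} x * (u x)\<^sup>2) \<partial>lebesgue)
      \<le> (\<integral>\<^sup>+ x. ennreal (4 * (u x - average l u x)\<^sup>2) \<partial>lebesgue)"
  proof (intro nn_integral_mono ennreal_leI)
    fix x
    show "indicat_real {x. t < \<bar>u x\<bar>} x * (u x)\<^sup>2 \<le> 4 * (u x - average l u x)\<^sup>2"
    proof (cases "t < \<bar>u x\<bar>")
      case True
      have "a \<le> 2 * d" if "t < a" "b \<le> t / 2" "a - b \<le> d" for a b d :: real using that by argo
      from this[OF True avg[of x] abs_triangle_ineq2] have "\<bar>u x\<bar> \<le> 2 * \<bar>u x - average l u x\<bar>" .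
      then have "\<bar>u x\<bar>\<^sup>2 \<le> (2 * \<bar>u x - average l u x\<bar>)\<^sup>2" by (rule power_mono) simp
      then show ?thesis using True by (simp add: power_mult_distrib)
    qed simp
  qed
  also have "\<dots> = ennreal (LINT x|lebesgue. 4 * (u x - average l u x)\<^sup>2)"
    using L2_real_integrable[OF average_deviation(1)[OF l uH]] by (intro nn_integral_eq_integral) auto
  also have "\<dots> \<le> ennreal (4 * real DIM('a) * l\<^sup>2 * B\<^sup>2)"
    using average_deviation_size[OF u l] by (intro ennreal_leI) simp
  finally show ?thesis .
qed

lemma geometric_level:
  fixes q T s :: real
  assumes "q > 1" "T > 0" "T < s"
  obtains j :: nat where "T * q ^ j < s" "s \<le> T * q ^ Suc j"
proof -
  obtain n where n: "s / T < q ^ n" using real_arch_pow[OF assms(1)] by blast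
  define m where "m = (LEAST n. s \<le> T * q ^ n)"
  have "s \<le> T * q ^ n" using n assms by (simp add: field_simps)
  then have m: "s \<le> T * q ^ m" unfolding m_def by (rule LeastI)
  have "m \<noteq> 0" using m assms by (cases m) auto
  then obtain j where j: "m = Suc j" by (cases m) auto
  have "\<not> s \<le> T * q ^ j" using not_less_Least[of j "\<lambda>n. s \<le> T * q ^ n"] j by (simp add: m_def)
  then show ?thesis using that[of j] m j by (simp add: not_le)
qed

lemma powr_minus_2: "0 \<le> x \<Longrightarrow> x powr P = x powr (P - 2) * (x::real)\<^sup>2"
  using powr_add[of x "P - 2" 2] by simp

definition tail_const :: "nat \<Rightarrow> real \<Rightarrow> real \<Rightarrow> real" where
  "tail_const N q P = 4 * N * (2 * growth_const N q * q) powr (P - 2) / (1 - q powr (P - 2) / 4)"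

text \<open>
  Let \<open>T\<^sub>j = 2 D B q\<^sup>j\<close> with \<open>D = growth_const N q\<close>.  By \<open>average_growth\<close> the averages over cubes of side \<open>2\<^sup>-\<^sup>j\<close> are
  at most \<open>T\<^sub>j / 2\<close>, so \<open>u\<^sup>2\<close> has integral at most \<open>4 N B\<^sup>2 4\<^sup>-\<^sup>j\<close> over the points with \<open>\<bar>u\<bar> > T\<^sub>j\<close>.  Up to the next
  level, \<open>\<bar>u\<bar> powr P\<close> is at most \<open>T\<^bsub>j+1\<^esub> powr (P - 2)\<close> times \<open>u\<^sup>2\<close>; the contributions form a geometric series of
  ratio \<open>q powr (P - 2) / 4\<close>.
\<close>

lemma power_tail_estimate:
  fixes u :: "'a::euclidean_space \<Rightarrow> real"
  assumes u: "H1_size u B" and q: "q > 1" "sqrt (2 ^ DIM('a)) / 2 \<le> q" and P: "P > 2" "q powr (P - 2) < 4"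
  shows "(\<integral>\<^sup>+ x. ennreal (indicat_real {x. 2 * growth_const (DIM('a)) q * B * q ^ J < \<bar>u x\<bar>} x * \<bar>u x\<bar> powr P) \<partial>lebesgue)
    \<le> ennreal (tail_const (DIM('a)) q P * (q powr (P - 2) / 4) ^ J * B powr P)"
proof -
  let ?N = "DIM('a)"
  define D where "D = growth_const ?N q"
  have D: "D \<ge> 1" using growth_const_pos[OF q(1)] by (simp add: D_def)
  have B: "B > 0" and uH: "u \<in> H1" using u by (auto simp: H1_size_def)
  have [measurable]: "u \<in> borel_measurable lebesgue" using L2_measurable[OF H1_L2[OF uH]] .
  define T where "T j = 2 * D * B * q ^ (J + j)" for j
  have T: "T j > 0" for j using D B q by (simp add: T_def)
  have TSuc: "T j = T 0 * q ^ j" for j by (simp add: T_def power_add mult_ac)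
  define \<theta> where "\<theta> = q powr (P - 2) / 4"
  have \<theta>: "0 \<le> \<theta>" "\<theta> < 1" using P by (auto simp: \<theta>_def)
  have pw: "ennreal (indicat_real {x. T 0 < \<bar>u x\<bar>} x * \<bar>u x\<bar> powr P)
      \<le> (\<Sum>j. ennreal (T (Suc j) powr (P - 2)) * ennreal (indicat_real {x. T j < \<bar>u x\<bar>} x * (u x)\<^sup>2))" for x
  proof (cases "T 0 < \<bar>u x\<bar>")
    case True
    then obtain j where j: "T 0 * q ^ j < \<bar>u x\<bar>" "\<bar>u x\<bar> \<le> T 0 * q ^ Suc j"
      using geometric_level[OF q(1) T[of 0]] by blast
    have ux: "\<bar>u x\<bar> > 0" using True T[of 0] by linarith
    have "\<bar>u x\<bar> powr P = \<bar>u x\<bar> powr (P - 2) * (u x)\<^sup>2"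
      using powr_minus_2[of "\<bar>u x\<bar>" P] by simp
    also have "\<dots> \<le> T (Suc j) powr (P - 2) * (u x)\<^sup>2"
      using j(2) P unfolding TSuc[of "Suc j", symmetric] by (intro mult_right_mono powr_mono2) auto
    finally have "ennreal (indicat_real {x. T 0 < \<bar>u x\<bar>} x * \<bar>u x\<bar> powr P)
        \<le> ennreal (T (Suc j) powr (P - 2) * (u x)\<^sup>2)"
      using True by (intro ennreal_leI) simp
    also have "\<dots> = ennreal (T (Suc j) powr (P - 2)) * ennreal (indicat_real {x. T j < \<bar>u x\<bar>} x * (u x)\<^sup>2)"
      using j(1) unfolding TSuc[of j, symmetric] by (simp add: ennreal_mult)
    also have "\<dots> \<le> (\<Sum>j. ennreal (T (Suc j) powr (P - 2)) * ennreal (indicat_real {x. T j < \<bar>u x\<bar>} x * (u x)\<^sup>2))"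
      using sum_le_suminf[of "\<lambda>j. ennreal (T (Suc j) powr (P - 2)) * ennreal (indicat_real {x. T j < \<bar>u x\<bar>} x * (u x)\<^sup>2)" "{j}"]
      by simp
    finally show ?thesis .
  qed simp
  have lvl: "(\<integral>\<^sup>+ x. ennreal (T (Suc j) powr (P - 2)) * ennreal (indicat_real {x. T j < \<bar>u x\<bar>} x * (u x)\<^sup>2) \<partial>lebesgue)
      \<le> ennreal (4 * real ?N * (2 * D * q) powr (P - 2) * \<theta> ^ J * B powr P * \<theta> ^ j)" for j
  proof -
    have "(\<integral>\<^sup>+ x. ennreal (indicat_real {x. T j < \<bar>u x\<bar>} x * (u x)\<^sup>2) \<partial>lebesgue)
        \<le> ennreal (4 * real ?N * (1 / 2 ^ (J + j))\<^sup>2 * B\<^sup>2)"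
    proof (rule superlevel_estimate[OF u])
      show "\<bar>average (1 / 2 ^ (J + j)) u x\<bar> \<le> T j / 2" for x
        using average_growth[OF u q, of "J + j" x] by (simp add: T_def D_def)
    qed simp
    then have "(\<integral>\<^sup>+ x. ennreal (T (Suc j) powr (P - 2)) * ennreal (indicat_real {x. T j < \<bar>u x\<bar>} x * (u x)\<^sup>2) \<partial>lebesgue)
        \<le> ennreal (T (Suc j) powr (P - 2)) * ennreal (4 * real ?N * (1 / 2 ^ (J + j))\<^sup>2 * B\<^sup>2)"
      by (subst nn_integral_cmult) (measurable, rule mult_left_mono, auto)
    also have "\<dots> = ennreal (T (Suc j) powr (P - 2) * (4 * real ?N * (1 / 2 ^ (J + j))\<^sup>2 * B\<^sup>2))"
      by (subst ennreal_mult) auto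
    also have "T (Suc j) powr (P - 2) * (4 * real ?N * (1 / 2 ^ (J + j))\<^sup>2 * B\<^sup>2)
        = 4 * real ?N * (2 * D * q) powr (P - 2) * \<theta> ^ J * B powr P * \<theta> ^ j"
    proof -
      have "T (Suc j) = (2 * D * q) * B * q ^ (J + j)" by (simp add: T_def)
      then have "T (Suc j) powr (P - 2) = (2 * D * q) powr (P - 2) * B powr (P - 2) * (q ^ (J + j)) powr (P - 2)"
        by (simp only: powr_mult)
      also have "(q ^ (J + j)) powr (P - 2) = (q powr (P - 2)) ^ (J + j)"
      proof -
        have "(q ^ n) powr a = (q powr a) ^ n" for n a by (induction n) (simp_all add: powr_mult)
        then show ?thesis .
      qed
      finally have 1: "T (Suc j) powr (P - 2) = (2 * D * q) powr (P - 2) * B powr (P - 2) * (q powr (P - 2)) ^ (J + j)" .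
      have 2: "(1 / 2 ^ (J + j))\<^sup>2 = (1 / 4 :: real) ^ (J + j)"
        by (simp add: power2_eq_square power_one_over flip: power_mult_distrib)
      have 3: "B powr P = B powr (P - 2) * B\<^sup>2"
        using B by (intro powr_minus_2) simp
      have 4: "(q powr (P - 2)) ^ (J + j) * (1 / 4) ^ (J + j) = \<theta> ^ J * \<theta> ^ j"
        by (simp add: \<theta>_def flip: power_add power_mult_distrib)
      have "T (Suc j) powr (P - 2) * (4 * real ?N * (1 / 2 ^ (J + j))\<^sup>2 * B\<^sup>2)
          = 4 * real ?N * (2 * D * q) powr (P - 2) * (B powr (P - 2) * B\<^sup>2) * ((q powr (P - 2)) ^ (J + j) * (1 / 4) ^ (J + j))"
        unfolding 1 2 by (simp only: mult_ac)
      then show ?thesis unfolding 4 3[symmetric] by (simp only: mult_ac)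
    qed
    finally show ?thesis .
  qed
  have "(\<integral>\<^sup>+ x. ennreal (indicat_real {x. T 0 < \<bar>u x\<bar>} x * \<bar>u x\<bar> powr P) \<partial>lebesgue)
      \<le> (\<integral>\<^sup>+ x. (\<Sum>j. ennreal (T (Suc j) powr (P - 2)) * ennreal (indicat_real {x. T j < \<bar>u x\<bar>} x * (u x)\<^sup>2)) \<partial>lebesgue)"
    by (intro nn_integral_mono pw)
  also have "\<dots> = (\<Sum>j. \<integral>\<^sup>+ x. ennreal (T (Suc j) powr (P - 2)) * ennreal (indicat_real {x. T j < \<bar>u x\<bar>} x * (u x)\<^sup>2) \<partial>lebesgue)"
    by (rule nn_integral_suminf) measurable
  also have "\<dots> \<le> (\<Sum>j. ennreal (4 * real ?N * (2 * D * q) powr (P - 2) * \<theta> ^ J * B powr P * \<theta> ^ j))"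
    by (intro suminf_le lvl summableI)
  also have "\<dots> = ennreal (4 * real ?N * (2 * D * q) powr (P - 2) * \<theta> ^ J * B powr P * (1 / (1 - \<theta>)))"
  proof (rule suminf_ennreal_eq)
    show "(\<lambda>j. 4 * real ?N * (2 * D * q) powr (P - 2) * \<theta> ^ J * B powr P * \<theta> ^ j)
        sums (4 * real ?N * (2 * D * q) powr (P - 2) * \<theta> ^ J * B powr P * (1 / (1 - \<theta>)))"
      using \<theta> by (intro sums_mult geometric_sums) simp
  qed (use \<theta> in auto)
  also have "4 * real ?N * (2 * D * q) powr (P - 2) * \<theta> ^ J * B powr P * (1 / (1 - \<theta>))
      = tail_const ?N q P * \<theta> ^ J * B powr P"
    by (simp add: tail_const_def D_def \<theta>_def)
  finally show ?thesis by (simp add: T_def D_def \<theta>_def)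
qed

definition subcritical :: "nat \<Rightarrow> real \<Rightarrow> bool" where
  "subcritical N P \<longleftrightarrow> P > 2 \<and> ereal P < critical_exponent N"

text \<open>
  The growth rate \<open>2 powr (N/2 - 1)\<close> of the averages is admissible because \<open>(N/2 - 1) (P - 2) < 2\<close> holds for
  \<open>N \<le> 2\<close> and is, for larger \<open>N\<close>, another form of \<open>P < 2N / (N - 2)\<close>.
\<close>

lemma subcritical_ratio:
  assumes "subcritical N P"
  obtains q :: real where "q > 1" "sqrt (2 ^ N) / 2 \<le> q" "q powr (P - 2) < 4"
proof -
  have P: "P > 2" using assms by (simp add: subcritical_def)
  define q where "q = max (sqrt (2 ^ N) / 2) (2 powr (1 / (P - 2)))"
  have "1 < (2::real) powr (1 / (P - 2))" using P by simp
  then have 1: "q > 1" by (simp add: q_def)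
  have a: "(2 powr (1 / (P - 2))) powr (P - 2) < (4::real)" using P by (simp add: powr_powr)
  have b: "(sqrt (2 ^ N) / 2) powr (P - 2) < 4"
  proof -
    have "sqrt (2 ^ N) / 2 = 2 powr (real N / 2 - 1)"
      by (simp add: powr_diff powr_half_sqrt[symmetric] powr_powr powr_realpow[symmetric])
    then have "(sqrt (2 ^ N) / 2) powr (P - 2) = 2 powr ((real N / 2 - 1) * (P - 2))"
      by (simp add: powr_powr)
    also have "(real N / 2 - 1) * (P - 2) < 2"
    proof (cases "N \<ge> 3")
      case True
      then have "P < 2 * real N / (real N - 2)" using assms by (simp add: subcritical_def critical_exponent_def)
      then have "P * (real N - 2) < 2 * real N" using True by (simp add: pos_less_divide_eq)
      then show ?thesis by (simp add: field_simps)
    next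
      case False
      then have "real N / 2 - 1 \<le> 0" by simp
      then have "(real N / 2 - 1) * (P - 2) \<le> 0" using P by (intro mult_nonpos_nonneg) auto
      then show ?thesis by linarith
    qed
    then have "(2::real) powr ((real N / 2 - 1) * (P - 2)) < 2 powr 2" by (intro powr_less_mono) auto
    finally show ?thesis by simp
  qed
  have "q powr (P - 2) < 4" using a b by (auto simp: q_def max_def)
  then show ?thesis using that 1 by (simp add: q_def)
qed

text \<open>
  Below the level \<open>2 D B\<close> the power is at most a multiple of \<open>u\<^sup>2\<close>; above it the tail estimate applies.
\<close>

lemma Sobolev:
  assumes P: "subcritical (DIM('a::euclidean_space)) P"
  obtains C where "C > 0"
    "\<And>(u :: 'a \<Rightarrow> real) B. H1_size u B \<Longrightarrow> integrable lebesgue (\<lambda>x. \<bar>u x\<bar> powr P)"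
    "\<And>(u :: 'a \<Rightarrow> real) B. H1_size u B \<Longrightarrow> (LINT x|lebesgue. \<bar>u x\<bar> powr P) \<le> C * B powr P"
proof -
  let ?N = "DIM('a)"
  obtain q where q: "q > 1" "sqrt (2 ^ ?N) / 2 \<le> q" "q powr (P - 2) < 4"
    using subcritical_ratio[OF P] by blast
  have P2: "P > 2" using P by (simp add: subcritical_def)
  define D where "D = growth_const ?N q"
  have D: "D \<ge> 1" using growth_const_pos[OF q(1)] by (simp add: D_def)
  have tc: "tail_const ?N q P \<ge> 0" using q(3) by (simp add: tail_const_def)
  define C where "C = (2 * D) powr (P - 2) + tail_const ?N q P"
  have C: "C > 0" using D tc by (simp add: C_def add_pos_nonneg)
  have main: "(\<integral>\<^sup>+ x. ennreal (\<bar>u x\<bar> powr P) \<partial>lebesgue) \<le> ennreal (C * B powr P)" if u: "H1_size u B" for u :: "'a \<Rightarrow> real" and B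
  proof -
    have B: "B > 0" and uH: "u \<in> H1" using u by (auto simp: H1_size_def)
    have [measurable]: "u \<in> borel_measurable lebesgue" using L2_measurable[OF H1_L2[OF uH]] .
    let ?T = "2 * D * B"
    have "(\<integral>\<^sup>+ x. ennreal (\<bar>u x\<bar> powr P) \<partial>lebesgue)
        \<le> (\<integral>\<^sup>+ x. ennreal (?T powr (P - 2) * (u x)\<^sup>2) + ennreal (indicat_real {x. ?T * q ^ 0 < \<bar>u x\<bar>} x * \<bar>u x\<bar> powr P) \<partial>lebesgue)"
    proof (rule nn_integral_mono)
      fix x
      show "ennreal (\<bar>u x\<bar> powr P) \<le> ennreal (?T powr (P - 2) * (u x)\<^sup>2) + ennreal (indicat_real {x. ?T * q ^ 0 < \<bar>u x\<bar>} x * \<bar>u x\<bar> powr P)"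
      proof (cases "?T < \<bar>u x\<bar>")
        case False
        have "\<bar>u x\<bar> powr P \<le> ?T powr (P - 2) * (u x)\<^sup>2"
        proof (cases "u x = 0")
          case ux: False
          have "\<bar>u x\<bar> powr P = \<bar>u x\<bar> powr (P - 2) * (u x)\<^sup>2"
            using powr_minus_2[of "\<bar>u x\<bar>" P] by simp
          also have "\<dots> \<le> ?T powr (P - 2) * (u x)\<^sup>2"
            using False P2 by (intro mult_right_mono powr_mono2) auto
          finally show ?thesis .
        qed simp
        then show ?thesis by (intro add_increasing2 ennreal_leI) auto
      qed (simp add: add_increasing)
    qed
    also have "\<dots> = (\<integral>\<^sup>+ x. ennreal (?T powr (P - 2) * (u x)\<^sup>2) \<partial>lebesgue)
        + (\<integral>\<^sup>+ x. ennreal (indicat_real {x. ?T * q ^ 0 < \<bar>u x\<bar>} x * \<bar>u x\<bar> powr P) \<partial>lebesgue)"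
      by (rule nn_integral_add) measurable
    also have "\<dots> \<le> ennreal (?T powr (P - 2) * B\<^sup>2) + ennreal (tail_const ?N q P * (q powr (P - 2) / 4) ^ 0 * B powr P)"
    proof (rule add_mono)
      have "(\<integral>\<^sup>+ x. ennreal (?T powr (P - 2) * (u x)\<^sup>2) \<partial>lebesgue) = ennreal (LINT x|lebesgue. ?T powr (P - 2) * (u x)\<^sup>2)"
        using L2_real_integrable[OF H1_L2[OF uH]] by (intro nn_integral_eq_integral) auto
      also have "\<dots> \<le> ennreal (?T powr (P - 2) * B\<^sup>2)"
        using u by (intro ennreal_leI) (simp add: H1_size_def mult_left_mono)
      finally show "(\<integral>\<^sup>+ x. ennreal (?T powr (P - 2) * (u x)\<^sup>2) \<partial>lebesgue) \<le> ennreal (?T powr (P - 2) * B\<^sup>2)" .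
      show "(\<integral>\<^sup>+ x. ennreal (indicat_real {x. ?T * q ^ 0 < \<bar>u x\<bar>} x * \<bar>u x\<bar> powr P) \<partial>lebesgue)
          \<le> ennreal (tail_const ?N q P * (q powr (P - 2) / 4) ^ 0 * B powr P)"
        unfolding D_def by (rule power_tail_estimate[OF u q(1,2) P2 q(3)])
    qed
    also have "\<dots> = ennreal (?T powr (P - 2) * B\<^sup>2 + tail_const ?N q P * B powr P)"
      using tc by (simp add: ennreal_plus)
    also have "?T powr (P - 2) * B\<^sup>2 + tail_const ?N q P * B powr P = C * B powr P"
    proof -
      have "B powr P = B powr (P - 2) * B\<^sup>2" using B by (intro powr_minus_2) simp
      moreover have "?T powr (P - 2) = (2 * D) powr (P - 2) * B powr (P - 2)" by (rule powr_mult)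
      ultimately show ?thesis by (simp add: C_def algebra_simps)
    qed
    finally show ?thesis .
  qed
  have int: "integrable lebesgue (\<lambda>x. \<bar>u x\<bar> powr P)" if u: "H1_size u B" for u :: "'a \<Rightarrow> real" and B
  proof (rule integrableI_bounded)
    have [measurable]: "u \<in> borel_measurable lebesgue" using u L2_measurable[OF H1_L2] by (auto simp: H1_size_def)
    show "(\<lambda>x. \<bar>u x\<bar> powr P) \<in> borel_measurable lebesgue" by measurable
    show "(\<integral>\<^sup>+ x. ennreal (norm (\<bar>u x\<bar> powr P)) \<partial>lebesgue) < \<infinity>"
      using order.strict_trans1[OF main[OF u] ennreal_less_top] by simp
  qed
  show ?thesis
  proof (rule that[OF C int])
    fix u :: "'a \<Rightarrow> real" and B assume u: "H1_size u B"
    have "ennreal (LINT x|lebesgue. \<bar>u x\<bar> powr P) \<le> ennreal (C * B powr P)"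
      using main[OF u] nn_integral_eq_integral[OF int[OF u]] by simp
    then show "(LINT x|lebesgue. \<bar>u x\<bar> powr P) \<le> C * B powr P"
      using C by (simp add: ennreal_le_iff)
  qed
qed

section \<open>Vanishing, local compactness and escaping translates\<close>

lemma power_split_bound:
  fixes s \<epsilon> T P :: real
  assumes "\<epsilon> > 0" "T > 0" "P > 2"
  shows "\<bar>s\<bar> powr P \<le> \<epsilon> powr (P - 2) * s\<^sup>2 + T powr (P - 2) * (indicat_real {s. \<epsilon> < \<bar>s\<bar>} s * s\<^sup>2)
    + indicat_real {s. T < \<bar>s\<bar>} s * \<bar>s\<bar> powr P"
proof -
  have eq: "\<bar>s\<bar> powr P = \<bar>s\<bar> powr (P - 2) * s\<^sup>2" using powr_minus_2[of "\<bar>s\<bar>" P] by simp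
  have n: "0 \<le> \<epsilon> powr (P - 2) * s\<^sup>2" "0 \<le> T powr (P - 2) * (indicat_real {s. \<epsilon> < \<bar>s\<bar>} s * s\<^sup>2)"
    "0 \<le> indicat_real {s. T < \<bar>s\<bar>} s * \<bar>s\<bar> powr P" by auto
  consider "\<bar>s\<bar> \<le> \<epsilon>" | "\<epsilon> < \<bar>s\<bar>" "\<bar>s\<bar> \<le> T" | "T < \<bar>s\<bar>" by linarith
  then show ?thesis
  proof cases
    case 1
    then have "\<bar>s\<bar> powr P \<le> \<epsilon> powr (P - 2) * s\<^sup>2"
      unfolding eq using assms by (intro mult_right_mono powr_mono2) auto
    then show ?thesis using n by linarith
  next
    case 2
    then have "\<bar>s\<bar> powr P \<le> T powr (P - 2) * (indicat_real {s. \<epsilon> < \<bar>s\<bar>} s * s\<^sup>2)"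
      unfolding eq using assms by (auto intro!: mult_right_mono powr_mono2)
    then show ?thesis using n by linarith
  next
    case 3
    then have "\<bar>s\<bar> powr P = indicat_real {s. T < \<bar>s\<bar>} s * \<bar>s\<bar> powr P" by simp
    then show ?thesis using n by linarith
  qed
qed

text \<open>
  The values above a high level \<open>T\<close> are controlled by the Sobolev tail estimate, those below a small
  level \<open>\<epsilon>\<close> by the \<open>L2\<close> norm, and those in between by the superlevel estimate, once the averages
  have become smaller than \<open>\<epsilon>/2\<close>.
\<close>

lemma vanishing:
  fixes r :: "nat \<Rightarrow> 'a::euclidean_space \<Rightarrow> real"
  assumes P: "subcritical (DIM('a)) P" and r: "\<And>k. H1_size (r k) B"
    and avg: "\<And>l \<epsilon>. l > 0 \<Longrightarrow> \<epsilon> > 0 \<Longrightarrow> \<forall>\<^sub>F k in sequentially. \<forall>x. \<bar>average l (r k) x\<bar> \<le> \<epsilon>"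
  shows "(\<lambda>k. LINT x|lebesgue. \<bar>r k x\<bar> powr P) \<longlonglongrightarrow> 0"
proof (rule LIMSEQ_I)
  fix \<eta> :: real assume \<eta>: "\<eta> > 0"
  let ?N = "DIM('a)"
  obtain q where q: "q > 1" "sqrt (2 ^ ?N) / 2 \<le> q" "q powr (P - 2) < 4"
    using subcritical_ratio[OF P] by blast
  have P2: "P > 2" using P by (simp add: subcritical_def)
  have B: "B > 0" using r by (simp add: H1_size_def)
  define \<theta> where "\<theta> = q powr (P - 2) / 4"
  have \<theta>: "0 \<le> \<theta>" "\<theta> < 1" using q(3) by (auto simp: \<theta>_def)
  define K where "K = tail_const ?N q P * B powr P"
  have K: "K \<ge> 0" using q(3) by (simp add: K_def tail_const_def)
  have "(\<lambda>J. K * \<theta> ^ J) \<longlonglongrightarrow> K * 0"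
    by (intro tendsto_mult_left LIMSEQ_realpow_zero \<theta>)
  then have "\<forall>\<^sub>F J in sequentially. K * \<theta> ^ J < \<eta> / 4"
    using \<eta> by (intro order_tendstoD(2)[of _ "K * 0"]) auto
  then obtain J where J: "K * \<theta> ^ J < \<eta> / 4" by (meson eventually_False_sequentially eventually_mono)
  define T where "T = 2 * growth_const ?N q * B * q ^ J"
  have T: "T > 0" using growth_const_pos[OF q(1), of ?N] B q by (simp add: T_def)
  \<comment> \<open>The tail above \<open>T\<close> is at most \<open>\<eta>/4\<close> by the choice of \<open>J\<close>; then \<open>\<epsilon>\<close> and the side \<open>l\<close> make the other two parts at most \<open>\<eta>/4\<close>.\<close>
  define \<epsilon> where "\<epsilon> = (\<eta> / (4 * B\<^sup>2)) powr (1 / (P - 2))"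
  have \<epsilon>: "\<epsilon> > 0" "\<epsilon> powr (P - 2) * B\<^sup>2 = \<eta> / 4"
    using \<eta> B P2 by (auto simp: \<epsilon>_def powr_powr)
  define S where "S = T powr (P - 2) * (4 * real ?N * B\<^sup>2)"
  have S: "S > 0" using T B by (simp add: S_def)
  define l where "l = sqrt (\<eta> / (4 * S))"
  have l: "l > 0" "S * l\<^sup>2 = \<eta> / 4" using \<eta> S by (auto simp: l_def)
  have main: "(LINT x|lebesgue. \<bar>r k x\<bar> powr P) < \<eta>" if a: "\<forall>x. \<bar>average l (r k) x\<bar> \<le> \<epsilon> / 2" for k
  proof -
    have rk: "r k \<in> H1" "(LINT x|lebesgue. (r k x)\<^sup>2) \<le> B\<^sup>2" using r[of k] by (auto simp: H1_size_def)
    have [measurable]: "r k \<in> borel_measurable lebesgue" using L2_measurable[OF H1_L2[OF rk(1)]] .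
    have int: "integrable lebesgue (\<lambda>x. \<bar>r k x\<bar> powr P)" using Sobolev[OF P] r[of k] by metis
    have "ennreal (LINT x|lebesgue. \<bar>r k x\<bar> powr P) = (\<integral>\<^sup>+ x. ennreal (\<bar>r k x\<bar> powr P) \<partial>lebesgue)"
      by (rule nn_integral_eq_integral[symmetric, OF int]) simp
    also have "\<dots> \<le> (\<integral>\<^sup>+ x. (ennreal (\<epsilon> powr (P - 2) * (r k x)\<^sup>2)
          + ennreal (T powr (P - 2)) * ennreal (indicat_real {x. \<epsilon> < \<bar>r k x\<bar>} x * (r k x)\<^sup>2))
        + ennreal (indicat_real {x. T < \<bar>r k x\<bar>} x * \<bar>r k x\<bar> powr P) \<partial>lebesgue)"
    proof (rule nn_integral_mono)
      fix x
      have "\<bar>r k x\<bar> powr P \<le> \<epsilon> powr (P - 2) * (r k x)\<^sup>2 + T powr (P - 2) * (indicat_real {x. \<epsilon> < \<bar>r k x\<bar>} x * (r k x)\<^sup>2)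
          + indicat_real {x. T < \<bar>r k x\<bar>} x * \<bar>r k x\<bar> powr P"
        using power_split_bound[OF \<epsilon>(1) T P2, of "r k x"] by (simp add: indicator_def)
      then have "ennreal (\<bar>r k x\<bar> powr P) \<le> ennreal (\<epsilon> powr (P - 2) * (r k x)\<^sup>2 + T powr (P - 2) * (indicat_real {x. \<epsilon> < \<bar>r k x\<bar>} x * (r k x)\<^sup>2)
          + indicat_real {x. T < \<bar>r k x\<bar>} x * \<bar>r k x\<bar> powr P)" by (rule ennreal_leI)
      then show "ennreal (\<bar>r k x\<bar> powr P) \<le> (ennreal (\<epsilon> powr (P - 2) * (r k x)\<^sup>2)
          + ennreal (T powr (P - 2)) * ennreal (indicat_real {x. \<epsilon> < \<bar>r k x\<bar>} x * (r k x)\<^sup>2))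
        + ennreal (indicat_real {x. T < \<bar>r k x\<bar>} x * \<bar>r k x\<bar> powr P)"
        by (simp add: ennreal_plus ennreal_mult[symmetric])
    qed
    also have "\<dots> = (\<integral>\<^sup>+ x. ennreal (\<epsilon> powr (P - 2) * (r k x)\<^sup>2) \<partial>lebesgue)
        + ennreal (T powr (P - 2)) * (\<integral>\<^sup>+ x. ennreal (indicat_real {x. \<epsilon> < \<bar>r k x\<bar>} x * (r k x)\<^sup>2) \<partial>lebesgue)
        + (\<integral>\<^sup>+ x. ennreal (indicat_real {x. T < \<bar>r k x\<bar>} x * \<bar>r k x\<bar> powr P) \<partial>lebesgue)"
      by (simp add: nn_integral_add nn_integral_cmult)
    also have "\<dots> \<le> ennreal (\<eta> / 4) + ennreal (\<eta> / 4) + ennreal (\<eta> / 4)"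
    proof (intro add_mono)
      have "(\<integral>\<^sup>+ x. ennreal (\<epsilon> powr (P - 2) * (r k x)\<^sup>2) \<partial>lebesgue) = ennreal (LINT x|lebesgue. \<epsilon> powr (P - 2) * (r k x)\<^sup>2)"
        using L2_real_integrable[OF H1_L2[OF rk(1)]] by (intro nn_integral_eq_integral) auto
      also have "\<dots> \<le> ennreal (\<epsilon> powr (P - 2) * B\<^sup>2)"
        using rk(2) by (intro ennreal_leI) (simp add: mult_left_mono)
      finally show "(\<integral>\<^sup>+ x. ennreal (\<epsilon> powr (P - 2) * (r k x)\<^sup>2) \<partial>lebesgue) \<le> ennreal (\<eta> / 4)"
        using \<epsilon>(2) by simp
      have "ennreal (T powr (P - 2)) * (\<integral>\<^sup>+ x. ennreal (indicat_real {x. \<epsilon> < \<bar>r k x\<bar>} x * (r k x)\<^sup>2) \<partial>lebesgue)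
          \<le> ennreal (T powr (P - 2)) * ennreal (4 * real ?N * l\<^sup>2 * B\<^sup>2)"
        using superlevel_estimate[OF r l(1), of k \<epsilon>] a by (intro mult_left_mono) auto
      also have "\<dots> = ennreal (T powr (P - 2) * (4 * real ?N * l\<^sup>2 * B\<^sup>2))"
        by (rule ennreal_mult[symmetric]) auto
      also have "T powr (P - 2) * (4 * real ?N * l\<^sup>2 * B\<^sup>2) = \<eta> / 4"
        unfolding l(2)[symmetric] S_def by (simp add: mult_ac)
      finally show "ennreal (T powr (P - 2)) * (\<integral>\<^sup>+ x. ennreal (indicat_real {x. \<epsilon> < \<bar>r k x\<bar>} x * (r k x)\<^sup>2) \<partial>lebesgue) \<le> ennreal (\<eta> / 4)" .
      have "(\<integral>\<^sup>+ x. ennreal (indicat_real {x. T < \<bar>r k x\<bar>} x * \<bar>r k x\<bar> powr P) \<partial>lebesgue)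
          \<le> ennreal (tail_const ?N q P * (q powr (P - 2) / 4) ^ J * B powr P)"
        unfolding T_def by (rule power_tail_estimate[OF r q(1,2) P2 q(3)])
      also have "\<dots> = ennreal (K * \<theta> ^ J)" by (simp add: K_def \<theta>_def mult_ac)
      also have "\<dots> \<le> ennreal (\<eta> / 4)" using J by (intro ennreal_leI) simp
      finally show "(\<integral>\<^sup>+ x. ennreal (indicat_real {x. T < \<bar>r k x\<bar>} x * \<bar>r k x\<bar> powr P) \<partial>lebesgue) \<le> ennreal (\<eta> / 4)" .
    qed
    also have "\<dots> = ennreal (3 * (\<eta> / 4))" using \<eta> by (simp flip: ennreal_plus)
    finally have "(LINT x|lebesgue. \<bar>r k x\<bar> powr P) \<le> 3 * (\<eta> / 4)" using \<eta> by (simp add: ennreal_le_iff)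
    then show ?thesis using \<eta> by simp
  qed
  have "\<forall>\<^sub>F k in sequentially. (LINT x|lebesgue. \<bar>r k x\<bar> powr P) < \<eta>"
    using avg[OF l(1), of "\<epsilon> / 2"] \<epsilon>(1) by (auto elim!: eventually_mono intro: main)
  then obtain n where n: "\<And>k. k \<ge> n \<Longrightarrow> (LINT x|lebesgue. \<bar>r k x\<bar> powr P) < \<eta>"
    by (auto simp: eventually_sequentially)
  have "norm ((LINT x|lebesgue. \<bar>r k x\<bar> powr P) - 0) < \<eta>" if "k \<ge> n" for k
    using n[OF that] by simp
  then show "\<exists>no. \<forall>k\<ge>no. norm ((LINT x|lebesgue. \<bar>r k x\<bar> powr P) - 0) < \<eta>" by blast
qed

lemma average_add: "l > 0 \<Longrightarrow> u \<in> L2 \<Longrightarrow> v \<in> L2 \<Longrightarrow> average l (\<lambda>x. u x + v x) x = average l u x + average l v x"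
  using average_integrable[of l u x] average_integrable[of l v x]
  by (simp add: average_def distrib_left add_divide_distrib)

lemma average_scale: "average l (\<lambda>x. a * u x) x = a * average l u x"
  by (simp add: average_def mult.left_commute[of _ a])

lemma average_shift: "average l (\<lambda>z. u (z + a)) x = average l u (x + a)"
  by (simp add: average_def add_ac)

lemma H1_norm_size:
  assumes "b > 0" "u \<in> H1" "H1_norm b u \<le> M" "M > 0"
  shows "H1_size u ((1 + 1 / sqrt b) * M)"
proof -
  let ?\<kappa> = "1 + 1 / sqrt b"
  have \<kappa>: "?\<kappa> > 0" "?\<kappa>\<^sup>2 \<ge> 1" "?\<kappa>\<^sup>2 \<ge> 1 / b"
  proof -
    have i: "0 < 1 / sqrt b" using assms by simp
    then show "?\<kappa> > 0" by linarith
    have "1\<^sup>2 \<le> ?\<kappa>\<^sup>2" using i by (intro power_mono) auto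
    then show "?\<kappa>\<^sup>2 \<ge> 1" by simp
    have "(1 / sqrt b)\<^sup>2 \<le> ?\<kappa>\<^sup>2" using i by (intro power_mono) auto
    then show "?\<kappa>\<^sup>2 \<ge> 1 / b" using assms by (simp add: power_divide)
  qed
  have M2: "(H1_norm b u)\<^sup>2 \<le> M\<^sup>2" using assms H1_norm_nonneg by (intro power_mono) auto
  have "(LINT x|lebesgue. (u x)\<^sup>2) \<le> (1 / b) * M\<^sup>2"
    using L2_le_H1_norm[OF assms(1,2)] divide_right_mono[OF M2, of b] assms by simp
  also have "\<dots> \<le> ?\<kappa>\<^sup>2 * M\<^sup>2" using \<kappa> by (intro mult_right_mono) auto
  finally have 1: "(LINT x|lebesgue. (u x)\<^sup>2) \<le> (?\<kappa> * M)\<^sup>2" by (simp add: power_mult_distrib)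
  have "(LINT x|lebesgue. (norm (weak_gradient u x))\<^sup>2) \<le> 1 * M\<^sup>2"
    using gradient_le_H1_norm[OF assms(1,2)] M2 by simp
  also have "\<dots> \<le> ?\<kappa>\<^sup>2 * M\<^sup>2" using \<kappa> by (intro mult_right_mono) auto
  finally have 2: "(LINT x|lebesgue. (norm (weak_gradient u x))\<^sup>2) \<le> (?\<kappa> * M)\<^sup>2" by (simp add: power_mult_distrib)
  show ?thesis using 1 2 assms \<kappa> by (simp add: H1_size_def)
qed

text \<open>
  This is why averages at a fixed point pass to weak limits.
\<close>

lemma average_in_H1_dual:
  fixes x :: "'a::euclidean_space"
  assumes b: "b > 0" and l: "l > 0"
  shows "(\<lambda>v. average l v x) \<in> H1_dual b"
proof -
  have "\<bar>average l v x\<bar> \<le> (1 / sqrt b / sqrt (l ^ DIM('a))) * H1_norm b v" if "v \<in> H1" for v :: "'a \<Rightarrow> real"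
  proof -
    have "sqrt (LINT x|lebesgue. (v x)\<^sup>2) \<le> sqrt ((H1_norm b v)\<^sup>2 / b)"
      using L2_le_H1_norm[OF b that] by (rule real_sqrt_le_mono)
    also have "\<dots> = H1_norm b v / sqrt b" using H1_norm_nonneg[OF b that] by (simp add: real_sqrt_divide)
    finally have "sqrt (LINT x|lebesgue. (v x)\<^sup>2) / sqrt (l ^ DIM('a)) \<le> H1_norm b v / sqrt b / sqrt (l ^ DIM('a))"
      using l by (intro divide_right_mono) auto
    also have "\<dots> = (1 / sqrt b / sqrt (l ^ DIM('a))) * H1_norm b v" by simp
    finally show ?thesis by (rule order.trans[OF average_bound[OF l H1_L2[OF that]]])
  qed
  then have "\<exists>C. \<forall>v\<in>H1. \<bar>average l v x\<bar> \<le> C * H1_norm b v" by blast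
  then show ?thesis
    unfolding H1_dual_def using average_add[OF l H1_L2 H1_L2, of _ _ x] by (simp add: average_scale)
qed

lemma weakly_null_diff:
  assumes b: "b > 0" and "H1_weakly_converges b u w"
  shows "H1_weakly_converges b (\<lambda>k x. u k x - w x) (\<lambda>x. 0)"
proof -
  have H: "u k \<in> H1" "w \<in> H1" for k using assms by (auto simp: H1_weakly_converges_def)
  have "(\<lambda>k. form (\<lambda>_. b) (\<lambda>x. u k x - w x) v) \<longlonglongrightarrow> form (\<lambda>_. b) (\<lambda>x. 0) v" if v: "v \<in> H1" for v
  proof -
    have "(\<lambda>k. form (\<lambda>_. b) (u k) v - form (\<lambda>_. b) w v) \<longlonglongrightarrow> form (\<lambda>_. b) w v - form (\<lambda>_. b) w v"
      using assms v unfolding H1_weakly_converges_iff[OF b] by (intro tendsto_intros) auto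
    then show ?thesis by (simp add: form_diff_left L_infinity_const H v form_zero_left)
  qed
  then show ?thesis unfolding H1_weakly_converges_iff[OF b] using H by (simp add: H1_diff H1_zero)
qed

text \<open>
  For a small side \<open>l\<close> the deviation from the averages is small in \<open>L2\<close>, uniformly in \<open>k\<close>; for a fixed side the
  averages are bounded and, by weak convergence, tend to zero at every point.
\<close>

lemma Rellich:
  fixes u :: "nat \<Rightarrow> 'a::euclidean_space \<Rightarrow> real"
  assumes b: "b > 0" and weak: "H1_weakly_converges b u (\<lambda>x. 0)" and M: "\<And>k. H1_norm b (u k) \<le> M"
  shows "(\<lambda>k. LINT x|lebesgue. indicat_real (cball 0 R) x * (u k x)\<^sup>2) \<longlonglongrightarrow> 0"
proof -
  have uH: "u k \<in> H1" for k using weak by (auto simp: H1_weakly_converges_def)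
  have M1: "H1_norm b (u k) \<le> \<bar>M\<bar> + 1" for k using M[of k] by linarith
  define B where "B = (1 + 1 / sqrt b) * (\<bar>M\<bar> + 1)"
  have sz: "H1_size (u k) B" for k unfolding B_def by (rule H1_norm_size[OF b uH M1]) simp
  have B: "B > 0" using sz by (simp add: H1_size_def)
  let ?N = "DIM('a)" and ?I = "indicat_real (cball 0 R :: 'a set)"
  have cb[measurable]: "(cball 0 R :: 'a set) \<in> sets lebesgue" by simp
  have um[measurable]: "u k \<in> borel_measurable lebesgue" for k using L2_measurable[OF H1_L2[OF uH]] .
  have am[measurable]: "average l (u k) \<in> borel_measurable lebesgue" for l k by (rule average_measurable[OF H1_L2[OF uH]])
  have Iint: "integrable lebesgue ?I" using lmeasurable_cball[of 0 R] by (auto simp: fmeasurable_def)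
  have avg0: "(\<lambda>k. LINT x|lebesgue. ?I x * (average l (u k) x)\<^sup>2) \<longlonglongrightarrow> 0" if l: "l > 0" for l
  proof -
    have lim: "(\<lambda>k. average l (u k) x) \<longlonglongrightarrow> 0" for x
    proof -
      have "(\<lambda>k. average l (u k) x) \<longlonglongrightarrow> average l (\<lambda>x. 0) x"
      proof -
        have "\<forall>f\<in>H1_dual b. (\<lambda>k. f (u k)) \<longlonglongrightarrow> f (\<lambda>x. 0)"
          using weak by (simp add: H1_weakly_converges_def)
        from bspec[OF this average_in_H1_dual[OF b l, of x]] show ?thesis .
      qed
      then show ?thesis by (simp add: average_def)
    qed
    have bd: "\<bar>average l (u k) x\<bar> \<le> B / sqrt (l ^ ?N)" for k x
    proof -
      have "sqrt (LINT x|lebesgue. (u k x)\<^sup>2) \<le> sqrt (B\<^sup>2)"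
        using sz[of k] by (intro real_sqrt_le_mono) (simp add: H1_size_def)
      then have "sqrt (LINT x|lebesgue. (u k x)\<^sup>2) / sqrt (l ^ ?N) \<le> B / sqrt (l ^ ?N)"
        using B l by (intro divide_right_mono) auto
      then show ?thesis using average_bound[OF l H1_L2[OF uH[of k]], of x] by linarith
    qed
    have "(\<lambda>k. LINT x|lebesgue. ?I x * (average l (u k) x)\<^sup>2) \<longlonglongrightarrow> integral\<^sup>L (lebesgue :: 'a measure) (\<lambda>x. 0 :: real)"
    proof (rule integral_dominated_convergence[where w="\<lambda>x. (B / sqrt (l ^ ?N))\<^sup>2 * ?I x"])
      show "integrable lebesgue (\<lambda>x. (B / sqrt (l ^ ?N))\<^sup>2 * ?I x)" by (rule integrable_mult_right[OF Iint])
      show "AE x in lebesgue. (\<lambda>k. ?I x * (average l (u k) x)\<^sup>2) \<longlonglongrightarrow> 0"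
        using tendsto_mult_right_zero[OF tendsto_null_power[OF lim, of 2]] by (intro AE_I2) auto
      show "AE x in lebesgue. norm (?I x * (average l (u k) x)\<^sup>2) \<le> (B / sqrt (l ^ ?N))\<^sup>2 * ?I x" for k
        using power_mono[OF bd abs_ge_zero, of k _ 2] by (intro AE_I2) (simp add: indicator_def)
    qed measurable
    then show ?thesis by simp
  qed
  have int1: "integrable lebesgue (\<lambda>x. ?I x * f x)" if "integrable lebesgue f" for f :: "'a \<Rightarrow> real"
    using integrable_mult_indicator[OF cb that] by simp
  have est: "(LINT x|lebesgue. ?I x * (u k x)\<^sup>2)
      \<le> 2 * (real ?N * l\<^sup>2 * B\<^sup>2) + 2 * (LINT x|lebesgue. ?I x * (average l (u k) x)\<^sup>2)" if l: "l > 0" for k l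
  proof -
    note d = L2_real_integrable[OF average_deviation(1)[OF l uH[of k]]]
    note a = int1[OF L2_real_integrable[OF average_L2[OF l uH[of k]]]]
    have "(LINT x|lebesgue. ?I x * (u k x)\<^sup>2)
        \<le> (LINT x|lebesgue. 2 * (u k x - average l (u k) x)\<^sup>2 + 2 * (?I x * (average l (u k) x)\<^sup>2))"
    proof (rule integral_mono)
      show "?I x * (u k x)\<^sup>2 \<le> 2 * (u k x - average l (u k) x)\<^sup>2 + 2 * (?I x * (average l (u k) x)\<^sup>2)" for x
        using norm_add_sq_le[of "u k x - average l (u k) x" "average l (u k) x"] by (simp add: indicator_def)
    qed (use d a int1[OF L2_real_integrable[OF H1_L2[OF uH[of k]]]] in auto)
    also have "\<dots> = 2 * (LINT x|lebesgue. (u k x - average l (u k) x)\<^sup>2) + 2 * (LINT x|lebesgue. ?I x * (average l (u k) x)\<^sup>2)"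
      using d a by simp
    also have "\<dots> \<le> 2 * (real ?N * l\<^sup>2 * B\<^sup>2) + 2 * (LINT x|lebesgue. ?I x * (average l (u k) x)\<^sup>2)"
      using average_deviation_size[OF sz l, of k] by simp
    finally show ?thesis .
  qed
  show ?thesis
  proof (rule LIMSEQ_I)
    fix \<eta> :: real assume \<eta>: "\<eta> > 0"
    define l where "l = sqrt (\<eta> / (8 * real ?N * B\<^sup>2))"
    have l: "l > 0" "2 * (real ?N * l\<^sup>2 * B\<^sup>2) = \<eta> / 4" using \<eta> B by (auto simp: l_def field_simps)
    have "\<forall>\<^sub>F k in sequentially. (LINT x|lebesgue. ?I x * (average l (u k) x)\<^sup>2) < \<eta> / 8"
      using \<eta> by (intro order_tendstoD(2)[OF avg0[OF l(1)]]) auto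
    then obtain n where n: "\<And>k. k \<ge> n \<Longrightarrow> (LINT x|lebesgue. ?I x * (average l (u k) x)\<^sup>2) < \<eta> / 8"
      by (auto simp: eventually_sequentially)
    have "norm ((LINT x|lebesgue. ?I x * (u k x)\<^sup>2) - 0) < \<eta>" if "k \<ge> n" for k
    proof -
      have "0 \<le> (LINT x|lebesgue. ?I x * (u k x)\<^sup>2)" by (rule Bochner_Integration.integral_nonneg) simp
      then show ?thesis using est[OF l(1), of k] n[OF that] l(2) \<eta> by simp
    qed
    then show "\<exists>no. \<forall>k\<ge>no. norm ((LINT x|lebesgue. ?I x * (u k x)\<^sup>2) - 0) < \<eta>" by blast
  qed
qed

lemma outer_set_measurable: "{x::'a::euclidean_space. R \<le> norm x} \<in> sets lebesgue"
proof -
  have "closed {x::'a. R \<le> norm x}" by (intro closed_Collect_le continuous_intros)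
  then show ?thesis by (intro sets_completionI_sets) simp
qed

lemma L2_tail:
  fixes f :: "'a::euclidean_space \<Rightarrow> 'b::euclidean_space"
  assumes f: "f \<in> L2" and R: "filterlim R at_top sequentially"
  shows "(\<lambda>k. LINT x|lebesgue. indicat_real {x. R k \<le> norm x} x * (norm (f x))\<^sup>2) \<longlonglongrightarrow> 0"
proof -
  have [measurable]: "f \<in> borel_measurable lebesgue" by (rule L2_measurable[OF f])
  have [measurable]: "{x::'a. R k \<le> norm x} \<in> sets lebesgue" for k by (rule outer_set_measurable)
  have "(\<lambda>k. LINT x|lebesgue. indicat_real {x. R k \<le> norm x} x * (norm (f x))\<^sup>2) \<longlonglongrightarrow> integral\<^sup>L (lebesgue :: 'a measure) (\<lambda>x. 0 :: real)"
  proof (rule integral_dominated_convergence[where w="\<lambda>x. (norm (f x))\<^sup>2"])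
    show "AE x in lebesgue. (\<lambda>k. indicat_real {x. R k \<le> norm x} x * (norm (f x))\<^sup>2) \<longlonglongrightarrow> 0"
    proof (rule AE_I2)
      fix x :: 'a
      have "\<forall>\<^sub>F k in sequentially. norm x < R k" using R by (simp add: filterlim_at_top_dense)
      then have "\<forall>\<^sub>F k in sequentially. indicat_real {x. R k \<le> norm x} x * (norm (f x))\<^sup>2 = 0"
        by eventually_elim simp
      then show "(\<lambda>k. indicat_real {x. R k \<le> norm x} x * (norm (f x))\<^sup>2) \<longlonglongrightarrow> 0"
        by (rule tendsto_eventually)
    qed
    show "AE x in lebesgue. norm (indicat_real {x. R k \<le> norm x} x * (norm (f x))\<^sup>2) \<le> (norm (f x))\<^sup>2" for k
      by (simp add: indicator_def)
  qed (use L2_integrable[OF f] in measurable)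
  then show ?thesis by simp
qed

text \<open>
  One of \<open>x\<close> and \<open>x + z\<close> has norm at least \<open>\<bar>z\<bar>/2\<close>, and \<open>f\<close> and \<open>g\<close> have little mass that far out.
\<close>

lemma L2_inner_translate_null:
  fixes f g :: "'a::euclidean_space \<Rightarrow> 'b::euclidean_space"
  assumes f: "f \<in> L2" and g: "g \<in> L2" and z: "filterlim (\<lambda>k. norm (z k)) at_top sequentially"
  shows "(\<lambda>k. LINT x|lebesgue. f (x + z k) \<bullet> g x) \<longlonglongrightarrow> 0"
proof -
  define F where "F x = norm (f x)" for x
  define G where "G x = norm (g x)" for x
  define A where "A k = {x::'a. norm (z k) / 2 \<le> norm x}" for k
  have FL: "F \<in> L2" and GL: "G \<in> L2" using L2_norm[OF f] L2_norm[OF g] by (auto simp: F_def[abs_def] G_def[abs_def])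
  have Am: "A k \<in> sets lebesgue" for k unfolding A_def by (rule outer_set_measurable)
  have R: "filterlim (\<lambda>k. norm (z k) / 2) at_top sequentially"
    using filterlim_tendsto_pos_mult_at_top[OF tendsto_const[of "1/2"] _ z] by simp
  define a where "a k = (LINT x|lebesgue. (indicat_real (A k) x * F x)\<^sup>2)" for k
  define c where "c k = (LINT x|lebesgue. (indicat_real (A k) x * G x)\<^sup>2)" for k
  have a: "a \<longlonglongrightarrow> 0" and c: "c \<longlonglongrightarrow> 0"
    using L2_tail[OF FL R] L2_tail[OF GL R]
    by (simp_all add: a_def[abs_def] c_def[abs_def] A_def power_mult_distrib indicator_power2)
  have est: "\<bar>LINT x|lebesgue. f (x + z k) \<bullet> g x\<bar>
      \<le> sqrt (a k) * sqrt (LINT x|lebesgue. (G x)\<^sup>2) + sqrt (LINT x|lebesgue. (F x)\<^sup>2) * sqrt (c k)" for k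
  proof -
    let ?Fa = "\<lambda>x. indicat_real (A k) x * F x" and ?Ga = "\<lambda>x. indicat_real (A k) x * G x"
    have FaL: "?Fa \<in> L2" and GaL: "?Ga \<in> L2" by (intro L2_indicator_mult FL GL Am)+
    have "\<bar>LINT x|lebesgue. f (x + z k) \<bullet> g x\<bar> \<le> (LINT x|lebesgue. \<bar>f (x + z k) \<bullet> g x\<bar>)"
      by (rule integral_abs_bound)
    also have "\<dots> \<le> (LINT x|lebesgue. \<bar>?Fa (x + z k) * G x\<bar> + \<bar>F (x + z k) * ?Ga x\<bar>)"
    proof (rule integral_mono)
      fix x
      have 1: "\<bar>f (x + z k) \<bullet> g x\<bar> \<le> F (x + z k) * G x" unfolding F_def G_def by (rule Cauchy_Schwarz_ineq2)
      have "norm (z k) \<le> norm (x + z k) + norm x" using norm_triangle_ineq4[of "x + z k" x] by simp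
      then have "norm (z k) / 2 \<le> norm (x + z k) \<or> norm (z k) / 2 \<le> norm x" by linarith
      then have "x + z k \<in> A k \<or> x \<in> A k" by (simp add: A_def)
      moreover have "\<bar>f (x + z k) \<bullet> g x\<bar> \<le> \<bar>F (x + z k)\<bar> * \<bar>G x\<bar>"
        using 1 by (simp add: F_def G_def)
      ultimately show "\<bar>f (x + z k) \<bullet> g x\<bar> \<le> \<bar>?Fa (x + z k) * G x\<bar> + \<bar>F (x + z k) * ?Ga x\<bar>"
        by (elim disjE) (simp_all add: abs_mult add_increasing add_increasing2)
    qed (intro integrable_abs Bochner_Integration.integrable_add L2_inner_integrable L2_mult_integrable
        L2_translate[of f] L2_translate[OF FaL] L2_translate[OF FL] f g GL GaL)+
    also have "\<dots> = (LINT x|lebesgue. \<bar>?Fa (x + z k) * G x\<bar>) + (LINT x|lebesgue. \<bar>F (x + z k) * ?Ga x\<bar>)"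
      by (intro Bochner_Integration.integral_add integrable_abs L2_mult_integrable
          L2_translate[OF FaL] L2_translate[OF FL] GL GaL)
    also have "\<dots> \<le> sqrt (LINT x|lebesgue. (?Fa (x + z k))\<^sup>2) * sqrt (LINT x|lebesgue. (G x)\<^sup>2)
        + sqrt (LINT x|lebesgue. (F (x + z k))\<^sup>2) * sqrt (LINT x|lebesgue. (?Ga x)\<^sup>2)"
      by (intro add_mono L2_Cauchy_Schwarz_real L2_translate[OF FaL] L2_translate[OF FL] GL GaL)
    also have "(LINT x|lebesgue. (?Fa (x + z k))\<^sup>2) = a k"
      unfolding a_def by (rule integral_translate[OF borel_measurable_integrable[OF L2_real_integrable[OF FaL]]])
    also have "(LINT x|lebesgue. (F (x + z k))\<^sup>2) = (LINT x|lebesgue. (F x)\<^sup>2)"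
      by (rule integral_translate[OF borel_measurable_integrable[OF L2_real_integrable[OF FL]]])
    finally show ?thesis by (simp add: c_def)
  qed
  show ?thesis
  proof (rule Lim_null_comparison)
    show "\<forall>\<^sub>F k in sequentially. norm (LINT x|lebesgue. f (x + z k) \<bullet> g x)
        \<le> sqrt (a k) * sqrt (LINT x|lebesgue. (G x)\<^sup>2) + sqrt (LINT x|lebesgue. (F x)\<^sup>2) * sqrt (c k)"
      using est by simp
    have "(\<lambda>k. sqrt (a k) * sqrt (LINT x|lebesgue. (G x)\<^sup>2) + sqrt (LINT x|lebesgue. (F x)\<^sup>2) * sqrt (c k))
        \<longlonglongrightarrow> sqrt 0 * sqrt (LINT x|lebesgue. (G x)\<^sup>2) + sqrt (LINT x|lebesgue. (F x)\<^sup>2) * sqrt 0"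
      by (intro tendsto_intros a c)
    then show "(\<lambda>k. sqrt (a k) * sqrt (LINT x|lebesgue. (G x)\<^sup>2) + sqrt (LINT x|lebesgue. (F x)\<^sup>2) * sqrt (c k)) \<longlonglongrightarrow> 0"
      by simp
  qed
qed

lemma translates_weakly_null:
  assumes b: "b > 0" and w: "w \<in> H1" and z: "filterlim (\<lambda>k. norm (z k)) at_top sequentially"
  shows "H1_weakly_converges b (\<lambda>k x. w (x + z k)) (\<lambda>x. 0)"
proof -
  have "(\<lambda>k. form (\<lambda>_. b) (\<lambda>x. w (x + z k)) v) \<longlonglongrightarrow> 0" if v: "v \<in> H1" for v
  proof -
    note wk = H1_translate[OF w]
    have eq: "form (\<lambda>_. b) (\<lambda>x. w (x + z k)) v
        = (LINT x|lebesgue. weak_gradient w (x + z k) \<bullet> weak_gradient v x) + b * (LINT x|lebesgue. w (x + z k) \<bullet> v x)" for k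
    proof -
      have "(LINT x|lebesgue. weak_gradient (\<lambda>x. w (x + z k)) x \<bullet> weak_gradient v x)
          = (LINT x|lebesgue. weak_gradient w (x + z k) \<bullet> weak_gradient v x)"
      proof (rule integral_cong_AE)
        show "AE x in lebesgue. weak_gradient (\<lambda>x. w (x + z k)) x \<bullet> weak_gradient v x = weak_gradient w (x + z k) \<bullet> weak_gradient v x"
          using weak_gradient_translate[OF w, of "z k"] by eventually_elim simp
      qed (intro borel_measurable_integrable L2_inner_integrable weak_gradient_L2 wk v L2_translate[of "weak_gradient w"] w)+
      then show ?thesis
        by (simp add: form_split[OF L_infinity_const wk v] mult.assoc)
    qed
    have "(\<lambda>k. (LINT x|lebesgue. weak_gradient w (x + z k) \<bullet> weak_gradient v x) + b * (LINT x|lebesgue. w (x + z k) \<bullet> v x)) \<longlonglongrightarrow> 0 + b * 0"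
      by (intro tendsto_intros L2_inner_translate_null weak_gradient_L2 H1_L2 w v z)
    then show ?thesis by (simp add: eq)
  qed
  then show ?thesis
    unfolding H1_weakly_converges_iff[OF b] using w by (simp add: H1_translate H1_zero form_zero_left L_infinity_const)
qed

section \<open>Power nonlinearities with a variable exponent\<close>

definition odd_power :: "real \<Rightarrow> real \<Rightarrow> real" where
  "odd_power p s = \<bar>s\<bar> powr (p - 2) * s"

lemma odd_power_abs: "\<bar>odd_power p s\<bar> = \<bar>s\<bar> powr (p - 1)"
  using powr_mult_base[of "\<bar>s\<bar>" "p - 2"] by (simp add: odd_power_def abs_mult mult.commute)

lemma odd_power_self: "odd_power p s * s = \<bar>s\<bar> powr p"
  using powr_minus_2[of "\<bar>s\<bar>" p] by (simp add: odd_power_def power2_eq_square mult.assoc)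

lemma abs_powr_Suc: "\<bar>s\<bar> powr (p - 1) * \<bar>s::real\<bar> = \<bar>s\<bar> powr p"
  using powr_mult_base[of "\<bar>s\<bar>" "p - 1"] by (simp add: mult.commute)

lemma powr_between:
  fixes s :: real
  assumes "a \<le> p" "p \<le> P" "0 \<le> a"
  shows "\<bar>s\<bar> powr p \<le> \<bar>s\<bar> powr a + \<bar>s\<bar> powr P"
proof (cases "\<bar>s\<bar> \<le> 1")
  case True
  then have "\<bar>s\<bar> powr p \<le> \<bar>s\<bar> powr a" using assms by (intro powr_mono') auto
  then show ?thesis by (simp add: add_increasing2)
next
  case False
  then have "\<bar>s\<bar> powr p \<le> \<bar>s\<bar> powr P" using assms by (intro powr_mono) auto
  then show ?thesis by (simp add: add_increasing)
qed

lemma powr_le_square_plus: "2 \<le> p \<Longrightarrow> p \<le> P \<Longrightarrow> \<bar>s\<bar> powr p \<le> s\<^sup>2 + \<bar>s::real\<bar> powr P"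
  using powr_between[of 2 p P s] by simp

text \<open>
  A form of Young's inequality, from the cases \<open>\<bar>t\<bar> \<le> \<epsilon> \<bar>s\<bar>\<close> and \<open>\<bar>s\<bar> < \<bar>t\<bar> / \<epsilon>\<close>, whose constant is the same for all
  exponents up to \<open>P\<close>, so that \<open>p\<close> may depend on the point.
\<close>

lemma coupling_bound:
  fixes s t :: real
  assumes \<epsilon>: "0 < \<epsilon>" "\<epsilon> \<le> 1" and p: "1 \<le> p" "p \<le> P"
  shows "\<bar>s\<bar> powr (p - 1) * \<bar>t\<bar> \<le> \<epsilon> * \<bar>s\<bar> powr p + (1 / \<epsilon>) powr P * \<bar>t\<bar> powr p"
proof (cases "\<bar>t\<bar> \<le> \<epsilon> * \<bar>s\<bar>")
  case True
  have "\<bar>s\<bar> powr (p - 1) * \<bar>t\<bar> \<le> \<bar>s\<bar> powr (p - 1) * (\<epsilon> * \<bar>s\<bar>)"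
    using True by (rule mult_left_mono) simp
  also have "\<dots> = \<epsilon> * \<bar>s\<bar> powr p" using abs_powr_Suc[of s p] by (simp add: mult.left_commute)
  finally show ?thesis by (simp add: add_increasing2)
next
  case False
  then have "\<bar>s\<bar> \<le> (1 / \<epsilon>) * \<bar>t\<bar>" using \<epsilon> by (simp add: field_simps)
  then have "\<bar>s\<bar> powr (p - 1) \<le> ((1 / \<epsilon>) * \<bar>t\<bar>) powr (p - 1)" using p by (intro powr_mono2) auto
  also have "\<dots> = (1 / \<epsilon>) powr (p - 1) * \<bar>t\<bar> powr (p - 1)" by (rule powr_mult)
  also have "\<dots> \<le> (1 / \<epsilon>) powr P * \<bar>t\<bar> powr (p - 1)"
    using \<epsilon> p by (intro mult_right_mono powr_mono) auto
  finally have "\<bar>s\<bar> powr (p - 1) * \<bar>t\<bar> \<le> (1 / \<epsilon>) powr P * \<bar>t\<bar> powr (p - 1) * \<bar>t\<bar>"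
    by (rule mult_right_mono) simp
  also have "\<dots> = (1 / \<epsilon>) powr P * \<bar>t\<bar> powr p" using abs_powr_Suc[of t p] by (simp add: mult.assoc)
  finally show ?thesis using \<epsilon> by (simp add: add_increasing)
qed

lemma abs_powr_difference_ordered:
  fixes a b p :: real
  assumes "p > 1" "0 \<le> b" "b \<le> a"
  shows "\<bar>a powr p - b powr p\<bar> \<le> p * a powr (p - 1) * (a - b)"
proof (cases "b = a")
  case False
  then have ba: "b < a" using assms by simp
  have d: "((\<lambda>x. x powr p) has_real_derivative p * z powr (p - 1)) (at z)" if "z > 0" for z
    using that by (rule has_real_derivative_powr)
  have "continuous_on {b..a} (\<lambda>x. x powr p)"
    using assms by (intro continuous_on_powr' continuous_intros) auto
  then obtain l z where z: "b < z" "z < a" "((\<lambda>x. x powr p) has_real_derivative l) (at z)"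
    "a powr p - b powr p = (a - b) * l"
    using MVT[OF ba, of "\<lambda>x. x powr p"] d assms(2) by (smt (verit) real_differentiable_def)
  have z0: "z > 0" using z assms by linarith
  have l: "l = p * z powr (p - 1)" using DERIV_unique[OF z(3) d[OF z0]] .
  have "z powr (p - 1) \<le> a powr (p - 1)" using z z0 assms by (intro powr_mono2) auto
  then have "l \<le> p * a powr (p - 1)" unfolding l using assms by (intro mult_left_mono) auto
  then have "(a - b) * l \<le> (a - b) * (p * a powr (p - 1))" using ba by (intro mult_left_mono) auto
  moreover have "0 \<le> (a - b) * l" unfolding l using ba assms by simp
  ultimately show ?thesis unfolding z(4) by (simp add: mult_ac)
qed simp

lemma abs_powr_difference:
  fixes s t p Z :: real
  assumes p: "p > 1" and Z: "\<bar>s\<bar> \<le> Z" "\<bar>t\<bar> \<le> Z"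
  shows "\<bar>\<bar>s\<bar> powr p - \<bar>t\<bar> powr p\<bar> \<le> p * Z powr (p - 1) * \<bar>s - t\<bar>"
proof -
  have *: "\<bar>\<bar>s\<bar> powr p - \<bar>t\<bar> powr p\<bar> \<le> p * Z powr (p - 1) * \<bar>s - t\<bar>"
    if "\<bar>t\<bar> \<le> \<bar>s\<bar>" "\<bar>s\<bar> \<le> Z" for s t :: real
  proof -
    have "\<bar>\<bar>s\<bar> powr p - \<bar>t\<bar> powr p\<bar> \<le> p * \<bar>s\<bar> powr (p - 1) * (\<bar>s\<bar> - \<bar>t\<bar>)"
      using that by (intro abs_powr_difference_ordered p) auto
    also have "\<dots> \<le> p * Z powr (p - 1) * \<bar>s - t\<bar>"
      using that p by (intro mult_mono powr_mono2 abs_triangle_ineq2) auto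
    finally show ?thesis .
  qed
  show ?thesis
  proof (cases "\<bar>t\<bar> \<le> \<bar>s\<bar>")
    case True
    then show ?thesis using * Z by blast
  next
    case False
    then show ?thesis using *[of s t] Z by (simp add: abs_minus_commute)
  qed
qed

lemma has_derivative_abs_powr:
  fixes p :: real
  assumes p: "p > 1"
  shows "((\<lambda>s. \<bar>s\<bar> powr p / p) has_real_derivative odd_power p s) (at s)"
proof -
  consider "s > 0" | "s < 0" | "s = 0" by linarith
  then show ?thesis
  proof cases
    case 1
    have "((\<lambda>x. x powr p / p) has_real_derivative p * s powr (p - 1) / p) (at s)"
      by (intro DERIV_cdivide has_real_derivative_powr 1)
    then have "((\<lambda>x. x powr p / p) has_real_derivative odd_power p s) (at s)"
      using 1 p powr_mult_base[of s "p - 2"] by (simp add: odd_power_def mult.commute)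
    then show ?thesis
      by (rule has_field_derivative_transform_within_open[where S="{0<..}"]) (use 1 in auto)
  next
    case 2
    have "((\<lambda>x. (- x) powr p / p) has_real_derivative p * (- s) powr (p - 1) * - 1 / p) (at s)"
      using 2 by (intro DERIV_cdivide DERIV_chain2[OF has_real_derivative_powr]) (auto intro!: derivative_eq_intros)
    then have "((\<lambda>x. (- x) powr p / p) has_real_derivative odd_power p s) (at s)"
    proof -
      have "s * (- s) powr (p - 2) = - ((- s) powr (p - 1))"
        using 2 powr_mult_base[of "- s" "p - 2"] by (simp add: minus_equation_iff)
      then show ?thesis
        using \<open>((\<lambda>x. (- x) powr p / p) has_real_derivative p * (- s) powr (p - 1) * - 1 / p) (at s)\<close> 2 p
        by (simp add: odd_power_def mult.commute)
    qed
    then show ?thesis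
      by (rule has_field_derivative_transform_within_open[where S="{..<0}"]) (use 2 in auto)
  next
    case 3
    have "((\<lambda>h. \<bar>h\<bar> powr (p - 1) / p) \<longlongrightarrow> \<bar>0\<bar> powr (p - 1) / p) (at (0::real))"
      using p by (intro tendsto_intros tendsto_powr') auto
    then have lim: "((\<lambda>h. \<bar>h\<bar> powr (p - 1) / p) \<longlongrightarrow> 0) (at (0::real))" by simp
    have eq: "\<bar>\<bar>h\<bar> powr p / p / h\<bar> = \<bar>h\<bar> powr (p - 1) / p" if "h \<noteq> 0" for h :: real
    proof -
      have "\<bar>h\<bar> powr p = \<bar>h\<bar> powr (p - 1) * \<bar>h\<bar>" by (rule abs_powr_Suc[symmetric])
      then show ?thesis using that p by (simp add: abs_mult)
    qed
    have "((\<lambda>h. \<bar>\<bar>h\<bar> powr p / p / h\<bar>) \<longlongrightarrow> 0) (at (0::real))"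
    proof (rule Lim_transform_eventually[OF lim])
      show "\<forall>\<^sub>F h in at 0. \<bar>h\<bar> powr (p - 1) / p = \<bar>\<bar>h\<bar> powr p / p / h\<bar>"
        unfolding eventually_at_filter by (intro always_eventually allI impI eq[symmetric])
    qed
    then have "((\<lambda>h. \<bar>h\<bar> powr p / p / h) \<longlongrightarrow> 0) (at (0::real))"
      by (rule tendsto_rabs_zero_cancel)
    then show ?thesis using 3 by (simp add: DERIV_def odd_power_def)
  qed
qed

text \<open>
  Joint continuity in both arguments.  At \<open>t = 0\<close> the exponent \<open>p k - 2\<close> may tend to zero as well, and \<open>powr\<close> is
  not continuous there; but \<open>2 \<le> p k\<close> bounds the value by \<open>\<bar>s k\<bar>\<close>.
\<close>

lemma odd_power_tendsto:
  assumes s: "(\<lambda>k. s k) \<longlonglongrightarrow> t" and p: "(\<lambda>k. p k) \<longlonglongrightarrow> q" and p2: "\<And>k. 2 \<le> p k"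
  shows "(\<lambda>k. odd_power (p k) (s k)) \<longlonglongrightarrow> odd_power q t"
proof (cases "t = 0")
  case False
  then show ?thesis unfolding odd_power_def by (intro tendsto_intros s p) simp
next
  case True
  have "(\<lambda>k. odd_power (p k) (s k)) \<longlonglongrightarrow> 0"
  proof (rule Lim_null_comparison)
    have "\<forall>\<^sub>F k in sequentially. \<bar>s k\<bar> < 1"
      using order_tendstoD(2)[OF tendsto_rabs[OF s], of 1] True by simp
    then show "\<forall>\<^sub>F k in sequentially. norm (odd_power (p k) (s k)) \<le> \<bar>s k\<bar>"
    proof eventually_elim
      case (elim k)
      have "\<bar>s k\<bar> powr (p k - 1) \<le> \<bar>s k\<bar> powr 1" using elim p2[of k] by (intro powr_mono') auto
      then show ?case by (simp add: odd_power_abs)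
    qed
    show "(\<lambda>k. \<bar>s k\<bar>) \<longlonglongrightarrow> 0" using tendsto_rabs[OF s] True by simp
  qed
  then show ?thesis using True by (simp add: odd_power_def)
qed

text \<open>
  The bounds \<open>pm\<close> and \<open>P\<close> are shared by \<open>p\<close>, its translates and its limit at infinity, so that all estimates in
  terms of them are uniform along translations.
\<close>

definition exponent :: "real \<Rightarrow> real \<Rightarrow> ('a::euclidean_space \<Rightarrow> real) \<Rightarrow> bool" where
  "exponent pm P p \<longleftrightarrow> 2 < pm \<and> subcritical (DIM('a)) P \<and> p \<in> borel_measurable borel \<and>
     (\<forall>x. pm \<le> p x \<and> p x \<le> P)"

lemma exponentD:
  assumes "exponent pm P p"
  shows "2 < pm" "pm \<le> p x" "p x \<le> P" "2 < p x" "p \<in> borel_measurable lebesgue"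
  using assms by (auto simp: exponent_def intro: measurable_completion less_le_trans)

lemma exponent_subcritical:
  assumes "exponent pm P (p :: 'a::euclidean_space \<Rightarrow> real)"
  shows "subcritical (DIM('a)) P" "subcritical (DIM('a)) pm"
proof -
  have "pm \<le> P" using assms order.trans[of pm "p 0" P] by (simp add: exponent_def)
  moreover show P: "subcritical (DIM('a)) P" using assms by (simp add: exponent_def)
  ultimately show "subcritical (DIM('a)) pm"
    using assms order.strict_trans1[of "ereal pm" "ereal P"] by (simp add: subcritical_def exponent_def)
qed

lemma H1_size_exists:
  assumes "u \<in> H1" obtains B where "H1_size u B"
proof -
  have "H1_norm 1 u \<ge> 0" using H1_norm_nonneg[of 1 u] assms by simp
  then show ?thesis using H1_norm_size[of 1 u "H1_norm 1 u + 1"] assms that by auto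
qed

lemma H1_power_integrable:
  fixes u :: "'a::euclidean_space \<Rightarrow> real"
  assumes "subcritical (DIM('a)) P" "u \<in> H1" shows "integrable lebesgue (\<lambda>x. \<bar>u x\<bar> powr P)"
  using Sobolev[OF assms(1)] H1_size_exists[OF assms(2)] by metis

lemma modular_integrable:
  fixes u :: "'a::euclidean_space \<Rightarrow> real"
  assumes p: "exponent pm P p" and u: "u \<in> H1"
  shows "integrable lebesgue (\<lambda>x. \<bar>u x\<bar> powr p x)"
proof (rule Bochner_Integration.integrable_bound)
  have [measurable]: "u \<in> borel_measurable lebesgue" "p \<in> borel_measurable lebesgue"
    using L2_measurable[OF H1_L2[OF u]] exponentD(5)[OF p] .
  show "integrable lebesgue (\<lambda>x. (u x)\<^sup>2 + \<bar>u x\<bar> powr P)"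
    by (intro Bochner_Integration.integrable_add L2_real_integrable H1_L2 u H1_power_integrable exponent_subcritical[OF p])
  show "(\<lambda>x. \<bar>u x\<bar> powr p x) \<in> borel_measurable lebesgue" by measurable
  show "AE x in lebesgue. norm (\<bar>u x\<bar> powr p x) \<le> norm ((u x)\<^sup>2 + \<bar>u x\<bar> powr P)"
    using powr_le_square_plus[OF less_imp_le[OF exponentD(4)[OF p]] exponentD(3)[OF p]] by (intro AE_I2) simp
qed

lemma modular_bound:
  assumes P: "subcritical (DIM('a::euclidean_space)) P"
  obtains K where "\<And>(u :: 'a \<Rightarrow> real) pm (p :: 'a \<Rightarrow> real). exponent pm P p \<Longrightarrow> H1_size u B \<Longrightarrow> (LINT x|lebesgue. \<bar>u x\<bar> powr p x) \<le> K"
proof -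
  obtain C where C: "\<And>(u :: 'a \<Rightarrow> real) B. H1_size u B \<Longrightarrow> integrable lebesgue (\<lambda>x. \<bar>u x\<bar> powr P)"
    "\<And>(u :: 'a \<Rightarrow> real) B. H1_size u B \<Longrightarrow> (LINT x|lebesgue. \<bar>u x\<bar> powr P) \<le> C * B powr P"
    using Sobolev[OF P] by metis
  show ?thesis
  proof (rule that[of "B\<^sup>2 + C * B powr P"])
    fix u p :: "'a \<Rightarrow> real" and pm assume p: "exponent pm P p" and u: "H1_size u B"
    have uH: "u \<in> H1" using u by (simp add: H1_size_def)
    have "(LINT x|lebesgue. \<bar>u x\<bar> powr p x) \<le> (LINT x|lebesgue. (u x)\<^sup>2 + \<bar>u x\<bar> powr P)"
      using powr_le_square_plus[OF less_imp_le[OF exponentD(4)[OF p]] exponentD(3)[OF p]]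
      by (intro integral_mono modular_integrable[OF p uH] Bochner_Integration.integrable_add L2_real_integrable H1_L2 uH C(1)[OF u])
    also have "\<dots> = (LINT x|lebesgue. (u x)\<^sup>2) + (LINT x|lebesgue. \<bar>u x\<bar> powr P)"
      by (intro Bochner_Integration.integral_add L2_real_integrable H1_L2 uH C(1)[OF u])
    also have "\<dots> \<le> B\<^sup>2 + C * B powr P" using u C(2)[OF u] by (simp add: H1_size_def)
    finally show "(LINT x|lebesgue. \<bar>u x\<bar> powr p x) \<le> B\<^sup>2 + C * B powr P" .
  qed
qed

lemma odd_power_measurable:
  assumes [measurable]: "u \<in> borel_measurable M" "p \<in> borel_measurable M"
  shows "(\<lambda>x. odd_power (p x) (u x)) \<in> borel_measurable M"
  unfolding odd_power_def by measurable

lemma odd_power_integrable: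
  assumes p: "exponent pm P p" and u: "u \<in> H1" and v: "v \<in> H1"
  shows "integrable lebesgue (\<lambda>x. odd_power (p x) (u x) * v x)"
proof (rule Bochner_Integration.integrable_bound)
  show "integrable lebesgue (\<lambda>x. \<bar>u x\<bar> powr p x + \<bar>v x\<bar> powr p x)"
    by (intro Bochner_Integration.integrable_add modular_integrable[OF p] u v)
  show "(\<lambda>x. odd_power (p x) (u x) * v x) \<in> borel_measurable lebesgue"
    by (intro borel_measurable_times odd_power_measurable L2_measurable H1_L2 u v exponentD(5)[OF p])
  show "AE x in lebesgue. norm (odd_power (p x) (u x) * v x) \<le> norm (\<bar>u x\<bar> powr p x + \<bar>v x\<bar> powr p x)"
  proof (rule AE_I2)
    fix x
    have "\<bar>u x\<bar> powr (p x - 1) * \<bar>v x\<bar> \<le> 1 * \<bar>u x\<bar> powr p x + (1 / 1) powr P * \<bar>v x\<bar> powr p x"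
      using exponentD(4)[OF p, of x] exponentD(3)[OF p, of x] by (intro coupling_bound) auto
    then show "norm (odd_power (p x) (u x) * v x) \<le> norm (\<bar>u x\<bar> powr p x + \<bar>v x\<bar> powr p x)"
      by (simp add: abs_mult odd_power_abs)
  qed
qed

lemma coupling_null:
  assumes p: "exponent pm P p" and u: "\<And>k. u k \<in> H1" and r: "\<And>k. r k \<in> H1"
    and K: "\<And>k. (LINT x|lebesgue. \<bar>u k x\<bar> powr p x) \<le> K"
    and null: "(\<lambda>k. LINT x|lebesgue. \<bar>r k x\<bar> powr p x) \<longlonglongrightarrow> 0"
  shows "(\<lambda>k. LINT x|lebesgue. odd_power (p x) (u k x) * r k x) \<longlonglongrightarrow> 0"
proof (rule LIMSEQ_I)
  fix \<eta> :: real assume \<eta>: "\<eta> > 0"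
  have K0: "0 \<le> K" by (rule order.trans[OF _ K]) simp
  define \<epsilon> where "\<epsilon> = min 1 (\<eta> / (2 * (K + 1)))"
  have \<epsilon>: "0 < \<epsilon>" "\<epsilon> \<le> 1" using \<eta> K0 by (auto simp: \<epsilon>_def)
  have "\<epsilon> * K \<le> (\<eta> / (2 * (K + 1))) * K" using K0 by (intro mult_right_mono) (auto simp: \<epsilon>_def)
  also have "\<dots> \<le> \<eta> / 2" using K0 \<eta> by (simp add: field_simps)
  finally have \<epsilon>K: "\<epsilon> * K \<le> \<eta> / 2" .
  have est: "\<bar>LINT x|lebesgue. odd_power (p x) (u k x) * r k x\<bar>
      \<le> \<eta> / 2 + (1 / \<epsilon>) powr P * (LINT x|lebesgue. \<bar>r k x\<bar> powr p x)" for k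
  proof -
    note iu = modular_integrable[OF p u[of k]] and ir = modular_integrable[OF p r[of k]]
    have "\<bar>LINT x|lebesgue. odd_power (p x) (u k x) * r k x\<bar> \<le> (LINT x|lebesgue. \<bar>odd_power (p x) (u k x) * r k x\<bar>)"
      by (rule integral_abs_bound)
    also have "\<dots> \<le> (LINT x|lebesgue. \<epsilon> * \<bar>u k x\<bar> powr p x + (1 / \<epsilon>) powr P * \<bar>r k x\<bar> powr p x)"
    proof (rule integral_mono)
      show "\<bar>odd_power (p x) (u k x) * r k x\<bar> \<le> \<epsilon> * \<bar>u k x\<bar> powr p x + (1 / \<epsilon>) powr P * \<bar>r k x\<bar> powr p x" for x
        unfolding abs_mult odd_power_abs
        using exponentD(4)[OF p, of x] exponentD(3)[OF p, of x] \<epsilon> by (intro coupling_bound) auto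
    qed (use iu ir odd_power_integrable[OF p u[of k] r[of k]] in auto)
    also have "\<dots> = \<epsilon> * (LINT x|lebesgue. \<bar>u k x\<bar> powr p x) + (1 / \<epsilon>) powr P * (LINT x|lebesgue. \<bar>r k x\<bar> powr p x)"
      using iu ir by simp
    also have "\<epsilon> * (LINT x|lebesgue. \<bar>u k x\<bar> powr p x) \<le> \<epsilon> * K" using K \<epsilon> by (intro mult_left_mono) auto
    finally show ?thesis using \<epsilon>K by linarith
  qed
  have "(\<lambda>k. (1 / \<epsilon>) powr P * (LINT x|lebesgue. \<bar>r k x\<bar> powr p x)) \<longlonglongrightarrow> (1 / \<epsilon>) powr P * 0"
    by (intro tendsto_mult_left null)
  then have "\<forall>\<^sub>F k in sequentially. (1 / \<epsilon>) powr P * (LINT x|lebesgue. \<bar>r k x\<bar> powr p x) < \<eta> / 2"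
    using \<eta> by (intro order_tendstoD(2)) auto
  then obtain n where n: "\<And>k. k \<ge> n \<Longrightarrow> (1 / \<epsilon>) powr P * (LINT x|lebesgue. \<bar>r k x\<bar> powr p x) < \<eta> / 2"
    by (auto simp: eventually_sequentially)
  have "norm ((LINT x|lebesgue. odd_power (p x) (u k x) * r k x) - 0) < \<eta>" if "k \<ge> n" for k
    using est[of k] n[OF that] by simp
  then show "\<exists>no. \<forall>k\<ge>no. norm ((LINT x|lebesgue. odd_power (p x) (u k x) * r k x) - 0) < \<eta>" by blast
qed

section \<open>Weak continuity of the nonlinearity\<close>

text \<open>
  With the weight \<open>1 / (1 + \<bar>x\<bar>)\<close> the convergence in \<open>L2\<close> on every ball becomes one convergence in \<open>L1\<close>, so that a
  single subsequence serves the whole space.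
\<close>

lemma weakly_convergent_AE_subsequence:
  fixes v :: "nat \<Rightarrow> 'a::euclidean_space \<Rightarrow> real"
  assumes b: "b > 0" and weak: "H1_weakly_converges b v w" and M: "\<And>k. H1_norm b (v k) \<le> M"
  obtains s where "strict_mono s" "AE x in lebesgue. (\<lambda>k. v (s k) x) \<longlonglongrightarrow> w x"
proof -
  have H: "v k \<in> H1" "w \<in> H1" for k using weak by (auto simp: H1_weakly_converges_def)
  define z where "z k x = v k x - w x" for k x
  have zH: "z k \<in> H1" for k unfolding z_def using H1_diff[OF H(1) H(2)] .
  have zM: "H1_norm b (z k) \<le> M + H1_norm b w" for k
    using H1_norm_triangle[OF b H(1) H1_scale[OF H(2), of "- 1"], of k] H1_norm_scale[OF b H(2), of "- 1"] M[of k]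
    by (simp add: z_def[abs_def])
  have zweak: "H1_weakly_converges b z (\<lambda>x. 0)"
    using weakly_null_diff[OF b weak] by (simp add: z_def[abs_def])
  have zM1: "H1_norm b (z k) \<le> \<bar>M + H1_norm b w\<bar> + 1" for k using zM[of k] by linarith
  define B where "B = (1 + 1 / sqrt b) * (\<bar>M + H1_norm b w\<bar> + 1)"
  have sz: "H1_size (z k) B" for k unfolding B_def by (rule H1_norm_size[OF b zH zM1]) simp
  have zm[measurable]: "z k \<in> borel_measurable lebesgue" for k by (rule L2_measurable[OF H1_L2[OF zH]])
  have nm[measurable]: "(\<lambda>x::'a. norm x) \<in> borel_measurable lebesgue"
    by (rule continuous_measurable_lebesgue) (intro continuous_intros)
  have pos: "1 + norm x > 0" for x :: 'a using norm_ge_zero[of x] by linarith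
  define f where "f k x = (z k x)\<^sup>2 / (1 + norm x)" for k x
  have fnn: "0 \<le> f k x" for k x using pos[of x] by (simp add: f_def)
  have fint: "integrable lebesgue (f k)" for k
  proof (rule Bochner_Integration.integrable_bound[OF L2_real_integrable[OF H1_L2[OF zH[of k]]]])
    show "f k \<in> borel_measurable lebesgue" unfolding f_def by measurable
    show "AE x in lebesgue. norm (f k x) \<le> norm ((z k x)\<^sup>2)"
    proof (rule AE_I2)
      fix x
      have "(z k x)\<^sup>2 / (1 + norm x) \<le> (z k x)\<^sup>2 / 1" by (intro divide_left_mono) (use pos[of x] in auto)
      then show "norm (f k x) \<le> norm ((z k x)\<^sup>2)" using fnn[of k x] by (simp add: f_def)
    qed
  qed
  have cb: "cball 0 R \<in> sets lebesgue" for R by simp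
  have est: "(LINT x|lebesgue. f k x) \<le> (LINT x|lebesgue. indicat_real (cball 0 R) x * (z k x)\<^sup>2) + B\<^sup>2 / (1 + R)" if R: "R > 0" for k R
  proof -
    note zi = L2_real_integrable[OF H1_L2[OF zH[of k]]]
    have zi2: "integrable lebesgue (\<lambda>x. indicat_real (cball 0 R) x * (z k x)\<^sup>2)"
      using integrable_mult_indicator[OF cb zi] by simp
    have "(LINT x|lebesgue. f k x) \<le> (LINT x|lebesgue. indicat_real (cball 0 R) x * (z k x)\<^sup>2 + (1 / (1 + R)) * (z k x)\<^sup>2)"
    proof (rule integral_mono[OF fint])
      show "f k x \<le> indicat_real (cball 0 R) x * (z k x)\<^sup>2 + (1 / (1 + R)) * (z k x)\<^sup>2" for x
      proof (cases "x \<in> cball 0 R")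
        case True
        have "(z k x)\<^sup>2 / (1 + norm x) \<le> (z k x)\<^sup>2 / 1" by (intro divide_left_mono) (use pos[of x] in auto)
        moreover have "0 \<le> (1 / (1 + R)) * (z k x)\<^sup>2" using R by simp
        ultimately show ?thesis using True by (simp add: f_def)
      next
        case False
        have "(z k x)\<^sup>2 / (1 + norm x) \<le> (z k x)\<^sup>2 / (1 + R)"
          using False R pos[of x] by (intro divide_left_mono) auto
        then show ?thesis using False by (simp add: f_def)
      qed
    qed (use zi zi2 in auto)
    also have "\<dots> = (LINT x|lebesgue. indicat_real (cball 0 R) x * (z k x)\<^sup>2) + (1 / (1 + R)) * (LINT x|lebesgue. (z k x)\<^sup>2)"
      using zi zi2 by simp
    also have "(1 / (1 + R)) * (LINT x|lebesgue. (z k x)\<^sup>2) \<le> (1 / (1 + R)) * B\<^sup>2"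
      using sz[of k] R by (intro mult_left_mono) (auto simp: H1_size_def)
    finally show ?thesis by simp
  qed
  have "(\<lambda>k. LINT x|lebesgue. norm (f k x)) \<longlonglongrightarrow> 0"
  proof (rule LIMSEQ_I)
    fix \<eta> :: real assume \<eta>: "\<eta> > 0"
    \<comment> \<open>Outside the ball of radius \<open>R\<close> the weight is at most \<open>1 / (1 + R)\<close>.\<close>
    define R where "R = 2 * B\<^sup>2 / \<eta> + 1"
    have R: "R > 0" using \<eta> by (simp add: R_def add_nonneg_pos)
    have BR: "B\<^sup>2 / (1 + R) \<le> \<eta> / 2"
    proof -
      have "B\<^sup>2 \<le> (\<eta> / 2) * (1 + R)" using \<eta> by (simp add: R_def field_simps)
      then show ?thesis using R by (simp add: pos_divide_le_eq)
    qed
    have "\<forall>\<^sub>F k in sequentially. (LINT x|lebesgue. indicat_real (cball 0 R) x * (z k x)\<^sup>2) < \<eta> / 2"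
      using \<eta> by (intro order_tendstoD(2)[OF Rellich[OF b zweak zM]]) auto
    then obtain n where n: "\<And>k. k \<ge> n \<Longrightarrow> (LINT x|lebesgue. indicat_real (cball 0 R) x * (z k x)\<^sup>2) < \<eta> / 2"
      by (auto simp: eventually_sequentially)
    have "(LINT x|lebesgue. f k x) < \<eta>" if "k \<ge> n" for k
      using est[OF R, of k] n[OF that] BR by linarith
    moreover have "0 \<le> (LINT x|lebesgue. f k x)" for k using fnn by simp
    ultimately show "\<exists>no. \<forall>k\<ge>no. norm ((LINT x|lebesgue. norm (f k x)) - 0) < \<eta>" using fnn by auto
  qed
  from tendsto_L1_AE_subseq[OF fint this] obtain s where s: "strict_mono s" "AE x in lebesgue. (\<lambda>k. f (s k) x) \<longlonglongrightarrow> 0"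
    by blast
  have "AE x in lebesgue. (\<lambda>k. v (s k) x) \<longlonglongrightarrow> w x"
    using s(2)
  proof eventually_elim
    case (elim x)
    have "(\<lambda>k. sqrt ((1 + norm x) * f (s k) x)) \<longlonglongrightarrow> sqrt ((1 + norm x) * 0)"
      by (intro tendsto_intros elim)
    then have "(\<lambda>k. \<bar>z (s k) x\<bar>) \<longlonglongrightarrow> 0" using pos[of x] by (simp add: f_def)
    then have "(\<lambda>k. z (s k) x) \<longlonglongrightarrow> 0" by (rule tendsto_rabs_zero_cancel)
    then show ?case by (simp add: z_def LIM_zero_iff)
  qed
  then show ?thesis using that s(1) by blast
qed

text \<open>
  In \<open>\<integral> odd_power p u * \<phi>\<close> the values of \<open>u\<close> are cut off at \<open>M \<bar>\<phi>\<bar>\<close>.  This costs at most \<open>2/M\<close> times the modular of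
  \<open>u\<close>, as \<open>\<bar>\<phi>\<bar> \<le> \<bar>u\<bar> / M\<close> where the cut takes effect, and leaves an integrand dominated by a function of \<open>\<phi>\<close>
  alone.
\<close>

definition clamp_abs :: "real \<Rightarrow> real \<Rightarrow> real" where
  "clamp_abs c s = max (- c) (min c s)"

lemma clamp_abs_error:
  assumes M: "M > 0" and p: "p \<ge> 1"
  shows "\<bar>odd_power p s * t - odd_power p (clamp_abs (M * \<bar>t\<bar>) s) * t\<bar> \<le> (2 / M) * \<bar>s\<bar> powr p"
proof (cases "\<bar>s\<bar> \<le> M * \<bar>t\<bar>")
  case True
  then have "clamp_abs (M * \<bar>t\<bar>) s = s" by (simp add: clamp_abs_def)
  then show ?thesis using M by simp
next
  case False
  then have t: "\<bar>t\<bar> \<le> \<bar>s\<bar> / M" using M by (simp add: field_simps)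
  have "0 \<le> M * \<bar>t\<bar>" using M by simp
  then have "\<bar>clamp_abs (M * \<bar>t\<bar>) s\<bar> \<le> \<bar>s\<bar>" by (auto simp: clamp_abs_def)
  then have 1: "\<bar>odd_power p (clamp_abs (M * \<bar>t\<bar>) s)\<bar> \<le> \<bar>s\<bar> powr (p - 1)"
    unfolding odd_power_abs using p by (intro powr_mono2) auto
  have "\<bar>odd_power p s * t - odd_power p (clamp_abs (M * \<bar>t\<bar>) s) * t\<bar>
      = \<bar>odd_power p s - odd_power p (clamp_abs (M * \<bar>t\<bar>) s)\<bar> * \<bar>t\<bar>"
    by (simp add: left_diff_distrib flip: abs_mult)
  also have "\<dots> \<le> (2 * \<bar>s\<bar> powr (p - 1)) * (\<bar>s\<bar> / M)"
  proof (intro mult_mono t)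
    show "\<bar>odd_power p s - odd_power p (clamp_abs (M * \<bar>t\<bar>) s)\<bar> \<le> 2 * \<bar>s\<bar> powr (p - 1)"
      using 1 odd_power_abs[of p s] abs_triangle_ineq4[of "odd_power p s" "odd_power p (clamp_abs (M * \<bar>t\<bar>) s)"] by linarith
  qed auto
  also have "\<dots> = (2 / M) * \<bar>s\<bar> powr p" using abs_powr_Suc[of s p] by simp
  finally show ?thesis .
qed

lemma clamp_abs_dominated:
  assumes M: "M \<ge> 1" and p: "2 \<le> p" "p \<le> P"
  shows "\<bar>odd_power p (clamp_abs (M * \<bar>t\<bar>) s) * t\<bar> \<le> M powr P * (t\<^sup>2 + \<bar>t\<bar> powr P)"
proof -
  have "0 \<le> M * \<bar>t\<bar>" using M by simp
  then have "\<bar>clamp_abs (M * \<bar>t\<bar>) s\<bar> \<le> M * \<bar>t\<bar>" by (simp add: clamp_abs_def abs_le_iff max_def min_def)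
  then have "\<bar>odd_power p (clamp_abs (M * \<bar>t\<bar>) s)\<bar> \<le> (M * \<bar>t\<bar>) powr (p - 1)"
    unfolding odd_power_abs using p by (intro powr_mono2) auto
  also have "\<dots> = M powr (p - 1) * \<bar>t\<bar> powr (p - 1)" by (rule powr_mult)
  also have "\<dots> \<le> M powr P * \<bar>t\<bar> powr (p - 1)" using M p by (intro mult_right_mono powr_mono) auto
  finally have "\<bar>odd_power p (clamp_abs (M * \<bar>t\<bar>) s)\<bar> * \<bar>t\<bar> \<le> M powr P * \<bar>t\<bar> powr (p - 1) * \<bar>t\<bar>"
    by (rule mult_right_mono) simp
  also have "\<dots> = M powr P * \<bar>t\<bar> powr p" using abs_powr_Suc[of t p] by (simp add: mult.assoc)
  also have "\<dots> \<le> M powr P * (t\<^sup>2 + \<bar>t\<bar> powr P)"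
    using powr_le_square_plus[OF p, of t] by (intro mult_left_mono) auto
  finally show ?thesis by (simp add: abs_mult)
qed

lemma odd_power_weak_continuity_AE:
  fixes v :: "nat \<Rightarrow> 'a::euclidean_space \<Rightarrow> real"
  assumes v: "\<And>k. v k \<in> H1" and w: "w \<in> H1" and \<phi>: "\<phi> \<in> H1"
    and ae: "AE x in lebesgue. (\<lambda>k. v k x) \<longlonglongrightarrow> w x"
    and p: "\<And>k. exponent pm P (p k)" and q: "exponent pm P q" and pq: "\<And>x. (\<lambda>k. p k x) \<longlonglongrightarrow> q x"
    and K: "\<And>k. (LINT x|lebesgue. \<bar>v k x\<bar> powr p k x) \<le> K" "(LINT x|lebesgue. \<bar>w x\<bar> powr q x) \<le> K"
  shows "(\<lambda>k. LINT x|lebesgue. odd_power (p k x) (v k x) * \<phi> x) \<longlonglongrightarrow> (LINT x|lebesgue. odd_power (q x) (w x) * \<phi> x)"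
proof -
  have [measurable]: "v k \<in> borel_measurable lebesgue" "w \<in> borel_measurable lebesgue" "\<phi> \<in> borel_measurable lebesgue"
    "p k \<in> borel_measurable lebesgue" "q \<in> borel_measurable lebesgue" for k
    using L2_measurable[OF H1_L2] v w \<phi> exponentD(5)[OF p] exponentD(5)[OF q] by auto
  have K0: "0 \<le> K" by (rule order.trans[OF _ K(2)]) simp
  let ?c = "\<lambda>M p v x. odd_power (p x) (clamp_abs (M * \<bar>\<phi> x\<bar>) (v x)) * \<phi> x"
  have dom: "integrable lebesgue (\<lambda>x. M powr P * ((\<phi> x)\<^sup>2 + \<bar>\<phi> x\<bar> powr P))" for M
    by (intro integrable_mult_right Bochner_Integration.integrable_add L2_real_integrable H1_L2 \<phi>
        H1_power_integrable exponent_subcritical[OF q])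
  have cm: "?c M p v \<in> borel_measurable lebesgue"
    if [measurable]: "v \<in> borel_measurable lebesgue" "p \<in> borel_measurable lebesgue" for M p v
    unfolding odd_power_def clamp_abs_def by measurable
  have cint: "integrable lebesgue (?c M p v)" if "M \<ge> 1" "v \<in> H1" "exponent pm P p" for M p v
  proof (rule Bochner_Integration.integrable_bound[OF dom[of M]])
    show "?c M p v \<in> borel_measurable lebesgue"
      using cm[OF L2_measurable[OF H1_L2[OF that(2)]] exponentD(5)[OF that(3)]] .
    show "AE x in lebesgue. norm (?c M p v x) \<le> norm (M powr P * ((\<phi> x)\<^sup>2 + \<bar>\<phi> x\<bar> powr P))"
    proof (rule AE_I2)
      fix x
      have "\<bar>?c M p v x\<bar> \<le> M powr P * ((\<phi> x)\<^sup>2 + \<bar>\<phi> x\<bar> powr P)"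
        using exponentD(4)[OF that(3), of x] exponentD(3)[OF that(3), of x] that(1) by (intro clamp_abs_dominated) auto
      then show "norm (?c M p v x) \<le> norm (M powr P * ((\<phi> x)\<^sup>2 + \<bar>\<phi> x\<bar> powr P))" by simp
    qed
  qed
  have err: "\<bar>(LINT x|lebesgue. odd_power (p x) (v x) * \<phi> x) - (LINT x|lebesgue. ?c M p v x)\<bar> \<le> (2 / M) * K"
    if M: "M \<ge> 1" and v: "v \<in> H1" and p: "exponent pm P p" and K: "(LINT x|lebesgue. \<bar>v x\<bar> powr p x) \<le> K" for M p v
  proof -
    note i1 = odd_power_integrable[OF p v \<phi>] and i2 = cint[OF M v p]
    have "\<bar>(LINT x|lebesgue. odd_power (p x) (v x) * \<phi> x) - (LINT x|lebesgue. ?c M p v x)\<bar>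
        = \<bar>LINT x|lebesgue. odd_power (p x) (v x) * \<phi> x - ?c M p v x\<bar>"
      using i1 i2 by simp
    also have "\<dots> \<le> (LINT x|lebesgue. \<bar>odd_power (p x) (v x) * \<phi> x - ?c M p v x\<bar>)"
      by (rule integral_abs_bound)
    also have "\<dots> \<le> (LINT x|lebesgue. (2 / M) * \<bar>v x\<bar> powr p x)"
    proof (rule integral_mono)
      show "\<bar>odd_power (p x) (v x) * \<phi> x - ?c M p v x\<bar> \<le> (2 / M) * \<bar>v x\<bar> powr p x" for x
        using M exponentD(4)[OF p, of x] by (intro clamp_abs_error) auto
    qed (use i1 i2 modular_integrable[OF p v] in \<open>auto intro!: integrable_abs\<close>)
    also have "\<dots> = (2 / M) * (LINT x|lebesgue. \<bar>v x\<bar> powr p x)" by simp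
    also have "\<dots> \<le> (2 / M) * K" using K M by (intro mult_left_mono) auto
    finally show ?thesis .
  qed
  have clim: "(\<lambda>k. LINT x|lebesgue. ?c M (p k) (v k) x) \<longlonglongrightarrow> (LINT x|lebesgue. ?c M q w x)" if M: "M \<ge> 1" for M
  proof (rule integral_dominated_convergence[OF _ _ dom[of M]])
    show "AE x in lebesgue. (\<lambda>k. ?c M (p k) (v k) x) \<longlonglongrightarrow> ?c M q w x"
      using ae
    proof eventually_elim
      case (elim x)
      have "(\<lambda>k. clamp_abs (M * \<bar>\<phi> x\<bar>) (v k x)) \<longlonglongrightarrow> clamp_abs (M * \<bar>\<phi> x\<bar>) (w x)"
        unfolding clamp_abs_def by (intro tendsto_intros elim)
      then show ?case
        using less_imp_le[OF exponentD(4)[OF p]] by (intro tendsto_mult_right odd_power_tendsto pq) auto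
    qed
    show "AE x in lebesgue. norm (?c M (p k) (v k) x) \<le> M powr P * ((\<phi> x)\<^sup>2 + \<bar>\<phi> x\<bar> powr P)" for k
      unfolding real_norm_def
      using less_imp_le[OF exponentD(4)[OF p]] exponentD(3)[OF p] M by (intro AE_I2 clamp_abs_dominated) auto
    show "?c M q w \<in> borel_measurable lebesgue" by (rule cm) measurable
    show "?c M (p k) (v k) \<in> borel_measurable lebesgue" for k by (rule cm) measurable
  qed
  show ?thesis
  proof (rule LIMSEQ_I)
    fix \<eta> :: real assume \<eta>: "\<eta> > 0"
    \<comment> \<open>Each of the two truncation errors is then at most \<open>\<eta>/4\<close>.\<close>
    define M where "M = 1 + 8 * K / \<eta>"
    have M: "M \<ge> 1" using K0 \<eta> by (simp add: M_def)
    have MK: "(2 / M) * K \<le> \<eta> / 4"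
    proof -
      have "8 * K \<le> \<eta> * M" using \<eta> by (simp add: M_def field_simps)
      then show ?thesis using M by (simp add: field_simps)
    qed
    obtain n where n: "\<And>k. k \<ge> n \<Longrightarrow> norm ((LINT x|lebesgue. ?c M (p k) (v k) x) - (LINT x|lebesgue. ?c M q w x)) < \<eta> / 2"
      using LIMSEQ_D[OF clim[OF M], of "\<eta> / 2"] \<eta> by auto
    have "norm ((LINT x|lebesgue. odd_power (p k x) (v k x) * \<phi> x) - (LINT x|lebesgue. odd_power (q x) (w x) * \<phi> x)) < \<eta>"
      if "k \<ge> n" for k
    proof -
      have "\<bar>a - d\<bar> < \<eta>" if "\<bar>a - b\<bar> \<le> \<eta> / 4" "\<bar>b - c\<bar> < \<eta> / 2" "\<bar>d - c\<bar> \<le> \<eta> / 4" for a b c d :: real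
        using that by linarith
      from this[OF order.trans[OF err[OF M v p K(1)] MK] _ order.trans[OF err[OF M w q K(2)] MK], of k] n[OF that]
      show ?thesis by simp
    qed
    then show "\<exists>no. \<forall>k\<ge>no. norm ((LINT x|lebesgue. odd_power (p k x) (v k x) * \<phi> x) - (LINT x|lebesgue. odd_power (q x) (w x) * \<phi> x)) < \<eta>"
      by blast
  qed
qed

lemma weakly_converges_subseq:
  "H1_weakly_converges b v w \<Longrightarrow> strict_mono s \<Longrightarrow> H1_weakly_converges b (\<lambda>k. v (s k)) w"
  using LIMSEQ_subseq_LIMSEQ unfolding H1_weakly_converges_def o_def by blast

text \<open>
  Every subsequence has a further subsequence that converges almost everywhere.
\<close>

lemma odd_power_weak_continuity:
  fixes v :: "nat \<Rightarrow> 'a::euclidean_space \<Rightarrow> real"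
  assumes b: "b > 0" and weak: "H1_weakly_converges b v w" and M: "\<And>k. H1_norm b (v k) \<le> M" and \<phi>: "\<phi> \<in> H1"
    and p: "\<And>k. exponent pm P (p k)" and q: "exponent pm P q" and pq: "\<And>x. (\<lambda>k. p k x) \<longlonglongrightarrow> q x"
  shows "(\<lambda>k. LINT x|lebesgue. odd_power (p k x) (v k x) * \<phi> x) \<longlonglongrightarrow> (LINT x|lebesgue. odd_power (q x) (w x) * \<phi> x)"
    (is "?a \<longlonglongrightarrow> ?l")
proof (rule ccontr)
  assume "\<not> ?a \<longlonglongrightarrow> ?l"
  then obtain e where e: "e > 0" "\<not> (\<forall>\<^sub>F k in sequentially. dist (?a k) ?l < e)"
    by (auto simp: tendsto_iff)
  from not_eventually_sequentiallyD[OF e(2)]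
  obtain s :: "nat \<Rightarrow> nat" where "strict_mono s \<and> (\<forall>k. \<not> dist (?a (s k)) ?l < e)" ..
  then have s: "strict_mono s" "\<forall>k. \<not> dist (?a (s k)) ?l < e" by simp_all
  have H: "v k \<in> H1" "w \<in> H1" for k using weak by (auto simp: H1_weakly_converges_def)
  obtain s' where s': "strict_mono s'" "AE x in lebesgue. (\<lambda>k. v (s (s' k)) x) \<longlonglongrightarrow> w x"
    by (rule weakly_convergent_AE_subsequence[OF b weakly_converges_subseq[OF weak s(1)] M]) blast
  define M' where "M' = \<bar>M\<bar> + H1_norm b w + 1"
  have M': "M' > 0" "H1_norm b (v k) \<le> M'" "H1_norm b w \<le> M'" for k
    using M[of k] H1_norm_nonneg[OF b H(2)] by (auto simp: M'_def)
  define B where "B = (1 + 1 / sqrt b) * M'"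
  have sz: "H1_size (v k) B" "H1_size w B" for k
    unfolding B_def using M' by (intro H1_norm_size[OF b] H; simp)+
  obtain K where K: "\<And>(u :: 'a \<Rightarrow> real) pm (p :: 'a \<Rightarrow> real). exponent pm P p \<Longrightarrow> H1_size u B \<Longrightarrow> (LINT x|lebesgue. \<bar>u x\<bar> powr p x) \<le> K"
    using modular_bound[OF exponent_subcritical(1)[OF q], of B] by metis
  have "strict_mono (\<lambda>k. s (s' k))" using s(1) s'(1) by (simp add: strict_mono_def)
  from LIMSEQ_subseq_LIMSEQ[OF pq this] have pq': "(\<lambda>k. p (s (s' k)) x) \<longlonglongrightarrow> q x" for x by (simp add: o_def)
  have "(\<lambda>k. ?a (s (s' k))) \<longlonglongrightarrow> ?l"
    by (rule odd_power_weak_continuity_AE[OF H(1) H(2) \<phi> s'(2) p q pq' K[OF p sz(1)] K[OF q sz(2)]])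
  then have "\<forall>\<^sub>F k in sequentially. dist (?a (s (s' k))) ?l < e" using e(1) by (simp add: tendsto_iff)
  then show False using s(2) by (auto simp: eventually_sequentially)
qed

section \<open>Derivatives of the energy and of the Luxemburg norm\<close>

lemma H1_derivative_quotient:
  assumes b: "b > 0" and D: "has_H1_derivative b F D u" and v: "v \<in> H1"
  shows "(\<lambda>n. (F (\<lambda>x. u x + inverse (real (Suc n)) * v x) - F u) / inverse (real (Suc n))) \<longlonglongrightarrow> D v"
proof (rule LIMSEQ_I)
  fix e :: real assume e: "e > 0"
  define \<epsilon> where "\<epsilon> = e / (2 * (H1_norm b v + 1))"
  have nv: "0 \<le> H1_norm b v" by (rule H1_norm_nonneg[OF b v])
  have \<epsilon>: "\<epsilon> > 0" using e nv by (simp add: \<epsilon>_def)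
  have \<epsilon>v: "\<epsilon> * H1_norm b v < e"
  proof -
    have "\<epsilon> * H1_norm b v \<le> \<epsilon> * (H1_norm b v + 1)" using \<epsilon> by (intro mult_left_mono) auto
    also have "\<dots> = e / 2"
    proof -
      have "e / (2 * c) * c = e / 2" if "c > 0" for c using that by simp
      from this[of "H1_norm b v + 1"] show ?thesis using nv by (simp add: \<epsilon>_def)
    qed
    finally show ?thesis using e by simp
  qed
  obtain \<delta> where \<delta>: "\<delta> > 0" "\<And>h. h \<in> H1 \<Longrightarrow> H1_norm b h < \<delta> \<Longrightarrow>
      \<bar>F (\<lambda>x. u x + h x) - F u - D h\<bar> \<le> \<epsilon> * H1_norm b h"
    using D \<epsilon> unfolding has_H1_derivative_def by metis
  have "(\<lambda>n. inverse (real (Suc n)) * H1_norm b v) \<longlonglongrightarrow> 0 * H1_norm b v"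
    by (intro tendsto_mult_right LIMSEQ_inverse_real_of_nat)
  then have "\<forall>\<^sub>F n in sequentially. inverse (real (Suc n)) * H1_norm b v < \<delta>"
    using \<delta>(1) by (intro order_tendstoD(2)) auto
  then obtain N where N: "\<And>n. n \<ge> N \<Longrightarrow> inverse (real (Suc n)) * H1_norm b v < \<delta>"
    by (auto simp: eventually_sequentially)
  have "norm ((F (\<lambda>x. u x + inverse (real (Suc n)) * v x) - F u) / inverse (real (Suc n)) - D v) < e" if n: "n \<ge> N" for n
  proof -
    define t where "t = inverse (real (Suc n))"
    have t: "t > 0" by (simp add: t_def)
    have nt: "H1_norm b (\<lambda>x. t * v x) = t * H1_norm b v" using t by (simp add: H1_norm_scale[OF b v])
    have Dt: "D (\<lambda>x. t * v x) = t * D v" using D v by (simp add: has_H1_derivative_def H1_dual_def)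
    have "H1_norm b (\<lambda>x. t * v x) < \<delta>" unfolding nt using N[OF n] by (simp only: t_def)
    from \<delta>(2)[OF H1_scale[OF v] this]
    have "\<bar>F (\<lambda>x. u x + t * v x) - F u - t * D v\<bar> \<le> \<epsilon> * (t * H1_norm b v)"
      unfolding nt Dt .
    then have "\<bar>F (\<lambda>x. u x + t * v x) - F u - t * D v\<bar> / t \<le> \<epsilon> * H1_norm b v"
      using t by (simp add: pos_divide_le_eq mult_ac)
    also have "\<bar>F (\<lambda>x. u x + t * v x) - F u - t * D v\<bar> / t = \<bar>(F (\<lambda>x. u x + t * v x) - F u) / t - D v\<bar>"
    proof -
      have "\<bar>x - t * d\<bar> / t = \<bar>x / t - d\<bar>" for x d
      proof -
        have "x / t - d = (x - t * d) / t" using t by (simp add: field_simps)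
        then show ?thesis using t by (simp add: abs_divide)
      qed
      then show ?thesis .
    qed
    finally show ?thesis using \<epsilon>v by (simp add: t_def)
  qed
  then show "\<exists>no. \<forall>n\<ge>no. norm ((F (\<lambda>x. u x + inverse (real (Suc n)) * v x) - F u) / inverse (real (Suc n)) - D v) < e"
    by blast
qed

lemma energy_derivative:
  assumes b: "b > 0" and V: "V \<in> L_infinity" and u: "u \<in> H1" and v: "v \<in> H1"
    and D: "has_H1_derivative b (energy V) D u"
  shows "D v = 2 * form V u v"
proof -
  have exp: "energy V (\<lambda>x. u x + t * v x) = energy V u + 2 * t * form V u v + t\<^sup>2 * form V v v" for t
  proof -
    have tv: "(\<lambda>x. t * v x) \<in> H1" and utv: "(\<lambda>x. u x + t * v x) \<in> H1" using u v by (auto intro: H1_add H1_scale)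
    have "form V (\<lambda>x. u x + t * v x) w = form V u w + t * form V v w" if "w \<in> H1" for w
      by (simp add: form_add_left[OF V u tv that] form_scale_left[OF V v that])
    then show ?thesis
      using form_commute[of V u "\<lambda>x. u x + t * v x"] form_commute[of V v "\<lambda>x. u x + t * v x"] form_commute[of V v u]
      by (simp add: energy_form u v utv algebra_simps power2_eq_square)
  qed
  have "(\<lambda>n. 2 * form V u v + inverse (real (Suc n)) * form V v v) \<longlonglongrightarrow> 2 * form V u v + 0 * form V v v"
    by (intro tendsto_intros LIMSEQ_inverse_real_of_nat)
  moreover have "(energy V (\<lambda>x. u x + inverse (real (Suc n)) * v x) - energy V u) / inverse (real (Suc n))
      = 2 * form V u v + inverse (real (Suc n)) * form V v v" for n
  proof -
    have "(x + 2 * t * a + t\<^sup>2 * c - x) / t = 2 * a + t * c" if "t \<noteq> 0" for x t a c :: real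
      using that by (simp add: field_simps power2_eq_square)
    from this[of "inverse (real (Suc n))"] show ?thesis unfolding exp by simp
  qed
  ultimately have "(\<lambda>n. (energy V (\<lambda>x. u x + inverse (real (Suc n)) * v x) - energy V u) / inverse (real (Suc n)))
      \<longlonglongrightarrow> 2 * form V u v" by simp
  then show ?thesis using H1_derivative_quotient[OF b D v] LIMSEQ_unique by blast
qed

lemma exponent_pos: "exponent pm P p \<Longrightarrow> 0 < p x"
  using exponentD(4)[of pm P p x] by simp

definition weighted_modular :: "('a::euclidean_space \<Rightarrow> real) \<Rightarrow> ('a \<Rightarrow> real) \<Rightarrow> real" where
  "weighted_modular p u = (LINT x|lebesgue. \<bar>u x\<bar> powr p x / p x)"

lemma weighted_modular_integrable:
  assumes p: "exponent pm P p" and u: "u \<in> H1"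
  shows "integrable lebesgue (\<lambda>x. \<bar>u x\<bar> powr p x / p x)"
proof (rule Bochner_Integration.integrable_bound[OF modular_integrable[OF p u]])
  have [measurable]: "u \<in> borel_measurable lebesgue" "p \<in> borel_measurable lebesgue"
    using L2_measurable[OF H1_L2[OF u]] exponentD(5)[OF p] .
  show "(\<lambda>x. \<bar>u x\<bar> powr p x / p x) \<in> borel_measurable lebesgue" by measurable
  show "AE x in lebesgue. norm (\<bar>u x\<bar> powr p x / p x) \<le> norm (\<bar>u x\<bar> powr p x)"
  proof (rule AE_I2)
    fix x
    have "\<bar>u x\<bar> powr p x / p x \<le> \<bar>u x\<bar> powr p x / 1" using exponentD(4)[OF p, of x] by (intro divide_left_mono) auto
    then show "norm (\<bar>u x\<bar> powr p x / p x) \<le> norm (\<bar>u x\<bar> powr p x)" using exponentD(4)[OF p, of x] by simp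
  qed
qed

lemma luxemburg_eq:
  assumes p: "exponent pm P p" and u: "u \<in> H1"
  shows "luxemburg p u = Inf {\<gamma>. \<gamma> > 0 \<and> weighted_modular p (\<lambda>x. inverse \<gamma> * u x) \<le> 1}"
proof -
  have "(\<integral>\<^sup>+ x. ennreal (\<bar>u x / \<gamma>\<bar> powr p x / p x) \<partial>lebesgue) \<le> 1 \<longleftrightarrow> weighted_modular p (\<lambda>x. inverse \<gamma> * u x) \<le> 1" for \<gamma>
  proof -
    have "(\<integral>\<^sup>+ x. ennreal (\<bar>u x / \<gamma>\<bar> powr p x / p x) \<partial>lebesgue)
        = (\<integral>\<^sup>+ x. ennreal (\<bar>inverse \<gamma> * u x\<bar> powr p x / p x) \<partial>lebesgue)"
      by (simp add: divide_inverse mult.commute)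
    also have "\<dots> = ennreal (weighted_modular p (\<lambda>x. inverse \<gamma> * u x))"
      unfolding weighted_modular_def
      by (rule nn_integral_eq_integral[OF weighted_modular_integrable[OF p H1_scale[OF u]]])
        (auto intro!: AE_I2 divide_nonneg_pos exponent_pos[OF p])
    finally show ?thesis by (simp add: ennreal_le_1)
  qed
  then show ?thesis by (simp add: luxemburg_def)
qed

lemma weighted_modular_scale_mono:
  assumes p: "exponent pm P p" and u: "u \<in> H1" and ab: "0 \<le> a" "a \<le> c"
  shows "weighted_modular p (\<lambda>x. a * u x) \<le> weighted_modular p (\<lambda>x. c * u x)"
  unfolding weighted_modular_def
proof (rule integral_mono)
  fix x
  have "\<bar>a * u x\<bar> \<le> \<bar>c * u x\<bar>" using ab by (simp add: abs_mult mult_right_mono)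
  then show "\<bar>a * u x\<bar> powr p x / p x \<le> \<bar>c * u x\<bar> powr p x / p x"
    using exponentD(4)[OF p, of x] by (intro divide_right_mono powr_mono2) auto
qed (intro weighted_modular_integrable[OF p] H1_scale u)+

lemma weighted_modular_scale_tendsto:
  assumes p: "exponent pm P p" and u: "u \<in> H1" and a: "a \<longlonglongrightarrow> c" and c: "0 < c"
  shows "(\<lambda>n. weighted_modular p (\<lambda>x. a n * u x)) \<longlonglongrightarrow> weighted_modular p (\<lambda>x. c * u x)"
proof -
  have "Bseq a" using a by (meson Bseq_conv_Bfun convergentI convergent_imp_Bseq)
  then obtain A where A: "A > 0" "\<And>n. \<bar>a n\<bar> \<le> A" by (auto simp: Bseq_def)
  show ?thesis
    unfolding weighted_modular_def
  proof (rule integral_dominated_convergence[where w="\<lambda>x. \<bar>A * u x\<bar> powr p x / p x"])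
    show "integrable lebesgue (\<lambda>x. \<bar>A * u x\<bar> powr p x / p x)"
      by (rule weighted_modular_integrable[OF p H1_scale[OF u]])
    show "AE x in lebesgue. (\<lambda>n. \<bar>a n * u x\<bar> powr p x / p x) \<longlonglongrightarrow> \<bar>c * u x\<bar> powr p x / p x"
    proof (rule AE_I2)
      fix x
      show "(\<lambda>n. \<bar>a n * u x\<bar> powr p x / p x) \<longlonglongrightarrow> \<bar>c * u x\<bar> powr p x / p x"
      proof (cases "u x = 0")
        case False
        then show ?thesis using exponentD(4)[OF p, of x] c by (intro tendsto_intros a) auto
      qed simp
    qed
    show "AE x in lebesgue. norm (\<bar>a n * u x\<bar> powr p x / p x) \<le> \<bar>A * u x\<bar> powr p x / p x" for n
    proof (rule AE_I2)
      fix x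
      have "\<bar>a n * u x\<bar> \<le> \<bar>A * u x\<bar>" using A by (simp add: abs_mult mult_right_mono)
      then have "\<bar>a n * u x\<bar> powr p x / p x \<le> \<bar>A * u x\<bar> powr p x / p x"
        using exponentD(4)[OF p, of x] by (intro divide_right_mono powr_mono2) auto
      then show "norm (\<bar>a n * u x\<bar> powr p x / p x) \<le> \<bar>A * u x\<bar> powr p x / p x"
        using exponentD(4)[OF p, of x] by simp
    qed
  qed (intro borel_measurable_integrable weighted_modular_integrable[OF p] H1_scale u)+
qed

text \<open>
  Under scaling the weighted modular is monotone and continuous, so that its value at the infimum defining the norm is
  the threshold.
\<close>

lemma weighted_modular_at_luxemburg:
  assumes p: "exponent pm P p" and u: "u \<in> H1" and pos: "luxemburg p u > 0"
  shows "weighted_modular p (\<lambda>x. inverse (luxemburg p u) * u x) = 1"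
proof (rule antisym)
  let ?\<Phi> = "\<lambda>\<gamma>. weighted_modular p (\<lambda>x. inverse \<gamma> * u x)"
  define S where "S = {\<gamma>. \<gamma> > 0 \<and> ?\<Phi> \<gamma> \<le> 1}"
  define L where "L = luxemburg p u"
  have L: "L = Inf S" "L > 0" using luxemburg_eq[OF p u] pos by (auto simp: L_def S_def)
  have below: "\<And>s. s \<in> S \<Longrightarrow> L \<le> s"
    unfolding L(1) by (rule cInf_lower) (auto simp: S_def intro!: bdd_belowI[of _ 0])
  have ne: "S \<noteq> {}"
  proof -
    let ?c = "weighted_modular p u"
    have c0: "?c \<ge> 0" unfolding weighted_modular_def
      by (intro Bochner_Integration.integral_nonneg divide_nonneg_pos exponent_pos[OF p]) simp
    \<comment> \<open>As the exponents exceed \<open>1\<close>, dividing by \<open>g \<ge> 1\<close> reduces the modular at least by the factor \<open>g\<close>.\<close>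
    define g where "g = 1 + ?c"
    have g: "g \<ge> 1" using c0 by (simp add: g_def)
    have "?\<Phi> g \<le> (LINT x|lebesgue. inverse g * (\<bar>u x\<bar> powr p x / p x))"
      unfolding weighted_modular_def
    proof (rule integral_mono)
      fix x
      have "\<bar>inverse g * u x\<bar> powr p x = inverse g powr p x * \<bar>u x\<bar> powr p x"
        using g by (simp add: abs_mult powr_mult)
      also have "inverse g powr p x \<le> inverse g powr 1"
        using g exponentD(4)[OF p, of x] by (intro powr_mono') (auto simp: field_simps)
      finally have "\<bar>inverse g * u x\<bar> powr p x \<le> inverse g * \<bar>u x\<bar> powr p x"
        using g by (simp add: mult_right_mono)
      then have "\<bar>inverse g * u x\<bar> powr p x / p x \<le> (inverse g * \<bar>u x\<bar> powr p x) / p x"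
        using exponentD(4)[OF p, of x] by (intro divide_right_mono) auto
      then show "\<bar>inverse g * u x\<bar> powr p x / p x \<le> inverse g * (\<bar>u x\<bar> powr p x / p x)" by simp
    qed (intro integrable_mult_right weighted_modular_integrable[OF p] H1_scale u)+
    also have "\<dots> = inverse g * ?c" unfolding weighted_modular_def by (rule integral_mult_right_zero)
    also have "\<dots> \<le> 1" using g c0 by (simp add: g_def field_simps)
    finally show ?thesis using g by (auto simp: S_def intro!: exI[of _ g])
  qed
  have above: "?\<Phi> \<gamma> \<le> 1" if gt: "\<gamma> > L" for \<gamma>
  proof -
    obtain s where s: "s \<in> S" "s < \<gamma>" using cInf_lessD[OF ne, of \<gamma>] gt L(1) by auto
    then have "?\<Phi> \<gamma> \<le> ?\<Phi> s"
      by (intro weighted_modular_scale_mono[OF p u]) (auto simp: S_def intro!: le_imp_inverse_le)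
    then show ?thesis using s by (simp add: S_def)
  qed
  \<comment> \<open>The double successor keeps \<open>1 - 1/(n+2)\<close> positive.\<close>
  have seq: "(\<lambda>n. inverse (real (Suc (Suc n)))) \<longlonglongrightarrow> 0"
    using LIMSEQ_Suc[OF LIMSEQ_inverse_real_of_nat] .
  show "?\<Phi> (luxemburg p u) \<le> 1"
  proof (rule LIMSEQ_le_const2)
    have "(\<lambda>n. inverse (L * (1 + inverse (real (Suc (Suc n)))))) \<longlonglongrightarrow> inverse (L * (1 + 0))"
      using L by (intro tendsto_intros seq) auto
    then have "(\<lambda>n. inverse (L * (1 + inverse (real (Suc (Suc n)))))) \<longlonglongrightarrow> inverse L" by simp
    from weighted_modular_scale_tendsto[OF p u this] L
    show "(\<lambda>n. ?\<Phi> (L * (1 + inverse (real (Suc (Suc n)))))) \<longlonglongrightarrow> ?\<Phi> (luxemburg p u)" by (simp add: L_def)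
    have "L < L * (1 + inverse (real (Suc (Suc n))))" for n using L by simp
    then show "\<exists>N. \<forall>n\<ge>N. ?\<Phi> (L * (1 + inverse (real (Suc (Suc n))))) \<le> 1" using above by blast
  qed
  show "1 \<le> ?\<Phi> (luxemburg p u)"
  proof (rule LIMSEQ_le_const)
    have "(\<lambda>n. inverse (L * (1 - inverse (real (Suc (Suc n)))))) \<longlonglongrightarrow> inverse (L * (1 - 0))"
      using L by (intro tendsto_intros seq) auto
    then have "(\<lambda>n. inverse (L * (1 - inverse (real (Suc (Suc n)))))) \<longlonglongrightarrow> inverse L" by simp
    from weighted_modular_scale_tendsto[OF p u this] L
    show "(\<lambda>n. ?\<Phi> (L * (1 - inverse (real (Suc (Suc n)))))) \<longlonglongrightarrow> ?\<Phi> (luxemburg p u)" by (simp add: L_def)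
    have "1 \<le> ?\<Phi> (L * (1 - inverse (real (Suc (Suc n)))))" for n
    proof -
      have i: "0 < 1 - inverse (real (Suc (Suc n)))" "1 - inverse (real (Suc (Suc n))) < 1" by (auto simp: field_simps)
      have "L * (1 - inverse (real (Suc (Suc n)))) < L * 1" using L i(2) by (intro mult_strict_left_mono) auto
      then have "L * (1 - inverse (real (Suc (Suc n)))) \<notin> S" using below by fastforce
      moreover have "0 < L * (1 - inverse (real (Suc (Suc n))))" using L(2) i(1) by (rule mult_pos_pos)
      ultimately show ?thesis unfolding S_def by simp
    qed
    then show "\<exists>N. \<forall>n\<ge>N. 1 \<le> ?\<Phi> (L * (1 - inverse (real (Suc (Suc n)))))" by blast
  qed
qed

lemma powr_add_bound:
  fixes a b p P :: real
  assumes "0 \<le> a" "0 \<le> b" "0 \<le> p" "p \<le> P"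
  shows "(a + b) powr p \<le> 2 powr P * (a powr p + b powr p)"
proof -
  have "(a + b) powr p \<le> (2 * max a b) powr p" using assms by (intro powr_mono2) auto
  also have "\<dots> = 2 powr p * max a b powr p" by (rule powr_mult)
  also have "\<dots> \<le> 2 powr P * (a powr p + b powr p)"
    using assms by (intro mult_mono powr_mono) (auto simp: max_def)
  finally show ?thesis .
qed

text \<open>
  The function \<open>u + t v\<close> divided by its Luxemburg norm stays on the level set of the weighted modular;
  differentiating this at \<open>t = 0\<close> gives the derivative of the norm.
\<close>

lemma luxemburg_derivative:
  assumes b: "b > 0" and p: "exponent pm P p" and u: "u \<in> H1" and v: "v \<in> H1"
    and lux: "luxemburg p u = 1" and E: "has_H1_derivative b (luxemburg p) E u"
  shows "(LINT x|lebesgue. odd_power (p x) (u x) * v x) = E v * modular p u"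
proof -
  define t where "t n = inverse (real (Suc n))" for n
  have t: "0 < t n" "t n \<le> 1" "t \<longlonglongrightarrow> 0" for n
    using LIMSEQ_inverse_real_of_nat by (auto simp: t_def[abs_def] inverse_le_1_iff)
  define \<gamma> where "\<gamma> n = luxemburg p (\<lambda>x. u x + t n * v x)" for n
  \<comment> \<open>The difference quotients of the norm.\<close>
  define e where "e n = (\<gamma> n - 1) / t n" for n
  have e: "e \<longlonglongrightarrow> E v"
    using H1_derivative_quotient[OF b E v] by (simp add: e_def[abs_def] \<gamma>_def t_def lux)
  have \<gamma>e: "\<gamma> n = 1 + t n * e n" for n using t(1)[of n] by (simp add: e_def)
  have \<gamma>lim: "\<gamma> \<longlonglongrightarrow> 1"
  proof -
    have "(\<lambda>n. 1 + t n * e n) \<longlonglongrightarrow> 1 + 0 * E v" by (intro tendsto_intros t e)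
    then show ?thesis by (simp add: \<gamma>e[abs_def])
  qed
  have "Bseq e" using e by (meson convergentI convergent_imp_Bseq)
  then obtain A where A: "A > 0" "\<And>n. \<bar>e n\<bar> \<le> A" by (auto simp: Bseq_def)
  have "\<forall>\<^sub>F n in sequentially. \<gamma> n > 1 / 2" using order_tendstoD(1)[OF \<gamma>lim, of "1/2"] by simp
  then obtain N where N: "\<And>n. n \<ge> N \<Longrightarrow> \<gamma> n > 1 / 2" by (auto simp: eventually_sequentially)
  \<comment> \<open>The normalized function is \<open>w n = u + t n * a n\<close>, where \<open>a n\<close> tends to \<open>v - E v * u\<close>.\<close>
  define a where "a n x = (v x - e n * u x) / \<gamma> n" for n x
  define w where "w n x = u x + t n * a n x" for n x
  have w_eq: "w n x = inverse (\<gamma> n) * (u x + t n * v x)" if "n \<ge> N" for n x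
  proof -
    have g: "\<gamma> n \<noteq> 0" using N[OF that] by auto
    have "w n x * \<gamma> n = u x * \<gamma> n + t n * (v x - e n * u x)" using g by (simp add: w_def a_def field_simps)
    also have "\<dots> = u x + t n * v x" by (simp add: \<gamma>e algebra_simps)
    finally show ?thesis using g by (simp add: field_simps)
  qed
  have aH: "a n \<in> H1" for n
  proof -
    have "(\<lambda>x. inverse (\<gamma> n) * (v x - e n * u x)) \<in> H1" by (intro H1_scale H1_diff u v)
    then show ?thesis by (simp add: a_def[abs_def] divide_inverse mult.commute)
  qed
  have wH: "w n \<in> H1" for n unfolding w_def[abs_def] by (intro H1_add u H1_scale aH)
  define q where "q n x = (\<bar>w n x\<bar> powr p x / p x - \<bar>u x\<bar> powr p x / p x) / t n" for n x
  have q0: "(LINT x|lebesgue. q n x) = 0" if n: "n \<ge> N" for n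
  proof -
    have H: "(\<lambda>x. u x + t n * v x) \<in> H1" by (intro H1_add u H1_scale v)
    have "weighted_modular p (w n) = 1"
      using weighted_modular_at_luxemburg[OF p H] N[OF n] by (simp add: w_eq[OF n, abs_def] \<gamma>_def)
    moreover have "weighted_modular p u = 1" using weighted_modular_at_luxemburg[OF p u] lux by simp
    ultimately show ?thesis
      using weighted_modular_integrable[OF p wH[of n]] weighted_modular_integrable[OF p u]
      by (simp add: q_def weighted_modular_def)
  qed
  \<comment> \<open>For \<open>n \<ge> N\<close>, where \<open>\<gamma> n > 1/2\<close>, this bounds \<open>u\<close>, \<open>a n\<close> and \<open>w n\<close>.\<close>
  define Z where "Z x = (4 + 2 * A) * \<bar>u x\<bar> + 4 * \<bar>v x\<bar>" for x
  have Zint: "integrable lebesgue (\<lambda>x. Z x powr p x)"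
  proof (rule Bochner_Integration.integrable_bound)
    show "integrable lebesgue (\<lambda>x. 2 powr P * (\<bar>(4 + 2 * A) * u x\<bar> powr p x + \<bar>4 * v x\<bar> powr p x))"
      by (intro integrable_mult_right Bochner_Integration.integrable_add modular_integrable[OF p] H1_scale u v)
    have [measurable]: "u \<in> borel_measurable lebesgue" "v \<in> borel_measurable lebesgue" "p \<in> borel_measurable lebesgue"
      using L2_measurable[OF H1_L2] u v exponentD(5)[OF p] by auto
    show "(\<lambda>x. Z x powr p x) \<in> borel_measurable lebesgue" unfolding Z_def by measurable
    show "AE x in lebesgue. norm (Z x powr p x) \<le> norm (2 powr P * (\<bar>(4 + 2 * A) * u x\<bar> powr p x + \<bar>4 * v x\<bar> powr p x))"
    proof (rule AE_I2)
      fix x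
      have "Z x powr p x \<le> 2 powr P * (((4 + 2 * A) * \<bar>u x\<bar>) powr p x + (4 * \<bar>v x\<bar>) powr p x)"
        unfolding Z_def using A exponentD(4)[OF p, of x] exponentD(3)[OF p, of x] by (intro powr_add_bound) auto
      then show "norm (Z x powr p x) \<le> norm (2 powr P * (\<bar>(4 + 2 * A) * u x\<bar> powr p x + \<bar>4 * v x\<bar> powr p x))"
        using A by (simp add: abs_mult)
    qed
  qed
  have lim: "(\<lambda>n. LINT x|lebesgue. q (n + N) x) \<longlonglongrightarrow> (LINT x|lebesgue. odd_power (p x) (u x) * (v x - E v * u x))"
  proof (rule integral_dominated_convergence[OF _ _ Zint])
    show "(\<lambda>x. odd_power (p x) (u x) * (v x - E v * u x)) \<in> borel_measurable lebesgue"
      by (intro borel_measurable_integrable odd_power_integrable[OF p u] H1_diff H1_scale u v)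
    show "q (n + N) \<in> borel_measurable lebesgue" for n
    proof -
      have [measurable]: "w (n + N) \<in> borel_measurable lebesgue" "u \<in> borel_measurable lebesgue" "p \<in> borel_measurable lebesgue"
        using L2_measurable[OF H1_L2] wH u exponentD(5)[OF p] by auto
      show ?thesis unfolding q_def[abs_def] by measurable
    qed
    show "AE x in lebesgue. (\<lambda>n. q (n + N) x) \<longlonglongrightarrow> odd_power (p x) (u x) * (v x - E v * u x)"
    proof (rule AE_I2)
      fix x
      have alim: "(\<lambda>n. a n x) \<longlonglongrightarrow> (v x - E v * u x) / 1"
        unfolding a_def by (intro tendsto_intros e \<gamma>lim) simp
      have wlim: "(\<lambda>n. w n x) \<longlonglongrightarrow> u x"
      proof -
        have "(\<lambda>n. u x + t n * a n x) \<longlonglongrightarrow> u x + 0 * ((v x - E v * u x) / 1)" by (intro tendsto_intros t alim)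
        then show ?thesis by (simp add: w_def)
      qed
      have "p x > 1" using exponentD(4)[OF p, of x] by simp
      \<comment> \<open>Caratheodory's form of the derivative copes with the varying direction \<open>a n x\<close>.\<close>
      from has_derivative_abs_powr[OF this, of "u x"] obtain g where
        g: "\<And>z. \<bar>z\<bar> powr p x / p x - \<bar>u x\<bar> powr p x / p x = g z * (z - u x)" "isCont g (u x)" "g (u x) = odd_power (p x) (u x)"
        unfolding CARAT_DERIV by metis
      have "q n x = g (w n x) * a n x" for n
        using t(1)[of n] by (simp add: q_def g(1) w_def)
      moreover have "(\<lambda>n. g (w n x) * a n x) \<longlonglongrightarrow> g (u x) * ((v x - E v * u x) / 1)"
        by (intro tendsto_mult alim isCont_tendsto_compose[OF g(2) wlim])
      ultimately have "(\<lambda>n. q n x) \<longlonglongrightarrow> odd_power (p x) (u x) * (v x - E v * u x)" by (simp add: g(3))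
      then show "(\<lambda>n. q (n + N) x) \<longlonglongrightarrow> odd_power (p x) (u x) * (v x - E v * u x)"
        by (rule LIMSEQ_ignore_initial_segment)
    qed
    show "AE x in lebesgue. norm (q (n + N) x) \<le> Z x powr p x" for n
    proof (rule AE_I2)
      fix x
      define k where "k = n + N"
      have k: "\<gamma> k > 1 / 2" using N[of k] by (simp add: k_def)
      have Z0: "0 \<le> Z x" using A by (simp add: Z_def)
      have absa: "\<bar>a k x\<bar> \<le> 2 * (\<bar>v x\<bar> + A * \<bar>u x\<bar>)"
      proof -
        have "\<bar>v x - e k * u x\<bar> \<le> \<bar>v x\<bar> + \<bar>e k\<bar> * \<bar>u x\<bar>" using abs_triangle_ineq4[of "v x" "e k * u x"] by (simp add: abs_mult)
        also have "\<dots> \<le> \<bar>v x\<bar> + A * \<bar>u x\<bar>" using A(2)[of k] by (intro add_left_mono mult_right_mono) auto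
        finally have "\<bar>v x - e k * u x\<bar> / \<gamma> k \<le> (\<bar>v x\<bar> + A * \<bar>u x\<bar>) / (1 / 2)" using k A by (intro frac_le) auto
        then show ?thesis using k by (simp add: a_def)
      qed
      have aZ: "\<bar>a k x\<bar> \<le> Z x" unfolding Z_def using absa A by (simp add: algebra_simps)
      have "\<bar>t k * a k x\<bar> \<le> 1 * \<bar>a k x\<bar>" unfolding abs_mult using t(1,2)[of k] by (intro mult_right_mono) auto
      then have "\<bar>w k x\<bar> \<le> \<bar>u x\<bar> + \<bar>a k x\<bar>" unfolding w_def using abs_triangle_ineq[of "u x" "t k * a k x"] by linarith
      moreover have "\<bar>u x\<bar> + 2 * (\<bar>v x\<bar> + A * \<bar>u x\<bar>) \<le> Z x" unfolding Z_def by (simp add: algebra_simps)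
      ultimately have wZ: "\<bar>w k x\<bar> \<le> Z x" using absa by linarith
      have uZ: "\<bar>u x\<bar> \<le> Z x"
      proof -
        have "0 \<le> A * \<bar>u x\<bar>" using A by simp
        then show ?thesis unfolding Z_def by (simp add: algebra_simps)
      qed
      have px: "p x > 1" using exponentD(4)[OF p, of x] by simp
      have "\<bar>\<bar>w k x\<bar> powr p x - \<bar>u x\<bar> powr p x\<bar> \<le> p x * Z x powr (p x - 1) * \<bar>w k x - u x\<bar>"
        by (rule abs_powr_difference[OF px wZ uZ])
      also have "\<bar>w k x - u x\<bar> = t k * \<bar>a k x\<bar>" using t(1)[of k] by (simp add: w_def abs_mult)
      also have "p x * Z x powr (p x - 1) * (t k * \<bar>a k x\<bar>) \<le> p x * Z x powr (p x - 1) * (t k * Z x)"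
        using aZ t(1)[of k] px by (intro mult_left_mono) auto
      also have "\<dots> = p x * t k * Z x powr p x"
        using abs_powr_Suc[of "Z x" "p x"] Z0 by (simp add: mult_ac)
      finally have "\<bar>\<bar>w k x\<bar> powr p x - \<bar>u x\<bar> powr p x\<bar> \<le> p x * t k * Z x powr p x" .
      moreover have "\<bar>q k x\<bar> = \<bar>\<bar>w k x\<bar> powr p x - \<bar>u x\<bar> powr p x\<bar> / (p x * t k)"
        using px t(1)[of k] by (simp add: q_def abs_divide abs_mult flip: diff_divide_distrib)
      ultimately show "norm (q (n + N) x) \<le> Z x powr p x"
        using px t(1)[of k] by (simp add: k_def[symmetric] pos_divide_le_eq mult_ac)
    qed
  qed
  then have "(LINT x|lebesgue. odd_power (p x) (u x) * (v x - E v * u x)) = 0"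
    by (simp add: q0 LIMSEQ_const_iff)
  moreover have "(LINT x|lebesgue. odd_power (p x) (u x) * (v x - E v * u x))
      = (LINT x|lebesgue. odd_power (p x) (u x) * v x) - E v * modular p u"
  proof -
    have "(LINT x|lebesgue. odd_power (p x) (u x) * (v x - E v * u x))
        = (LINT x|lebesgue. odd_power (p x) (u x) * v x - E v * (odd_power (p x) (u x) * u x))"
      by (intro Bochner_Integration.integral_cong) (auto simp: algebra_simps)
    also have "\<dots> = (LINT x|lebesgue. odd_power (p x) (u x) * v x) - E v * (LINT x|lebesgue. odd_power (p x) (u x) * u x)"
      using odd_power_integrable[OF p u v] odd_power_integrable[OF p u u] by simp
    finally show ?thesis by (simp add: odd_power_self modular_def)
  qed
  ultimately show ?thesis by simp
qed

text \<open>
  On the constraint \<open>\<bar>u\<bar> powr p / p\<close> has integral \<open>1\<close>, and \<open>pm \<le> p \<le> P\<close>.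
\<close>

lemma modular_on_manifold:
  assumes p: "exponent pm P p" and u: "u \<in> H1" and lux: "luxemburg p u = 1"
  shows "pm \<le> modular p u" "modular p u \<le> P"
proof -
  have 1: "weighted_modular p u = 1" using weighted_modular_at_luxemburg[OF p u] lux by simp
  note wi = weighted_modular_integrable[OF p u] and mi = modular_integrable[OF p u]
  have pw: "pm * (\<bar>u x\<bar> powr p x / p x) \<le> \<bar>u x\<bar> powr p x" "\<bar>u x\<bar> powr p x \<le> P * (\<bar>u x\<bar> powr p x / p x)" for x
  proof -
    have px: "p x > 0" "pm \<le> p x" "p x \<le> P" using exponentD[OF p] order.strict_trans[of 0 2 "p x"] by auto
    define Y where "Y = \<bar>u x\<bar> powr p x / p x"
    have Y: "\<bar>u x\<bar> powr p x = p x * Y" "0 \<le> Y" using px by (simp_all add: Y_def)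
    have "pm * Y \<le> p x * Y" "p x * Y \<le> P * Y" using px Y(2) by (auto intro!: mult_right_mono)
    then show "pm * (\<bar>u x\<bar> powr p x / p x) \<le> \<bar>u x\<bar> powr p x" "\<bar>u x\<bar> powr p x \<le> P * (\<bar>u x\<bar> powr p x / p x)"
      unfolding Y_def[symmetric] Y(1) by simp_all
  qed
  have "(LINT x|lebesgue. pm * (\<bar>u x\<bar> powr p x / p x)) \<le> modular p u"
    unfolding modular_def by (intro integral_mono integrable_mult_right wi mi pw)
  then show "pm \<le> modular p u"
    using 1 unfolding integral_mult_right_zero weighted_modular_def by simp
  have "modular p u \<le> (LINT x|lebesgue. P * (\<bar>u x\<bar> powr p x / p x))"
    unfolding modular_def by (intro integral_mono integrable_mult_right wi mi pw)
  then show "modular p u \<le> P"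
    using 1 unfolding integral_mult_right_zero weighted_modular_def by simp
qed

section \<open>Profiles of an almost critical sequence\<close>

lemma average_local_bound:
  fixes f :: "'a::euclidean_space \<Rightarrow> real"
  assumes l: "l > 0" and f: "f \<in> L2" and x: "norm x \<le> R"
  shows "\<bar>average l f x\<bar> \<le> sqrt (LINT x|lebesgue. indicat_real (cball 0 (R + sqrt (real DIM('a)) * l)) x * (f x)\<^sup>2)
    / sqrt (l ^ DIM('a))"
proof -
  let ?S = "cball 0 (R + sqrt (real DIM('a)) * l) :: 'a set"
  have "average l f x = average l (\<lambda>x. indicat_real ?S x * f x) x"
  proof -
    have eq: "indicat_real (cube l) z * f (x + z) = indicat_real (cube l) z * (indicat_real ?S (x + z) * f (x + z))" for z
    proof (cases "z \<in> cube l")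
      case True
      have "norm z \<le> sqrt (real DIM('a) * l\<^sup>2)" using cube_norm[OF True] by (rule real_le_rsqrt)
      also have "\<dots> = sqrt (real DIM('a)) * l" using l by (simp add: real_sqrt_mult)
      finally have "norm (x + z) \<le> R + sqrt (real DIM('a)) * l" using x norm_triangle_ineq[of x z] by linarith
      then show ?thesis by simp
    qed simp
    show ?thesis unfolding average_def by (simp only: eq)
  qed
  moreover have "(\<lambda>x. indicat_real ?S x * f x) \<in> L2" by (rule L2_indicator_mult[OF f]) simp
  ultimately show ?thesis
    using average_bound[OF l, of "\<lambda>x. indicat_real ?S x * f x" x]
    by (simp add: power_mult_distrib indicator_power2)
qed

lemma H1_norm_zero_AE:
  assumes b: "b > 0" and w: "w \<in> H1" and 0: "H1_norm b w = 0"
  shows "AE x in lebesgue. w x = 0"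
proof -
  have "(LINT x|lebesgue. (w x)\<^sup>2) \<le> 0" using L2_le_H1_norm[OF b w] 0 by simp
  moreover have "0 \<le> (LINT x|lebesgue. (w x)\<^sup>2)" by simp
  ultimately have "(LINT x|lebesgue. (w x)\<^sup>2) = 0" by simp
  then have "AE x in lebesgue. (w x)\<^sup>2 = 0"
    using integral_nonneg_eq_0_iff_AE[OF L2_real_integrable[OF H1_L2[OF w]]] by simp
  then show ?thesis by eventually_elim simp
qed

text \<open>
  Outside a large ball \<open>U\<close> is small, and inside it \<open>f k\<close> tends to zero in \<open>L2\<close>.
\<close>

lemma potential_null:
  fixes f g :: "nat \<Rightarrow> 'a::euclidean_space \<Rightarrow> real"
  assumes U: "U \<in> L_infinity" and Ulim: "\<And>\<epsilon>. \<epsilon> > 0 \<Longrightarrow> \<exists>R. AE x in lebesgue. R \<le> norm x \<longrightarrow> \<bar>U x\<bar> \<le> \<epsilon>"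
    and f: "\<And>k. f k \<in> L2" "\<And>k. (LINT x|lebesgue. (f k x)\<^sup>2) \<le> A" and g: "\<And>k. g k \<in> L2" "\<And>k. (LINT x|lebesgue. (g k x)\<^sup>2) \<le> A"
    and loc: "\<And>R. (\<lambda>k. LINT x|lebesgue. indicat_real (cball 0 R) x * (f k x)\<^sup>2) \<longlonglongrightarrow> 0"
  shows "(\<lambda>k. LINT x|lebesgue. U x * f k x * g k x) \<longlonglongrightarrow> 0"
proof (rule LIMSEQ_I)
  fix \<eta> :: real assume \<eta>: "\<eta> > 0"
  obtain C0 where "AE x in lebesgue. \<bar>U x\<bar> \<le> C0" using U by (auto simp: L_infinity_def)
  then have C: "AE x in lebesgue. \<bar>U x\<bar> \<le> \<bar>C0\<bar>" by eventually_elim linarith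
  have A: "A \<ge> 0" by (rule order.trans[OF _ f(2)[of 0]]) simp
  define \<epsilon> where "\<epsilon> = \<eta> / (2 * (A + 1))"
  have \<epsilon>: "\<epsilon> > 0" using \<eta> A by (simp add: \<epsilon>_def)
  have \<epsilon>A: "\<epsilon> * A < \<eta>"
  proof -
    have "\<epsilon> * A \<le> \<epsilon> * (A + 1)" using \<epsilon> by (intro mult_left_mono) auto
    also have "\<dots> = \<eta> / 2"
    proof -
      have "\<eta> / (2 * c) * c = \<eta> / 2" if "c > 0" for c using that by simp
      from this[of "A + 1"] show ?thesis using A by (simp add: \<epsilon>_def)
    qed
    finally show ?thesis using \<eta> by simp
  qed
  obtain R where R: "AE x in lebesgue. R \<le> norm x \<longrightarrow> \<bar>U x\<bar> \<le> \<epsilon>" using Ulim[OF \<epsilon>] by blast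
  let ?S = "cball 0 R :: 'a set"
  define \<sigma> where "\<sigma> k = (LINT x|lebesgue. indicat_real ?S x * (f k x)\<^sup>2)" for k
  have est: "\<bar>LINT x|lebesgue. U x * f k x * g k x\<bar> \<le> \<bar>C0\<bar> * (sqrt (\<sigma> k) * sqrt A) + \<epsilon> * A" for k
  proof -
    let ?f = "\<lambda>x. indicat_real ?S x * f k x"
    have fS: "?f \<in> L2" by (rule L2_indicator_mult[OF f(1)]) simp
    have i1: "integrable lebesgue (\<lambda>x. \<bar>?f x * g k x\<bar>)" by (rule integrable_abs[OF L2_mult_integrable[OF fS g(1)]])
    have i2: "integrable lebesgue (\<lambda>x. \<bar>f k x * g k x\<bar>)" by (rule integrable_abs[OF L2_mult_integrable[OF f(1) g(1)]])
    have "\<bar>LINT x|lebesgue. U x * f k x * g k x\<bar> \<le> (LINT x|lebesgue. \<bar>U x * f k x * g k x\<bar>)"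
      by (rule integral_abs_bound)
    also have "\<dots> \<le> (LINT x|lebesgue. \<bar>C0\<bar> * \<bar>?f x * g k x\<bar> + \<epsilon> * \<bar>f k x * g k x\<bar>)"
    proof (rule integral_mono_AE)
      show "integrable lebesgue (\<lambda>x. \<bar>U x * f k x * g k x\<bar>)"
        by (rule integrable_abs[OF potential_integrable[OF U f(1) g(1)]])
      show "integrable lebesgue (\<lambda>x. \<bar>C0\<bar> * \<bar>?f x * g k x\<bar> + \<epsilon> * \<bar>f k x * g k x\<bar>)"
        using i1 i2 by (intro Bochner_Integration.integrable_add integrable_mult_right)
      show "AE x in lebesgue. \<bar>U x * f k x * g k x\<bar> \<le> \<bar>C0\<bar> * \<bar>?f x * g k x\<bar> + \<epsilon> * \<bar>f k x * g k x\<bar>"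
        using C R
      proof eventually_elim
        case (elim x)
        have eq: "\<bar>U x * f k x * g k x\<bar> = \<bar>U x\<bar> * \<bar>f k x * g k x\<bar>" by (simp add: abs_mult)
        show ?case
        proof (cases "x \<in> ?S")
          case True
          have "\<bar>U x\<bar> * \<bar>f k x * g k x\<bar> \<le> \<bar>C0\<bar> * \<bar>f k x * g k x\<bar>" using elim(1) by (intro mult_right_mono) auto
          moreover have "0 \<le> \<epsilon> * \<bar>f k x * g k x\<bar>" using \<epsilon> by simp
          ultimately show ?thesis unfolding eq using True by simp
        next
          case False
          then have "\<bar>U x\<bar> * \<bar>f k x * g k x\<bar> \<le> \<epsilon> * \<bar>f k x * g k x\<bar>" using elim(2) by (intro mult_right_mono) auto
          then show ?thesis unfolding eq using False by simp
        qed
      qed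
    qed
    also have "\<dots> = \<bar>C0\<bar> * (LINT x|lebesgue. \<bar>?f x * g k x\<bar>) + \<epsilon> * (LINT x|lebesgue. \<bar>f k x * g k x\<bar>)"
      using i1 i2 by simp
    also have "\<dots> \<le> \<bar>C0\<bar> * (sqrt (\<sigma> k) * sqrt A) + \<epsilon> * A"
    proof (intro add_mono mult_left_mono)
      have "(LINT x|lebesgue. \<bar>?f x * g k x\<bar>) \<le> sqrt (LINT x|lebesgue. (?f x)\<^sup>2) * sqrt (LINT x|lebesgue. (g k x)\<^sup>2)"
        by (rule L2_Cauchy_Schwarz_real[OF fS g(1)])
      also have "\<dots> \<le> sqrt (\<sigma> k) * sqrt A"
        unfolding \<sigma>_def using g(2)[of k] by (intro mult_mono) (auto simp: power_mult_distrib indicator_power2 intro!: real_sqrt_le_mono)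
      finally show "(LINT x|lebesgue. \<bar>?f x * g k x\<bar>) \<le> sqrt (\<sigma> k) * sqrt A" .
      have "(LINT x|lebesgue. \<bar>f k x * g k x\<bar>) \<le> sqrt (LINT x|lebesgue. (f k x)\<^sup>2) * sqrt (LINT x|lebesgue. (g k x)\<^sup>2)"
        by (rule L2_Cauchy_Schwarz_real[OF f(1) g(1)])
      also have "\<dots> \<le> sqrt A * sqrt A"
        using f(2)[of k] g(2)[of k] A by (intro mult_mono) (auto intro!: real_sqrt_le_mono)
      finally show "(LINT x|lebesgue. \<bar>f k x * g k x\<bar>) \<le> A" using A by simp
    qed (use \<epsilon> in auto)
    finally show ?thesis .
  qed
  have "(\<lambda>k. \<bar>C0\<bar> * (sqrt (\<sigma> k) * sqrt A) + \<epsilon> * A) \<longlonglongrightarrow> \<bar>C0\<bar> * (sqrt 0 * sqrt A) + \<epsilon> * A"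
    using loc[of R] unfolding \<sigma>_def by (intro tendsto_intros)
  then have "\<forall>\<^sub>F k in sequentially. \<bar>C0\<bar> * (sqrt (\<sigma> k) * sqrt A) + \<epsilon> * A < \<eta>"
    using \<epsilon>A by (intro order_tendstoD(2)) auto
  then obtain n where n: "\<And>k. k \<ge> n \<Longrightarrow> \<bar>C0\<bar> * (sqrt (\<sigma> k) * sqrt A) + \<epsilon> * A < \<eta>"
    by (auto simp: eventually_sequentially)
  have "norm ((LINT x|lebesgue. U x * f k x * g k x) - 0) < \<eta>" if "k \<ge> n" for k
    using est[of k] n[OF that] by simp
  then show "\<exists>no. \<forall>k\<ge>no. norm ((LINT x|lebesgue. U x * f k x * g k x) - 0) < \<eta>" by blast
qed

lemma exponent_translate:
  assumes "exponent pm P p" shows "exponent pm P (\<lambda>x. p (x + a))"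
proof -
  have [measurable]: "p \<in> borel_measurable borel" using assms by (simp add: exponent_def)
  have "(\<lambda>x. p (x + a)) \<in> borel_measurable borel" by measurable
  then show ?thesis using assms by (simp add: exponent_def)
qed

text \<open>
  The functions \<open>u k\<close> solve \<open>- \<Delta> u + V u = lam k \<bar>u\<bar> powr (p - 2) u\<close> up to an error that tends to zero in the dual of \<open>H1\<close>.
  The constant \<open>b\<close> is the limit of \<open>V\<close> at infinity, and \<open>L0\<close> the limit of the multipliers.
\<close>

locale almost_critical =
  fixes V p :: "'a::euclidean_space \<Rightarrow> real" and b pinf pm P M L0 :: real
    and u :: "nat \<Rightarrow> 'a \<Rightarrow> real" and lam \<epsilon>s :: "nat \<Rightarrow> real"
  assumes b: "b > 0" and V: "V \<in> L_infinity"
    and Vlim: "\<And>\<epsilon>. \<epsilon> > 0 \<Longrightarrow> \<exists>R. AE x in lebesgue. R \<le> norm x \<longrightarrow> \<bar>V x - b\<bar> \<le> \<epsilon>"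
    and p: "exponent pm P p" and plim: "(p \<longlongrightarrow> pinf) at_infinity"
    and uH: "\<And>k. u k \<in> H1" and uM: "\<And>k. H1_norm b (u k) \<le> M"
    and \<epsilon>s: "\<epsilon>s \<longlonglongrightarrow> 0" and lam: "lam \<longlonglongrightarrow> L0"
    and critical: "\<And>k v. v \<in> H1 \<Longrightarrow>
      \<bar>form V (u k) v - lam k * (LINT x|lebesgue. odd_power (p x) (u k x) * v x)\<bar> \<le> \<epsilon>s k * H1_norm b v"
begin

abbreviation B :: "('a \<Rightarrow> real) \<Rightarrow> ('a \<Rightarrow> real) \<Rightarrow> real" where "B \<equiv> form (\<lambda>_. b)"

lemma M_nonneg: "0 \<le> M"
  using H1_norm_nonneg[OF b uH[of 0]] uM[of 0] by linarith

lemma pinf_exponent: "exponent pm P (\<lambda>_::'a. pinf)"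
proof -
  have "at_infinity \<noteq> (bot :: 'a filter)" using trivial_limit_at_infinity by blast
  then have "pm \<le> pinf" "pinf \<le> P"
    using tendsto_lowerbound[OF plim, of pm] tendsto_upperbound[OF plim, of P] exponentD(2,3)[OF p] by auto
  then show ?thesis using p by (auto simp: exponent_def)
qed

lemma U_bounded: "(\<lambda>x. V x - b) \<in> L_infinity"
proof -
  obtain C where [measurable]: "V \<in> borel_measurable lebesgue" and C: "AE x in lebesgue. \<bar>V x\<bar> \<le> C"
    using V by (auto simp: L_infinity_def)
  have "AE x in lebesgue. \<bar>V x - b\<bar> \<le> C + \<bar>b\<bar>" using C by eventually_elim linarith
  moreover have "(\<lambda>x. V x - b) \<in> borel_measurable lebesgue" by measurable
  ultimately show ?thesis unfolding L_infinity_def by blast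
qed

lemma form_potential:
  assumes "f \<in> H1" "g \<in> H1"
  shows "form V f g = B f g + (LINT x|lebesgue. (V x - b) * f x * g x)"
proof -
  have "(LINT x|lebesgue. V x * f x * g x) = (LINT x|lebesgue. b * f x * g x + (V x - b) * f x * g x)"
    by (intro Bochner_Integration.integral_cong) (auto simp: algebra_simps)
  also have "\<dots> = (LINT x|lebesgue. b * f x * g x) + (LINT x|lebesgue. (V x - b) * f x * g x)"
    by (intro Bochner_Integration.integral_add potential_integrable L_infinity_const U_bounded H1_L2 assms)
  finally show ?thesis using assms by (simp add: form_split[OF V] form_split[OF L_infinity_const])
qed

lemma potential_null_H1:
  assumes f: "H1_weakly_converges b f (\<lambda>x. 0)" "\<And>k. H1_norm b (f k) \<le> A"
    and g: "\<And>k. g k \<in> H1" "\<And>k. H1_norm b (g k) \<le> A"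
  shows "(\<lambda>k. LINT x|lebesgue. (V x - b) * f k x * g k x) \<longlonglongrightarrow> 0"
proof (rule potential_null[OF U_bounded Vlim])
  have fH: "f k \<in> H1" for k using f by (auto simp: H1_weakly_converges_def)
  have *: "(LINT x|lebesgue. (h x)\<^sup>2) \<le> A\<^sup>2 / b" if "h \<in> H1" "H1_norm b h \<le> A" for h :: "'a \<Rightarrow> real"
  proof -
    have "(H1_norm b h)\<^sup>2 \<le> A\<^sup>2" using that H1_norm_nonneg[OF b] by (intro power_mono) auto
    then have "(H1_norm b h)\<^sup>2 / b \<le> A\<^sup>2 / b" using b by (intro divide_right_mono) auto
    then show ?thesis using L2_le_H1_norm[OF b that(1)] by linarith
  qed
  show "f k \<in> L2" "g k \<in> L2" for k using fH g H1_L2 by auto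
  show "(LINT x|lebesgue. (f k x)\<^sup>2) \<le> A\<^sup>2 / b" "(LINT x|lebesgue. (g k x)\<^sup>2) \<le> A\<^sup>2 / b" for k
    using * fH f(2) g by auto
  show "(\<lambda>k. LINT x|lebesgue. indicat_real (cball 0 R) x * (f k x)\<^sup>2) \<longlonglongrightarrow> 0" for R
    by (rule Rellich[OF b f])
qed

lemma translate_swap:
  assumes "f \<in> H1" "v \<in> H1"
  shows "B f (\<lambda>x. v (x - y)) = B (\<lambda>x. f (x + y)) v"
  using form_translate[OF assms(1) H1_translate[OF assms(2), of "- y"], of b y] by simp

lemma H1_shift_back: "v \<in> H1 \<Longrightarrow> (\<lambda>x. v (x - y)) \<in> H1"
  using H1_translate[of v "- y"] by simp

lemma H1_norm_shift_back: "v \<in> H1 \<Longrightarrow> H1_norm b (\<lambda>x. v (x - y)) = H1_norm b v"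
  using H1_norm_translate[OF b, of v "- y"] by simp

text \<open>
  In the coordinates centred at \<open>y k\<close> the exponent \<open>p (x + y k)\<close> depends on \<open>k\<close>; the limit \<open>q\<close> is \<open>p\<close> itself for
  \<open>y = 0\<close> and the constant \<open>pinf\<close> for escaping \<open>y\<close>.
\<close>

lemma nonlinearity_limit:
  assumes r: "strict_mono r" and weak: "H1_weakly_converges b (\<lambda>k x. u (r k) (x + y k)) w" and v: "v \<in> H1"
    and q: "exponent pm P q" "\<And>x. (\<lambda>k. p (x + y k)) \<longlonglongrightarrow> q x"
  shows "(\<lambda>k. LINT x|lebesgue. odd_power (p x) (u (r k) x) * v (x - y k)) \<longlonglongrightarrow> (LINT x|lebesgue. odd_power (q x) (w x) * v x)"
proof -
  have "(\<lambda>k. LINT x|lebesgue. odd_power (p (x + y k)) (u (r k) (x + y k)) * v x) \<longlonglongrightarrow> (LINT x|lebesgue. odd_power (q x) (w x) * v x)"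
    by (rule odd_power_weak_continuity[OF b weak _ v exponent_translate[OF p] q])
      (use uM H1_norm_translate[OF b uH] in auto)
  moreover have "(LINT x|lebesgue. odd_power (p (x + y k)) (u (r k) (x + y k)) * v x)
      = (LINT x|lebesgue. odd_power (p x) (u (r k) x) * v (x - y k))" for k
    using integral_translate[OF borel_measurable_integrable[OF odd_power_integrable[OF p uH[of "r k"] H1_shift_back[OF v, of "y k"]]], of "y k"]
    by simp
  ultimately show ?thesis by simp
qed

lemma almost_critical_limit:
  assumes r: "strict_mono r" and v: "\<And>k. v k \<in> H1" "\<And>k. H1_norm b (v k) \<le> A"
    and n: "(\<lambda>k. LINT x|lebesgue. odd_power (p x) (u (r k) x) * v k x) \<longlonglongrightarrow> n"
  shows "(\<lambda>k. form V (u (r k)) (v k)) \<longlonglongrightarrow> L0 * n"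
proof -
  have er: "(\<lambda>k. \<epsilon>s (r k)) \<longlonglongrightarrow> 0" and lr: "(\<lambda>k. lam (r k)) \<longlonglongrightarrow> L0"
    using LIMSEQ_subseq_LIMSEQ[OF \<epsilon>s r] LIMSEQ_subseq_LIMSEQ[OF lam r] by (auto simp: o_def)
  let ?n = "\<lambda>k. LINT x|lebesgue. odd_power (p x) (u (r k) x) * v k x"
  have "(\<lambda>k. form V (u (r k)) (v k) - lam (r k) * ?n k) \<longlonglongrightarrow> 0"
  proof (rule Lim_null_comparison)
    show "\<forall>\<^sub>F k in sequentially. norm (form V (u (r k)) (v k) - lam (r k) * ?n k) \<le> \<bar>\<epsilon>s (r k)\<bar> * A"
    proof (intro always_eventually allI)
      fix k
      have "\<epsilon>s (r k) * H1_norm b (v k) \<le> \<bar>\<epsilon>s (r k)\<bar> * A"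
        using v(2)[of k] H1_norm_nonneg[OF b v(1)[of k]] by (intro mult_mono) auto
      then show "norm (form V (u (r k)) (v k) - lam (r k) * ?n k) \<le> \<bar>\<epsilon>s (r k)\<bar> * A"
        using critical[OF v(1)[of k], of "r k"] by simp
    qed
    show "(\<lambda>k. \<bar>\<epsilon>s (r k)\<bar> * A) \<longlonglongrightarrow> 0" using tendsto_mult_right[OF tendsto_rabs[OF er], of A] by simp
  qed
  from tendsto_add[OF this tendsto_mult[OF lr n]] show ?thesis by simp
qed

lemma limit_equation_at_zero:
  assumes r: "strict_mono r" and weak: "H1_weakly_converges b (\<lambda>k. u (r k)) w" and v: "v \<in> H1"
  shows "form V w v = L0 * (LINT x|lebesgue. odd_power (p x) (w x) * v x)"
proof -
  have wH: "w \<in> H1" using weak by (simp add: H1_weakly_converges_def)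
  have "(\<lambda>k. LINT x|lebesgue. odd_power (p x) (u (r k) x) * v (x - 0)) \<longlonglongrightarrow> (LINT x|lebesgue. odd_power (p x) (w x) * v x)"
    by (rule nonlinearity_limit[OF r _ v p]) (use weak in auto)
  then have 1: "(\<lambda>k. form V (u (r k)) v) \<longlonglongrightarrow> L0 * (LINT x|lebesgue. odd_power (p x) (w x) * v x)"
    by (intro almost_critical_limit[OF r v order.refl]) simp
  define z where "z k x = u (r k) x - w x" for k x
  have zH: "z k \<in> H1" for k unfolding z_def using H1_diff[OF uH wH] .
  have zw: "H1_weakly_converges b z (\<lambda>x. 0)" using weakly_null_diff[OF b weak] by (simp add: z_def[abs_def])
  have zM: "H1_norm b (z k) \<le> M + H1_norm b w + H1_norm b v" for k
    using H1_norm_triangle[OF b uH H1_scale[OF wH, of "- 1"], of "r k"] H1_norm_scale[OF b wH, of "- 1"] uM[of "r k"]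
      H1_norm_nonneg[OF b v] by (simp add: z_def[abs_def])
  have vM: "H1_norm b v \<le> M + H1_norm b w + H1_norm b v" using M_nonneg H1_norm_nonneg[OF b wH] by simp
  have "(\<lambda>k. B (z k) v + (LINT x|lebesgue. (V x - b) * z k x * v x)) \<longlonglongrightarrow> B (\<lambda>x. 0) v + 0"
    using zw v unfolding H1_weakly_converges_iff[OF b]
    by (intro tendsto_add potential_null_H1[OF zw zM _ vM]) auto
  then have "(\<lambda>k. form V (z k) v) \<longlonglongrightarrow> 0"
    by (simp add: form_potential zH v form_zero_left L_infinity_const)
  then have "(\<lambda>k. form V (u (r k)) v - form V w v) \<longlonglongrightarrow> 0"
    by (simp add: z_def[abs_def] form_diff_left[OF V uH wH v])
  then have "(\<lambda>k. form V (u (r k)) v) \<longlonglongrightarrow> form V w v" by (simp add: LIM_zero_iff)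
  then show ?thesis using 1 LIMSEQ_unique by blast
qed

lemma translated_exponent_limit:
  assumes y: "filterlim (\<lambda>k. norm (y k)) at_top sequentially"
  shows "(\<lambda>k. p (x + y k)) \<longlonglongrightarrow> pinf"
proof -
  have "filterlim (\<lambda>k. norm (x + y k)) at_top sequentially"
  proof (rule filterlim_at_top_mono)
    show "filterlim (\<lambda>k. - norm x + norm (y k)) at_top sequentially"
      by (rule filterlim_tendsto_add_at_top[OF tendsto_const y])
    have "- norm x + norm (y k) \<le> norm (x + y k)" for k
      using norm_triangle_ineq4[of "x + y k" x] by simp
    then show "\<forall>\<^sub>F k in sequentially. - norm x + norm (y k) \<le> norm (x + y k)" by simp
  qed
  then have "filterlim (\<lambda>k. x + y k) at_infinity sequentially" by (simp add: filterlim_norm_at_top_imp_at_infinity)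
  then show ?thesis by (rule filterlim_compose[OF plim])
qed

text \<open>
  The equation is tested with the translates \<open>v (x - y k)\<close>.  They tend weakly to zero, and therefore do not see \<open>V - b\<close>
  in the limit.
\<close>

lemma limit_equation_at_infinity:
  assumes r: "strict_mono r" and weak: "H1_weakly_converges b (\<lambda>k x. u (r k) (x + y k)) w" and v: "v \<in> H1"
    and y: "filterlim (\<lambda>k. norm (y k)) at_top sequentially"
  shows "B w v = L0 * (LINT x|lebesgue. odd_power pinf (w x) * v x)"
proof -
  define vk where "vk k x = v (x - y k)" for k x
  have vkH: "vk k \<in> H1" and vkN: "H1_norm b (vk k) = H1_norm b v" for k
    unfolding vk_def using H1_shift_back[OF v] H1_norm_shift_back[OF v] by auto
  have "(\<lambda>k. LINT x|lebesgue. odd_power (p x) (u (r k) x) * v (x - y k)) \<longlonglongrightarrow> (LINT x|lebesgue. odd_power pinf (w x) * v x)"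
    by (rule nonlinearity_limit[OF r weak v pinf_exponent translated_exponent_limit[OF y]])
  then have 1: "(\<lambda>k. form V (u (r k)) (vk k)) \<longlonglongrightarrow> L0 * (LINT x|lebesgue. odd_power pinf (w x) * v x)"
    by (intro almost_critical_limit[OF r vkH]) (auto simp: vkN vk_def)
  have vkw: "H1_weakly_converges b vk (\<lambda>x. 0)"
    using translates_weakly_null[OF b v, of "\<lambda>k. - y k"] y by (simp add: vk_def[abs_def])
  have "(\<lambda>k. LINT x|lebesgue. (V x - b) * vk k x * u (r k) x) \<longlonglongrightarrow> 0"
    by (rule potential_null_H1[OF vkw, of "M + H1_norm b v"])
      (use vkN uH uM M_nonneg H1_norm_nonneg[OF b v] in \<open>auto simp: add_increasing add_increasing2\<close>)
  then have 2: "(\<lambda>k. LINT x|lebesgue. (V x - b) * u (r k) x * vk k x) \<longlonglongrightarrow> 0" by (simp add: mult_ac)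
  have 3: "(\<lambda>k. B (u (r k)) (vk k)) \<longlonglongrightarrow> B w v"
    unfolding vk_def translate_swap[OF uH v] using weak v unfolding H1_weakly_converges_iff[OF b] by blast
  have "(\<lambda>k. form V (u (r k)) (vk k)) \<longlonglongrightarrow> B w v + 0"
    unfolding form_potential[OF uH vkH] by (intro tendsto_add 2 3)
  then show ?thesis using 1 LIMSEQ_unique by fastforce
qed

text \<open>
  A nonzero solution of the limit equation satisfies \<open>\<parallel>w\<parallel>\<^sup>2 \<le> C \<parallel>w\<parallel> powr pinf\<close> by the Sobolev
  inequality, where \<open>pinf > 2\<close>; its norm therefore cannot be small.
\<close>

lemma limit_solution_lower_bound:
  obtains \<delta> where "\<delta> > 0"
    "\<And>w :: 'a \<Rightarrow> real. w \<in> H1 \<Longrightarrow> \<not> (AE x in lebesgue. w x = 0) \<Longrightarrow>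
       B w w = L0 * (LINT x|lebesgue. odd_power pinf (w x) * w x) \<Longrightarrow> \<delta> \<le> (H1_norm b w)\<^sup>2"
proof -
  have q: "subcritical (DIM('a)) pinf" and q2: "pinf > 2"
  proof -
    have "exponent pinf pinf (\<lambda>_::'a. pinf)"
      using pinf_exponent exponent_subcritical(1)[OF pinf_exponent]
      by (auto simp: exponent_def subcritical_def intro: order.strict_trans1[of "ereal pinf" "ereal P"])
    then show "subcritical (DIM('a)) pinf" "pinf > 2" by (auto simp: exponent_def)
  qed
  obtain C where C: "C > 0" "\<And>(u :: 'a \<Rightarrow> real) B. H1_size u B \<Longrightarrow> (LINT x|lebesgue. \<bar>u x\<bar> powr pinf) \<le> C * B powr pinf"
    using Sobolev[OF q] by metis
  define \<kappa> where "\<kappa> = 1 + 1 / sqrt b"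
  define K where "K = \<bar>L0\<bar> * C * \<kappa> powr pinf + 1"
  have \<kappa>: "\<kappa> > 0" using b by (simp add: \<kappa>_def add_pos_pos)
  have K: "K > 0" using C(1) by (simp add: K_def add_nonneg_pos)
  define d where "d = (1 / K) powr (1 / (pinf - 2))"
  have d: "d > 0" "d powr (pinf - 2) = 1 / K" using K q2 by (auto simp: d_def powr_powr)
  show ?thesis
  proof (rule that[of "d\<^sup>2"])
    show "d\<^sup>2 > 0" using d by simp
    fix w :: "'a \<Rightarrow> real"
    assume w: "w \<in> H1" and nz: "\<not> (AE x in lebesgue. w x = 0)"
      and eq: "B w w = L0 * (LINT x|lebesgue. odd_power pinf (w x) * w x)"
    define N where "N = H1_norm b w"
    have N: "N > 0" using H1_norm_zero_AE[OF b w] nz H1_norm_nonneg[OF b w] by (fastforce simp: N_def)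
    have sz: "H1_size w (\<kappa> * N)" unfolding \<kappa>_def by (rule H1_norm_size[OF b w]) (use N in \<open>auto simp: N_def\<close>)
    have "N\<^sup>2 = L0 * (LINT x|lebesgue. \<bar>w x\<bar> powr pinf)"
      using eq by (simp add: N_def H1_norm_power2[OF b w] odd_power_self)
    also have "\<dots> \<le> \<bar>L0\<bar> * (C * (\<kappa> * N) powr pinf)"
      by (intro mult_mono C(2)[OF sz]) auto
    also have "\<dots> = (\<bar>L0\<bar> * C * \<kappa> powr pinf) * N powr pinf" by (simp add: powr_mult)
    also have "\<dots> \<le> K * N powr pinf" unfolding K_def by (intro mult_right_mono) auto
    also have "N powr pinf = N powr (pinf - 2) * N\<^sup>2" using N by (intro powr_minus_2) simp
    finally have "1 * N\<^sup>2 \<le> (K * N powr (pinf - 2)) * N\<^sup>2" by (simp add: mult.assoc)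
    then have "1 \<le> K * N powr (pinf - 2)" by (rule mult_right_le_imp_le) (use N in simp)
    then have "d powr (pinf - 2) \<le> N powr (pinf - 2)" unfolding d(2) using K by (simp add: pos_divide_le_eq mult.commute)
    then have "d \<le> N" using powr_less_mono2[of "pinf - 2" N d] q2 N by (meson diff_gt_0_iff_gt not_less less_imp_le)
    then show "d\<^sup>2 \<le> (H1_norm b w)\<^sup>2" using d(1) by (simp add: N_def power_mono)
  qed
qed

text \<open>
  The first profile is the weak limit of the sequence itself, which may vanish; all others are nonzero and their centres
  escape.
\<close>

definition profiles :: "nat \<Rightarrow> (nat \<Rightarrow> 'a \<Rightarrow> real) \<Rightarrow> (nat \<Rightarrow> nat \<Rightarrow> 'a) \<Rightarrow> (nat \<Rightarrow> nat) \<Rightarrow> bool" where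
  "profiles m w y r \<longleftrightarrow> m \<ge> 1 \<and> strict_mono r \<and> (\<forall>k. y 1 k = 0) \<and>
     (\<forall>n\<in>{1..m}. H1_weakly_converges b (\<lambda>k x. u (r k) (x + y n k)) (w n)) \<and>
     (\<forall>n\<in>{1..m}. \<forall>l\<in>{1..m}. n \<noteq> l \<longrightarrow> filterlim (\<lambda>k. norm (y n k - y l k)) at_top sequentially) \<and>
     (\<forall>n\<in>{2..m}. \<not> (AE x in lebesgue. w n x = 0))"

definition remainder :: "nat \<Rightarrow> (nat \<Rightarrow> 'a \<Rightarrow> real) \<Rightarrow> (nat \<Rightarrow> nat \<Rightarrow> 'a) \<Rightarrow> (nat \<Rightarrow> nat) \<Rightarrow> nat \<Rightarrow> 'a \<Rightarrow> real" where
  "remainder m w y r k x = u (r k) x - (\<Sum>n=1..m. w n (x - y n k))"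

context
  fixes m w y r
  assumes prof: "profiles m w y r"
begin

lemma profile_H1: "n \<in> {1..m} \<Longrightarrow> w n \<in> H1"
  using prof unfolding profiles_def H1_weakly_converges_def by blast

lemma profile_weak: "n \<in> {1..m} \<Longrightarrow> H1_weakly_converges b (\<lambda>k x. u (r k) (x + y n k)) (w n)"
  using prof unfolding profiles_def by blast

lemma profile_divergent: "n \<in> {1..m} \<Longrightarrow> l \<in> {1..m} \<Longrightarrow> n \<noteq> l \<Longrightarrow>
    filterlim (\<lambda>k. norm (y n k - y l k)) at_top sequentially"
  using prof unfolding profiles_def by blast

lemma profile_basic: "m \<ge> 1" "strict_mono r" "y 1 k = 0"
  using prof unfolding profiles_def by auto

lemma profile_to_infinity: "n \<in> {2..m} \<Longrightarrow> filterlim (\<lambda>k. norm (y n k)) at_top sequentially"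
  using profile_divergent[of n 1] profile_basic by auto

lemma remainder_H1: "remainder m w y r k \<in> H1"
  unfolding remainder_def[abs_def]
  by (intro H1_diff uH H1_sum H1_shift_back profile_H1)

lemma form_remainder:
  assumes v: "v \<in> H1"
  shows "B (\<lambda>x. remainder m w y r k (x + a)) v
    = B (\<lambda>x. u (r k) (x + a)) v - (\<Sum>n=1..m. B (\<lambda>x. w n (x + (a - y n k))) v)"
proof -
  have eq: "(\<lambda>x. remainder m w y r k (x + a)) = (\<lambda>x. u (r k) (x + a) - (\<Sum>n=1..m. w n (x + (a - y n k))))"
    by (simp add: remainder_def add_diff_eq)
  have wH: "(\<lambda>x. w n (x + (a - y n k))) \<in> H1" if "n \<in> {1..m}" for n
    by (rule H1_translate[OF profile_H1[OF that]])
  have "B (\<lambda>x. u (r k) (x + a) - (\<Sum>n=1..m. w n (x + (a - y n k)))) v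
      = B (\<lambda>x. u (r k) (x + a)) v - B (\<lambda>x. \<Sum>n=1..m. w n (x + (a - y n k))) v"
    by (rule form_diff_left[OF L_infinity_const H1_translate[OF uH] H1_sum v]) (rule wH)
  also have "B (\<lambda>x. \<Sum>n=1..m. w n (x + (a - y n k))) v = (\<Sum>n=1..m. B (\<lambda>x. w n (x + (a - y n k))) v)"
    by (rule form_sum_left[OF L_infinity_const _ v]) (rule wH)
  finally show ?thesis unfolding eq .
qed

text \<open>
  Around \<open>y n\<close> the sequence tends to \<open>w n\<close>, while the other profiles escape.
\<close>

lemma remainder_weakly_null:
  assumes n: "n \<in> {1..m}"
  shows "H1_weakly_converges b (\<lambda>k x. remainder m w y r k (x + y n k)) (\<lambda>x. 0)"
proof -
  have "(\<lambda>k. B (\<lambda>x. remainder m w y r k (x + y n k)) v) \<longlonglongrightarrow> 0" if v: "v \<in> H1" for v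
  proof -
    have "(\<lambda>k. B (\<lambda>x. w l (x + (y n k - y l k))) v) \<longlonglongrightarrow> (if l = n then B (w n) v else 0)" if l: "l \<in> {1..m}" for l
    proof (cases "l = n")
      case False
      have "H1_weakly_converges b (\<lambda>k x. w l (x + (y n k - y l k))) (\<lambda>x. 0)"
        by (rule translates_weakly_null[OF b profile_H1[OF l]]) (use profile_divergent[OF n l] False in auto)
      then show ?thesis using v False unfolding H1_weakly_converges_iff[OF b]
        by (auto simp: form_zero_left L_infinity_const)
    qed simp
    then have "(\<lambda>k. B (\<lambda>x. u (r k) (x + y n k)) v - (\<Sum>l=1..m. B (\<lambda>x. w l (x + (y n k - y l k))) v))
        \<longlonglongrightarrow> B (w n) v - (\<Sum>l=1..m. if l = n then B (w n) v else 0)"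
      using profile_weak[OF n] v unfolding H1_weakly_converges_iff[OF b]
      by (intro tendsto_diff tendsto_sum) auto
    then show ?thesis using n by (simp add: form_remainder[OF v])
  qed
  then show ?thesis
    unfolding H1_weakly_converges_iff[OF b]
    by (simp add: H1_translate remainder_H1 H1_zero form_zero_left L_infinity_const)
qed

lemma remainder_profile_null:
  assumes n: "n \<in> {1..m}"
  shows "(\<lambda>k. B (\<lambda>x. w n (x - y n k)) (remainder m w y r k)) \<longlonglongrightarrow> 0"
proof -
  have "(\<lambda>k. B (\<lambda>x. remainder m w y r k (x + y n k)) (w n)) \<longlonglongrightarrow> B (\<lambda>x. 0) (w n)"
    using remainder_weakly_null[OF n] profile_H1[OF n] unfolding H1_weakly_converges_iff[OF b] by blast
  then show ?thesis
    using translate_swap[OF remainder_H1 profile_H1[OF n]]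
    by (simp add: form_commute[of _ "\<lambda>x. w n (x - _)"] form_zero_left L_infinity_const profile_H1[OF n])
qed

lemma remainder_square:
  "B (remainder m w y r k) (remainder m w y r k)
    = B (u (r k)) (remainder m w y r k) - (\<Sum>n=1..m. B (\<lambda>x. w n (x - y n k)) (remainder m w y r k))"
  using form_remainder[OF remainder_H1, of k 0 k] by simp

text \<open>
  The theorem of Pythagoras in the limit: the remainder becomes orthogonal to every translated profile.
\<close>

lemma remainder_norm_expansion:
  "(\<lambda>k. (H1_norm b (u (r k)))\<^sup>2 - (H1_norm b (remainder m w y r k))\<^sup>2) \<longlonglongrightarrow> (\<Sum>n=1..m. (H1_norm b (w n))\<^sup>2)"
proof -
  have 1: "B (u (r k)) (remainder m w y r k) = B (u (r k)) (u (r k)) - (\<Sum>n=1..m. B (\<lambda>x. u (r k) (x + y n k)) (w n))" for k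
  proof -
    have "B (remainder m w y r k) (u (r k)) = B (u (r k)) (u (r k)) - (\<Sum>n=1..m. B (\<lambda>x. w n (x - y n k)) (u (r k)))"
      using form_remainder[OF uH[of "r k"], of k 0] by simp
    moreover have "B (\<lambda>x. w n (x - y n k)) (u (r k)) = B (\<lambda>x. u (r k) (x + y n k)) (w n)" if "n \<in> {1..m}" for n
      using translate_swap[OF uH profile_H1[OF that]] by (simp add: form_commute[of _ "\<lambda>x. w n (x - _)"])
    ultimately show ?thesis by (simp add: form_commute[of _ "u (r k)" "remainder m w y r k"])
  qed
  have "(\<lambda>k. (\<Sum>n=1..m. B (\<lambda>x. u (r k) (x + y n k)) (w n)) + (\<Sum>n=1..m. B (\<lambda>x. w n (x - y n k)) (remainder m w y r k)))
      \<longlonglongrightarrow> (\<Sum>n=1..m. B (w n) (w n)) + (\<Sum>n=1..m. 0)"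
    using profile_weak profile_H1 unfolding H1_weakly_converges_iff[OF b]
    by (intro tendsto_add tendsto_sum remainder_profile_null) auto
  moreover have "(H1_norm b (u (r k)))\<^sup>2 - (H1_norm b (remainder m w y r k))\<^sup>2
      = (\<Sum>n=1..m. B (\<lambda>x. u (r k) (x + y n k)) (w n)) + (\<Sum>n=1..m. B (\<lambda>x. w n (x - y n k)) (remainder m w y r k))" for k
    using 1[of k] remainder_square[of k] by (simp add: H1_norm_power2[OF b] uH remainder_H1)
  ultimately show ?thesis
    by (simp add: H1_norm_power2[OF b] profile_H1)
qed

lemma remainder_bounded: "H1_norm b (remainder m w y r k) \<le> M + (\<Sum>n=1..m. H1_norm b (w n))"
proof -
  have sum_le: "H1_norm b (\<lambda>x. \<Sum>n\<in>I. f n x) \<le> (\<Sum>n\<in>I. H1_norm b (f n))" if "\<And>n. n \<in> I \<Longrightarrow> f n \<in> H1" "finite I"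
    for I and f :: "nat \<Rightarrow> 'a \<Rightarrow> real"
    using that(2,1)
  proof (induction I rule: finite_induct)
    case (insert i I)
    then have "H1_norm b (\<lambda>x. f i x + (\<Sum>n\<in>I. f n x)) \<le> H1_norm b (f i) + H1_norm b (\<lambda>x. \<Sum>n\<in>I. f n x)"
      by (intro H1_norm_triangle[OF b] H1_sum) auto
    then show ?case using insert by auto
  qed (simp add: H1_norm_zero[OF b])
  let ?s = "\<lambda>x. \<Sum>n=1..m. w n (x - y n k)"
  have sH: "?s \<in> H1" by (intro H1_sum H1_shift_back profile_H1)
  have "H1_norm b (remainder m w y r k) \<le> H1_norm b (u (r k)) + H1_norm b ?s"
    using H1_norm_triangle[OF b uH[of "r k"] H1_scale[OF sH, of "- 1"]] H1_norm_scale[OF b sH, of "- 1"]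
    by (simp add: remainder_def[abs_def])
  also have "\<dots> \<le> M + (\<Sum>n=1..m. H1_norm b (\<lambda>x. w n (x - y n k)))"
    by (intro add_mono uM sum_le H1_shift_back profile_H1) auto
  finally show ?thesis by (simp add: H1_norm_shift_back profile_H1)
qed

lemma profile_sum_bound: "(\<Sum>n=1..m. (H1_norm b (w n))\<^sup>2) \<le> M\<^sup>2"
proof (rule LIMSEQ_le_const2[OF remainder_norm_expansion])
  have "(H1_norm b (u (r k)))\<^sup>2 - (H1_norm b (remainder m w y r k))\<^sup>2 \<le> M\<^sup>2" for k
    using power_mono[OF uM[of "r k"] H1_norm_nonneg[OF b uH[of "r k"]], of 2]
      zero_le_power2[of "H1_norm b (remainder m w y r k)"] by linarith
  then show "\<exists>N. \<forall>k\<ge>N. (H1_norm b (u (r k)))\<^sup>2 - (H1_norm b (remainder m w y r k))\<^sup>2 \<le> M\<^sup>2" by blast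
qed

text \<open>
  Points at which the averages of the remainder stay large must escape from all \<open>y n\<close>, since the
  remainder tends to zero locally around each of them; the weak limit around such points is a
  further profile.
\<close>

lemma new_profile:
  assumes l: "l > 0" and \<epsilon>: "\<epsilon> > 0"
    and nv: "\<not> (\<forall>\<^sub>F k in sequentially. \<forall>x. \<bar>average l (remainder m w y r k) x\<bar> \<le> \<epsilon>)"
  shows "\<exists>w y r. profiles (Suc m) w y r"
proof -
  let ?R = "remainder m w y r"
  from not_eventually_sequentiallyD[OF nv]
  obtain s :: "nat \<Rightarrow> nat" where "strict_mono s \<and> (\<forall>k. \<not> (\<forall>x. \<bar>average l (?R (s k)) x\<bar> \<le> \<epsilon>))" ..
  then have s: "strict_mono s" and "\<forall>k. \<exists>x. \<epsilon> < \<bar>average l (?R (s k)) x\<bar>" by (auto simp: not_le)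
  then obtain z where z: "\<And>k. \<epsilon> < \<bar>average l (?R (s k)) (z k)\<bar>" by metis
  have zdiv: "filterlim (\<lambda>k. norm (z k - y n (s k))) at_top sequentially" if n: "n \<in> {1..m}" for n
  proof (rule ccontr)
    assume "\<not> filterlim (\<lambda>k. norm (z k - y n (s k))) at_top sequentially"
    then obtain R where "\<not> (\<forall>\<^sub>F k in sequentially. R \<le> norm (z k - y n (s k)))"
      by (auto simp: filterlim_at_top)
    from not_eventually_sequentiallyD[OF this]
    obtain t :: "nat \<Rightarrow> nat" where "strict_mono t \<and> (\<forall>k. \<not> R \<le> norm (z (t k) - y n (s (t k))))" ..
    then have t: "strict_mono t" "\<And>k. norm (z (t k) - y n (s (t k))) \<le> R" by (auto simp: not_le less_imp_le)
    define f where "f k x = ?R (s (t k)) (x + y n (s (t k)))" for k x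
    have fH: "f k \<in> H1" for k unfolding f_def using H1_translate[OF remainder_H1] .
    have st: "strict_mono (\<lambda>k. s (t k))" using s t(1) by (simp add: strict_mono_def)
    have fw: "H1_weakly_converges b f (\<lambda>x. 0)"
      using weakly_converges_subseq[OF remainder_weakly_null[OF n] st] by (simp add: f_def[abs_def])
    have fM: "H1_norm b (f k) \<le> M + (\<Sum>n=1..m. H1_norm b (w n))" for k
      unfolding f_def H1_norm_translate[OF b remainder_H1] by (rule remainder_bounded)
    define I where "I k = (LINT x|lebesgue. indicat_real (cball 0 (R + sqrt (real DIM('a)) * l)) x * (f k x)\<^sup>2)" for k
    have "(\<lambda>k. sqrt (I k) / sqrt (l ^ DIM('a))) \<longlonglongrightarrow> sqrt 0 / sqrt (l ^ DIM('a))"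
      unfolding I_def using l by (intro tendsto_intros Rellich[OF b fw fM]) auto
    moreover have "\<epsilon> \<le> sqrt (I k) / sqrt (l ^ DIM('a))" for k
    proof -
      have "average l (?R (s (t k))) (z (t k)) = average l (f k) (z (t k) - y n (s (t k)))"
        unfolding f_def average_shift by simp
      then show ?thesis
        using z[of "t k"] average_local_bound[OF l H1_L2[OF fH] t(2), of k k] unfolding I_def by simp
    qed
    ultimately have "\<epsilon> \<le> 0" by (intro LIMSEQ_le_const[of _ 0]) auto
    then show False using \<epsilon> by simp
  qed
  define g where "g k x = u (r (s k)) (x + z k)" for k x
  have gH: "g k \<in> H1" for k unfolding g_def using H1_translate[OF uH] .
  have gM: "H1_norm b (g k) \<le> M" for k unfolding g_def H1_norm_translate[OF b uH] by (rule uM)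
  obtain t w' where t: "strict_mono t" and w': "H1_weakly_converges b (\<lambda>k. g (t k)) w'"
    by (rule weak_compactness[OF b gH gM])
  have st: "strict_mono (\<lambda>k. s (t k))" using s t by (simp add: strict_mono_def)
  have w'nz: "\<not> (AE x in lebesgue. w' x = 0)"
  proof
    assume ae: "AE x in lebesgue. w' x = 0"
    have w'H: "w' \<in> H1" using w' by (simp add: H1_weakly_converges_def)
    have "average l w' 0 = average l (\<lambda>x. 0) (0 :: 'a)"
      by (rule average_cong[OF H1_L2[OF w'H] H1_L2[OF H1_zero] ae])
    then have a0: "average l w' 0 = 0" by (simp add: average_def)
    have dual: "(\<lambda>v. average l v (0::'a)) \<in> H1_dual b" by (rule average_in_H1_dual[OF b l])
    have dlim: "(\<lambda>k. average l (h k) 0) \<longlonglongrightarrow> average l h' 0" if h: "H1_weakly_converges b h h'" for h and h' :: "'a \<Rightarrow> real"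
    proof -
      have "\<forall>f\<in>H1_dual b. (\<lambda>k. f (h k)) \<longlonglongrightarrow> f h'" using h by (simp add: H1_weakly_converges_def)
      from bspec[OF this dual] show ?thesis .
    qed
    let ?a = "\<lambda>k. average l (g (t k)) 0 - (\<Sum>n=1..m. average l (\<lambda>x. w n (x + (z (t k) - y n (s (t k))))) 0)"
    have "?a \<longlonglongrightarrow> average l w' 0 - (\<Sum>n=1..m. average l (\<lambda>x. 0) (0 :: 'a))"
    proof (intro tendsto_diff tendsto_sum dlim w')
      fix n assume n: "n \<in> {1..m}"
      have "filterlim (\<lambda>k. norm (z (t k) - y n (s (t k)))) at_top sequentially"
        using filterlim_compose[OF zdiv[OF n] filterlim_subseq[OF t]] .
      then show "H1_weakly_converges b (\<lambda>k x. w n (x + (z (t k) - y n (s (t k))))) (\<lambda>x. 0)"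
        by (rule translates_weakly_null[OF b profile_H1[OF n]])
    qed
    moreover have z0: "average l (\<lambda>x. 0) (0 :: 'a) = 0" by (simp add: average_def)
    ultimately have "?a \<longlonglongrightarrow> 0" unfolding a0 z0 by simp
    then have "(\<lambda>k. \<bar>?a k\<bar>) \<longlonglongrightarrow> \<bar>0\<bar>" by (rule tendsto_rabs)
    moreover have "\<epsilon> \<le> \<bar>?a k\<bar>" for k
    proof -
      have sum: "average l (\<lambda>x. \<Sum>n\<in>I. h n x) 0 = (\<Sum>n\<in>I. average l (h n) 0)" if "finite I" "\<And>n. n \<in> I \<Longrightarrow> h n \<in> H1"
        for I and h :: "nat \<Rightarrow> 'a \<Rightarrow> real"
        using that
      proof (induction I rule: finite_induct)
        case (insert i I)
        then show ?case using average_add[OF l H1_L2[of "h i"] H1_L2[OF H1_sum[of I h]], of 0] by auto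
      qed (simp add: average_def)
      have "average l (?R (s (t k))) (z (t k)) = average l (\<lambda>x. ?R (s (t k)) (x + z (t k))) 0"
        unfolding average_shift by simp
      also have "(\<lambda>x. ?R (s (t k)) (x + z (t k)))
          = (\<lambda>x. g (t k) x - (\<Sum>n=1..m. w n (x + (z (t k) - y n (s (t k))))))"
        by (simp add: remainder_def g_def add_diff_eq)
      also have "average l \<dots> 0
          = average l (g (t k)) 0 - average l (\<lambda>x. \<Sum>n=1..m. w n (x + (z (t k) - y n (s (t k))))) 0"
        by (intro average_diff l H1_L2 gH H1_sum H1_translate profile_H1)
      also have "average l (\<lambda>x. \<Sum>n=1..m. w n (x + (z (t k) - y n (s (t k))))) 0
          = (\<Sum>n=1..m. average l (\<lambda>x. w n (x + (z (t k) - y n (s (t k))))) 0)"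
        by (rule sum) (rule finite_atLeastAtMost, rule H1_translate[OF profile_H1])
      finally show ?thesis using z[of "t k"] by simp
    qed
    ultimately have "\<epsilon> \<le> \<bar>0\<bar>" by (intro LIMSEQ_le_const) auto
    then show False using \<epsilon> by simp
  qed
  define W where "W n = (if n = Suc m then w' else w n)" for n
  define Y where "Y n k = (if n = Suc m then z (t k) else y n (s (t k)))" for n k
  have "profiles (Suc m) W Y (\<lambda>k. r (s (t k)))"
    unfolding profiles_def
  proof (intro conjI ballI allI impI)
    show "strict_mono (\<lambda>k. r (s (t k)))" using profile_basic(2) st by (simp add: strict_mono_def)
    show "Y 1 k = 0" for k using profile_basic by (simp add: Y_def)
    show "H1_weakly_converges b (\<lambda>k x. u (r (s (t k))) (x + Y n k)) (W n)" if "n \<in> {1..Suc m}" for n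
    proof (cases "n = Suc m")
      case True
      then show ?thesis using w' by (simp add: Y_def W_def g_def[abs_def])
    next
      case False
      then have "n \<in> {1..m}" using that by auto
      from weakly_converges_subseq[OF profile_weak[OF this] st] False show ?thesis by (simp add: Y_def W_def)
    qed
    show "filterlim (\<lambda>k. norm (Y n k - Y i k)) at_top sequentially" if ni: "n \<in> {1..Suc m}" "i \<in> {1..Suc m}" "n \<noteq> i" for n i
    proof -
      have new: "filterlim (\<lambda>k. norm (z (t k) - y n (s (t k)))) at_top sequentially" if "n \<in> {1..m}" for n
        using filterlim_compose[OF zdiv[OF that] filterlim_subseq[OF t]] .
      consider "n = Suc m" "i \<in> {1..m}" | "i = Suc m" "n \<in> {1..m}" | "n \<in> {1..m}" "i \<in> {1..m}"
        using ni by (auto simp: le_Suc_eq)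
      then show ?thesis
      proof cases
        case 1
        then show ?thesis using new[of i] by (simp add: Y_def)
      next
        case 2
        then show ?thesis using new[of n] by (simp add: Y_def norm_minus_commute)
      next
        case 3
        have "filterlim (\<lambda>k. norm (y n (s (t k)) - y i (s (t k)))) at_top sequentially"
          using filterlim_compose[OF profile_divergent[OF 3 ni(3)] filterlim_subseq[OF st]] .
        then show ?thesis using 3 by (simp add: Y_def)
      qed
    qed
    show "\<not> (AE x in lebesgue. W n x = 0)" if "n \<in> {2..Suc m}" for n
    proof (cases "n = Suc m")
      case True
      then show ?thesis using w'nz by (simp add: W_def)
    next
      case False
      then have "n \<in> {2..m}" using that by auto
      then show ?thesis using False prof unfolding profiles_def by (simp add: W_def)
    qed
  qed simp
  then show ?thesis by blast
qed

end

lemma profile_at_infinity_equation: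
  assumes "profiles m w y r" "n \<in> {2..m}" "v \<in> H1"
  shows "B (w n) v = L0 * (LINT x|lebesgue. odd_power pinf (w n x) * v x)"
  using limit_equation_at_infinity[OF profile_basic(2)[OF assms(1)] profile_weak[OF assms(1)] assms(3)
      profile_to_infinity[OF assms(1,2)]] assms(2) by simp

lemma first_profile_equation:
  assumes "profiles m w y r" "v \<in> H1"
  shows "form V (w 1) v = L0 * (LINT x|lebesgue. odd_power (p x) (w 1 x) * v x)"
  using limit_equation_at_zero[OF profile_basic(2)[OF assms(1)] _ assms(2)] profile_weak[OF assms(1), of 1]
    profile_basic[OF assms(1)] by simp

text \<open>
  Every profile after the first contributes at least \<open>\<delta>\<close> to a sum that is at most \<open>M\<^sup>2\<close>, which bounds the number of
  profiles.
\<close>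

lemma maximal_profiles:
  obtains m w y r where "profiles m w y r" "\<And>w y r. \<not> profiles (Suc m) w y r"
proof -
  obtain \<delta> where \<delta>: "\<delta> > 0" "\<And>w :: 'a \<Rightarrow> real. w \<in> H1 \<Longrightarrow> \<not> (AE x in lebesgue. w x = 0) \<Longrightarrow>
       B w w = L0 * (LINT x|lebesgue. odd_power pinf (w x) * w x) \<Longrightarrow> \<delta> \<le> (H1_norm b w)\<^sup>2"
    by (fact limit_solution_lower_bound)
  define Q where "Q m \<longleftrightarrow> (\<exists>w y r. profiles m w y r)" for m
  have bound: "real m \<le> 1 + M\<^sup>2 / \<delta>" if Qm: "Q m" for m
  proof -
    obtain w y r where pr: "profiles m w y r" using Qm unfolding Q_def by blast
    have "(\<Sum>n=2..m. \<delta>) \<le> (\<Sum>n=2..m. (H1_norm b (w n))\<^sup>2)"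
    proof (rule sum_mono)
      fix n assume n: "n \<in> {2..m}"
      then have n1: "n \<in> {1..m}" by simp
      show "\<delta> \<le> (H1_norm b (w n))\<^sup>2"
        by (rule \<delta>(2)[OF profile_H1[OF pr n1] _ profile_at_infinity_equation[OF pr n profile_H1[OF pr n1]]])
          (use pr n in \<open>simp add: profiles_def\<close>)
    qed
    also have "\<dots> \<le> (\<Sum>n=1..m. (H1_norm b (w n))\<^sup>2)" by (rule sum_mono2) auto
    also have "\<dots> \<le> M\<^sup>2" by (rule profile_sum_bound[OF pr])
    finally have "real (m - 1) * \<delta> \<le> M\<^sup>2" by simp
    then have "real (m - 1) \<le> M\<^sup>2 / \<delta>" using \<delta>(1) by (simp add: pos_le_divide_eq)
    then show ?thesis by linarith
  qed
  have Q1: "Q 1"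
  proof -
    obtain r w where rw: "strict_mono r" "H1_weakly_converges b (\<lambda>k. u (r k)) w"
      by (rule weak_compactness[OF b uH uM])
    then have "profiles 1 (\<lambda>_. w) (\<lambda>_ _. 0) r" by (simp add: profiles_def)
    then show ?thesis by (auto simp: Q_def)
  qed
  obtain K :: nat where K: "1 + M\<^sup>2 / \<delta> < real K" using reals_Archimedean2 by blast
  have QK: "m \<le> K" if "Q m" for m using bound[OF that] K by linarith
  define m where "m = (GREATEST m. Q m)"
  have "Q m" unfolding m_def by (rule GreatestI_nat[of Q 1 K, OF Q1 QK])
  moreover have "\<not> Q (Suc m)"
  proof
    assume "Q (Suc m)"
    from Greatest_le_nat[of Q "Suc m" K, OF this QK] have "Suc m \<le> m" by (simp add: m_def)
    then show False by simp
  qed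
  ultimately show ?thesis using that by (auto simp: Q_def)
qed

end

section \<open>Strong convergence of the remainder\<close>

context almost_critical
begin

lemma sum_first: "(1::nat) \<le> m \<Longrightarrow> (\<Sum>n=1..m. f n) = (f 1 + (\<Sum>n=2..m. f n) :: real)"
  using sum.atLeast_Suc_atMost[of 1 m f] by (simp add: numeral_2_eq_2)

text \<open>
  As no further profile exists, the averages of the remainder tend to zero uniformly, hence the remainder tends to zero
  in \<open>L\<^sup>q\<close> for every subcritical \<open>q\<close>, in particular for the two bounds of the exponent.  The nonlinearity tested with the
  remainder is then negligible.  By the equation so is the linear part, and by orthogonality to the profiles the latter is
  the square of the norm of the remainder.
\<close>

lemma remainder_vanishes:
  assumes pr: "profiles m w y r" and maximal: "\<And>w y r. \<not> profiles (Suc m) w y r"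
  shows "(\<lambda>k. H1_norm b (remainder m w y r k)) \<longlonglongrightarrow> 0"
    and "(\<lambda>k. LINT x|lebesgue. odd_power (p x) (u (r k) x) * remainder m w y r k x) \<longlonglongrightarrow> 0"
proof -
  let ?R = "remainder m w y r"
  define A where "A = M + (\<Sum>n=1..m. H1_norm b (w n)) + 1"
  have RA: "H1_norm b (?R k) \<le> A" for k using remainder_bounded[OF pr, of k] by (simp add: A_def)
  have sum0: "0 \<le> (\<Sum>n=1..m. H1_norm b (w n))"
    by (intro sum_nonneg H1_norm_nonneg[OF b] profile_H1[OF pr])
  have A: "A > 0" and MA: "M \<le> A" using M_nonneg sum0 by (auto simp: A_def)
  have RH: "?R k \<in> H1" for k by (rule remainder_H1[OF pr])
  define C where "C = (1 + 1 / sqrt b) * A"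
  have szR: "H1_size (?R k) C" for k unfolding C_def by (rule H1_norm_size[OF b RH RA A])
  have szu: "H1_size (u k) C" for k
    unfolding C_def by (rule H1_norm_size[OF b uH order.trans[OF uM MA] A])
  have avg: "\<forall>\<^sub>F k in sequentially. \<forall>x. \<bar>average l (?R k) x\<bar> \<le> \<epsilon>" if "l > 0" "\<epsilon> > 0" for l \<epsilon>
    using new_profile[OF pr that] maximal by blast
  have van: "(\<lambda>k. LINT x|lebesgue. \<bar>?R k x\<bar> powr q) \<longlonglongrightarrow> 0" if "subcritical (DIM('a)) q" for q
    by (rule vanishing[OF that szR avg])
  have null: "(\<lambda>k. LINT x|lebesgue. \<bar>?R k x\<bar> powr p x) \<longlonglongrightarrow> 0"
  proof (rule tendsto_sandwich[OF always_eventually always_eventually tendsto_const])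
    let ?up = "\<lambda>k. (LINT x|lebesgue. \<bar>?R k x\<bar> powr pm) + (LINT x|lebesgue. \<bar>?R k x\<bar> powr P)"
    show "?up \<longlonglongrightarrow> 0"
      using tendsto_add[OF van[OF exponent_subcritical(2)[OF p]] van[OF exponent_subcritical(1)[OF p]]] by simp
    show "\<forall>k. 0 \<le> (LINT x|lebesgue. \<bar>?R k x\<bar> powr p x)" by simp
    show "\<forall>k. (LINT x|lebesgue. \<bar>?R k x\<bar> powr p x) \<le> ?up k"
    proof
      fix k
      note i1 = H1_power_integrable[OF exponent_subcritical(1)[OF p] RH[of k]]
        and i2 = H1_power_integrable[OF exponent_subcritical(2)[OF p] RH[of k]]
      have "(LINT x|lebesgue. \<bar>?R k x\<bar> powr p x) \<le> (LINT x|lebesgue. \<bar>?R k x\<bar> powr pm + \<bar>?R k x\<bar> powr P)"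
      proof (rule integral_mono[OF modular_integrable[OF p RH] Bochner_Integration.integrable_add[OF i2 i1]])
        show "\<bar>?R k x\<bar> powr p x \<le> \<bar>?R k x\<bar> powr pm + \<bar>?R k x\<bar> powr P" for x
          using exponentD(2,3)[OF p, of x] exponentD(1)[OF p] by (intro powr_between) auto
      qed
      then show "(LINT x|lebesgue. \<bar>?R k x\<bar> powr p x) \<le> ?up k" using i1 i2 by simp
    qed
  qed
  obtain K where K: "\<And>(u :: 'a \<Rightarrow> real) pm (p :: 'a \<Rightarrow> real). exponent pm P p \<Longrightarrow> H1_size u C \<Longrightarrow> (LINT x|lebesgue. \<bar>u x\<bar> powr p x) \<le> K"
    using modular_bound[OF exponent_subcritical(1)[OF p], where B=C] by metis
  show nl: "(\<lambda>k. LINT x|lebesgue. odd_power (p x) (u (r k) x) * ?R k x) \<longlonglongrightarrow> 0"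
    by (rule coupling_null[OF p uH RH K[OF p szu] null])
  have 1: "(\<lambda>k. form V (u (r k)) (?R k)) \<longlonglongrightarrow> L0 * 0"
    by (rule almost_critical_limit[OF profile_basic(2)[OF pr] RH RA nl])
  have "H1_weakly_converges b ?R (\<lambda>x. 0)"
    using remainder_weakly_null[OF pr, of 1] profile_basic[OF pr] by simp
  then have "(\<lambda>k. LINT x|lebesgue. (V x - b) * ?R k x * u (r k) x) \<longlonglongrightarrow> 0"
    by (rule potential_null_H1[OF _ RA uH order.trans[OF uM MA]])
  then have 2: "(\<lambda>k. LINT x|lebesgue. (V x - b) * u (r k) x * ?R k x) \<longlonglongrightarrow> 0" by (simp add: mult_ac)
  have 3: "B (u (r k)) (?R k) = form V (u (r k)) (?R k) - (LINT x|lebesgue. (V x - b) * u (r k) x * ?R k x)" for k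
    using form_potential[OF uH RH] by simp
  have "(\<lambda>k. B (u (r k)) (?R k) - (\<Sum>n=1..m. B (\<lambda>x. w n (x - y n k)) (?R k))) \<longlonglongrightarrow> (L0 * 0 - 0) - (\<Sum>n=1..m. 0)"
    unfolding 3 by (intro tendsto_diff tendsto_sum 1 2 remainder_profile_null[OF pr])
  then have "(\<lambda>k. sqrt (B (?R k) (?R k))) \<longlonglongrightarrow> sqrt 0"
    by (intro tendsto_real_sqrt) (simp add: remainder_square[OF pr])
  then show "(\<lambda>k. H1_norm b (?R k)) \<longlonglongrightarrow> 0" by (simp add: H1_norm_def energy_form)
qed

text \<open>
  Testing the nonlinearity at \<open>u\<close> with \<open>u\<close> itself and inserting the decomposition of the test function,
  each profile sees in the limit only itself.
\<close>

lemma modular_splitting: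
  assumes pr: "profiles m w y r" and maximal: "\<And>w y r. \<not> profiles (Suc m) w y r"
  shows "(\<lambda>k. modular p (u (r k))) \<longlonglongrightarrow> modular p (w 1) + (\<Sum>n=2..m. modular (\<lambda>_. pinf) (w n))"
proof -
  let ?R = "remainder m w y r"
  let ?o = "\<lambda>k x. odd_power (p x) (u (r k) x)"
  have wH: "(\<lambda>x. w n (x - y n k)) \<in> H1" if "n \<in> {1..m}" for n k by (rule H1_shift_back[OF profile_H1[OF pr that]])
  have split: "modular p (u (r k)) = (\<Sum>n=1..m. LINT x|lebesgue. ?o k x * w n (x - y n k)) + (LINT x|lebesgue. ?o k x * ?R k x)" for k
  proof -
    have "modular p (u (r k)) = (LINT x|lebesgue. (\<Sum>n=1..m. ?o k x * w n (x - y n k)) + ?o k x * ?R k x)"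
      unfolding modular_def
    proof (intro Bochner_Integration.integral_cong refl)
      fix x
      have "\<bar>u (r k) x\<bar> powr p x = ?o k x * ((\<Sum>n=1..m. w n (x - y n k)) + ?R k x)"
        by (simp add: remainder_def odd_power_self)
      then show "\<bar>u (r k) x\<bar> powr p x = (\<Sum>n=1..m. ?o k x * w n (x - y n k)) + ?o k x * ?R k x"
        by (simp add: distrib_left sum_distrib_left)
    qed
    also have "\<dots> = (LINT x|lebesgue. (\<Sum>n=1..m. ?o k x * w n (x - y n k))) + (LINT x|lebesgue. ?o k x * ?R k x)"
      by (intro Bochner_Integration.integral_add Bochner_Integration.integrable_sum odd_power_integrable[OF p uH]
          wH remainder_H1[OF pr])
    also have "(LINT x|lebesgue. (\<Sum>n=1..m. ?o k x * w n (x - y n k))) = (\<Sum>n=1..m. LINT x|lebesgue. ?o k x * w n (x - y n k))"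
      by (intro Bochner_Integration.integral_sum odd_power_integrable[OF p uH] wH)
    finally show ?thesis .
  qed
  define \<rho> where "\<rho> n = (if n = 1 then modular p (w 1) else modular (\<lambda>_. pinf) (w n))" for n
  have lim: "(\<lambda>k. LINT x|lebesgue. ?o k x * w n (x - y n k)) \<longlonglongrightarrow> \<rho> n" if n: "n \<in> {1..m}" for n
  proof (cases "n = 1")
    case True
    have "(\<lambda>k. LINT x|lebesgue. ?o k x * w n (x - y n k)) \<longlonglongrightarrow> (LINT x|lebesgue. odd_power (p x) (w n x) * w n x)"
      by (rule nonlinearity_limit[OF profile_basic(2)[OF pr] profile_weak[OF pr n] profile_H1[OF pr n] p])
        (simp add: True profile_basic(3)[OF pr, simplified])
    then show ?thesis using True by (simp add: \<rho>_def odd_power_self modular_def)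
  next
    case False
    then have n2: "n \<in> {2..m}" using n by auto
    have "(\<lambda>k. LINT x|lebesgue. ?o k x * w n (x - y n k)) \<longlonglongrightarrow> (LINT x|lebesgue. odd_power pinf (w n x) * w n x)"
      by (rule nonlinearity_limit[OF profile_basic(2)[OF pr] profile_weak[OF pr n] profile_H1[OF pr n] pinf_exponent
            translated_exponent_limit[OF profile_to_infinity[OF pr n2]]])
    then show ?thesis using False by (simp add: \<rho>_def odd_power_self modular_def)
  qed
  have "(\<lambda>k. modular p (u (r k))) \<longlonglongrightarrow> (\<Sum>n=1..m. \<rho> n) + 0"
    unfolding split by (intro tendsto_add tendsto_sum lim remainder_vanishes(2)[OF pr maximal])
  moreover have "(\<Sum>n=1..m. \<rho> n) = modular p (w 1) + (\<Sum>n=2..m. modular (\<lambda>_. pinf) (w n))"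
    unfolding sum_first[OF profile_basic(1)[OF pr]] by (simp add: \<rho>_def)
  ultimately show ?thesis by simp
qed

text \<open>
  The squared norms add up by \<open>remainder_norm_expansion\<close>.  As \<open>V - b\<close> tends to zero at infinity, only the weak limit
  contributes to the integral of \<open>(V - b) u\<^sup>2\<close>.
\<close>

lemma energy_splitting:
  assumes pr: "profiles m w y r" and maximal: "\<And>w y r. \<not> profiles (Suc m) w y r"
  shows "(\<lambda>k. energy V (u (r k))) \<longlonglongrightarrow> energy V (w 1) + (\<Sum>n=2..m. energy (\<lambda>_. b) (w n))"
proof -
  have m1: "1 \<in> {1..m}" using profile_basic(1)[OF pr] by simp
  have w1: "w 1 \<in> H1" by (rule profile_H1[OF pr m1])
  have weak: "H1_weakly_converges b (\<lambda>k. u (r k)) (w 1)"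
    using profile_weak[OF pr m1] profile_basic(3)[OF pr] by simp
  define z where "z k x = u (r k) x - w 1 x" for k x
  define g where "g k x = u (r k) x + w 1 x" for k x
  have zH: "z k \<in> H1" and gH: "g k \<in> H1" for k unfolding z_def g_def by (rule H1_diff[OF uH w1], rule H1_add[OF uH w1])
  have zN: "H1_norm b (z k) \<le> M + H1_norm b (w 1)" for k
    using H1_norm_triangle[OF b uH H1_scale[OF w1, of "- 1"], of "r k"] H1_norm_scale[OF b w1, of "- 1"] uM[of "r k"]
    by (simp add: z_def[abs_def])
  have gN: "H1_norm b (g k) \<le> M + H1_norm b (w 1)" for k
    using H1_norm_triangle[OF b uH w1, of "r k"] uM[of "r k"] by (simp add: g_def[abs_def])
  have zw: "H1_weakly_converges b z (\<lambda>x. 0)" using weakly_null_diff[OF b weak] by (simp add: z_def[abs_def])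
  have pot: "(\<lambda>k. LINT x|lebesgue. (V x - b) * z k x * g k x) \<longlonglongrightarrow> 0"
    by (rule potential_null_H1[OF zw zN gH gN])
  \<comment> \<open>Here \<open>u\<^sup>2 - w\<^sup>2 = z g\<close>, where \<open>z = u - w\<close> tends weakly to zero and \<open>g = u + w\<close> is bounded.\<close>
  have eq: "energy V (u (r k)) = (H1_norm b (u (r k)))\<^sup>2 + (LINT x|lebesgue. (V x - b) * w 1 x * w 1 x)
      + (LINT x|lebesgue. (V x - b) * z k x * g k x)" for k
  proof -
    have "(LINT x|lebesgue. (V x - b) * u (r k) x * u (r k) x)
        = (LINT x|lebesgue. (V x - b) * w 1 x * w 1 x + (V x - b) * z k x * g k x)"
      by (intro Bochner_Integration.integral_cong) (auto simp: z_def g_def algebra_simps)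
    also have "\<dots> = (LINT x|lebesgue. (V x - b) * w 1 x * w 1 x) + (LINT x|lebesgue. (V x - b) * z k x * g k x)"
      by (intro Bochner_Integration.integral_add potential_integrable U_bounded H1_L2 w1 zH gH)
    finally show ?thesis
      unfolding energy_form form_potential[OF uH uH] H1_norm_power2[OF b uH] by simp
  qed
  have norm: "(\<lambda>k. (H1_norm b (u (r k)))\<^sup>2) \<longlonglongrightarrow> (\<Sum>n=1..m. (H1_norm b (w n))\<^sup>2)"
  proof -
    have "(\<lambda>k. ((H1_norm b (u (r k)))\<^sup>2 - (H1_norm b (remainder m w y r k))\<^sup>2) + (H1_norm b (remainder m w y r k))\<^sup>2)
        \<longlonglongrightarrow> (\<Sum>n=1..m. (H1_norm b (w n))\<^sup>2) + 0\<^sup>2"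
      by (intro tendsto_add tendsto_power remainder_norm_expansion[OF pr] remainder_vanishes(1)[OF pr maximal])
    then show ?thesis by simp
  qed
  have "(\<lambda>k. energy V (u (r k))) \<longlonglongrightarrow> (\<Sum>n=1..m. (H1_norm b (w n))\<^sup>2) + (LINT x|lebesgue. (V x - b) * w 1 x * w 1 x) + 0"
    unfolding eq by (intro tendsto_add norm tendsto_const pot)
  moreover have "(\<Sum>n=1..m. (H1_norm b (w n))\<^sup>2) = B (w 1) (w 1) + (\<Sum>n=2..m. energy (\<lambda>_. b) (w n))"
    unfolding sum_first[OF profile_basic(1)[OF pr]]
    by (intro arg_cong2[of _ _ _ _ "(+)"] sum.cong refl H1_norm_power2[OF b w1])
      (simp add: H1_norm_power2[OF b] energy_form profile_H1[OF pr])
  moreover have "energy V (w 1) = B (w 1) (w 1) + (LINT x|lebesgue. (V x - b) * w 1 x * w 1 x)"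
    unfolding energy_form by (rule form_potential[OF w1 w1])
  ultimately show ?thesis by (simp only: add_ac add_0_left)
qed

end

section \<open>Palais-Smale sequences\<close>

lemma H1_dual_norm_bound:
  fixes f :: "('a::euclidean_space \<Rightarrow> real) \<Rightarrow> real"
  assumes b: "b > 0" and f: "f \<in> H1_dual b" and v: "v \<in> H1"
  shows "\<bar>f v\<bar> \<le> H1_dual_norm b f * H1_norm b v"
proof -
  have "\<exists>C. \<forall>u\<in>H1. \<bar>f u\<bar> \<le> C * H1_norm b u" using f by (simp add: H1_dual_def)
  then obtain C where C: "\<And>u. u \<in> H1 \<Longrightarrow> \<bar>f u\<bar> \<le> C * H1_norm b u" by blast
  have scale: "f (\<lambda>x. a * u x) = a * f u" if "u \<in> H1" for a and u :: "'a \<Rightarrow> real" using f that by (simp add: H1_dual_def)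
  have bdd: "bdd_above ((\<lambda>v. \<bar>f v\<bar>) ` {v \<in> H1. H1_norm b v \<le> 1})"
  proof (rule bdd_aboveI2)
    fix u :: "'a \<Rightarrow> real" assume u: "u \<in> {v \<in> H1. H1_norm b v \<le> 1}"
    then have "C * H1_norm b u \<le> \<bar>C\<bar> * 1" using H1_norm_nonneg[OF b, of u] by (intro mult_mono) auto
    then show "\<bar>f u\<bar> \<le> \<bar>C\<bar>" using C[of u] u by simp
  qed
  have nn: "0 \<le> H1_norm b v" by (rule H1_norm_nonneg[OF b v])
  show ?thesis
  proof (cases "H1_norm b v = 0")
    case True
    then show ?thesis using C[OF v] by simp
  next
    case False
    then have N: "H1_norm b v > 0" using nn by simp
    let ?e = "\<lambda>x. inverse (H1_norm b v) * v x"
    have e: "?e \<in> H1" "H1_norm b ?e \<le> 1" using N by (auto simp: H1_norm_scale[OF b v] intro: H1_scale v)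
    have "\<bar>f ?e\<bar> \<le> H1_dual_norm b f"
      unfolding H1_dual_norm_def by (rule cSUP_upper[OF _ bdd]) (use e in simp)
    then have "inverse (H1_norm b v) * \<bar>f v\<bar> \<le> H1_dual_norm b f" using N by (simp add: scale[OF v] abs_mult)
    then show ?thesis using N by (simp add: field_simps)
  qed
qed

text \<open>
  The potential is at least \<open>b/2\<close> outside a ball, and inside that ball the \<open>L2\<close> norm is controlled by
  the constraint, because \<open>u\<^sup>2 \<le> 1 + \<bar>u\<bar> powr p\<close>.
\<close>

lemma constraint_energy_bound:
  fixes u :: "nat \<Rightarrow> 'a::euclidean_space \<Rightarrow> real"
  assumes b: "b > 0" and V: "V \<in> L_infinity" and p: "exponent pm P p"
    and Vlim: "\<And>\<epsilon>. \<epsilon> > 0 \<Longrightarrow> \<exists>R. AE x in lebesgue. R \<le> norm x \<longrightarrow> \<bar>V x - b\<bar> \<le> \<epsilon>"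
    and u: "\<And>k. u k \<in> H1" and lux: "\<And>k. luxemburg p (u k) = 1" and C1: "\<And>k. energy V (u k) \<le> C1"
  obtains M where "\<And>k. H1_norm b (u k) \<le> M"
proof -
  obtain C0 where "AE x in lebesgue. \<bar>V x\<bar> \<le> C0" using V by (auto simp: L_infinity_def)
  then have C: "AE x in lebesgue. \<bar>V x\<bar> \<le> \<bar>C0\<bar>" by eventually_elim linarith
  obtain R where R: "AE x in lebesgue. R \<le> norm x \<longrightarrow> \<bar>V x - b\<bar> \<le> b / 2" using Vlim[of "b / 2"] b by auto
  let ?S = "cball 0 R :: 'a set"
  have Iint: "integrable lebesgue (indicat_real ?S)" using lmeasurable_cball[of 0 R] by (auto simp: fmeasurable_def)
  define D where "D = \<bar>C0\<bar> + b"
  have D: "D \<ge> 0" using b by (simp add: D_def)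
  define K where "K = C1 + D * ((LINT x|lebesgue. indicat_real ?S x) + P)"
  have est: "(H1_norm b (u k))\<^sup>2 \<le> 2 * K" for k
  proof -
    have V2: "integrable lebesgue (\<lambda>x. V x * (u k x)\<^sup>2)"
      using potential_integrable[OF V H1_L2[OF u] H1_L2[OF u], of k k] by (simp add: power2_eq_square mult.assoc)
    have u2: "integrable lebesgue (\<lambda>x. (u k x)\<^sup>2)" by (rule L2_real_integrable[OF H1_L2[OF u]])
    note mi = modular_integrable[OF p u[of k]]
    have "b * (LINT x|lebesgue. (u k x)\<^sup>2) - (LINT x|lebesgue. V x * (u k x)\<^sup>2)
        = (LINT x|lebesgue. b * (u k x)\<^sup>2 - V x * (u k x)\<^sup>2)" using V2 u2 by simp
    also have "\<dots> \<le> (LINT x|lebesgue. (b / 2) * (u k x)\<^sup>2 + D * (indicat_real ?S x + \<bar>u k x\<bar> powr p x))"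
    proof (rule integral_mono_AE)
      show "AE x in lebesgue. b * (u k x)\<^sup>2 - V x * (u k x)\<^sup>2 \<le> (b / 2) * (u k x)\<^sup>2 + D * (indicat_real ?S x + \<bar>u k x\<bar> powr p x)"
        using C R
      proof eventually_elim
        case (elim x)
        have pos: "0 \<le> D * \<bar>u k x\<bar> powr p x" using D by simp
        show ?case
        proof (cases "x \<in> ?S")
          case True
          have "\<bar>u k x\<bar> powr 2 \<le> \<bar>u k x\<bar> powr 0 + \<bar>u k x\<bar> powr p x"
            using exponentD(4)[OF p, of x] by (intro powr_between) auto
          then have sq: "(u k x)\<^sup>2 \<le> 1 + \<bar>u k x\<bar> powr p x" by (cases "u k x = 0") auto
          have "b - V x \<le> D" using elim(1) unfolding D_def by linarith
          then have "(b - V x) * (u k x)\<^sup>2 \<le> D * (u k x)\<^sup>2" by (rule mult_right_mono) simp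
          also have "\<dots> \<le> D * (1 + \<bar>u k x\<bar> powr p x)" using sq D by (rule mult_left_mono)
          finally have "(b - V x) * (u k x)\<^sup>2 \<le> D * (1 + \<bar>u k x\<bar> powr p x)" .
          moreover have "0 \<le> (b / 2) * (u k x)\<^sup>2" using b by simp
          ultimately show ?thesis using True by (simp add: left_diff_distrib)
        next
          case False
          then have "\<bar>V x - b\<bar> \<le> b / 2" using elim(2) by simp
          then have "b - V x \<le> b / 2" by linarith
          then have "(b - V x) * (u k x)\<^sup>2 \<le> (b / 2) * (u k x)\<^sup>2" by (rule mult_right_mono) simp
          then show ?thesis using False pos by (simp add: left_diff_distrib)
        qed
      qed
    qed (use V2 u2 Iint mi in auto)
    also have "\<dots> = (b / 2) * (LINT x|lebesgue. (u k x)\<^sup>2) + D * ((LINT x|lebesgue. indicat_real ?S x) + modular p (u k))"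
      using u2 Iint mi unfolding modular_def by simp
    also have "\<dots> \<le> (b / 2) * (LINT x|lebesgue. (u k x)\<^sup>2) + D * ((LINT x|lebesgue. indicat_real ?S x) + P)"
      using modular_on_manifold(2)[OF p u lux, of k] D by (intro add_left_mono mult_left_mono) auto
    finally have 1: "b * (LINT x|lebesgue. (u k x)\<^sup>2) - (LINT x|lebesgue. V x * (u k x)\<^sup>2)
        \<le> (b / 2) * (LINT x|lebesgue. (u k x)\<^sup>2) + D * ((LINT x|lebesgue. indicat_real ?S x) + P)" .
    have 2: "energy V (u k) = (LINT x|lebesgue. (norm (weak_gradient (u k) x))\<^sup>2) + (LINT x|lebesgue. V x * (u k x)\<^sup>2)"
      using form_split[OF V u u, of k k] by (simp add: energy_form dot_square_norm power2_eq_square mult.assoc)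
    have 3: "(H1_norm b (u k))\<^sup>2 = (LINT x|lebesgue. (norm (weak_gradient (u k) x))\<^sup>2) + b * (LINT x|lebesgue. (u k x)\<^sup>2)"
      by (simp add: H1_norm_power2[OF b u] form_diagonal[OF u])
    have 4: "0 \<le> (LINT x|lebesgue. (norm (weak_gradient (u k) x))\<^sup>2)" by simp
    have gen: "g + b * s \<le> 2 * (c + d)" if "b * s - v \<le> b / 2 * s + d" "g + v \<le> c" "0 \<le> g" for g s v c d
      using that by (simp add: field_simps)
    show ?thesis unfolding 3 K_def
      by (rule gen[OF _ _ 4]) (use 1 2 C1[of k] in auto)
  qed
  show ?thesis
  proof (rule that[of "sqrt (2 * K)"])
    show "H1_norm b (u k) \<le> sqrt (2 * K)" for k using est[of k] by (rule real_le_rsqrt)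
  qed
qed

text \<open>
  The derivatives of \<open>J\<close> and \<open>I\<close> at \<open>u\<^sub>k\<close> are \<open>2 form V u\<^sub>k\<close> and the pairing with the nonlinearity divided by \<open>\<rho>(u\<^sub>k)\<close>;
  the multiplier of the equation is accordingly \<open>\<mu>\<^sub>k / (2 \<rho>(u\<^sub>k))\<close>.  Testing with \<open>u\<^sub>k\<close> itself gives
  \<open>J(u\<^sub>k) - \<mu>\<^sub>k / 2 \<rightarrow> 0\<close>, hence \<open>\<mu>\<^sub>k \<rightarrow> 2c\<close>.
\<close>

lemma Palais_Smale_almost_critical:
  fixes u :: "nat \<Rightarrow> 'a::euclidean_space \<Rightarrow> real"
  assumes b: "b > 0" and V: "V \<in> L_infinity" and p: "exponent pm P p" and plim: "(p \<longlongrightarrow> pinf) at_infinity"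
    and Vlim: "\<And>\<epsilon>. \<epsilon> > 0 \<Longrightarrow> \<exists>R. AE x in lebesgue. R \<le> norm x \<longrightarrow> \<bar>V x - b\<bar> \<le> \<epsilon>"
    and PS: "Palais_Smale b V p c u"
  obtains s \<rho>\<^sub>0 M lam \<epsilon>s where "strict_mono s" "pm \<le> \<rho>\<^sub>0" "\<rho>\<^sub>0 \<le> P" "(\<lambda>k. modular p (u (s k))) \<longlonglongrightarrow> \<rho>\<^sub>0"
    "(\<lambda>k. energy V (u (s k))) \<longlonglongrightarrow> c"
    "almost_critical V p b pinf pm P M (c / \<rho>\<^sub>0) (\<lambda>k. u (s k)) lam \<epsilon>s"
proof -
  have uH: "u k \<in> H1" and lux: "luxemburg p (u k) = 1" for k
    using PS by (auto simp: Palais_Smale_def constraint_manifold_def)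
  have en: "(\<lambda>k. energy V (u k)) \<longlonglongrightarrow> c" using PS by (simp add: Palais_Smale_def)
  have "\<exists>D E \<mu>. (\<forall>k. has_H1_derivative b (energy V) (D k) (u k)) \<and>
        (\<forall>k. has_H1_derivative b (luxemburg p) (E k) (u k)) \<and>
        (\<lambda>k. H1_dual_norm b (\<lambda>v. D k v - \<mu> k * E k v)) \<longlonglongrightarrow> 0"
    using PS by (simp add: Palais_Smale_def)
  then obtain D E \<mu> where D: "\<And>k. has_H1_derivative b (energy V) (D k) (u k)"
    and E: "\<And>k. has_H1_derivative b (luxemburg p) (E k) (u k)"
    and dn: "(\<lambda>k. H1_dual_norm b (\<lambda>v. D k v - \<mu> k * E k v)) \<longlonglongrightarrow> 0"
    by blast
  have "Bseq (\<lambda>k. energy V (u k))" using en by (meson convergentI convergent_imp_Bseq)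
  then obtain C1 where "\<And>k. norm (energy V (u k)) \<le> C1" by (auto simp: Bseq_def)
  then have C1: "energy V (u k) \<le> C1" for k using abs_le_D1 by (metis real_norm_def)
  obtain M where M: "\<And>k. H1_norm b (u k) \<le> M"
    by (rule constraint_energy_bound[OF b V p Vlim uH lux C1]) (assumption | rule that)+
  have \<rho>: "pm \<le> modular p (u k)" "modular p (u k) \<le> P" for k using modular_on_manifold[OF p uH lux] by auto
  have pm: "pm > 2" by (rule exponentD(1)[OF p])
  have \<rho>0: "modular p (u k) > 0" for k using \<rho>(1)[of k] pm by linarith
  define d where "d k = H1_dual_norm b (\<lambda>v. D k v - \<mu> k * E k v)" for k
  have dual: "(\<lambda>v. D k v - \<mu> k * E k v) \<in> H1_dual b" for k
  proof -
    have DD: "D k \<in> H1_dual b" and EE: "E k \<in> H1_dual b" using D[of k] E[of k] by (auto simp: has_H1_derivative_def)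
    obtain C C' where C: "\<And>u. u \<in> H1 \<Longrightarrow> \<bar>D k u\<bar> \<le> C * H1_norm b u" "\<And>u. u \<in> H1 \<Longrightarrow> \<bar>E k u\<bar> \<le> C' * H1_norm b u"
      using DD EE unfolding H1_dual_def by blast
    have bd: "\<bar>D k u - \<mu> k * E k u\<bar> \<le> (C + \<bar>\<mu> k\<bar> * C') * H1_norm b u" if "u \<in> H1" for u
    proof -
      have "\<bar>D k u - \<mu> k * E k u\<bar> \<le> \<bar>D k u\<bar> + \<bar>\<mu> k\<bar> * \<bar>E k u\<bar>"
        using abs_triangle_ineq4[of "D k u" "\<mu> k * E k u"] by (simp add: abs_mult)
      also have "\<dots> \<le> C * H1_norm b u + \<bar>\<mu> k\<bar> * (C' * H1_norm b u)"
        by (intro add_mono mult_left_mono C that) simp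
      finally show ?thesis by (simp add: algebra_simps)
    qed
    then have "\<exists>C. \<forall>u\<in>H1. \<bar>D k u - \<mu> k * E k u\<bar> \<le> C * H1_norm b u" by blast
    then show ?thesis using DD EE by (simp add: H1_dual_def algebra_simps)
  qed
  have crit: "\<bar>form V (u k) v - (\<mu> k / (2 * modular p (u k))) * (LINT x|lebesgue. odd_power (p x) (u k x) * v x)\<bar>
      \<le> (d k / 2) * H1_norm b v" if v: "v \<in> H1" for k v
  proof -
    have "D k v = 2 * form V (u k) v" by (rule energy_derivative[OF b V uH v D])
    moreover have "(LINT x|lebesgue. odd_power (p x) (u k x) * v x) = E k v * modular p (u k)"
      by (rule luxemburg_derivative[OF b p uH v lux E])
    ultimately have "D k v - \<mu> k * E k v
        = 2 * (form V (u k) v - (\<mu> k / (2 * modular p (u k))) * (LINT x|lebesgue. odd_power (p x) (u k x) * v x))"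
      using \<rho>0[of k] by (simp add: field_simps)
    moreover have half: "\<bar>X\<bar> \<le> (e / 2) * N" if "\<bar>Y\<bar> \<le> e * N" "Y = 2 * X" for X Y e N :: real
      using that by (simp add: abs_mult)
    ultimately show ?thesis using half[OF H1_dual_norm_bound[OF b dual v, of k]] unfolding d_def by blast
  qed
  have \<mu>: "\<mu> \<longlonglongrightarrow> 2 * c"
  proof -
    have "(\<lambda>k. energy V (u k) - \<mu> k / 2) \<longlonglongrightarrow> 0"
    proof (rule Lim_null_comparison)
      show "\<forall>\<^sub>F k in sequentially. norm (energy V (u k) - \<mu> k / 2) \<le> \<bar>d k\<bar> / 2 * M"
      proof (intro always_eventually allI)
        fix k
        have "(LINT x|lebesgue. odd_power (p x) (u k x) * u k x) = modular p (u k)"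
          by (simp add: odd_power_self modular_def)
        then have "\<bar>energy V (u k) - \<mu> k / 2\<bar> \<le> (d k / 2) * H1_norm b (u k)"
          using crit[OF uH, of k k] \<rho>0[of k] by (simp add: energy_form)
        also have "\<dots> \<le> (\<bar>d k\<bar> / 2) * M"
          using M[of k] H1_norm_nonneg[OF b uH[of k]] by (intro mult_mono) auto
        finally show "norm (energy V (u k) - \<mu> k / 2) \<le> \<bar>d k\<bar> / 2 * M" by simp
      qed
      have "(\<lambda>k. \<bar>d k\<bar> / 2 * M) \<longlonglongrightarrow> \<bar>0\<bar> / 2 * M"
        unfolding d_def by (intro tendsto_intros dn) simp
      then show "(\<lambda>k. \<bar>d k\<bar> / 2 * M) \<longlonglongrightarrow> 0" by simp
    qed
    then have "(\<lambda>k. 2 * (energy V (u k) - (energy V (u k) - \<mu> k / 2))) \<longlonglongrightarrow> 2 * (c - 0)"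
      by (intro tendsto_intros en)
    then show ?thesis by simp
  qed
  have "bounded (range (\<lambda>k. modular p (u k)))"
    using \<rho>(2) \<rho>0 by (intro boundedI[of _ P]) (auto simp: abs_of_pos)
  then obtain \<rho>\<^sub>0 s where s: "strict_mono s" and \<rho>lim: "(\<lambda>k. modular p (u (s k))) \<longlonglongrightarrow> \<rho>\<^sub>0"
    using bounded_imp_convergent_subsequence[of "\<lambda>k. modular p (u k)"] by (auto simp: o_def)
  have \<rho>0b: "pm \<le> \<rho>\<^sub>0" "\<rho>\<^sub>0 \<le> P"
    using LIMSEQ_le_const[OF \<rho>lim, of pm] LIMSEQ_le_const2[OF \<rho>lim, of P] \<rho> by auto
  have lamlim: "(\<lambda>k. \<mu> (s k) / (2 * modular p (u (s k)))) \<longlonglongrightarrow> c / \<rho>\<^sub>0"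
  proof -
    have "(\<lambda>k. \<mu> (s k) / (2 * modular p (u (s k)))) \<longlonglongrightarrow> 2 * c / (2 * \<rho>\<^sub>0)"
      using LIMSEQ_subseq_LIMSEQ[OF \<mu> s] \<rho>0b pm by (intro tendsto_intros \<rho>lim) (auto simp: o_def)
    then show ?thesis by simp
  qed
  have dlim: "(\<lambda>k. d (s k) / 2) \<longlonglongrightarrow> 0"
  proof -
    have "(\<lambda>k. d (s k)) \<longlonglongrightarrow> 0" using LIMSEQ_subseq_LIMSEQ[OF dn s] by (simp add: o_def d_def)
    then show ?thesis using tendsto_divide[OF _ tendsto_const[of "2::real"]] by fastforce
  qed
  have enlim: "(\<lambda>k. energy V (u (s k))) \<longlonglongrightarrow> c" using LIMSEQ_subseq_LIMSEQ[OF en s] by (simp add: o_def)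
  have "almost_critical V p b pinf pm P M (c / \<rho>\<^sub>0) (\<lambda>k. u (s k)) (\<lambda>k. \<mu> (s k) / (2 * modular p (u (s k)))) (\<lambda>k. d (s k) / 2)"
    by unfold_locales (fact b V Vlim p plim uH M dlim lamlim crit)+
  then show ?thesis using that s \<rho>0b \<rho>lim enlim by blast
qed

lemma ess_at_infinity_limitD:
  fixes V :: "'a::euclidean_space \<Rightarrow> real"
  assumes "(V \<longlongrightarrow> l) ess_at_infinity" "\<epsilon> > 0"
  shows "\<exists>R. AE x in lebesgue. R \<le> norm x \<longrightarrow> \<bar>V x - l\<bar> \<le> \<epsilon>"
proof -
  have "\<forall>\<^sub>F x in inf at_infinity (ae_filter lebesgue). dist (V x) l < \<epsilon>"
    using tendstoD[OF assms] by (simp add: ess_at_infinity_def)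
  then obtain Q S where Q: "eventually Q at_infinity" and S: "eventually S (ae_filter lebesgue)"
    and QS: "\<And>x. Q x \<Longrightarrow> S x \<Longrightarrow> dist (V x) l < \<epsilon>" unfolding eventually_inf by blast
  obtain R where R: "\<And>x. R \<le> norm x \<Longrightarrow> Q x" using Q unfolding eventually_at_infinity by blast
  have "AE x in lebesgue. R \<le> norm x \<longrightarrow> \<bar>V x - l\<bar> \<le> \<epsilon>"
    using S
  proof eventually_elim
    case (elim x)
    then show ?case using QS[OF R elim] by (auto simp: dist_real_def intro: less_imp_le)
  qed
  then show ?thesis by blast
qed

lemma exponent_bounds:
  fixes p :: "'a::euclidean_space \<Rightarrow> real"
  assumes cont: "continuous_on UNIV p" and lo: "2 < p_minus p" and hi: "p_plus p < critical_exponent (DIM('a))"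
  obtains pm P where "p_minus p = ereal pm" "p_plus p = ereal P" "exponent pm P p"
proof -
  have lower: "p_minus p \<le> ereal (p x)" and upper: "ereal (p x) \<le> p_plus p" for x
    by (auto simp: p_minus_def p_plus_def intro: INF_lower SUP_upper)
  obtain pm where pm: "p_minus p = ereal pm"
    using lo lower[of 0] by (cases "p_minus p") auto
  obtain P where P: "p_plus p = ereal P"
    using hi upper[of 0] by (cases "p_plus p") auto
  have 2: "2 < pm" using lo by (simp add: pm)
  have b: "pm \<le> p x" "p x \<le> P" for x using lower[of x] upper[of x] by (auto simp: pm P)
  then have "2 < P" using 2 by (meson less_le_trans)
  then have "exponent pm P p"
    using 2 b hi cont by (auto simp: exponent_def subcritical_def P borel_measurable_continuous_onI)
  then show ?thesis using that pm P by blast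
qed

lemma weak_solutionI:
  assumes V: "V \<in> L_infinity" and p: "exponent pm P p" and w: "w \<in> H1"
    and eq: "\<And>v. v \<in> H1 \<Longrightarrow> form V w v = L * (LINT x|lebesgue. odd_power (p x) (w x) * v x)"
  shows "weak_solution V (\<lambda>x. L * (\<bar>w x\<bar> powr (p x - 2) * w x)) w"
  unfolding weak_solution_def odd_power_def[symmetric]
proof (intro conjI ballI w)
  fix v :: "'a \<Rightarrow> real" assume v: "v \<in> H1"
  have "integrable lebesgue (\<lambda>x. L * (odd_power (p x) (w x) * v x))"
    by (rule integrable_mult_right[OF odd_power_integrable[OF p w v]])
  then show "integrable lebesgue (\<lambda>x. L * odd_power (p x) (w x) * v x)" by (simp add: mult.assoc)
  have "form V w v = (LINT x|lebesgue. L * odd_power (p x) (w x) * v x)"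
    using eq[OF v] by (simp add: mult.assoc)
  then show "(LINT x|lebesgue. weak_gradient w x \<bullet> weak_gradient v x + V x * w x * v x)
      = (LINT x|lebesgue. L * odd_power (p x) (w x) * v x)" by (simp add: form_def)
qed

theorem proposition3p4:
  fixes V p :: "real ^ 'n \<Rightarrow> real"
    and Vinf pinf c :: real
    and u :: "nat \<Rightarrow> real ^ 'n \<Rightarrow> real"
  assumes "CARD('n) \<ge> 2"
    and "V \<in> L_infinity"
    and "(V \<longlongrightarrow> Vinf) ess_at_infinity"
    and "Vinf > 0"
    and "continuous_on UNIV p"
    and "2 < p_minus p"
    and "p_plus p < critical_exponent CARD('n)"
    and "(p \<longlongrightarrow> pinf) at_infinity"
    and "Palais_Smale Vinf V p c u"
  shows "\<exists>(m::nat) (w :: nat \<Rightarrow> real ^ 'n \<Rightarrow> real) (y :: nat \<Rightarrow> nat \<Rightarrow> real ^ 'n)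
            (r :: nat \<Rightarrow> nat) (\<rho>\<^sub>0::real).
      m \<ge> 1 \<and>
      (\<forall>n\<in>{1..m}. w n \<in> H1) \<and>
      (\<forall>k. y 1 k = 0) \<and>
      (\<forall>n\<in>{2..m}. \<not> (AE x in lebesgue. w n x = 0)) \<and>
      strict_mono r \<and>
      p_minus p \<le> ereal \<rho>\<^sub>0 \<and> ereal \<rho>\<^sub>0 \<le> p_plus p \<and>
      (\<lambda>k. modular p (u (r k))) \<longlonglongrightarrow> \<rho>\<^sub>0 \<and>
      (\<forall>n\<in>{1..m}. H1_weakly_converges Vinf (\<lambda>k x. u (r k) (x + y n k)) (w n)) \<and>
      (\<forall>n\<in>{1..m}. \<forall>l\<in>{1..m}. n \<noteq> l \<longrightarrow>
         filterlim (\<lambda>k. norm (y n k - y l k)) at_top sequentially) \<and>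
      ereal (\<Sum>n=1..m. (H1_norm Vinf (w n))\<^sup>2)
        \<le> liminf (\<lambda>k. ereal ((H1_norm Vinf (u (r k)))\<^sup>2)) \<and>
      weak_solution V (\<lambda>x. c / \<rho>\<^sub>0 * (\<bar>w 1 x\<bar> powr (p x - 2) * w 1 x)) (w 1) \<and>
      (\<forall>n\<in>{2..m}.
         weak_solution (\<lambda>_. Vinf) (\<lambda>x. c / \<rho>\<^sub>0 * (\<bar>w n x\<bar> powr (pinf - 2) * w n x)) (w n)) \<and>
      energy V (w 1) = c / \<rho>\<^sub>0 * modular p (w 1) \<and>
      (\<forall>n\<in>{2..m}. energy (\<lambda>_. Vinf) (w n) = c / \<rho>\<^sub>0 * modular (\<lambda>_. pinf) (w n)) \<and>
      modular p (w 1) + (\<Sum>n=2..m. modular (\<lambda>_. pinf) (w n)) = \<rho>\<^sub>0 \<and>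
      energy V (w 1) + (\<Sum>n=2..m. energy (\<lambda>_. Vinf) (w n)) = c \<and>
      (\<lambda>k. H1_norm Vinf (\<lambda>x. u (r k) x - (\<Sum>n=1..m. w n (x - y n k)))) \<longlonglongrightarrow> 0"
proof -
  note b = assms(4) and V = assms(2) and PS = assms(9)
  obtain pm P where pmP: "p_minus p = ereal pm" "p_plus p = ereal P" and p: "exponent pm P p"
    using exponent_bounds[OF assms(5,6)] assms(7) by auto
  note Vlim = ess_at_infinity_limitD[OF assms(3)]
  obtain s \<rho>\<^sub>0 M lam \<epsilon>s where s: "strict_mono s" and \<rho>b: "pm \<le> \<rho>\<^sub>0" "\<rho>\<^sub>0 \<le> P"
    and \<rho>lim: "(\<lambda>k. modular p (u (s k))) \<longlonglongrightarrow> \<rho>\<^sub>0" and enlim: "(\<lambda>k. energy V (u (s k))) \<longlonglongrightarrow> c"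
    and ac: "almost_critical V p Vinf pinf pm P M (c / \<rho>\<^sub>0) (\<lambda>k. u (s k)) lam \<epsilon>s"
    by (rule Palais_Smale_almost_critical[OF b V p assms(8) Vlim PS]) (assumption | rule that)+
  interpret almost_critical V p Vinf pinf pm P M "c / \<rho>\<^sub>0" "\<lambda>k. u (s k)" lam \<epsilon>s by (rule ac)
  obtain m w y t where pr: "profiles m w y t" and maximal: "\<And>w y r. \<not> profiles (Suc m) w y r"
    by (rule maximal_profiles) blast
  note t = profile_basic(2)[OF pr]
  define r where "r k = s (t k)" for k
  have m1: "1 \<in> {1..m}" using profile_basic(1)[OF pr] by simp
  have eq1: "form V (w 1) v = c / \<rho>\<^sub>0 * (LINT x|lebesgue. odd_power (p x) (w 1 x) * v x)" if "v \<in> H1" for v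
    by (rule first_profile_equation[OF pr that])
  have eqn: "form (\<lambda>_. Vinf) (w n) v = c / \<rho>\<^sub>0 * (LINT x|lebesgue. odd_power pinf (w n x) * v x)"
    if "n \<in> {2..m}" "v \<in> H1" for n v
    by (rule profile_at_infinity_equation[OF pr that])
  have wH: "w n \<in> H1" if "n \<in> {1..m}" for n by (rule profile_H1[OF pr that])
  have wH2: "w n \<in> H1" if "n \<in> {2..m}" for n using wH[of n] that by simp
  have "ereal (\<Sum>n=1..m. (H1_norm Vinf (w n))\<^sup>2) \<le> liminf (\<lambda>k. ereal ((H1_norm Vinf (u (r k)))\<^sup>2))"
  proof -
    have lim: "(\<lambda>k. ereal ((H1_norm Vinf (u (r k)))\<^sup>2 - (H1_norm Vinf (remainder m w y t k))\<^sup>2))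
        \<longlonglongrightarrow> ereal (\<Sum>n=1..m. (H1_norm Vinf (w n))\<^sup>2)"
      using remainder_norm_expansion[OF pr] by (simp add: r_def)
    have "ereal (\<Sum>n=1..m. (H1_norm Vinf (w n))\<^sup>2)
        = liminf (\<lambda>k. ereal ((H1_norm Vinf (u (r k)))\<^sup>2 - (H1_norm Vinf (remainder m w y t k))\<^sup>2))"
      by (rule lim_imp_Liminf[OF sequentially_bot lim, symmetric])
    also have "\<dots> \<le> liminf (\<lambda>k. ereal ((H1_norm Vinf (u (r k)))\<^sup>2))"
      by (rule Liminf_mono) simp
    finally show ?thesis .
  qed
  moreover have "weak_solution V (\<lambda>x. c / \<rho>\<^sub>0 * (\<bar>w 1 x\<bar> powr (p x - 2) * w 1 x)) (w 1)"
    by (rule weak_solutionI[OF V p wH[OF m1] eq1])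
  moreover have "\<forall>n\<in>{2..m}. weak_solution (\<lambda>_. Vinf) (\<lambda>x. c / \<rho>\<^sub>0 * (\<bar>w n x\<bar> powr (pinf - 2) * w n x)) (w n)"
    using weak_solutionI[OF L_infinity_const pinf_exponent wH2 eqn] by blast
  moreover have "energy V (w 1) = c / \<rho>\<^sub>0 * modular p (w 1)"
    using eq1[OF wH[OF m1]] by (simp add: energy_form odd_power_self modular_def)
  moreover have "\<forall>n\<in>{2..m}. energy (\<lambda>_. Vinf) (w n) = c / \<rho>\<^sub>0 * modular (\<lambda>_. pinf) (w n)"
    using eqn wH2 by (simp add: energy_form odd_power_self modular_def)
  moreover have \<rho>r: "(\<lambda>k. modular p (u (r k))) \<longlonglongrightarrow> \<rho>\<^sub>0"
    using LIMSEQ_subseq_LIMSEQ[OF \<rho>lim t] by (simp add: o_def r_def)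
  moreover have "modular p (w 1) + (\<Sum>n=2..m. modular (\<lambda>_. pinf) (w n)) = \<rho>\<^sub>0"
    using LIMSEQ_unique[OF modular_splitting[OF pr maximal]] \<rho>r by (simp add: r_def)
  moreover have "energy V (w 1) + (\<Sum>n=2..m. energy (\<lambda>_. Vinf) (w n)) = c"
    using LIMSEQ_unique[OF energy_splitting[OF pr maximal]] LIMSEQ_subseq_LIMSEQ[OF enlim t] by (simp add: o_def)
  moreover have "(\<lambda>k. H1_norm Vinf (\<lambda>x. u (r k) x - (\<Sum>n=1..m. w n (x - y n k)))) \<longlonglongrightarrow> 0"
    using remainder_vanishes(1)[OF pr maximal] by (simp add: remainder_def[abs_def] r_def)
  moreover have "strict_mono r" using s t by (simp add: strict_mono_def r_def)
  moreover have "\<forall>n\<in>{1..m}. H1_weakly_converges Vinf (\<lambda>k x. u (r k) (x + y n k)) (w n)"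
    using profile_weak[OF pr] by (simp add: r_def)
  moreover have "p_minus p \<le> ereal \<rho>\<^sub>0" "ereal \<rho>\<^sub>0 \<le> p_plus p" using \<rho>b by (simp_all add: pmP)
  moreover have "\<forall>k. y 1 k = 0" using profile_basic(3)[OF pr] by simp
  moreover have "\<forall>n\<in>{2..m}. \<not> (AE x in lebesgue. w n x = 0)" using pr unfolding profiles_def by blast
  moreover have "\<forall>n\<in>{1..m}. \<forall>l\<in>{1..m}. n \<noteq> l \<longrightarrow> filterlim (\<lambda>k. norm (y n k - y l k)) at_top sequentially"
    using profile_divergent[OF pr] by blast
  moreover have "\<forall>n\<in>{1..m}. w n \<in> H1" using wH by blast
  ultimately show ?thesis using profile_basic(1)[OF pr]
    by (intro exI[of _ m] exI[of _ w] exI[of _ y] exI[of _ r] exI[of _ \<rho>\<^sub>0] conjI)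
qed

end
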